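(* Let $\Omega\subset\mathbb{R}^2$ be a domain, $\vec F\in C^1(\Omega)$ a vector field, $H\in C^1(\Omega)$, and let $u\in C^1(\Omega)$ be a weak solution to $\operatorname{div}\frac{\nabla u+\vec F}{|\nabla u+\vec F|}=H$. Assume further that $N^\perp(\operatorname{curl}\vec F)$ and $N(H)$ exist and are continuous (extended over singular points) in $\Omega$. Suppose $\operatorname{curl}\vec F(p)\neq0$ for any nondegenerate singular point $p$. Then: (a) the set of nondegenerate singular points consists of $C^1$ smooth curves; (b) the two characteristic curves issuing from a nondegenerate singular point $p_0$ have the same angle with the tangent line of the singular curve through $p_0$.
   Context: A domain is an open connected set. For $u\in C^1(\Omega)$ the singular set $S_{\vec F}(u)$ is the set of points (singular points) where $\nabla u+\vec F=0$; other points are nonsingular. $u\in C^1(\Omega)$ is a weak solution to $\operatorname{div}\frac{\nabla u+\vec F}{|\nabla u+\vec F|}=H$ if for every $\varphi\in C_0^\infty(\Omega)$ $$\int_{S_{\vec F}(u)}|\nabla\varphi|+\int_{\Omega\setminus S_{\vec F}(u)}\frac{\nabla u+\vec F}{|\nabla u+\vec F|}\cdot\nabla\varphi+\int_\Omega H\varphi\ge 0 .$$ For $\vec F=(F_1,F_2)$, $\operatorname{curl}\vec F:=(F_2)_x-(F_1)_y$. At nonsingular points $N:=\frac{\nabla u+\vec F}{|\nabla u+\vec F|}=(\cos\theta,\sin\theta)$ and $N^\perp:=(\sin\theta,-\cos\theta)$. $N(f)$, $N^\perp(f)$ denote derivatives in the directions $N$, $N^\perp$; "exist and are continuous (extended over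 singular points) in $\Omega$" means they exist at nonsingular points and extend to continuous functions on $\Omega$. Characteristic curves are integral curves of $N^\perp$; seed curves are integral curves of $N$. Nondegenerate singular point. Put $K=S_{\vec F}(u)$. Let $p\in K$ and suppose: (i) there is an open neighborhood $U\subset\Omega$ of $p$ such that $U\cap K$ is a $C^0$ curve $\gamma$ through $p$ dividing $U$ into two connected regions $U^+$ and $U^-$; (ii) for any $q\in\gamma$ there are exactly two characteristic curves $\Gamma_q^+,\Gamma_q^-$ issuing from $q$, with $\Gamma_q^\pm\subset U^\pm$. Take $q^\pm\in\Gamma_q^\pm\setminus\{q\}$ and a seed curve $\gamma_\pm$ through $q^\pm$ each point of which emits a characteristic curve in $U^\pm$ hitting $\gamma$ (in a neighborhood of $p$). Parametrize $\gamma_\pm$ by arc length $\tau^\pm$ in an open interval containing $\tau_0^\pm$ (so $\partial/\partial\tau^\pm=\pm N$ up to choice of sign), and let $X_\pm(\tau^\pm)\in\gamma$ be the point where the characteristic curve from $\gamma_\pm(\tau^\pm)$ hits $\gamma$; assume $X_+(\tau_0^+)=X_-(\tau_0^-)=:p_0$. Let $(x_\pm,y_\pm,\theta_\pm)(\sigma,\tau^\pm)$ solve $$\frac{dx}{d\sigma}=\sin\theta,\quad \frac{dy}{d\sigma}=-\cos\theta,\quad \frac{d\theta}{d\sigma}=-H(x,y)$$ with $(x_\pm,y_\pm)(0,\tau^\pm)=\gamma_\pm(\tau^\pm)$, $\theta_\pm(0,\tau^\pm)=\theta(\gamma_\pm(\tau^\pm))$, let $P_\pm=(x_\pm,y_\pm)$,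 and write $X_\pm(\tau^\pm)=P_\pm(\sigma_\pm(\tau^\pm),\tau^\pm)$ with $\sigma_\pm$ continuous. The point $p_0$ is called nondegenerate if, for both signs, $$\det\frac{\partial(x_\pm,y_\pm)}{\partial(\sigma,\tau^\pm)}\ne0\quad\text{at }(\sigma_\pm(\tau_0^\pm),\tau_0^\pm).$$ This does not depend on the choice of seed curves. The singular curve through $p_0$ in (b) is the curve of nondegenerate singular points through $p_0$. *)

theory Defs
  imports "HOL-Analysis.Analysis"
begin

section \<open>Differential calculus in the plane\<close>

definition partial :: "2 \<Rightarrow> (real^2 \<Rightarrow> 'b::real_normed_vector) \<Rightarrow> real^2 \<Rightarrow> 'b"
  where "partial i f x = frechet_derivative f (at x) (axis i 1)"

definition C1_on :: "(real^2) set \<Rightarrow> (real^2 \<Rightarrow> 'b::real_normed_vector) \<Rightarrow> bool"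
  where "C1_on A f \<longleftrightarrow>
    (\<forall>x\<in>A. f differentiable (at x)) \<and> (\<forall>i. continuous_on A (partial i f))"

definition grad :: "(real^2 \<Rightarrow> real) \<Rightarrow> real^2 \<Rightarrow> real^2"
  where "grad u x = (\<chi> i. partial i u x)"

definition curl :: "(real^2 \<Rightarrow> real^2) \<Rightarrow> real^2 \<Rightarrow> real"
  where "curl F x = partial 1 F x $ 2 - partial 2 F x $ 1"

primrec iter_partial :: "2 list \<Rightarrow> (real^2 \<Rightarrow> real) \<Rightarrow> real^2 \<Rightarrow> real"
  where
    "iter_partial [] f = f"
  | "iter_partial (i # ks) f = partial i (iter_partial ks f)"

text \<open>Test functions on \<open>\<Omega>\<close> are regarded as functions on the whole plane, extended by zero.\<close>

definition test_function :: "(real^2) set \<Rightarrow> (real^2 \<Rightarrow> real) \<Rightarrow> bool"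
  where "test_function \<Omega> \<phi> \<longleftrightarrow>
    (\<forall>ks. iter_partial ks \<phi> differentiable_on UNIV) \<and>
    compact (closure {x. \<phi> x \<noteq> 0}) \<and> closure {x. \<phi> x \<noteq> 0} \<subseteq> \<Omega>"

section \<open>Singular set and weak solutions\<close>

definition sing_set :: "(real^2) set \<Rightarrow> (real^2 \<Rightarrow> real^2) \<Rightarrow> (real^2 \<Rightarrow> real) \<Rightarrow> (real^2) set"
  where "sing_set \<Omega> F u = {x \<in> \<Omega>. grad u x + F x = 0}"

text \<open>\<open>normal_dir\<close> and \<open>char_dir\<close> are \<open>N\<close> and \<open>N\<^sup>\<bottom>\<close>; they are only meaningful at nonsingular
  points. Note that \<open>N\<^sup>\<bottom>\<close> is \<open>N\<close> rotated clockwise.\<close>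

definition normal_dir :: "(real^2 \<Rightarrow> real^2) \<Rightarrow> (real^2 \<Rightarrow> real) \<Rightarrow> real^2 \<Rightarrow> real^2"
  where "normal_dir F u x = (grad u x + F x) /\<^sub>R norm (grad u x + F x)"

definition char_dir :: "(real^2 \<Rightarrow> real^2) \<Rightarrow> (real^2 \<Rightarrow> real) \<Rightarrow> real^2 \<Rightarrow> real^2"
  where "char_dir F u x = vector [normal_dir F u x $ 2, - (normal_dir F u x $ 1)]"

definition weak_solution ::
  "(real^2) set \<Rightarrow> (real^2 \<Rightarrow> real^2) \<Rightarrow> (real^2 \<Rightarrow> real) \<Rightarrow> (real^2 \<Rightarrow> real) \<Rightarrow> bool"
  where "weak_solution \<Omega> F H u \<longleftrightarrow>
    (\<forall>\<phi>. test_function \<Omega> \<phi> \<longrightarrow>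
      (LINT x:sing_set \<Omega> F u|lborel. norm (grad \<phi> x))
      + (LINT x:\<Omega> - sing_set \<Omega> F u|lborel. normal_dir F u x \<bullet> grad \<phi> x)
      + (LINT x:\<Omega>|lborel. H x * \<phi> x) \<ge> 0)"

text \<open>The derivative of \<open>f\<close> in the direction of the field \<open>X\<close> exists at every point of
  \<open>\<Omega> - K\<close>, and it extends to a continuous function on \<open>\<Omega>\<close>.\<close>

definition dir_deriv_extends ::
  "(real^2) set \<Rightarrow> (real^2) set \<Rightarrow> (real^2 \<Rightarrow> real^2) \<Rightarrow> (real^2 \<Rightarrow> real) \<Rightarrow> bool"
  where "dir_deriv_extends \<Omega> K X f \<longleftrightarrow>
    (\<exists>g. continuous_on \<Omega> g \<and>
      (\<forall>x\<in>\<Omega> - K. ((\<lambda>t. f (x + t *\<^sub>R X x)) has_real_derivative g x) (at 0)))"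

section \<open>Characteristic curves issuing from a singular point\<close>

text \<open>A characteristic curve issuing from \<open>q\<close> is parametrized by arc length starting at \<open>q\<close>.
  It is unoriented as a curve, so the parametrization runs along \<open>N\<^sup>\<bottom>\<close> or against it;
  the sign \<open>s\<close> is constant along the curve.\<close>

definition char_curve_from ::
  "(real^2) set \<Rightarrow> (real^2 \<Rightarrow> real^2) \<Rightarrow> (real^2 \<Rightarrow> real) \<Rightarrow> real^2 \<Rightarrow> (real \<Rightarrow> real^2) \<Rightarrow> real \<Rightarrow> bool"
  where "char_curve_from \<Omega> F u q c \<epsilon> \<longleftrightarrow>
    0 < \<epsilon> \<and> continuous_on {0..<\<epsilon>} c \<and> c 0 = q \<and>
    (\<exists>s\<in>{1, -1}. \<forall>t\<in>{0<..<\<epsilon>}.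
       c t \<in> \<Omega> - sing_set \<Omega> F u \<and> (c has_vector_derivative s *\<^sub>R char_dir F u (c t)) (at t))"

text \<open>There are exactly two characteristic curves issuing from \<open>q\<close>, namely \<open>c\<^sub>1\<close> and \<open>c\<^sub>2\<close>.
  Curves are counted up to agreement near \<open>q\<close>, as any such curve can be shortened.\<close>

definition the_two_char_curves ::
  "(real^2) set \<Rightarrow> (real^2 \<Rightarrow> real^2) \<Rightarrow> (real^2 \<Rightarrow> real) \<Rightarrow> real^2 \<Rightarrow>
   (real \<Rightarrow> real^2) \<Rightarrow> real \<Rightarrow> (real \<Rightarrow> real^2) \<Rightarrow> real \<Rightarrow> bool"
  where "the_two_char_curves \<Omega> F u q c\<^sub>1 \<epsilon>\<^sub>1 c\<^sub>2 \<epsilon>\<^sub>2 \<longleftrightarrow>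
    char_curve_from \<Omega> F u q c\<^sub>1 \<epsilon>\<^sub>1 \<and> char_curve_from \<Omega> F u q c\<^sub>2 \<epsilon>\<^sub>2 \<and>
    \<not> (\<forall>\<^sub>F t in at_right 0. c\<^sub>1 t = c\<^sub>2 t) \<and>
    (\<forall>c \<epsilon>. char_curve_from \<Omega> F u q c \<epsilon> \<longrightarrow>
       (\<forall>\<^sub>F t in at_right 0. c t = c\<^sub>1 t) \<or> (\<forall>\<^sub>F t in at_right 0. c t = c\<^sub>2 t))"

section \<open>Nondegenerate singular points\<close>

text \<open>The nondegeneracy condition at \<open>p\<close> from one side \<open>V\<close> of the singular curve \<open>C\<close>.
  Here \<open>g\<close> is a seed curve, defined on an open interval around \<open>\<tau>\<^sub>0\<close>, and \<open>(P, \<theta>)\<close> is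
  the solution of the characteristic system with initial values on \<open>g\<close>, on an open set \<open>W\<close> of
  pairs \<open>(\<sigma>, \<tau>)\<close>. For each \<open>\<tau>\<close> the curve \<open>P(\<cdot>, \<tau>)\<close>, from \<open>\<sigma> = 0\<close> up to the hitting time
  \<open>h \<tau>\<close> (which may be negative), is a characteristic curve inside \<open>V\<close> that hits \<open>C\<close>
  at the point \<open>P (h \<tau>) \<tau>\<close>.  For \<open>\<tau> = \<tau>\<^sub>0\<close> this is the characteristic curve issuing from \<open>p\<close> into
  \<open>V\<close>, so \<open>g \<tau>\<^sub>0\<close> lies on it.\<close>

definition nondegenerate_side ::
  "(real^2) set \<Rightarrow> (real^2 \<Rightarrow> real^2) \<Rightarrow> (real^2 \<Rightarrow> real) \<Rightarrow> (real^2 \<Rightarrow> real) \<Rightarrow>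
   (real^2) set \<Rightarrow> (real^2) set \<Rightarrow> real^2 \<Rightarrow> bool"
  where "nondegenerate_side \<Omega> F H u C V p \<longleftrightarrow>
    (\<exists>\<alpha> \<beta> \<tau>\<^sub>0 s (g :: real \<Rightarrow> real^2) W (P :: real \<Rightarrow> real \<Rightarrow> real^2) (\<theta> :: real \<Rightarrow> real \<Rightarrow> real)
        (h :: real \<Rightarrow> real) P\<^sub>\<sigma> P\<^sub>\<tau>.
      \<alpha> < \<tau>\<^sub>0 \<and> \<tau>\<^sub>0 < \<beta> \<and> s \<in> {1, -1} \<and>
      (\<forall>\<tau>\<in>{\<alpha><..<\<beta>}. g \<tau> \<in> V \<and> (g has_vector_derivative s *\<^sub>R normal_dir F u (g \<tau>)) (at \<tau>)) \<and>
      open W \<and> W \<subseteq> UNIV \<times> {\<alpha><..<\<beta>} \<and>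
      (\<forall>\<tau>\<in>{\<alpha><..<\<beta>}. is_interval {\<sigma>. (\<sigma>, \<tau>) \<in> W} \<and> (0, \<tau>) \<in> W \<and> (h \<tau>, \<tau>) \<in> W) \<and>
      (\<forall>(\<sigma>, \<tau>)\<in>W. P \<sigma> \<tau> \<in> \<Omega> \<and>
         ((\<lambda>\<sigma>. P \<sigma> \<tau>) has_vector_derivative vector [sin (\<theta> \<sigma> \<tau>), - cos (\<theta> \<sigma> \<tau>)]) (at \<sigma>) \<and>
         ((\<lambda>\<sigma>. \<theta> \<sigma> \<tau>) has_real_derivative - H (P \<sigma> \<tau>)) (at \<sigma>)) \<and>
      (\<forall>\<tau>\<in>{\<alpha><..<\<beta>}. P 0 \<tau> = g \<tau> \<and>
         normal_dir F u (g \<tau>) = vector [cos (\<theta> 0 \<tau>), sin (\<theta> 0 \<tau>)]) \<and>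
      continuous_on {\<alpha><..<\<beta>} (\<theta> 0) \<and>
      (\<forall>\<tau>\<in>{\<alpha><..<\<beta>}. P (h \<tau>) \<tau> \<in> C \<and>
         (\<forall>\<sigma>\<in>closed_segment 0 (h \<tau>) - {h \<tau>}. P \<sigma> \<tau> \<in> V \<and>
            ((\<lambda>\<sigma>. P \<sigma> \<tau>) has_vector_derivative char_dir F u (P \<sigma> \<tau>)) (at \<sigma>))) \<and>
      continuous_on {\<alpha><..<\<beta>} h \<and>
      P (h \<tau>\<^sub>0) \<tau>\<^sub>0 = p \<and>
      ((\<lambda>\<sigma>. P \<sigma> \<tau>\<^sub>0) has_vector_derivative P\<^sub>\<sigma>) (at (h \<tau>\<^sub>0)) \<and>
      ((\<lambda>\<tau>. P (h \<tau>\<^sub>0) \<tau>) has_vector_derivative P\<^sub>\<tau>) (at \<tau>\<^sub>0) \<and>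
      det (transpose (vector [P\<^sub>\<sigma>, P\<^sub>\<tau>]) :: real^2^2) \<noteq> 0)"

text \<open>The base point of the neighborhood \<open>U\<close> may be taken to be the nondegenerate point
  itself, as \<open>U\<close> is a neighborhood of each point of \<open>U \<inter> K\<close> with the same properties.\<close>

definition nondegenerate_point ::
  "(real^2) set \<Rightarrow> (real^2 \<Rightarrow> real^2) \<Rightarrow> (real^2 \<Rightarrow> real) \<Rightarrow> (real^2 \<Rightarrow> real) \<Rightarrow> real^2 \<Rightarrow> bool"
  where "nondegenerate_point \<Omega> F H u p \<longleftrightarrow> p \<in> sing_set \<Omega> F u \<and>
    (\<exists>U V\<^sub>1 V\<^sub>2. open U \<and> p \<in> U \<and> U \<subseteq> \<Omega> \<and>
      (U \<inter> sing_set \<Omega> F u) homeomorphic {0<..<1::real} \<and>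
      U - sing_set \<Omega> F u = V\<^sub>1 \<union> V\<^sub>2 \<and> V\<^sub>1 \<inter> V\<^sub>2 = {} \<and>
      open V\<^sub>1 \<and> connected V\<^sub>1 \<and> V\<^sub>1 \<noteq> {} \<and> open V\<^sub>2 \<and> connected V\<^sub>2 \<and> V\<^sub>2 \<noteq> {} \<and>
      (\<forall>q\<in>U \<inter> sing_set \<Omega> F u. \<exists>c\<^sub>1 \<epsilon>\<^sub>1 c\<^sub>2 \<epsilon>\<^sub>2. the_two_char_curves \<Omega> F u q c\<^sub>1 \<epsilon>\<^sub>1 c\<^sub>2 \<epsilon>\<^sub>2 \<and>
         c\<^sub>1 ` {0<..<\<epsilon>\<^sub>1} \<subseteq> V\<^sub>1 \<and> c\<^sub>2 ` {0<..<\<epsilon>\<^sub>2} \<subseteq> V\<^sub>2) \<and>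
      nondegenerate_side \<Omega> F H u (U \<inter> sing_set \<Omega> F u) V\<^sub>1 p \<and>
      nondegenerate_side \<Omega> F H u (U \<inter> sing_set \<Omega> F u) V\<^sub>2 p)"

section \<open>Curves and angles\<close>

text \<open>Near \<open>p\<close> the set \<open>A\<close> is a \<open>C\<^sup>1\<close> curve through \<open>p\<close>: its part in the neighborhood \<open>V\<close>
  is parametrized by the regular \<open>C\<^sup>1\<close> embedding \<open>r\<close>, with \<open>r 0 = p\<close>.\<close>

definition C1_curve_at ::
  "(real^2) set \<Rightarrow> real^2 \<Rightarrow> (real^2) set \<Rightarrow> (real \<Rightarrow> real^2) \<Rightarrow> bool"
  where "C1_curve_at A p V r \<longleftrightarrow> open V \<and> p \<in> V \<and> r 0 = p \<and>
    r C1_differentiable_on {-1<..<1} \<and>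
    (\<forall>t\<in>{-1<..<1}. vector_derivative r (at t) \<noteq> 0) \<and>
    (\<exists>r'. homeomorphism {-1<..<1} (V \<inter> A) r r')"

text \<open>The angle, in \<open>[0, \<pi>/2]\<close>, between the direction \<open>v\<close> and the line spanned by \<open>w\<close>.\<close>

definition angle_with_line :: "real^2 \<Rightarrow> real^2 \<Rightarrow> real"
  where "angle_with_line v w = arccos (\<bar>v \<bullet> w\<bar> / (norm v * norm w))"

end

theory Submission
  imports Defs "HOL-Computational_Algebra.Polynomial"
begin

text \<open>Write \<open>N = (cos \<theta>, sin \<theta>)\<close> for the unit field along \<open>grad u + F\<close>, let T be N turned clockwise,
  and let K be the singular set. The proof describes K near a nondegenerate point p as a level
  line of a stream function.

  Regularity of one side. On one side of K the characteristics form a fan \<open>P \<sigma> \<tau>\<close>, the flow of the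
  characteristic system from a seed curve. As u is only \<open>C\<^sup>1\<close>, the angle of the seed is a priori
  only continuous in \<open>\<tau>\<close>, so the fan need not be differentiable in \<open>\<tau>\<close>. One derivative is gained
  from the circulation \<open>u Q' - u Q + F Q \<bullet> (Q' - Q)\<close> between corresponding points Q, \<open>Q'\<close> of
  neighboring characteristics (\<open>flux\<close>). To first order it is \<open>\<bar>grad u + F\<bar>\<close> times the normal
  displacement, and by Stokes' theorem its derivative along the characteristic is \<open>curl F\<close> times
  that displacement. These two relations recover the displacement, hence also the initial change
  of the angle, from the initial positions (\<open>observability\<close>); applied to differences of difference
  quotients this yields \<open>initial_quot_Cauchy\<close>, and the fan is \<open>C\<^sup>1\<close>. Where its Jacobian does not
  vanish, it is a chart that reaches across K, and it extends N to a \<open>C\<^sup>1\<close> unit field of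
  divergence H on a full neighborhood of p, whose characteristics cross K from one side to the
  other (\<open>local_structure\<close>).

  The role of the curl. Along the fan \<open>(\<bar>grad u + F\<bar> J)' = curl F J\<close>, with J the Jacobian. Since
  \<open>grad u + F\<close> vanishes on K, the sign of \<open>curl F p\<close> decides whether characteristics run into K
  along T or against it (\<open>hitting_sign\<close>), in the same way on both sides. Let \<open>N\<^sub>+\<close> and \<open>N\<^sub>-\<close> be
  the two extensions of N. If they agreed at p, uniqueness for the characteristic system would
  make the two crossing curves through p coincide, although one of them leaves a side exactly when
  the other enters it (\<open>normals_differ\<close>).

  The weak equation. It says that N has no jump of flux across K: the field \<open>Z = N\<^sub>+ - N\<^sub>-\<close>, which
  is \<open>C\<^sup>1\<close>, divergence free and nonzero near p, satisfies \<open>\<integral>\<^sub>V Z \<bullet> grad \<phi> = 0\<close> on one side V for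
  all \<open>C\<^sup>1\<close> functions \<open>\<phi>\<close> with compact support near p (\<open>weak_jump\<close>). Let \<open>\<psi>\<close> be a stream function
  of Z. A function \<open>\<phi>\<close> that is concentrated near an arc of a level line of \<open>\<psi>\<close> shows that no such
  line joins a point of one side to a point of the other (\<open>no_level_crossing\<close>). On the other hand
  \<open>Z \<bullet> N\<^sub>+ = \<bar>Z\<bar>\<^sup>2 / 2 > 0\<close>, so \<open>\<psi>\<close> is strictly monotone along crossing curves; were \<open>\<psi>\<close> not
  constant on K, crossing curves through two points of K would yield such a line
  (\<open>stream_constant\<close>). Hence K is near p a level line of \<open>\<psi>\<close>, a \<open>C\<^sup>1\<close> curve with tangent Z
  (\<open>singular_curve\<close>).

  The angles. The tangents of the two characteristics at p are \<open>N\<^sub>+\<close> and \<open>N\<^sub>-\<close> turned by a right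
  angle, up to a common sign, and the line spanned by
  \<open>Z = N\<^sub>+ - N\<^sub>-\<close> makes the same angle with both (\<open>equal_angles\<close>).\<close>

section \<open>Continuously differentiable functions in the plane\<close>

lemma C1_on_has_derivative:
  assumes "C1_on A f" and "x \<in> A"
  shows "(f has_derivative frechet_derivative f (at x)) (at x)"
proof -
  have "f differentiable (at x)" using assms by (simp add: C1_on_def)
  then show ?thesis by (simp add: frechet_derivative_works)
qed

lemma frechet_derivative_partial:
  assumes "f differentiable (at x)"
  shows "frechet_derivative f (at x) v = (\<Sum>i\<in>UNIV. v $ i *\<^sub>R partial i f x)"
proof -
  interpret D: bounded_linear "frechet_derivative f (at x)"
    using assms[unfolded frechet_derivative_works] by (rule has_derivative_bounded_linear)
  have "v = (\<Sum>i\<in>UNIV. v $ i *\<^sub>R axis i 1)"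
    using basis_expansion[of v] by (simp only: scalar_mult_eq_scaleR)
  then have "frechet_derivative f (at x) v
      = frechet_derivative f (at x) (\<Sum>i\<in>UNIV. v $ i *\<^sub>R axis i 1)"
    by (rule arg_cong)
  then show ?thesis
    by (simp add: D.sum D.scaleR partial_def)
qed

lemma frechet_derivative_eq_grad:
  assumes "f differentiable (at x)"
  shows "frechet_derivative f (at x) v = grad f x \<bullet> v"
  unfolding frechet_derivative_partial[OF assms] inner_vec_def grad_def by (simp add: mult.commute)

text \<open>Continuous partial derivatives give strict differentiability, uniformly on compact sets. All
  later estimates compare two nearby points, neither of which is the base point, so the ordinary
  derivative would not do.\<close>

lemma C1_on_strictly_differentiable:
  fixes f :: "real^2 \<Rightarrow> 'b::real_normed_vector"
  assumes "open A" and f: "C1_on A f" and S: "compact S" "S \<subseteq> A" and "\<eta> > 0"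
  obtains \<delta> where "\<delta> > 0" "\<And>z. z \<in> S \<Longrightarrow> ball z \<delta> \<subseteq> A"
    "\<And>z x y. \<lbrakk>z \<in> S; x \<in> ball z \<delta>; y \<in> ball z \<delta>\<rbrakk> \<Longrightarrow>
      norm (f y - f x - frechet_derivative f (at z) (y - x)) \<le> \<eta> * norm (y - x)"
    "\<And>z w v. \<lbrakk>z \<in> S; w \<in> ball z \<delta>\<rbrakk> \<Longrightarrow>
      norm (frechet_derivative f (at w) v - frechet_derivative f (at z) v) \<le> \<eta> * norm v"
proof -
  obtain r where r: "r > 0" "(\<Union>z\<in>S. cball z r) \<subseteq> A"
    using compact_subset_open_imp_cball_epsilon_subset[OF S(1) \<open>open A\<close> S(2)] by blast
  define S' where "S' = (\<Union>z\<in>S. cball z r)"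
  have "S' = {x + y |x y. x \<in> S \<and> y \<in> cball 0 r}"
    by (force simp: S'_def dist_norm norm_minus_commute intro: exI[of _ "_ - _"])
  then have cS': "compact S'"
    using compact_sums[OF S(1) compact_cball[of 0 r]] by simp
  have diff: "f differentiable (at x)" if "x \<in> A" for x
    using f that by (auto simp: C1_on_def)
  have "uniformly_continuous_on S' (partial i f)" for i
    using f r cS' by (auto simp: C1_on_def S'_def intro!: compact_uniformly_continuous
        intro: continuous_on_subset)
  then have "\<exists>d>0. \<forall>x\<in>S'. \<forall>y\<in>S'. dist y x < d \<longrightarrow> dist (partial i f y) (partial i f x) < \<eta>/2" for i
    using \<open>\<eta> > 0\<close> unfolding uniformly_continuous_on_def by (meson half_gt_zero)
  then obtain d where d: "\<And>i. d i > 0"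
    "\<And>i x y. \<lbrakk>x \<in> S'; y \<in> S'; dist y x < d i\<rbrakk> \<Longrightarrow> dist (partial i f y) (partial i f x) < \<eta>/2"
    by metis
  define \<delta> where "\<delta> = min r (Min (range d))"
  have "\<delta> > 0" using r d by (auto simp: \<delta>_def)
  have \<delta>d: "\<delta> \<le> d i" for i
    by (simp add: \<delta>_def min.coboundedI2)
  have sub: "ball z \<delta> \<subseteq> S'" "z \<in> S'" if "z \<in> S" for z
    using that \<open>\<delta> > 0\<close> r by (auto simp: S'_def \<delta>_def intro!: bexI[of _ z])
  have S'A: "S' \<subseteq> A" using r by (simp add: S'_def)
  have clos: "norm (frechet_derivative f (at w) v - frechet_derivative f (at z) v) \<le> \<eta> * norm v"
    if "z \<in> S" "w \<in> ball z \<delta>" for z w v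
  proof -
    have wz: "w \<in> S'" "z \<in> S'" "dist w z < \<delta>"
      using sub that by (blast, blast, simp add: dist_commute)
    have le: "norm (v $ i *\<^sub>R (partial i f w - partial i f z)) \<le> norm v * (\<eta>/2)" for i
    proof -
      have "norm (partial i f w - partial i f z) \<le> \<eta>/2"
        using d(2)[of z w i] wz \<delta>d[of i] by (simp add: dist_norm)
      then show ?thesis
        unfolding norm_scaleR using component_le_norm_cart[of v i] by (intro mult_mono) auto
    qed
    have "frechet_derivative f (at w) v - frechet_derivative f (at z) v
        = (\<Sum>i\<in>UNIV. v $ i *\<^sub>R (partial i f w - partial i f z))"
      using wz S'A by (simp add: frechet_derivative_partial diff subset_iff sum_subtractf
          scaleR_diff_right)
    also have "norm \<dots> \<le> (\<Sum>i\<in>(UNIV::2 set). norm v * (\<eta>/2))"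
      by (rule sum_norm_le) (use le in auto)
    finally show ?thesis by (simp add: mult.commute)
  qed
  show ?thesis
  proof (rule that[OF \<open>\<delta> > 0\<close>])
    show "ball z \<delta> \<subseteq> A" if "z \<in> S" for z
      using sub(1)[OF that] S'A by blast
    show "norm (f y - f x - frechet_derivative f (at z) (y - x)) \<le> \<eta> * norm (y - x)"
      if "z \<in> S" "x \<in> ball z \<delta>" "y \<in> ball z \<delta>" for z x y
    proof -
      have bl: "bounded_linear (frechet_derivative f (at z))"
        using C1_on_has_derivative[OF f, of z] sub(2)[OF that(1)] S'A
        by (blast intro: has_derivative_bounded_linear)
      let ?g = "\<lambda>w. f w - frechet_derivative f (at z) w"
      have "norm (?g y - ?g x) \<le> \<eta> * norm (y - x)"
      proof (rule differentiable_bound[of "ball z \<delta>" ?g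
            "\<lambda>w v. frechet_derivative f (at w) v - frechet_derivative f (at z) v"])
        fix w assume w: "w \<in> ball z \<delta>"
        then have "w \<in> A" using sub[OF that(1)] S'A by blast
        then show "(?g has_derivative
            (\<lambda>v. frechet_derivative f (at w) v - frechet_derivative f (at z) v)) (at w within ball z \<delta>)"
          by (intro has_derivative_diff has_derivative_at_withinI[OF C1_on_has_derivative[OF f]]
              bounded_linear_imp_has_derivative[OF bl])
        show "onorm (\<lambda>v. frechet_derivative f (at w) v - frechet_derivative f (at z) v) \<le> \<eta>"
          by (rule onorm_bound[OF _ clos[OF that(1) w]]) (use \<open>\<eta> > 0\<close> in simp)
      qed (use that in simp_all)
      then show ?thesis
        by (simp add: linear_diff[OF bounded_linear.linear[OF bl]] algebra_simps)
    qed
  qed (use clos in auto)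
qed

lemma C1_on_continuous: "C1_on A f \<Longrightarrow> continuous_on A f"
  unfolding C1_on_def by (meson continuous_at_imp_continuous_on differentiable_imp_continuous_within)

lemma C1_on_grad_continuous: "C1_on A f \<Longrightarrow> continuous_on A (grad f)"
  unfolding C1_on_def grad_def by (intro continuous_intros) auto

lemma C1_on_derivative_bound:
  fixes f :: "real^2 \<Rightarrow> 'b::real_normed_vector"
  assumes f: "C1_on A f" and S: "compact S" "S \<subseteq> A"
  obtains M where "M \<ge> 0" "\<And>z v. z \<in> S \<Longrightarrow> norm (frechet_derivative f (at z) v) \<le> M * norm v"
proof -
  have "\<exists>M. \<forall>z\<in>S. norm (partial i f z) \<le> M" for i
  proof -
    have "bounded (partial i f ` S)"
      using f S by (intro compact_imp_bounded compact_continuous_image)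
        (auto simp: C1_on_def intro: continuous_on_subset)
    then show ?thesis by (auto simp: bounded_iff)
  qed
  then have "\<exists>M. \<forall>i. \<forall>z\<in>S. norm (partial i f z) \<le> M i"
    by (intro choice allI)
  then obtain M where M: "\<And>i z. z \<in> S \<Longrightarrow> norm (partial i f z) \<le> M i"
    by blast
  show ?thesis
  proof (rule that[of "\<Sum>i\<in>UNIV. \<bar>M i\<bar>"])
    show "norm (frechet_derivative f (at z) v) \<le> (\<Sum>i\<in>UNIV. \<bar>M i\<bar>) * norm v" if "z \<in> S" for z v
    proof -
      have "f differentiable (at z)" using f S that by (auto simp: C1_on_def)
      then have "frechet_derivative f (at z) v = (\<Sum>i\<in>UNIV. v $ i *\<^sub>R partial i f z)"
        by (rule frechet_derivative_partial)
      also have "norm \<dots> \<le> (\<Sum>i\<in>UNIV. \<bar>M i\<bar> * norm v)"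
      proof (rule sum_norm_le)
        fix i :: 2
        show "norm (v $ i *\<^sub>R partial i f z) \<le> \<bar>M i\<bar> * norm v"
        proof -
          have "norm (partial i f z) \<le> \<bar>M i\<bar>" using M[OF that, of i] by linarith
          then have "\<bar>v $ i\<bar> * norm (partial i f z) \<le> norm v * \<bar>M i\<bar>"
            by (intro mult_mono component_le_norm_cart) simp_all
          then show ?thesis by (simp add: mult.commute)
        qed
      qed
      finally show ?thesis by (simp add: sum_distrib_right)
    qed
  qed (simp add: sum_nonneg)
qed

section \<open>Estimates of Gronwall type\<close>

text \<open>Working with the square of the norm avoids a case distinction at zeros of e, and bounding
  \<open>2 * norm (e t) * \<rho>\<close> by squares explains the constant \<open>2*C+1\<close>.\<close>

lemma gronwall:
  fixes e :: "real \<Rightarrow> 'a::real_inner"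
  assumes d: "\<And>t. t \<in> {S1..S2} \<Longrightarrow> (e has_vector_derivative e' t) (at t within {S1..S2})"
    and b: "\<And>t. t \<in> {S1..S2} \<Longrightarrow> norm (e' t) \<le> C * norm (e t) + \<rho>"
    and "0 \<le> C" "0 \<le> \<rho>" "S1 \<le> 0" "0 \<le> S2" and t: "t \<in> {S1..S2}"
  shows "norm (e t) \<le> (1 + \<bar>t\<bar>) * exp ((2*C+1) * \<bar>t\<bar>) * (norm (e 0) + \<rho>)"
proof -
  define K where "K = 2*C + 1"
  define N where "N t = (norm (e t))\<^sup>2" for t
  have N': "(N has_real_derivative 2 * (e t \<bullet> e' t)) (at t within {S1..S2})" if "t \<in> {S1..S2}" for t
  proof -
    have "N = (\<lambda>t. e t \<bullet> e t)" by (simp add: N_def dot_square_norm fun_eq_iff)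
    then show ?thesis
      using bounded_bilinear.has_vector_derivative[OF bounded_bilinear_inner d[OF that] d[OF that]]
      by (simp add: has_real_derivative_iff_has_vector_derivative inner_commute)
  qed
  have bd: "\<bar>2 * (e t \<bullet> e' t)\<bar> \<le> K * N t + \<rho>\<^sup>2" if "t \<in> {S1..S2}" for t
  proof -
    have "\<bar>2 * (e t \<bullet> e' t)\<bar> \<le> 2 * (norm (e t) * norm (e' t))"
      using Cauchy_Schwarz_ineq2[of "e t" "e' t"] by simp
    also have "\<dots> \<le> 2 * (norm (e t) * (C * norm (e t) + \<rho>))"
      using b[OF that] by (simp add: mult_left_mono)
    also have "\<dots> = 2*C * N t + 2 * norm (e t) * \<rho>"
      by (simp add: N_def power2_eq_square algebra_simps)
    also have "\<dots> \<le> K * N t + \<rho>\<^sup>2"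
      using sum_squares_bound[of "norm (e t)" \<rho>] by (simp add: K_def N_def algebra_simps)
    finally show ?thesis .
  qed
  have key: "N t \<le> (N 0 + \<rho>\<^sup>2 * \<bar>t\<bar>) * exp (K * \<bar>t\<bar>)"
  proof (cases "t \<ge> 0")
    case True
    let ?G = "\<lambda>t. N t * exp (- K * t) - \<rho>\<^sup>2 * t"
    have "?G t \<le> ?G 0"
    proof (rule DERIV_nonpos_imp_decreasing_open[of 0 t, OF True])
      fix s assume s: "0 < s" "s < t"
      then have sI: "s \<in> {S1..S2}" and int: "s \<in> interior {S1..S2}" using assms by auto
      then have "(N has_real_derivative 2 * (e s \<bullet> e' s)) (at s)"
        using N' at_within_interior by metis
      then have "(?G has_real_derivative (2 * (e s \<bullet> e' s) - K * N s) * exp (- K * s) - \<rho>\<^sup>2) (at s)"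
        by (auto intro!: derivative_eq_intros simp: left_diff_distrib)
      moreover have "(2 * (e s \<bullet> e' s) - K * N s) * exp (- K * s) \<le> \<rho>\<^sup>2 * 1"
      proof (rule mult_mono)
        show "2 * (e s \<bullet> e' s) - K * N s \<le> \<rho>\<^sup>2" using bd[OF sI] by linarith
        show "exp (- K * s) \<le> 1" using s \<open>0 \<le> C\<close> by (simp add: K_def mult_nonpos_nonneg)
      qed simp_all
      ultimately show "\<exists>y. (?G has_real_derivative y) (at s) \<and> y \<le> 0"
        by force
    next
      have "continuous_on {S1..S2} N"
        using N' by (meson DERIV_continuous continuous_on_eq_continuous_within)
      then have "continuous_on {0..t} N"
        using assms by (auto elim!: continuous_on_subset)
      then show "continuous_on {0..t} ?G" by (intro continuous_intros)
    qed
    then have "N t * exp (- K * t) * exp (K * t) \<le> (N 0 + \<rho>\<^sup>2 * t) * exp (K * t)"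
      by (intro mult_right_mono) simp_all
    then show ?thesis using True by (simp add: mult.assoc flip: exp_add)
  next
    case False
    let ?G = "\<lambda>t. N t * exp (K * t) + \<rho>\<^sup>2 * t"
    have "?G t \<le> ?G 0"
    proof (rule DERIV_nonneg_imp_increasing_open[of t 0])
      fix s assume s: "t < s" "s < 0"
      then have sI: "s \<in> {S1..S2}" and int: "s \<in> interior {S1..S2}" using assms by auto
      then have "(N has_real_derivative 2 * (e s \<bullet> e' s)) (at s)"
        using N' at_within_interior by metis
      then have "(?G has_real_derivative (2 * (e s \<bullet> e' s) + K * N s) * exp (K * s) + \<rho>\<^sup>2) (at s)"
        by (auto intro!: derivative_eq_intros simp: distrib_right)
      moreover have "(- (2 * (e s \<bullet> e' s)) - K * N s) * exp (K * s) \<le> \<rho>\<^sup>2 * 1"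
      proof (rule mult_mono)
        show "- (2 * (e s \<bullet> e' s)) - K * N s \<le> \<rho>\<^sup>2" using bd[OF sI] by linarith
        show "exp (K * s) \<le> 1" using s \<open>0 \<le> C\<close> by (simp add: K_def mult_nonneg_nonpos)
      qed simp_all
      then have "0 \<le> (2 * (e s \<bullet> e' s) + K * N s) * exp (K * s) + \<rho>\<^sup>2"
        by (simp add: left_diff_distrib distrib_right)
      ultimately show "\<exists>y. (?G has_real_derivative y) (at s) \<and> 0 \<le> y"
        by (intro exI[where x = "(2 * (e s \<bullet> e' s) + K * N s) * exp (K * s) + \<rho>\<^sup>2"] conjI)
    next
      have "continuous_on {S1..S2} N"
        using N' by (meson DERIV_continuous continuous_on_eq_continuous_within)
      then have "continuous_on {t..0} N"
        using assms by (auto elim!: continuous_on_subset)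
      then show "continuous_on {t..0} ?G" by (intro continuous_intros)
    qed (use False in auto)
    then have "N t * exp (K * t) * exp (- K * t) \<le> (N 0 - \<rho>\<^sup>2 * t) * exp (- K * t)"
      by (intro mult_right_mono) simp_all
    then show ?thesis using False by (simp add: mult.assoc flip: exp_add)
  qed
  let ?X = "exp (K * \<bar>t\<bar>)"
  have X1: "?X \<ge> 1" using \<open>0 \<le> C\<close> by (simp add: K_def)
  have "(norm (e t))\<^sup>2 \<le> ((norm (e 0))\<^sup>2 + \<rho>\<^sup>2 * \<bar>t\<bar>) * ?X" using key by (simp add: N_def)
  also have "\<dots> \<le> ((1 + \<bar>t\<bar>) * (norm (e 0) + \<rho>))\<^sup>2 * ?X\<^sup>2"
  proof (rule mult_mono)
    have "(norm (e 0))\<^sup>2 + \<rho>\<^sup>2 * \<bar>t\<bar> \<le> (1 + \<bar>t\<bar>) * ((norm (e 0))\<^sup>2 + \<rho>\<^sup>2)"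
      by (simp add: algebra_simps)
    also have "\<dots> \<le> (1 + \<bar>t\<bar>)\<^sup>2 * (norm (e 0) + \<rho>)\<^sup>2"
    proof (rule mult_mono)
      show "1 + \<bar>t\<bar> \<le> (1 + \<bar>t\<bar>)\<^sup>2" by (rule self_le_power) simp_all
      show "(norm (e 0))\<^sup>2 + \<rho>\<^sup>2 \<le> (norm (e 0) + \<rho>)\<^sup>2"
        using \<open>0 \<le> \<rho>\<close> by (simp add: power2_sum)
    qed simp_all
    finally show "(norm (e 0))\<^sup>2 + \<rho>\<^sup>2 * \<bar>t\<bar> \<le> ((1 + \<bar>t\<bar>) * (norm (e 0) + \<rho>))\<^sup>2"
      by (simp add: power_mult_distrib)
    show "?X \<le> ?X\<^sup>2" by (rule self_le_power[OF X1]) simp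
  qed simp_all
  also have "\<dots> = ((1 + \<bar>t\<bar>) * ?X * (norm (e 0) + \<rho>))\<^sup>2"
    by (simp only: power_mult_distrib ac_simps)
  finally have "(norm (e t))\<^sup>2 \<le> ((1 + \<bar>t\<bar>) * ?X * (norm (e 0) + \<rho>))\<^sup>2" .
  then show ?thesis
    unfolding K_def by (rule power2_le_imp_le) (use \<open>0 \<le> \<rho>\<close> in simp)
qed

text \<open>The differential inequality is only available while \<open>norm (e t)\<close> is below \<open>\<delta>\<close>. By continuity
  the estimate cannot be left: at a first time with \<open>norm (e t) = \<delta>\<close> Gronwall's bound, which is
  below \<open>\<delta>\<close>, would already hold.\<close>

lemma gronwall_bootstrap_forward:
  fixes e :: "real \<Rightarrow> 'a::real_inner"
  assumes d: "\<And>t. t \<in> {0..S} \<Longrightarrow> (e has_vector_derivative e' t) (at t within {0..S})"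
    and b: "\<And>t. \<lbrakk>t \<in> {0..S}; norm (e t) < \<delta>\<rbrakk> \<Longrightarrow> norm (e' t) \<le> C * norm (e t)"
    and C: "0 \<le> C" and small: "(1 + S) * exp ((2*C+1) * S) * norm (e 0) < \<delta>"
    and t: "t \<in> {0..S}"
  shows "norm (e t) \<le> (1 + S) * exp ((2*C+1) * S) * norm (e 0)"
proof -
  define G where "G = (1 + S) * exp ((2*C+1) * S)"
  have "0 \<le> S" using t by simp
  have cont: "continuous_on {0..S} e"
    using d has_vector_derivative_continuous continuous_on_eq_continuous_within by blast
  have below: "norm (e r) \<le> G * norm (e 0)"
    if r: "r \<in> {0..S}" and lt: "\<And>s. s \<in> {0..r} \<Longrightarrow> norm (e s) < \<delta>" for r
  proof -
    have "norm (e r) \<le> (1 + \<bar>r\<bar>) * exp ((2*C+1) * \<bar>r\<bar>) * (norm (e 0) + 0)"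
    proof (rule gronwall[where e' = e' and ?S1.0 = 0 and ?S2.0 = r])
      show "(e has_vector_derivative e' s) (at s within {0..r})" if "s \<in> {0..r}" for s
        using d[of s] r that by (intro has_vector_derivative_within_subset[OF d]) auto
      show "norm (e' s) \<le> C * norm (e s) + 0" if "s \<in> {0..r}" for s
        using b[of s] lt[OF that] r that by auto
    qed (use r C in auto)
    also have "\<dots> \<le> G * norm (e 0)"
    proof -
      have "(2*C+1) * r \<le> (2*C+1) * S"
        using r C by (intro mult_left_mono) auto
      then have "(1 + r) * exp ((2*C+1) * r) \<le> G"
        unfolding G_def using r by (intro mult_mono) auto
      then show ?thesis using r by (simp add: mult_right_mono)
    qed
    finally show ?thesis .
  qed
  have "norm (e s) < \<delta>" if s: "s \<in> {0..S}" for s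
  proof (rule ccontr)
    assume "\<not> norm (e s) < \<delta>"
    define B where "B = {s \<in> {0..S}. \<delta> \<le> norm (e s)}"
    have "closed B"
      unfolding B_def by (intro continuous_on_closed_Collect_le continuous_intros cont closed_atLeastAtMost)
    moreover have "B \<noteq> {}" using s \<open>\<not> norm (e s) < \<delta>\<close> by (auto simp: B_def)
    moreover have bdd: "bdd_below B" by (rule bdd_belowI[of _ 0]) (simp add: B_def)
    ultimately have InfB: "Inf B \<in> B" by (intro closed_contains_Inf)
    define m where "m = Inf B"
    have m: "m \<in> {0..S}" "\<delta> \<le> norm (e m)" using InfB by (auto simp: B_def m_def)
    have lt: "norm (e r) < \<delta>" if "r \<in> {0..<m}" for r
    proof (rule ccontr)
      assume "\<not> norm (e r) < \<delta>"
      then have "r \<in> B" using that m by (auto simp: B_def)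
      then show False using cInf_lower[OF _ bdd] that by (force simp: m_def)
    qed
    have G1: "norm (e 0) \<le> G * norm (e 0)"
      using below[of 0] \<open>0 \<le> S\<close> C small mult_mono[of 1 "1+S" 1 "exp ((2*C+1) * S)"]
      by (simp add: G_def mult_le_cancel_right1)
    have "norm (e m) \<le> G * norm (e 0)"
    proof (cases "m = 0")
      case True then show ?thesis using G1 by simp
    next
      case False
      then have "m > 0" using m by simp
      have *: "norm (e r) \<le> G * norm (e 0)" if "r \<in> {0..<m}" for r
        using below[of r] lt that m by auto
      have "((\<lambda>r. norm (e r)) \<longlongrightarrow> norm (e m)) (at m within {0..<m})"
        using cont m unfolding continuous_on_def
        by (intro tendsto_norm tendsto_within_subset[of e _ m "{0..S}" "{0..<m}"]) auto
      moreover have "at m within {0..<m} \<noteq> bot"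
        using \<open>m > 0\<close> by (simp add: at_within_eq_bot_iff)
      ultimately show ?thesis
        by (intro tendsto_upperbound) (use * in \<open>auto simp: eventually_at_filter\<close>)
    qed
    then show False using small m by (simp add: G_def)
  qed
  then show ?thesis using below[OF t] t by (auto simp: G_def)
qed

lemma gronwall_bootstrap:
  fixes e :: "real \<Rightarrow> 'a::real_inner"
  assumes d: "\<And>t. t \<in> {S1..S2} \<Longrightarrow> (e has_vector_derivative e' t) (at t)"
    and b: "\<And>t. \<lbrakk>t \<in> {S1..S2}; norm (e t) < \<delta>\<rbrakk> \<Longrightarrow> norm (e' t) \<le> C * norm (e t)"
    and C: "0 \<le> C" and R: "-R \<le> S1" "S1 \<le> 0" "0 \<le> S2" "S2 \<le> R"
    and small: "(1 + R) * exp ((2*C+1) * R) * norm (e 0) < \<delta>"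
    and t: "t \<in> {S1..S2}"
  shows "norm (e t) \<le> (1 + R) * exp ((2*C+1) * R) * norm (e 0)"
proof -
  have mono: "(1 + S) * exp ((2*C+1) * S) * norm (e 0) \<le> (1 + R) * exp ((2*C+1) * R) * norm (e 0)"
    if "0 \<le> S" "S \<le> R" for S
  proof -
    have "(2*C+1) * S \<le> (2*C+1) * R" using that C by (intro mult_left_mono) auto
    then have "(1 + S) * exp ((2*C+1) * S) \<le> (1 + R) * exp ((2*C+1) * R)"
      using that by (intro mult_mono) auto
    then show ?thesis by (simp add: mult_right_mono)
  qed
  show ?thesis
  proof (cases "0 \<le> t")
    case True
    have "norm (e t) \<le> (1 + S2) * exp ((2*C+1) * S2) * norm (e 0)"
    proof (rule gronwall_bootstrap_forward[where e' = e' and \<delta> = \<delta>])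
      show "(e has_vector_derivative e' s) (at s within {0..S2})" if "s \<in> {0..S2}" for s
        by (rule has_vector_derivative_at_within[OF d]) (use that R in simp)
      show "norm (e' s) \<le> C * norm (e s)" if "s \<in> {0..S2}" "norm (e s) < \<delta>" for s
        using b[of s] that R by simp
      show "(1 + S2) * exp ((2*C+1) * S2) * norm (e 0) < \<delta>" using mono[of S2] small R by linarith
    qed (use C t True in simp_all)
    then show ?thesis using mono[of S2] R by linarith
  next
    case False
    let ?g = "\<lambda>t. e (- t)"
    have "norm (?g (- t)) \<le> (1 + - S1) * exp ((2*C+1) * - S1) * norm (?g 0)"
    proof (rule gronwall_bootstrap_forward[where e' = "\<lambda>s. - e' (- s)" and \<delta> = \<delta>])
      show "(?g has_vector_derivative - e' (- s)) (at s within {0..- S1})" if "s \<in> {0..- S1}" for s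
      proof -
        have "((e \<circ> uminus) has_vector_derivative (-1) *\<^sub>R e' (- s)) (at s within {0..- S1})"
        proof (rule vector_diff_chain_within)
          show "(uminus has_vector_derivative - 1) (at s within {0..- S1})"
            by (auto intro!: derivative_eq_intros)
          show "(e has_vector_derivative e' (- s)) (at (- s) within uminus ` {0..- S1})"
            by (rule has_vector_derivative_at_within[OF d]) (use that R in simp)
        qed
        then show ?thesis by (simp add: o_def)
      qed
      show "norm (- e' (- s)) \<le> C * norm (?g s)" if "s \<in> {0..- S1}" "norm (?g s) < \<delta>" for s
        using b[of "- s"] that R by simp
      show "(1 + - S1) * exp ((2*C+1) * - S1) * norm (?g 0) < \<delta>"
        using mono[of "- S1"] small R by simp
    qed (use C t False in simp_all)
    then show ?thesis using mono[of "- S1"] R by simp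
  qed
qed

section \<open>Differentiability of trajectories in a parameter\<close>

definition diff_quot :: "(real \<Rightarrow> real \<Rightarrow> 'a::real_vector) \<Rightarrow> real \<Rightarrow> real \<Rightarrow> real \<Rightarrow> 'a"
  where "diff_quot y \<sigma> \<tau> \<tau>' = (y \<sigma> \<tau>' - y \<sigma> \<tau>) /\<^sub>R (\<tau>' - \<tau>)"

text \<open>Differentiability of y with respect to the parameter, uniform on I, expressed without naming
  the derivative. As both end points of the difference quotients vary, it also contains the
  continuity of the derivative at \<open>\<tau>\<close>.\<close>

definition quot_Cauchy :: "(real \<Rightarrow> real \<Rightarrow> 'a::real_normed_vector) \<Rightarrow> real set \<Rightarrow> real \<Rightarrow> bool"
  where "quot_Cauchy y I \<tau> \<longleftrightarrow> (\<forall>\<epsilon>>0. \<exists>d>0. \<forall>t1\<in>ball \<tau> d. \<forall>t1'\<in>ball \<tau> d. \<forall>t2\<in>ball \<tau> d. \<forall>t2'\<in>ball \<tau> d.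
     t1 \<noteq> t1' \<longrightarrow> t2 \<noteq> t2' \<longrightarrow>
     (\<forall>\<sigma>\<in>I. norm (diff_quot y \<sigma> t1 t1' - diff_quot y \<sigma> t2 t2') \<le> \<epsilon>))"

text \<open>Trajectories of a strictly differentiable field f with linearization L, whose initial values
  are merely continuous in the parameter. Differentiability of the initial values is added as a
  hypothesis on top of the locale, because for the characteristics it is derived by means of the
  estimates proved here.\<close>

locale flow_family =
  fixes f :: "'a::euclidean_space \<Rightarrow> 'a" and L :: "'a \<Rightarrow> 'a \<Rightarrow> 'a" and A :: "'a set"
    and W :: "(real \<times> real) set" and y :: "real \<Rightarrow> real \<Rightarrow> 'a"
  assumes strict: "\<And>S \<eta>. \<lbrakk>compact S; S \<subseteq> A; \<eta> > 0\<rbrakk> \<Longrightarrow> \<exists>\<delta>>0. \<forall>z\<in>S. ball z \<delta> \<subseteq> A \<and>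
      (\<forall>x\<in>ball z \<delta>. \<forall>x'\<in>ball z \<delta>. norm (f x' - f x - L z (x' - x)) \<le> \<eta> * norm (x' - x))"
    and L_linear: "\<And>z. z \<in> A \<Longrightarrow> linear (L z)"
    and L_bound: "\<And>S. \<lbrakk>compact S; S \<subseteq> A\<rbrakk> \<Longrightarrow> \<exists>M\<ge>0. \<forall>z\<in>S. \<forall>v. norm (L z v) \<le> M * norm v"
    and open_W: "open W"
    and W_star: "\<And>\<sigma> \<tau>. (\<sigma>, \<tau>) \<in> W \<Longrightarrow> closed_segment 0 \<sigma> \<times> {\<tau>} \<subseteq> W"
    and in_A: "\<And>\<sigma> \<tau>. (\<sigma>, \<tau>) \<in> W \<Longrightarrow> y \<sigma> \<tau> \<in> A"
    and sol: "\<And>\<sigma> \<tau>. (\<sigma>, \<tau>) \<in> W \<Longrightarrow> ((\<lambda>\<sigma>. y \<sigma> \<tau>) has_vector_derivative f (y \<sigma> \<tau>)) (at \<sigma>)"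
    and init_cont: "\<And>\<tau>. (0, \<tau>) \<in> W \<Longrightarrow> isCont (y 0) \<tau>"
begin

lemma trajectory_continuous: "{S1..S2} \<times> {\<tau>} \<subseteq> W \<Longrightarrow> continuous_on {S1..S2} (\<lambda>\<sigma>. y \<sigma> \<tau>)"
  by (intro continuous_at_imp_continuous_on ballI has_vector_derivative_continuous[OF sol]) auto

lemma trajectory_compact:
  "{S1..S2} \<times> {\<tau>} \<subseteq> W \<Longrightarrow> compact ((\<lambda>\<sigma>. y \<sigma> \<tau>) ` {S1..S2}) \<and> (\<lambda>\<sigma>. y \<sigma> \<tau>) ` {S1..S2} \<subseteq> A"
  using in_A by (intro conjI compact_continuous_image trajectory_continuous) auto

lemma nearby_times_in_W:
  assumes "{S1..S2} \<times> {\<tau>} \<subseteq> W"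
  obtains d where "d > 0" "\<And>\<tau>'. \<tau>' \<in> ball \<tau> d \<Longrightarrow> {S1..S2} \<times> {\<tau>'} \<subseteq> W"
proof -
  have "compact ({S1..S2} \<times> {\<tau>})" by (intro compact_Times) auto
  then obtain d where d: "d > 0" "(\<Union>x\<in>{S1..S2} \<times> {\<tau>}. ball x d) \<subseteq> W"
    using compact_subset_open_imp_ball_epsilon_subset[OF _ open_W assms] by blast
  show ?thesis
  proof (rule that[OF d(1)])
    fix \<tau>' assume t: "\<tau>' \<in> ball \<tau> d"
    have "(\<sigma>, \<tau>') \<in> ball (\<sigma>, \<tau>) d" for \<sigma> using t by (simp add: dist_Pair_Pair)
    then show "{S1..S2} \<times> {\<tau>'} \<subseteq> W" using d(2) by fastforce
  qed
qed

lemma continuous_dependence: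
  assumes I: "{S1..S2} \<times> {\<tau>} \<subseteq> W" "S1 \<le> 0" "0 \<le> S2" and "\<epsilon> > 0"
  obtains d where "d > 0" "\<And>\<tau>'. \<tau>' \<in> ball \<tau> d \<Longrightarrow> {S1..S2} \<times> {\<tau>'} \<subseteq> W"
    "\<And>\<tau>' \<sigma>. \<lbrakk>\<tau>' \<in> ball \<tau> d; \<sigma> \<in> {S1..S2}\<rbrakk> \<Longrightarrow> norm (y \<sigma> \<tau>' - y \<sigma> \<tau>) < \<epsilon>"
proof -
  let ?S = "(\<lambda>\<sigma>. y \<sigma> \<tau>) ` {S1..S2}"
  have S: "compact ?S" "?S \<subseteq> A" using trajectory_compact[OF I(1)] by auto
  obtain \<delta> where \<delta>: "\<delta> > 0" "\<And>z x x'. \<lbrakk>z \<in> ?S; x \<in> ball z \<delta>; x' \<in> ball z \<delta>\<rbrakk> \<Longrightarrow>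
      norm (f x' - f x - L z (x' - x)) \<le> 1 * norm (x' - x)"
    using strict[OF S, of 1] by (metis zero_less_one)
  obtain M where M: "M \<ge> 0" "\<And>z v. z \<in> ?S \<Longrightarrow> norm (L z v) \<le> M * norm v"
    using L_bound[OF S] by blast
  define \<delta>' where "\<delta>' = min \<delta> \<epsilon>"
  have \<delta>': "\<delta>' > 0" "\<delta>' \<le> \<delta>" "\<delta>' \<le> \<epsilon>" using \<delta> \<open>\<epsilon> > 0\<close> by (auto simp: \<delta>'_def)
  define R where "R = max (- S1) S2"
  define G where "G = (1 + R) * exp ((2*(M+1)+1) * R)"
  have "R \<ge> 0" using I by (auto simp: R_def)
  then have "G > 0" by (auto simp: G_def intro!: mult_pos_pos)
  obtain d1 where d1: "d1 > 0" "\<And>\<tau>'. \<tau>' \<in> ball \<tau> d1 \<Longrightarrow> {S1..S2} \<times> {\<tau>'} \<subseteq> W"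
    using nearby_times_in_W[OF I(1)] by blast
  have "(0, \<tau>) \<in> W" using I by auto
  then have "isCont (y 0) \<tau>" by (rule init_cont)
  moreover have "\<delta>' / G > 0" using \<delta>' \<open>G > 0\<close> by simp
  ultimately obtain d2 where d2: "d2 > 0" "\<And>\<tau>'. dist \<tau>' \<tau> < d2 \<Longrightarrow> dist (y 0 \<tau>') (y 0 \<tau>) < \<delta>' / G"
    unfolding continuous_at_eps_delta dist_norm by blast
  show ?thesis
  proof (rule that[of "min d1 d2"])
    show "min d1 d2 > 0" using d1 d2 by simp
    show "{S1..S2} \<times> {\<tau>'} \<subseteq> W" if "\<tau>' \<in> ball \<tau> (min d1 d2)" for \<tau>'
      using d1 that by simp
    fix \<tau>' \<sigma> assume t: "\<tau>' \<in> ball \<tau> (min d1 d2)" and s: "\<sigma> \<in> {S1..S2}"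
    have W': "{S1..S2} \<times> {\<tau>'} \<subseteq> W" using d1 t by simp
    let ?e = "\<lambda>\<sigma>. y \<sigma> \<tau>' - y \<sigma> \<tau>"
    have "norm (?e 0) < \<delta>' / G" using d2(2)[of \<tau>'] t by (simp add: dist_norm abs_minus_commute)
    then have small: "G * norm (?e 0) < \<delta>'" using \<open>G > 0\<close> by (simp add: pos_less_divide_eq mult.commute)
    have "norm (?e \<sigma>) \<le> G * norm (?e 0)"
      unfolding G_def
    proof (rule gronwall_bootstrap[where \<delta> = \<delta>' and e' = "\<lambda>\<sigma>. f (y \<sigma> \<tau>') - f (y \<sigma> \<tau>)" and e = ?e])
      show "(?e has_vector_derivative f (y r \<tau>') - f (y r \<tau>)) (at r)" if "r \<in> {S1..S2}" for r
        using that W' I by (intro has_vector_derivative_diff sol) auto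
      show "norm (f (y r \<tau>') - f (y r \<tau>)) \<le> (M + 1) * norm (?e r)"
        if r: "r \<in> {S1..S2}" and lt: "norm (?e r) < \<delta>'" for r
      proof -
        have z: "y r \<tau> \<in> ?S" using r by blast
        have "norm (f (y r \<tau>') - f (y r \<tau>) - L (y r \<tau>) (?e r)) \<le> 1 * norm (?e r)"
          using lt \<delta>' \<open>\<delta> > 0\<close> by (intro \<delta>(2)[OF z]) (auto simp: dist_norm norm_minus_commute)
        moreover have "norm (L (y r \<tau>) (?e r)) \<le> M * norm (?e r)" by (rule M(2)[OF z])
        ultimately show ?thesis
          using norm_triangle_sub[of "f (y r \<tau>') - f (y r \<tau>)" "L (y r \<tau>) (?e r)"]
          unfolding distrib_right by linarith
      qed
      show "(1 + R) * exp ((2 * (M + 1) + 1) * R) * norm (?e 0) < \<delta>'"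
        using small by (simp add: G_def)
    qed (use M(1) I s in \<open>auto simp: R_def\<close>)
    then show "norm (?e \<sigma>) < \<epsilon>" using small \<delta>' by linarith
  qed
qed

lemma difference_linearized:
  assumes I: "{S1..S2} \<times> {\<tau>} \<subseteq> W" "S1 \<le> 0" "0 \<le> S2" and "\<epsilon> > 0"
  obtains d where "d > 0" "\<And>\<tau>'. \<tau>' \<in> ball \<tau> d \<Longrightarrow> {S1..S2} \<times> {\<tau>'} \<subseteq> W"
    "\<And>t1 t2 \<sigma>. \<lbrakk>t1 \<in> ball \<tau> d; t2 \<in> ball \<tau> d; \<sigma> \<in> {S1..S2}\<rbrakk> \<Longrightarrow>
      norm (f (y \<sigma> t2) - f (y \<sigma> t1) - L (y \<sigma> \<tau>) (y \<sigma> t2 - y \<sigma> t1)) \<le> \<epsilon> * norm (y \<sigma> t2 - y \<sigma> t1)"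
proof -
  let ?S = "(\<lambda>\<sigma>. y \<sigma> \<tau>) ` {S1..S2}"
  have S: "compact ?S" "?S \<subseteq> A" using trajectory_compact[OF I(1)] by auto
  obtain \<delta> where \<delta>: "\<delta> > 0" "\<And>z x x'. \<lbrakk>z \<in> ?S; x \<in> ball z \<delta>; x' \<in> ball z \<delta>\<rbrakk> \<Longrightarrow>
      norm (f x' - f x - L z (x' - x)) \<le> \<epsilon> * norm (x' - x)"
    using strict[OF S \<open>\<epsilon> > 0\<close>] by blast
  obtain d where d: "d > 0" "\<And>\<tau>'. \<tau>' \<in> ball \<tau> d \<Longrightarrow> {S1..S2} \<times> {\<tau>'} \<subseteq> W"
    "\<And>\<tau>' \<sigma>. \<lbrakk>\<tau>' \<in> ball \<tau> d; \<sigma> \<in> {S1..S2}\<rbrakk> \<Longrightarrow> norm (y \<sigma> \<tau>' - y \<sigma> \<tau>) < \<delta>"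
    using continuous_dependence[OF I \<open>\<delta> > 0\<close>] by blast
  show ?thesis
  proof (rule that[OF d(1,2)])
    fix t1 t2 \<sigma> assume *: "t1 \<in> ball \<tau> d" "t2 \<in> ball \<tau> d" "\<sigma> \<in> {S1..S2}"
    then show "norm (f (y \<sigma> t2) - f (y \<sigma> t1) - L (y \<sigma> \<tau>) (y \<sigma> t2 - y \<sigma> t1))
        \<le> \<epsilon> * norm (y \<sigma> t2 - y \<sigma> t1)"
      using d(3)[of t1 \<sigma>] d(3)[of t2 \<sigma>]
      by (intro \<delta>(2)) (auto simp: dist_norm norm_minus_commute)
  qed
qed

lemma difference_bound:
  assumes I: "{S1..S2} \<times> {\<tau>} \<subseteq> W" "S1 \<le> 0" "0 \<le> S2"
  obtains d G where "d > 0" "G \<ge> 1"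
    "\<And>t1 t2 \<sigma>. \<lbrakk>t1 \<in> ball \<tau> d; t2 \<in> ball \<tau> d; \<sigma> \<in> {S1..S2}\<rbrakk> \<Longrightarrow>
      norm (y \<sigma> t2 - y \<sigma> t1) \<le> G * norm (y 0 t2 - y 0 t1)"
proof -
  let ?S = "(\<lambda>\<sigma>. y \<sigma> \<tau>) ` {S1..S2}"
  have S: "compact ?S" "?S \<subseteq> A" using trajectory_compact[OF I(1)] by auto
  obtain M where M: "M \<ge> 0" "\<And>z v. z \<in> ?S \<Longrightarrow> norm (L z v) \<le> M * norm v"
    using L_bound[OF S] by blast
  obtain d where d: "d > 0" "\<And>\<tau>'. \<tau>' \<in> ball \<tau> d \<Longrightarrow> {S1..S2} \<times> {\<tau>'} \<subseteq> W"
    "\<And>t1 t2 \<sigma>. \<lbrakk>t1 \<in> ball \<tau> d; t2 \<in> ball \<tau> d; \<sigma> \<in> {S1..S2}\<rbrakk> \<Longrightarrow>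
      norm (f (y \<sigma> t2) - f (y \<sigma> t1) - L (y \<sigma> \<tau>) (y \<sigma> t2 - y \<sigma> t1)) \<le> 1 * norm (y \<sigma> t2 - y \<sigma> t1)"
    using difference_linearized[OF I zero_less_one] by blast
  define R where "R = max (- S1) S2"
  define G where "G = (1 + R) * exp ((2*(M+1)+1) * R)"
  have "R \<ge> 0" using I by (auto simp: R_def)
  then have "G \<ge> 1 * 1" unfolding G_def using M(1) by (intro mult_mono) auto
  show ?thesis
  proof (rule that[OF d(1), of G])
    fix t1 t2 \<sigma> assume *: "t1 \<in> ball \<tau> d" "t2 \<in> ball \<tau> d" "\<sigma> \<in> {S1..S2}"
    let ?e = "\<lambda>\<sigma>. y \<sigma> t2 - y \<sigma> t1"
    show "norm (?e \<sigma>) \<le> G * norm (?e 0)"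
      unfolding G_def
    proof (rule gronwall_bootstrap[where \<delta> = "G * norm (?e 0) + 1"
          and e' = "\<lambda>\<sigma>. f (y \<sigma> t2) - f (y \<sigma> t1)" and e = ?e])
      show "(?e has_vector_derivative f (y r t2) - f (y r t1)) (at r)" if "r \<in> {S1..S2}" for r
        using that d(2)[OF *(1)] d(2)[OF *(2)] by (intro has_vector_derivative_diff sol) auto
      show "norm (f (y r t2) - f (y r t1)) \<le> (M + 1) * norm (?e r)" if r: "r \<in> {S1..S2}" for r
      proof -
        have "norm (L (y r \<tau>) (?e r)) \<le> M * norm (?e r)" by (rule M(2)) (use r in blast)
        then show ?thesis
          using d(3)[OF *(1,2) r]
            norm_triangle_sub[of "f (y r t2) - f (y r t1)" "L (y r \<tau>) (?e r)"]
          unfolding distrib_right by linarith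
      qed
      show "(1 + R) * exp ((2 * (M + 1) + 1) * R) * norm (?e 0) < G * norm (?e 0) + 1"
        by (simp add: G_def)
    qed (use M(1) I *(3) in \<open>auto simp: R_def\<close>)
  qed (use \<open>G \<ge> 1 * 1\<close> in simp)
qed

end

lemma quot_CauchyE:
  assumes "quot_Cauchy y I \<tau>" "\<epsilon> > 0"
  obtains d where "d > 0" "\<And>t1 t1' t2 t2' \<sigma>. \<lbrakk>t1 \<in> ball \<tau> d; t1' \<in> ball \<tau> d; t2 \<in> ball \<tau> d; t2' \<in> ball \<tau> d;
      t1 \<noteq> t1'; t2 \<noteq> t2'; \<sigma> \<in> I\<rbrakk> \<Longrightarrow> norm (diff_quot y \<sigma> t1 t1' - diff_quot y \<sigma> t2 t2') \<le> \<epsilon>"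
proof -
  have "\<exists>d>0. \<forall>t1\<in>ball \<tau> d. \<forall>t1'\<in>ball \<tau> d. \<forall>t2\<in>ball \<tau> d. \<forall>t2'\<in>ball \<tau> d.
     t1 \<noteq> t1' \<longrightarrow> t2 \<noteq> t2' \<longrightarrow>
     (\<forall>\<sigma>\<in>I. norm (diff_quot y \<sigma> t1 t1' - diff_quot y \<sigma> t2 t2') \<le> \<epsilon>)"
    using assms unfolding quot_Cauchy_def by simp
  then show ?thesis using that by blast
qed

context flow_family
begin

lemma quot_Cauchy_bounded:
  assumes "quot_Cauchy y I \<tau>" "\<sigma> \<in> I"
  obtains B d where "d > 0" "B \<ge> 0"
    "\<And>t1 t1'. \<lbrakk>t1 \<in> ball \<tau> d; t1' \<in> ball \<tau> d; t1 \<noteq> t1'\<rbrakk> \<Longrightarrow> norm (diff_quot y \<sigma> t1 t1') \<le> B"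
proof -
  obtain d where d: "d > 0" "\<And>t1 t1' t2 t2'. \<lbrakk>t1 \<in> ball \<tau> d; t1' \<in> ball \<tau> d; t2 \<in> ball \<tau> d; t2' \<in> ball \<tau> d;
      t1 \<noteq> t1'; t2 \<noteq> t2'; \<sigma> \<in> I\<rbrakk> \<Longrightarrow> norm (diff_quot y \<sigma> t1 t1' - diff_quot y \<sigma> t2 t2') \<le> 1"
    using quot_CauchyE[OF assms(1) zero_less_one, where thesis = thesis] by blast
  let ?q = "diff_quot y \<sigma> \<tau> (\<tau> + d/2)"
  show ?thesis
  proof (rule that[OF d(1), of "norm ?q + 1"])
    fix t1 t1' assume *: "t1 \<in> ball \<tau> d" "t1' \<in> ball \<tau> d" "t1 \<noteq> t1'"
    have "norm (diff_quot y \<sigma> t1 t1' - ?q) \<le> 1"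
      by (rule d(2)) (use \<open>d > 0\<close> * assms(2) in \<open>simp_all add: dist_norm\<close>)
    then show "norm (diff_quot y \<sigma> t1 t1') \<le> norm ?q + 1"
      using norm_triangle_sub[of "diff_quot y \<sigma> t1 t1'" ?q] by linarith
  qed simp
qed

lemma diff_quot_derivative:
  assumes "(\<sigma>, t1) \<in> W" "(\<sigma>, t2) \<in> W"
  shows "((\<lambda>\<sigma>. diff_quot y \<sigma> t1 t2) has_vector_derivative
    (f (y \<sigma> t2) - f (y \<sigma> t1)) /\<^sub>R (t2 - t1)) (at \<sigma>)"
  unfolding diff_quot_def divide_inverse
  by (intro bounded_linear.has_vector_derivative[OF bounded_linear_scaleR_right]
      has_vector_derivative_diff sol assms)

lemma diff_quot_linearized:
  assumes z: "y \<sigma> \<tau> \<in> A" and "t1 \<noteq> t2"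
    and le: "norm (f (y \<sigma> t2) - f (y \<sigma> t1) - L (y \<sigma> \<tau>) (y \<sigma> t2 - y \<sigma> t1)) \<le> \<epsilon> * norm (y \<sigma> t2 - y \<sigma> t1)"
  shows "norm ((f (y \<sigma> t2) - f (y \<sigma> t1)) /\<^sub>R (t2 - t1) - L (y \<sigma> \<tau>) (diff_quot y \<sigma> t1 t2))
    \<le> \<epsilon> * norm (diff_quot y \<sigma> t1 t2)"
proof -
  let ?D = "f (y \<sigma> t2) - f (y \<sigma> t1) - L (y \<sigma> \<tau>) (y \<sigma> t2 - y \<sigma> t1)"
  have "(f (y \<sigma> t2) - f (y \<sigma> t1)) /\<^sub>R (t2 - t1) - L (y \<sigma> \<tau>) (diff_quot y \<sigma> t1 t2)
      = ?D /\<^sub>R (t2 - t1)"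
    unfolding diff_quot_def linear_cmul[OF L_linear[OF z]] by (simp add: scaleR_diff_right)
  then have "norm ((f (y \<sigma> t2) - f (y \<sigma> t1)) /\<^sub>R (t2 - t1) - L (y \<sigma> \<tau>) (diff_quot y \<sigma> t1 t2))
      = \<bar>inverse (t2 - t1)\<bar> * norm ?D" by simp
  also have "\<dots> \<le> \<bar>inverse (t2 - t1)\<bar> * (\<epsilon> * norm (y \<sigma> t2 - y \<sigma> t1))"
    by (intro mult_left_mono le) simp
  also have "\<dots> = \<epsilon> * norm (diff_quot y \<sigma> t1 t2)"
    by (simp add: diff_quot_def)
  finally show ?thesis .
qed

text \<open>The difference of two difference quotients solves the linearized equation along the base
  trajectory up to a small error, so Gronwall's inequality carries the Cauchy property from time 0
  to all times.\<close>

lemma quot_Cauchy_propagates: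
  assumes I: "{S1..S2} \<times> {\<tau>} \<subseteq> W" "S1 \<le> 0" "0 \<le> S2" and init: "quot_Cauchy y {0} \<tau>"
  shows "quot_Cauchy y {S1..S2} \<tau>"
  unfolding quot_Cauchy_def
proof (intro allI impI)
  fix \<epsilon> :: real assume "\<epsilon> > 0"
  let ?S = "(\<lambda>\<sigma>. y \<sigma> \<tau>) ` {S1..S2}"
  have S: "compact ?S" "?S \<subseteq> A" using trajectory_compact[OF I(1)] by auto
  obtain M where M: "M \<ge> 0" "\<And>z v. z \<in> ?S \<Longrightarrow> norm (L z v) \<le> M * norm v"
    using L_bound[OF S] by blast
  obtain B d1 where B: "d1 > 0" "B \<ge> 0"
    "\<And>t1 t1'. \<lbrakk>t1 \<in> ball \<tau> d1; t1' \<in> ball \<tau> d1; t1 \<noteq> t1'\<rbrakk> \<Longrightarrow> norm (diff_quot y 0 t1 t1') \<le> B"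
    by (rule quot_Cauchy_bounded[OF init singletonI]) (rule that)
  obtain d2 G where G: "d2 > 0" "G \<ge> 1"
    "\<And>t1 t2 \<sigma>. \<lbrakk>t1 \<in> ball \<tau> d2; t2 \<in> ball \<tau> d2; \<sigma> \<in> {S1..S2}\<rbrakk> \<Longrightarrow>
      norm (y \<sigma> t2 - y \<sigma> t1) \<le> G * norm (y 0 t2 - y 0 t1)"
    using difference_bound[OF I] by blast
  define R where "R = max (- S1) S2"
  define K where "K = (1 + R) * exp ((2*M+1) * R)"
  have "R \<ge> 0" using I by (auto simp: R_def)
  then have "K > 0" by (auto simp: K_def intro!: mult_pos_pos)
  define \<kappa> where "\<kappa> = \<epsilon> / (2 * K)"
  have "\<kappa> > 0" using \<open>\<epsilon> > 0\<close> \<open>K > 0\<close> by (simp add: \<kappa>_def)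
  define \<eta> where "\<eta> = \<kappa> / (2 * G * B + 1)"
  have GB: "2 * G * B + 1 > 0" using G B by (simp add: add_nonneg_pos)
  have "\<eta> > 0" using GB \<open>\<kappa> > 0\<close> by (simp add: \<eta>_def)
  obtain d3 where d3: "d3 > 0" "\<And>\<tau>'. \<tau>' \<in> ball \<tau> d3 \<Longrightarrow> {S1..S2} \<times> {\<tau>'} \<subseteq> W"
    "\<And>t1 t2 \<sigma>. \<lbrakk>t1 \<in> ball \<tau> d3; t2 \<in> ball \<tau> d3; \<sigma> \<in> {S1..S2}\<rbrakk> \<Longrightarrow>
      norm (f (y \<sigma> t2) - f (y \<sigma> t1) - L (y \<sigma> \<tau>) (y \<sigma> t2 - y \<sigma> t1)) \<le> \<eta> * norm (y \<sigma> t2 - y \<sigma> t1)"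
    using difference_linearized[OF I \<open>\<eta> > 0\<close>] by blast
  obtain d4 where d4: "d4 > 0" "\<And>t1 t1' t2 t2'. \<lbrakk>t1 \<in> ball \<tau> d4; t1' \<in> ball \<tau> d4; t2 \<in> ball \<tau> d4; t2' \<in> ball \<tau> d4;
      t1 \<noteq> t1'; t2 \<noteq> t2'\<rbrakk> \<Longrightarrow> norm (diff_quot y 0 t1 t1' - diff_quot y 0 t2 t2') \<le> \<kappa>"
    by (rule quot_CauchyE[OF init \<open>\<kappa> > 0\<close>]) (rule that, assumption, simp)
  define d where "d = Min {d1, d2, d3, d4}"
  have d: "d > 0" "d \<le> d1" "d \<le> d2" "d \<le> d3" "d \<le> d4"
    using B(1) G(1) d3(1) d4(1) by (auto simp: d_def)
  show "\<exists>d>0. \<forall>t1\<in>ball \<tau> d. \<forall>t1'\<in>ball \<tau> d. \<forall>t2\<in>ball \<tau> d. \<forall>t2'\<in>ball \<tau> d. t1 \<noteq> t1' \<longrightarrow> t2 \<noteq> t2' \<longrightarrow>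
     (\<forall>\<sigma>\<in>{S1..S2}. norm (diff_quot y \<sigma> t1 t1' - diff_quot y \<sigma> t2 t2') \<le> \<epsilon>)"
  proof (intro exI conjI ballI impI)
    show "d > 0" by fact
    fix t1 t1' t2 t2' \<sigma>
    assume t: "t1 \<in> ball \<tau> d" "t1' \<in> ball \<tau> d" "t2 \<in> ball \<tau> d" "t2' \<in> ball \<tau> d"
      and ne: "t1 \<noteq> t1'" "t2 \<noteq> t2'" and s: "\<sigma> \<in> {S1..S2}"
    let ?q1 = "\<lambda>\<sigma>. diff_quot y \<sigma> t1 t1'" and ?q2 = "\<lambda>\<sigma>. diff_quot y \<sigma> t2 t2'"
    let ?d1 = "\<lambda>\<sigma>. (f (y \<sigma> t1') - f (y \<sigma> t1)) /\<^sub>R (t1' - t1)"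
    let ?d2 = "\<lambda>\<sigma>. (f (y \<sigma> t2') - f (y \<sigma> t2)) /\<^sub>R (t2' - t2)"
    have bnd: "norm (diff_quot y r a b) \<le> G * B" if ab: "a \<in> ball \<tau> d" "b \<in> ball \<tau> d" "a \<noteq> b" "r \<in> {S1..S2}" for a b r
    proof -
      have "norm (y r b - y r a) \<le> G * norm (y 0 b - y 0 a)" using ab d by (intro G(3)) auto
      then have "\<bar>inverse (b - a)\<bar> * norm (y r b - y r a) \<le> \<bar>inverse (b - a)\<bar> * (G * norm (y 0 b - y 0 a))"
        by (intro mult_left_mono) auto
      also have "\<dots> = G * norm (diff_quot y 0 a b)" by (simp add: diff_quot_def)
      also have "\<dots> \<le> G * B" using ab d G by (intro mult_left_mono B(3)) auto
      finally show ?thesis by (simp add: diff_quot_def)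
    qed
    have "norm (?q1 \<sigma> - ?q2 \<sigma>) \<le> (1 + \<bar>\<sigma>\<bar>) * exp ((2*M+1) * \<bar>\<sigma>\<bar>) * (norm (?q1 0 - ?q2 0) + \<kappa>)"
    proof (rule gronwall[where e' = "\<lambda>\<sigma>. ?d1 \<sigma> - ?d2 \<sigma>"])
      fix r assume r: "r \<in> {S1..S2}"
      have W: "(r, t1) \<in> W" "(r, t1') \<in> W" "(r, t2) \<in> W" "(r, t2') \<in> W" "(r, \<tau>) \<in> W"
        using d3(2)[of t1] d3(2)[of t1'] d3(2)[of t2] d3(2)[of t2'] t d I r by auto
      show "((\<lambda>\<sigma>. ?q1 \<sigma> - ?q2 \<sigma>) has_vector_derivative ?d1 r - ?d2 r) (at r within {S1..S2})"
        by (rule has_vector_derivative_at_within) (intro has_vector_derivative_diff diff_quot_derivative W)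
      have err: "norm ((f (y r b) - f (y r a)) /\<^sub>R (b - a) - L (y r \<tau>) (diff_quot y r a b)) \<le> \<eta> * (G * B)"
        if ab: "a \<in> ball \<tau> d" "b \<in> ball \<tau> d" "a \<noteq> b" for a b
      proof -
        have "norm ((f (y r b) - f (y r a)) /\<^sub>R (b - a) - L (y r \<tau>) (diff_quot y r a b))
            \<le> \<eta> * norm (diff_quot y r a b)"
          using ab d r by (intro diff_quot_linearized in_A W d3(3)) auto
        also have "\<dots> \<le> \<eta> * (G * B)"
          using bnd[OF ab r] \<open>\<eta> > 0\<close> by (intro mult_left_mono) auto
        finally show ?thesis .
      qed
      have eq: "?d1 r - ?d2 r = L (y r \<tau>) (?q1 r - ?q2 r) + (?d1 r - L (y r \<tau>) (?q1 r))
          - (?d2 r - L (y r \<tau>) (?q2 r))"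
        by (simp add: linear_diff[OF L_linear[OF in_A[OF W(5)]]])
      have n1: "norm (L (y r \<tau>) (?q1 r - ?q2 r)) \<le> M * norm (?q1 r - ?q2 r)"
        by (rule M(2)) (use r in blast)
      have "norm (?d1 r - ?d2 r) \<le> M * norm (?q1 r - ?q2 r) + \<eta> * (G * B) + \<eta> * (G * B)"
        unfolding eq using t ne
        by (intro norm_triangle_le_diff add_mono norm_triangle_le n1 err)
      moreover have "\<eta> * (G * B) + \<eta> * (G * B) \<le> \<kappa>"
      proof -
        have "\<eta> * (2 * G * B + 1) = \<kappa>" using GB by (simp add: \<eta>_def)
        then show ?thesis using \<open>\<eta> > 0\<close> by (simp add: algebra_simps)
      qed
      ultimately show "norm (?d1 r - ?d2 r) \<le> M * norm (?q1 r - ?q2 r) + \<kappa>" by linarith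
    qed (use M(1) I s \<open>\<kappa> > 0\<close> in auto)
    also have "\<dots> \<le> K * (\<kappa> + \<kappa>)"
    proof (rule mult_mono)
      have "\<bar>\<sigma>\<bar> \<le> R" using s by (auto simp: R_def)
      moreover from this have "(2*M+1) * \<bar>\<sigma>\<bar> \<le> (2*M+1) * R" using M(1) by (intro mult_left_mono) auto
      ultimately show "(1 + \<bar>\<sigma>\<bar>) * exp ((2*M+1) * \<bar>\<sigma>\<bar>) \<le> K"
        unfolding K_def by (intro mult_mono) auto
      show "norm (?q1 0 - ?q2 0) + \<kappa> \<le> \<kappa> + \<kappa>" using t d ne by (intro add_right_mono d4(2)) auto
    qed (use \<open>K > 0\<close> \<open>\<kappa> > 0\<close> in auto)
    also have "\<dots> = \<epsilon>" using \<open>K > 0\<close> by (simp add: \<kappa>_def)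
    finally show "norm (?q1 \<sigma> - ?q2 \<sigma>) \<le> \<epsilon>" .
  qed
qed

lemma quot_Cauchy_limit:
  assumes "quot_Cauchy y I \<tau>"
  obtains Y where "\<And>\<epsilon>. \<epsilon> > 0 \<Longrightarrow> \<exists>d>0. \<forall>t1\<in>ball \<tau> d. \<forall>t2\<in>ball \<tau> d. t1 \<noteq> t2 \<longrightarrow>
    (\<forall>\<sigma>\<in>I. norm (diff_quot y \<sigma> t1 t2 - Y \<sigma>) \<le> \<epsilon>)"
proof -
  define s where "s n = \<tau> + inverse (real (Suc n))" for n
  have s: "s n \<noteq> \<tau>" for n by (simp add: s_def)
  have slim: "s \<longlonglongrightarrow> \<tau>" unfolding s_def by (rule LIMSEQ_inverse_real_of_nat_add)
  have ev: "\<forall>\<^sub>F n in sequentially. s n \<in> ball \<tau> d" if "d > 0" for d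
    using tendstoD[OF slim that] by (simp add: dist_commute)
  define Y where "Y \<sigma> = lim (\<lambda>n. diff_quot y \<sigma> \<tau> (s n))" for \<sigma>
  have conv: "(\<lambda>n. diff_quot y \<sigma> \<tau> (s n)) \<longlonglongrightarrow> Y \<sigma>" if "\<sigma> \<in> I" for \<sigma>
  proof -
    have "Cauchy (\<lambda>n. diff_quot y \<sigma> \<tau> (s n))"
    proof (rule metric_CauchyI)
      fix e :: real assume "e > 0"
      then have "e/2 > 0" by simp
      then obtain d where d: "d > 0" "\<And>t1 t1' t2 t2'. \<lbrakk>t1 \<in> ball \<tau> d; t1' \<in> ball \<tau> d; t2 \<in> ball \<tau> d; t2' \<in> ball \<tau> d;
          t1 \<noteq> t1'; t2 \<noteq> t2'; \<sigma> \<in> I\<rbrakk> \<Longrightarrow> norm (diff_quot y \<sigma> t1 t1' - diff_quot y \<sigma> t2 t2') \<le> e/2"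
        using quot_CauchyE[OF assms \<open>e/2 > 0\<close>, where thesis = thesis] by blast
      obtain N where N: "\<And>n. n \<ge> N \<Longrightarrow> s n \<in> ball \<tau> d"
        using ev[OF d(1)] by (auto simp: eventually_sequentially)
      show "\<exists>M. \<forall>m\<ge>M. \<forall>n\<ge>M. dist (diff_quot y \<sigma> \<tau> (s m)) (diff_quot y \<sigma> \<tau> (s n)) < e"
      proof (intro exI allI impI)
        fix m n assume "m \<ge> N" "n \<ge> N"
        then have "norm (diff_quot y \<sigma> \<tau> (s m) - diff_quot y \<sigma> \<tau> (s n)) \<le> e/2"
          by (intro d(2)) (use d(1) N s[of n] s[of m] \<open>\<sigma> \<in> I\<close> in simp_all)
        then show "dist (diff_quot y \<sigma> \<tau> (s m)) (diff_quot y \<sigma> \<tau> (s n)) < e"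
          using \<open>e > 0\<close> by (simp add: dist_norm)
      qed
    qed
    then show ?thesis
      unfolding Y_def by (simp add: Cauchy_convergent convergent_LIMSEQ_iff[THEN iffD1])
  qed
  show ?thesis
  proof (rule that[of Y])
    fix \<epsilon> :: real assume "\<epsilon> > 0"
    then obtain d where d: "d > 0" "\<And>t1 t1' t2 t2' \<sigma>. \<lbrakk>t1 \<in> ball \<tau> d; t1' \<in> ball \<tau> d; t2 \<in> ball \<tau> d; t2' \<in> ball \<tau> d;
        t1 \<noteq> t1'; t2 \<noteq> t2'; \<sigma> \<in> I\<rbrakk> \<Longrightarrow> norm (diff_quot y \<sigma> t1 t1' - diff_quot y \<sigma> t2 t2') \<le> \<epsilon>"
      using quot_CauchyE[OF assms \<open>\<epsilon> > 0\<close>] by blast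
    show "\<exists>d>0. \<forall>t1\<in>ball \<tau> d. \<forall>t2\<in>ball \<tau> d. t1 \<noteq> t2 \<longrightarrow>
        (\<forall>\<sigma>\<in>I. norm (diff_quot y \<sigma> t1 t2 - Y \<sigma>) \<le> \<epsilon>)"
    proof (intro exI conjI ballI impI)
      fix t1 t2 \<sigma> assume *: "t1 \<in> ball \<tau> d" "t2 \<in> ball \<tau> d" "t1 \<noteq> t2" "\<sigma> \<in> I"
      have "(\<lambda>n. norm (diff_quot y \<sigma> t1 t2 - diff_quot y \<sigma> \<tau> (s n)))
          \<longlonglongrightarrow> norm (diff_quot y \<sigma> t1 t2 - Y \<sigma>)"
        by (intro tendsto_norm tendsto_diff tendsto_const conv *)
      moreover have "\<forall>\<^sub>F n in sequentially. norm (diff_quot y \<sigma> t1 t2 - diff_quot y \<sigma> \<tau> (s n)) \<le> \<epsilon>"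
        using ev[OF d(1)]
      proof (rule eventually_mono)
        show "norm (diff_quot y \<sigma> t1 t2 - diff_quot y \<sigma> \<tau> (s n)) \<le> \<epsilon>" if "s n \<in> ball \<tau> d" for n
          by (rule d(2)) (use * d(1) that s[of n] in simp_all)
      qed
      ultimately show "norm (diff_quot y \<sigma> t1 t2 - Y \<sigma>) \<le> \<epsilon>"
        by (rule tendsto_upperbound) simp
    qed (rule d(1))
  qed
qed

lemma diff_quot_tendsto:
  assumes "(y \<sigma> has_vector_derivative D) (at \<tau>)"
  shows "((\<lambda>\<tau>'. diff_quot y \<sigma> \<tau> \<tau>') \<longlongrightarrow> D) (at \<tau>)"
proof -
  have "((\<lambda>\<tau>'. (y \<sigma> \<tau>' - y \<sigma> \<tau> - (\<tau>' - \<tau>) *\<^sub>R D) /\<^sub>R norm (\<tau>' - \<tau>)) \<longlongrightarrow> 0) (at \<tau>)"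
    using assms unfolding has_vector_derivative_def has_derivative_within by (simp add: divide_inverse algebra_simps)
  then have "((\<lambda>\<tau>'. norm ((y \<sigma> \<tau>' - y \<sigma> \<tau> - (\<tau>' - \<tau>) *\<^sub>R D) /\<^sub>R norm (\<tau>' - \<tau>))) \<longlongrightarrow> 0) (at \<tau>)"
    by (rule tendsto_norm_zero)
  moreover have "\<forall>\<^sub>F \<tau>' in at \<tau>. norm ((y \<sigma> \<tau>' - y \<sigma> \<tau> - (\<tau>' - \<tau>) *\<^sub>R D) /\<^sub>R norm (\<tau>' - \<tau>)) = norm (diff_quot y \<sigma> \<tau> \<tau>' - D)"
  proof (rule eventually_at_filter[THEN iffD2], rule always_eventually, intro allI impI)
    fix \<tau>' assume "\<tau>' \<noteq> \<tau>"
    then have "diff_quot y \<sigma> \<tau> \<tau>' - D = (y \<sigma> \<tau>' - y \<sigma> \<tau> - (\<tau>' - \<tau>) *\<^sub>R D) /\<^sub>R (\<tau>' - \<tau>)"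
      by (simp add: diff_quot_def scaleR_diff_right)
    then show "norm ((y \<sigma> \<tau>' - y \<sigma> \<tau> - (\<tau>' - \<tau>) *\<^sub>R D) /\<^sub>R norm (\<tau>' - \<tau>)) = norm (diff_quot y \<sigma> \<tau> \<tau>' - D)"
      by simp
  qed
  ultimately have "((\<lambda>\<tau>'. norm (diff_quot y \<sigma> \<tau> \<tau>' - D)) \<longlongrightarrow> 0) (at \<tau>)"
    by (rule Lim_transform_eventually)
  then have "((\<lambda>\<tau>'. diff_quot y \<sigma> \<tau> \<tau>' - D) \<longlongrightarrow> 0) (at \<tau>)"
    by (rule tendsto_norm_zero_cancel)
  then show ?thesis by (rule LIM_zero_cancel)
qed

definition param_deriv :: "real \<Rightarrow> real \<Rightarrow> 'a"
  where "param_deriv \<sigma> \<tau> = vector_derivative (y \<sigma>) (at \<tau>)"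

context
  assumes init_Cauchy: "\<And>\<tau>. (0, \<tau>) \<in> W \<Longrightarrow> quot_Cauchy y {0} \<tau>"
begin

lemma param_deriv_uniform_limit:
  assumes I: "{S1..S2} \<times> {\<tau>} \<subseteq> W" "S1 \<le> 0" "0 \<le> S2"
  shows "\<And>\<epsilon>. \<epsilon> > 0 \<Longrightarrow> \<exists>d>0. \<forall>t1\<in>ball \<tau> d. \<forall>t2\<in>ball \<tau> d. t1 \<noteq> t2 \<longrightarrow>
    (\<forall>\<sigma>\<in>{S1..S2}. norm (diff_quot y \<sigma> t1 t2 - param_deriv \<sigma> \<tau>) \<le> \<epsilon>)"
    and "\<And>\<sigma>. \<sigma> \<in> {S1..S2} \<Longrightarrow> (y \<sigma> has_vector_derivative param_deriv \<sigma> \<tau>) (at \<tau>)"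
proof -
  have "(0, \<tau>) \<in> W" using I by auto
  then obtain Y where Y: "\<And>\<epsilon>. \<epsilon> > 0 \<Longrightarrow> \<exists>d>0. \<forall>t1\<in>ball \<tau> d. \<forall>t2\<in>ball \<tau> d. t1 \<noteq> t2 \<longrightarrow>
    (\<forall>\<sigma>\<in>{S1..S2}. norm (diff_quot y \<sigma> t1 t2 - Y \<sigma>) \<le> \<epsilon>)"
    by (rule quot_Cauchy_limit[OF quot_Cauchy_propagates[OF I init_Cauchy]]) (rule that)
  have der: "(y \<sigma> has_vector_derivative Y \<sigma>) (at \<tau>)" if s: "\<sigma> \<in> {S1..S2}" for \<sigma>
    unfolding has_vector_derivative_def has_derivative_at_alt
  proof (intro conjI allI impI)
    show "bounded_linear (\<lambda>x. x *\<^sub>R Y \<sigma>)" by (rule bounded_linear_scaleR_left)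
    fix e :: real assume "e > 0"
    then obtain d where d: "d > 0" "\<And>t1 t2. t1\<in>ball \<tau> d \<Longrightarrow> t2\<in>ball \<tau> d \<Longrightarrow> t1 \<noteq> t2 \<Longrightarrow>
        norm (diff_quot y \<sigma> t1 t2 - Y \<sigma>) \<le> e"
      using Y[OF \<open>e > 0\<close>] s by blast
    show "\<exists>d>0. \<forall>x. norm (x - \<tau>) < d \<longrightarrow> norm (y \<sigma> x - y \<sigma> \<tau> - (x - \<tau>) *\<^sub>R Y \<sigma>) \<le> e * norm (x - \<tau>)"
    proof (intro exI conjI allI impI)
      fix x assume x: "norm (x - \<tau>) < d"
      show "norm (y \<sigma> x - y \<sigma> \<tau> - (x - \<tau>) *\<^sub>R Y \<sigma>) \<le> e * norm (x - \<tau>)"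
      proof (cases "x = \<tau>")
        case False
        have "norm (diff_quot y \<sigma> \<tau> x - Y \<sigma>) \<le> e"
          by (rule d(2)) (use x False d(1) in \<open>simp_all add: dist_norm abs_minus_commute\<close>)
        moreover have "y \<sigma> x - y \<sigma> \<tau> - (x - \<tau>) *\<^sub>R Y \<sigma> = (x - \<tau>) *\<^sub>R (diff_quot y \<sigma> \<tau> x - Y \<sigma>)"
          using False by (simp add: diff_quot_def scaleR_diff_right)
        ultimately show ?thesis
          by (simp only: norm_scaleR real_norm_def mult.commute[of e] mult_left_mono abs_ge_zero)
      qed simp
    qed (rule d(1))
  qed
  have eq: "param_deriv \<sigma> \<tau> = Y \<sigma>" if "\<sigma> \<in> {S1..S2}" for \<sigma>
    unfolding param_deriv_def by (rule vector_derivative_at[OF der[OF that]])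
  show "(y \<sigma> has_vector_derivative param_deriv \<sigma> \<tau>) (at \<tau>)" if "\<sigma> \<in> {S1..S2}" for \<sigma>
    using der[OF that] eq[OF that] by simp
  show "\<exists>d>0. \<forall>t1\<in>ball \<tau> d. \<forall>t2\<in>ball \<tau> d. t1 \<noteq> t2 \<longrightarrow>
    (\<forall>\<sigma>\<in>{S1..S2}. norm (diff_quot y \<sigma> t1 t2 - param_deriv \<sigma> \<tau>) \<le> \<epsilon>)" if "\<epsilon> > 0" for \<epsilon>
    using Y[OF that] eq by simp
qed

lemma interval_around_in_W:
  assumes "(\<sigma>, \<tau>) \<in> W"
  obtains S1 S2 where "{S1..S2} \<times> {\<tau>} \<subseteq> W" "S1 < 0" "0 < S2" "S1 < \<sigma>" "\<sigma> < S2"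
proof -
  have "compact (closed_segment 0 \<sigma> \<times> {\<tau>})" by (intro compact_Times) auto
  then obtain e where e: "e > 0" "(\<Union>x\<in>closed_segment 0 \<sigma> \<times> {\<tau>}. ball x e) \<subseteq> W"
    using compact_subset_open_imp_ball_epsilon_subset[OF _ open_W W_star[OF assms]] by blast
  show ?thesis
  proof (rule that[of "min 0 \<sigma> - e/2" "max 0 \<sigma> + e/2"])
    show "{min 0 \<sigma> - e/2..max 0 \<sigma> + e/2} \<times> {\<tau>} \<subseteq> W"
    proof clarify
      fix r assume r: "r \<in> {min 0 \<sigma> - e/2..max 0 \<sigma> + e/2}"
      define r' where "r' = max (min 0 \<sigma>) (min (max 0 \<sigma>) r)"
      have "r' \<in> closed_segment 0 \<sigma>" "\<bar>r' - r\<bar> < e"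
        using r e(1) by (cases "0 \<le> \<sigma>"; simp add: r'_def closed_segment_eq_real_ivl min_def max_def)+
      then have "(r, \<tau>) \<in> ball (r', \<tau>) e" "(r', \<tau>) \<in> closed_segment 0 \<sigma> \<times> {\<tau>}"
        by (auto simp: dist_Pair_Pair dist_norm)
      then show "(r, \<tau>) \<in> W" using e(2) by blast
    qed
  qed (use e(1) in auto)
qed

lemma param_deriv:
  assumes "(\<sigma>, \<tau>) \<in> W"
  shows "(y \<sigma> has_vector_derivative param_deriv \<sigma> \<tau>) (at \<tau>)"
proof -
  obtain S1 S2 where "{S1..S2} \<times> {\<tau>} \<subseteq> W" "S1 < 0" "0 < S2" "S1 < \<sigma>" "\<sigma> < S2"
    using interval_around_in_W[OF assms] by blast
  then show ?thesis using param_deriv_uniform_limit(2)[of S1 S2 \<tau> \<sigma>] by simp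
qed

text \<open>In the time variable \<open>param_deriv\<close> is a uniform limit of continuous functions; the Cauchy
  property supplies continuity in the parameter, uniformly in time.\<close>

lemma param_deriv_continuous: "continuous_on W (\<lambda>(\<sigma>, \<tau>). param_deriv \<sigma> \<tau>)"
  unfolding continuous_on_eq_continuous_at[OF open_W]
proof clarify
  fix \<sigma>0 \<tau>0 assume W0: "(\<sigma>0, \<tau>0) \<in> W"
  obtain S1 S2 where I: "{S1..S2} \<times> {\<tau>0} \<subseteq> W" "S1 < 0" "0 < S2" "S1 < \<sigma>0" "\<sigma>0 < S2"
    using interval_around_in_W[OF W0] by blast
  show "isCont (\<lambda>(\<sigma>, \<tau>). param_deriv \<sigma> \<tau>) (\<sigma>0, \<tau>0)"
    unfolding continuous_at_eps_delta
  proof (intro allI impI)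
    fix \<epsilon> :: real assume "\<epsilon> > 0"
    have I': "S1 \<le> 0" "0 \<le> S2" using I by auto
    have "\<epsilon>/5 > 0" using \<open>\<epsilon> > 0\<close> by simp
    then obtain d where d: "d > 0" "\<And>t1 t2 \<sigma>. t1 \<in> ball \<tau>0 d \<Longrightarrow> t2 \<in> ball \<tau>0 d \<Longrightarrow> t1 \<noteq> t2 \<Longrightarrow>
        \<sigma> \<in> {S1..S2} \<Longrightarrow> norm (diff_quot y \<sigma> t1 t2 - param_deriv \<sigma> \<tau>0) \<le> \<epsilon>/5"
      using param_deriv_uniform_limit(1)[OF I(1) I' \<open>\<epsilon>/5 > 0\<close>] by blast
    obtain d1 where d1: "d1 > 0" "\<And>\<tau>'. \<tau>' \<in> ball \<tau>0 d1 \<Longrightarrow> {S1..S2} \<times> {\<tau>'} \<subseteq> W"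
      using nearby_times_in_W[OF I(1)] by blast
    define t1 where "t1 = \<tau>0 + min d d1 / 2"
    have t1: "t1 \<in> ball \<tau>0 d" "t1 \<in> ball \<tau>0 d1" "\<tau>0 \<noteq> t1" "\<tau>0 \<in> ball \<tau>0 d"
      using d(1) d1(1) by (auto simp: t1_def dist_norm)
    let ?q = "\<lambda>\<sigma>. diff_quot y \<sigma> \<tau>0 t1"
    have "(\<sigma>0, t1) \<in> W" using d1(2)[OF t1(2)] I by auto
    then have "isCont ?q \<sigma>0"
      by (intro has_vector_derivative_continuous[OF diff_quot_derivative[OF W0]])
    then obtain d2 where d2: "d2 > 0" "\<And>\<sigma>. dist \<sigma> \<sigma>0 < d2 \<Longrightarrow> dist (?q \<sigma>) (?q \<sigma>0) < \<epsilon>/5"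
      using \<open>\<epsilon>/5 > 0\<close> unfolding continuous_at_eps_delta by blast
    define e where "e = Min {d, d1, d2, \<sigma>0 - S1, S2 - \<sigma>0}"
    have e: "e > 0" "e \<le> d" "e \<le> d1" "e \<le> d2" "e \<le> \<sigma>0 - S1" "e \<le> S2 - \<sigma>0"
      using d(1) d1(1) d2(1) I by (auto simp: e_def)
    show "\<exists>d>0. \<forall>z. dist z (\<sigma>0, \<tau>0) < d \<longrightarrow>
        dist (case z of (\<sigma>, \<tau>) \<Rightarrow> param_deriv \<sigma> \<tau>) (case (\<sigma>0, \<tau>0) of (\<sigma>, \<tau>) \<Rightarrow> param_deriv \<sigma> \<tau>) < \<epsilon>"
    proof (intro exI conjI allI impI)
      fix z assume z: "dist z (\<sigma>0, \<tau>0) < e"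
      obtain \<sigma> \<tau> where st: "z = (\<sigma>, \<tau>)" by fastforce
      have ds: "dist \<sigma> \<sigma>0 < e" "dist \<tau> \<tau>0 < e"
        using z dist_fst_le[of z "(\<sigma>0, \<tau>0)"] dist_snd_le[of z "(\<sigma>0, \<tau>0)"] by (auto simp: st)
      have sI: "\<sigma> \<in> {S1..S2}" "\<sigma>0 \<in> {S1..S2}" using ds(1) e I by (auto simp: dist_norm)
      have tb: "\<tau> \<in> ball \<tau>0 d" "\<tau> \<in> ball \<tau>0 d1" using ds(2) e by (auto simp: dist_commute)
      have "(\<sigma>, \<tau>) \<in> W" using d1(2)[OF tb(2)] sI by auto
      have A1: "norm (param_deriv \<sigma> \<tau> - param_deriv \<sigma> \<tau>0) \<le> \<epsilon>/5"
      proof (rule tendsto_upperbound)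
        show "((\<lambda>\<tau>'. norm (diff_quot y \<sigma> \<tau> \<tau>' - param_deriv \<sigma> \<tau>0)) \<longlongrightarrow> norm (param_deriv \<sigma> \<tau> - param_deriv \<sigma> \<tau>0)) (at \<tau>)"
          by (intro tendsto_norm tendsto_diff tendsto_const diff_quot_tendsto param_deriv \<open>(\<sigma>, \<tau>) \<in> W\<close>)
        show "\<forall>\<^sub>F \<tau>' in at \<tau>. norm (diff_quot y \<sigma> \<tau> \<tau>' - param_deriv \<sigma> \<tau>0) \<le> \<epsilon>/5"
          unfolding eventually_at_topological
          by (intro exI[of _ "ball \<tau>0 d"] conjI ballI impI open_ball tb(1) d(2)) (use sI in auto)
      qed simp
      have A2: "norm (?q \<sigma> - param_deriv \<sigma> \<tau>0) \<le> \<epsilon>/5" by (rule d(2)[OF t1(4,1,3) sI(1)])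
      have A3: "norm (?q \<sigma>0 - param_deriv \<sigma>0 \<tau>0) \<le> \<epsilon>/5" by (rule d(2)[OF t1(4,1,3) sI(2)])
      have A4: "dist (?q \<sigma>) (?q \<sigma>0) < \<epsilon>/5" by (rule d2(2)) (use ds e in simp)
      have "dist (param_deriv \<sigma> \<tau>) (param_deriv \<sigma>0 \<tau>0) \<le> dist (param_deriv \<sigma> \<tau>) (param_deriv \<sigma> \<tau>0)
          + dist (param_deriv \<sigma> \<tau>0) (?q \<sigma>) + dist (?q \<sigma>) (?q \<sigma>0) + dist (?q \<sigma>0) (param_deriv \<sigma>0 \<tau>0)"
        using dist_triangle[of "param_deriv \<sigma> \<tau>" "param_deriv \<sigma>0 \<tau>0" "param_deriv \<sigma> \<tau>0"]
          dist_triangle[of "param_deriv \<sigma> \<tau>0" "param_deriv \<sigma>0 \<tau>0" "?q \<sigma>"]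
          dist_triangle[of "?q \<sigma>" "param_deriv \<sigma>0 \<tau>0" "?q \<sigma>0"] by linarith
      also have "\<dots> < \<epsilon>"
        using A1 A2 A3 A4 \<open>\<epsilon> > 0\<close> unfolding dist_norm norm_minus_commute[of "param_deriv \<sigma> \<tau>0" "?q \<sigma>"] by linarith
      finally show "dist (case z of (\<sigma>, \<tau>) \<Rightarrow> param_deriv \<sigma> \<tau>) (case (\<sigma>0, \<tau>0) of (\<sigma>, \<tau>) \<Rightarrow> param_deriv \<sigma> \<tau>) < \<epsilon>"
        by (simp add: st)
    qed (rule e(1))
  qed
qed

text \<open>The partial derivative in time is continuous and the one in the parameter exists, which
  together give the total derivative.\<close>

lemma flow_has_derivative:
  assumes "(\<sigma>, \<tau>) \<in> W"
  shows "((\<lambda>(\<sigma>, \<tau>). y \<sigma> \<tau>) has_derivative (\<lambda>(a, b). a *\<^sub>R f (y \<sigma> \<tau>) + b *\<^sub>R param_deriv \<sigma> \<tau>)) (at (\<sigma>, \<tau>))"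
proof -
  obtain e where e: "e > 0" "ball (\<sigma>, \<tau>) e \<subseteq> W" using open_W assms openE by blast
  define r where "r = e / 2"
  have r: "r > 0" using e by (simp add: r_def)
  have box: "ball \<sigma> r \<times> ball \<tau> r \<subseteq> W"
  proof clarify
    fix a b assume "a \<in> ball \<sigma> r" "b \<in> ball \<tau> r"
    moreover have "dist (\<sigma>, \<tau>) (a, b) \<le> dist \<sigma> a + dist \<tau> b"
      unfolding dist_Pair_Pair by (rule sqrt_sum_squares_le_sum) simp_all
    ultimately have "dist (\<sigma>, \<tau>) (a, b) < e"
      by (simp add: r_def)
    then show "(a, b) \<in> W" using e by auto
  qed
  have op: "open (ball \<sigma> r \<times> ball \<tau> r)" by (intro open_Times open_ball)
  have "((\<lambda>(\<sigma>, \<tau>). y \<sigma> \<tau>) has_derivative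
      (\<lambda>(a, b). a *\<^sub>R f (y \<sigma> \<tau>) + blinfun_apply (blinfun_scaleR_left (param_deriv \<sigma> \<tau>)) b))
      (at (\<sigma>, \<tau>) within ball \<sigma> r \<times> ball \<tau> r)"
  proof (rule has_derivative_partialsI)
    show "((\<lambda>x. y x \<tau>) has_derivative (\<lambda>a. a *\<^sub>R f (y \<sigma> \<tau>))) (at \<sigma> within ball \<sigma> r)"
      using sol[OF assms] unfolding has_vector_derivative_def by (rule has_derivative_at_withinI)
    show "(y a has_derivative blinfun_apply (blinfun_scaleR_left (param_deriv a b))) (at b within ball \<tau> r)"
      if "a \<in> ball \<sigma> r" "b \<in> ball \<tau> r" for a b
    proof -
      have "(a, b) \<in> W" using that box by blast
      from param_deriv[OF this] show ?thesis
        unfolding has_vector_derivative_def by (auto intro: has_derivative_at_withinI)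
    qed
    have "isCont (\<lambda>(\<sigma>, \<tau>). param_deriv \<sigma> \<tau>) (\<sigma>, \<tau>)"
      using param_deriv_continuous assms open_W by (simp add: continuous_on_eq_continuous_at)
    then have "isCont (\<lambda>z. blinfun_scaleR_left (case z of (\<sigma>, \<tau>) \<Rightarrow> param_deriv \<sigma> \<tau>)) (\<sigma>, \<tau>)"
      by (intro continuous_intros)
    then show "continuous (at (\<sigma>, \<tau>) within ball \<sigma> r \<times> ball \<tau> r) (\<lambda>(\<sigma>, \<tau>). blinfun_scaleR_left (param_deriv \<sigma> \<tau>))"
      by (simp add: case_prod_unfold continuous_at_imp_continuous_at_within)
  qed (use r in auto)
  then show ?thesis
    using at_within_open[OF _ op, of "(\<sigma>, \<tau>)"] r by simp
qed

end

end

section \<open>The characteristic system\<close>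

lemma inner_2: "x \<bullet> y = x $ 1 * y $ 1 + x $ 2 * y $ 2" for x y :: "real^2"
  by (simp add: inner_vec_def sum_2)

lemma vector_2_eq: "vector [a, b] = a *\<^sub>R axis 1 1 + b *\<^sub>R (axis 2 1 :: real^2)"
  by (simp add: vec_eq_iff forall_2 axis_def)

definition dirN :: "real \<Rightarrow> real^2" where "dirN a = vector [cos a, sin a]"
definition dirT :: "real \<Rightarrow> real^2" where "dirT a = vector [sin a, - cos a]"

lemma dirN_component [simp]: "dirN a $ 1 = cos a" "dirN a $ 2 = sin a"
  and dirT_component [simp]: "dirT a $ 1 = sin a" "dirT a $ 2 = - cos a"
  by (simp_all add: dirN_def dirT_def)

lemma dir_inner [simp]: "dirN a \<bullet> dirN a = 1" "dirT a \<bullet> dirT a = 1" "dirN a \<bullet> dirT a = 0" "dirT a \<bullet> dirN a = 0"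
  by (simp_all add: inner_2 flip: power2_eq_square)

lemma norm_dir [simp]: "norm (dirN a) = 1" "norm (dirT a) = 1"
  by (simp_all add: norm_eq_1)

lemma dirT_has_vector_derivative: "(dirT has_vector_derivative dirN a) (at a within S)"
  unfolding dirT_def[abs_def] dirN_def vector_2_eq by (auto intro!: derivative_eq_intros)

lemma dirN_has_vector_derivative: "(dirN has_vector_derivative - dirT a) (at a within S)"
  unfolding dirN_def[abs_def] dirT_def vector_2_eq by (auto intro!: derivative_eq_intros)

lemma dirT_Lipschitz: "norm (dirT a - dirT b) \<le> \<bar>a - b\<bar>"
  using differentiable_bound[of UNIV dirT "\<lambda>a h. h *\<^sub>R dirN a" 1 a b]
    dirT_has_vector_derivative[unfolded has_vector_derivative_def]
  by (simp add: onorm_scaleR_left bounded_linear_ident onorm_id)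

lemma dirN_Lipschitz: "norm (dirN a - dirN b) \<le> \<bar>a - b\<bar>"
proof -
  have "dirN x = dirT (x + pi/2)" for x
    by (simp add: vec_eq_iff forall_2 sin_add cos_add)
  then show ?thesis using dirT_Lipschitz[of "a + pi/2" "b + pi/2"] by simp
qed

lemma dirT_linearized:
  assumes "\<bar>a - z\<bar> \<le> \<delta>" "\<bar>b - z\<bar> \<le> \<delta>"
  shows "norm (dirT b - dirT a - (b - a) *\<^sub>R dirN z) \<le> \<delta> * \<bar>b - a\<bar>"
proof -
  let ?g = "\<lambda>x. dirT x - x *\<^sub>R dirN z"
  have "norm (?g b - ?g a) \<le> \<delta> * norm (b - a)"
  proof (rule differentiable_bound[of "cball z \<delta>" ?g "\<lambda>x h. h *\<^sub>R (dirN x - dirN z)"])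
    show "(?g has_derivative (\<lambda>h. h *\<^sub>R (dirN x - dirN z))) (at x within cball z \<delta>)" for x
      using dirT_has_vector_derivative unfolding has_vector_derivative_def
      by (auto intro!: derivative_eq_intros simp: scaleR_diff_right)
    show "onorm (\<lambda>h. h *\<^sub>R (dirN x - dirN z)) \<le> \<delta>" if "x \<in> cball z \<delta>" for x
      using dirN_Lipschitz[of x z] that
      by (simp add: onorm_scaleR_left bounded_linear_ident onorm_id dist_norm abs_minus_commute)
  qed (use assms in \<open>auto simp: dist_norm abs_minus_commute\<close>)
  then show ?thesis by (simp add: scaleR_diff_left algebra_simps)
qed

definition char_field :: "(real^2 \<Rightarrow> real) \<Rightarrow> ((real^2) \<times> real) \<Rightarrow> (real^2) \<times> real"
  where "char_field H z = (dirT (snd z), - H (fst z))"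

text \<open>The derivative of \<open>char_field H\<close> at z, in the direction w.\<close>

definition char_lin :: "(real^2 \<Rightarrow> real) \<Rightarrow> ((real^2) \<times> real) \<Rightarrow> ((real^2) \<times> real) \<Rightarrow> (real^2) \<times> real"
  where "char_lin H z w = (snd w *\<^sub>R dirN (snd z), - frechet_derivative H (at (fst z)) (fst w))"

lemma norm_fst_snd_le: "norm (fst w) \<le> norm w" "norm (snd w) \<le> norm w"
  using norm_fst_le[of "fst w" "snd w"] norm_snd_le[of "snd w" "fst w"] by simp_all

lemma char_field_strict:
  assumes "open \<Omega>" and H: "C1_on \<Omega> H" and S: "compact S" "S \<subseteq> \<Omega> \<times> UNIV" and "\<eta> > 0"
  shows "\<exists>\<delta>>0. \<forall>z\<in>S. ball z \<delta> \<subseteq> \<Omega> \<times> UNIV \<and> (\<forall>x\<in>ball z \<delta>. \<forall>x'\<in>ball z \<delta>.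
      norm (char_field H x' - char_field H x - char_lin H z (x' - x)) \<le> \<eta> * norm (x' - x))"
proof -
  have S': "compact (fst ` S)" "fst ` S \<subseteq> \<Omega>"
    using S by (auto intro!: compact_continuous_image continuous_intros)
  have "\<eta>/2 > 0" using \<open>\<eta> > 0\<close> by simp
  then obtain \<delta> where \<delta>: "\<delta> > 0" "\<And>z. z \<in> fst ` S \<Longrightarrow> ball z \<delta> \<subseteq> \<Omega>"
    "\<And>z x y. \<lbrakk>z \<in> fst ` S; x \<in> ball z \<delta>; y \<in> ball z \<delta>\<rbrakk> \<Longrightarrow>
      norm (H y - H x - frechet_derivative H (at z) (y - x)) \<le> \<eta>/2 * norm (y - x)"
    by (rule C1_on_strictly_differentiable[OF \<open>open \<Omega>\<close> H S']) (rule that)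
  define d where "d = min \<delta> (\<eta>/2)"
  have d: "d > 0" "d \<le> \<delta>" "d \<le> \<eta>/2" using \<delta>(1) \<open>\<eta> > 0\<close> by (auto simp: d_def)
  have near: "fst x \<in> ball (fst z) \<delta>" "\<bar>snd x - snd z\<bar> \<le> \<eta>/2" if "x \<in> ball z d" for x z :: "(real^2) \<times> real"
    using that d dist_fst_le[of z x] dist_snd_le[of z x] by (auto simp: dist_norm abs_minus_commute)
  have "norm (char_field H x' - char_field H x - char_lin H z (x' - x)) \<le> \<eta> * norm (x' - x)"
    if z: "z \<in> S" and x: "x \<in> ball z d" "x' \<in> ball z d" for z x x'
  proof -
    have 1: "norm (dirT (snd x') - dirT (snd x) - (snd x' - snd x) *\<^sub>R dirN (snd z)) \<le> \<eta>/2 * norm (x' - x)"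
    proof -
      have "norm (dirT (snd x') - dirT (snd x) - (snd x' - snd x) *\<^sub>R dirN (snd z)) \<le> \<eta>/2 * \<bar>snd x' - snd x\<bar>"
        by (rule dirT_linearized) (use near x in auto)
      also have "\<dots> \<le> \<eta>/2 * norm (x' - x)"
        using \<open>\<eta> > 0\<close> norm_fst_snd_le(2)[of "x' - x"] by (intro mult_left_mono) auto
      finally show ?thesis .
    qed
    have 2: "norm (H (fst x') - H (fst x) - frechet_derivative H (at (fst z)) (fst x' - fst x)) \<le> \<eta>/2 * norm (x' - x)"
    proof -
      have "norm (H (fst x') - H (fst x) - frechet_derivative H (at (fst z)) (fst x' - fst x)) \<le> \<eta>/2 * norm (fst x' - fst x)"
        by (rule \<delta>(3)) (use z near(1)[OF x(1)] near(1)[OF x(2)] in auto)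
      also have "\<dots> \<le> \<eta>/2 * norm (x' - x)"
        using \<open>\<eta> > 0\<close> norm_fst_snd_le(1)[of "x' - x"] by (intro mult_left_mono) auto
      finally show ?thesis .
    qed
    have "char_field H x' - char_field H x - char_lin H z (x' - x)
       = (dirT (snd x') - dirT (snd x) - (snd x' - snd x) *\<^sub>R dirN (snd z),
          - (H (fst x') - H (fst x) - frechet_derivative H (at (fst z)) (fst x' - fst x)))"
      by (simp add: char_field_def char_lin_def)
    also have "norm \<dots> \<le> \<eta>/2 * norm (x' - x) + \<eta>/2 * norm (x' - x)"
      using norm_Pair_le 1 2 by (smt (verit, best) norm_minus_cancel)
    finally show ?thesis by simp
  qed
  moreover have "ball z d \<subseteq> \<Omega> \<times> UNIV" if "z \<in> S" for z
  proof
    fix x assume "x \<in> ball z d"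
    then have "fst x \<in> ball (fst z) \<delta>" by (rule near)
    then have "fst x \<in> \<Omega>" using \<delta>(2)[of "fst z"] that by blast
    then show "x \<in> \<Omega> \<times> UNIV" by (simp add: mem_Times_iff)
  qed
  ultimately show ?thesis using d(1) by blast
qed

lemma char_lin_bound:
  assumes H: "C1_on \<Omega> H" and S: "compact S" "S \<subseteq> \<Omega> \<times> UNIV"
  shows "\<exists>M\<ge>0. \<forall>z\<in>S. \<forall>v. norm (char_lin H z v) \<le> M * norm v"
proof -
  have S': "compact (fst ` S)" "fst ` S \<subseteq> \<Omega>"
    using S by (auto intro!: compact_continuous_image continuous_intros)
  obtain M where M: "M \<ge> 0" "\<And>z v. z \<in> fst ` S \<Longrightarrow> norm (frechet_derivative H (at z) v) \<le> M * norm v"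
    by (rule C1_on_derivative_bound[OF H S']) (rule that)
  have "norm (char_lin H z v) \<le> (1 + M) * norm v" if "z \<in> S" for z v
  proof -
    have "norm (char_lin H z v) \<le> norm (snd v *\<^sub>R dirN (snd z)) + norm (- frechet_derivative H (at (fst z)) (fst v))"
      unfolding char_lin_def by (rule norm_Pair_le)
    also have "\<dots> \<le> norm (snd v) + M * norm (fst v)"
      using M(2)[of "fst z" "fst v"] that by simp
    also have "\<dots> \<le> norm v + M * norm v"
      using norm_fst_snd_le[of v] M(1) by (intro add_mono mult_left_mono) auto
    finally show ?thesis by (simp add: distrib_right)
  qed
  then show ?thesis using M(1) by (intro exI[of _ "1 + M"]) simp
qed

lemma char_lin_linear: "C1_on \<Omega> H \<Longrightarrow> fst z \<in> \<Omega> \<Longrightarrow> linear (char_lin H z)"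
proof -
  assume "C1_on \<Omega> H" "fst z \<in> \<Omega>"
  then interpret D: bounded_linear "frechet_derivative H (at (fst z))"
    by (intro has_derivative_bounded_linear[OF C1_on_has_derivative])
  show ?thesis
    by (rule linearI) (simp_all add: char_lin_def D.add D.scaleR algebra_simps)
qed

section \<open>Recovering the angle from a transported quantity\<close>

lemma increment_bound:
  fixes f :: "real \<Rightarrow> 'a::real_normed_vector"
  assumes "\<And>t. t \<in> closed_segment 0 s \<Longrightarrow> (f has_vector_derivative f' t) (at t)"
    and "\<And>t. t \<in> closed_segment 0 s \<Longrightarrow> norm (f' t) \<le> B"
  shows "norm (f s - f 0) \<le> B * \<bar>s\<bar>"
proof -
  have "norm (f s - f 0) \<le> B * norm (s - 0)"
  proof (rule differentiable_bound[of "closed_segment 0 s" f "\<lambda>t h. h *\<^sub>R f' t"])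
    show "(f has_derivative (\<lambda>h. h *\<^sub>R f' t)) (at t within closed_segment 0 s)" if "t \<in> closed_segment 0 s" for t
      using assms(1)[OF that] unfolding has_vector_derivative_def by (rule has_derivative_at_withinI)
    show "onorm (\<lambda>h. h *\<^sub>R f' t) \<le> B" if "t \<in> closed_segment 0 s" for t
      using assms(2)[OF that] by (simp add: onorm_scaleR_left bounded_linear_ident onorm_id)
  qed auto
  then show ?thesis by simp
qed

lemma gronwall_uniform:
  fixes e :: "real \<Rightarrow> 'a::real_inner"
  assumes "\<And>t. t \<in> {S1..S2} \<Longrightarrow> (e has_vector_derivative e' t) (at t)"
    and "\<And>t. t \<in> {S1..S2} \<Longrightarrow> norm (e' t) \<le> C * norm (e t) + \<rho>"
    and C: "0 \<le> C" and \<rho>: "0 \<le> \<rho>" and I: "S1 \<le> 0" "0 \<le> S2" "- R \<le> S1" "S2 \<le> R" and t: "t \<in> {S1..S2}"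
  shows "norm (e t) \<le> (1 + R) * exp ((2*C+1) * R) * (norm (e 0) + \<rho>)"
proof -
  have "norm (e t) \<le> (1 + \<bar>t\<bar>) * exp ((2*C+1) * \<bar>t\<bar>) * (norm (e 0) + \<rho>)"
    by (rule gronwall[OF has_vector_derivative_at_within]) (use assms in simp_all)
  also have "\<dots> \<le> (1 + R) * exp ((2*C+1) * R) * (norm (e 0) + \<rho>)"
  proof -
    have tR: "\<bar>t\<bar> \<le> R" using t I by auto
    then have "(2*C+1) * \<bar>t\<bar> \<le> (2*C+1) * R" using C by (intro mult_left_mono) auto
    then show ?thesis using tR \<rho> by (intro mult_right_mono mult_mono) auto
  qed
  finally show ?thesis .
qed

text \<open>Think of \<open>(v, k)\<close> as the variation of position and angle along a characteristic of angle
  \<open>a\<close>, and of j as the variation of the circulation, with \<open>D = \<bar>grad u + F\<bar>\<close> and \<open>c = curl F\<close>; all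
  relations hold up to the error \<open>\<eta>\<close>. The two relations for j combine to the linear equation
  \<open>j' = (c / D) j\<close> with small initial value, so j and with it the normal component w of v stay of
  order \<open>\<eta>\<close>. But w grows like \<open>\<sigma> * k 0\<close> for small \<open>\<sigma>\<close>, because \<open>v' = k N\<close>. Looking at one fixed
  time s bounds \<open>k 0\<close> by a multiple of \<open>\<eta>\<close>.\<close>

lemma observability:
  fixes a D c :: "real \<Rightarrow> real"
  assumes I: "S1 \<le> 0" "0 \<le> S2" "S1 < S2" and C: "C \<ge> 0" and "d0 > 0"
    and base: "\<And>\<sigma>. \<sigma> \<in> {S1..S2} \<Longrightarrow> (a has_real_derivative a' \<sigma>) (at \<sigma>)"
    and bounds: "\<And>\<sigma>. \<sigma> \<in> {S1..S2} \<Longrightarrow> \<bar>a' \<sigma>\<bar> \<le> C" "\<And>\<sigma>. \<sigma> \<in> {S1..S2} \<Longrightarrow> d0 \<le> D \<sigma>"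
      "\<And>\<sigma>. \<sigma> \<in> {S1..S2} \<Longrightarrow> D \<sigma> \<le> C" "\<And>\<sigma>. \<sigma> \<in> {S1..S2} \<Longrightarrow> \<bar>c \<sigma>\<bar> \<le> C"
  obtains M where "M \<ge> 0" "\<And>v v' k k' j j' \<eta>.
    \<lbrakk>\<eta> \<ge> 0; norm (v 0) \<le> \<eta>;
     \<And>\<sigma>. \<sigma> \<in> {S1..S2} \<Longrightarrow> (v has_vector_derivative v' \<sigma>) (at \<sigma>);
     \<And>\<sigma>. \<sigma> \<in> {S1..S2} \<Longrightarrow> norm (v' \<sigma> - k \<sigma> *\<^sub>R dirN (a \<sigma>)) \<le> \<eta>;
     \<And>\<sigma>. \<sigma> \<in> {S1..S2} \<Longrightarrow> (k has_real_derivative k' \<sigma>) (at \<sigma>);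
     \<And>\<sigma>. \<sigma> \<in> {S1..S2} \<Longrightarrow> \<bar>k' \<sigma>\<bar> \<le> C * norm (v \<sigma>) + \<eta>;
     \<And>\<sigma>. \<sigma> \<in> {S1..S2} \<Longrightarrow> \<bar>j \<sigma> - D \<sigma> * (dirN (a \<sigma>) \<bullet> v \<sigma>)\<bar> \<le> \<eta>;
     \<And>\<sigma>. \<sigma> \<in> {S1..S2} \<Longrightarrow> (j has_real_derivative j' \<sigma>) (at \<sigma>);
     \<And>\<sigma>. \<sigma> \<in> {S1..S2} \<Longrightarrow> \<bar>j' \<sigma> - c \<sigma> * (dirN (a \<sigma>) \<bullet> v \<sigma>)\<bar> \<le> \<eta>\<rbrakk>
    \<Longrightarrow> \<bar>k 0\<bar> \<le> M * \<eta>"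
proof -
  define R where "R = max (- S1) S2"
  have R: "- R \<le> S1" "S2 \<le> R" "R > 0" using I by (auto simp: R_def)
  define K1 where "K1 = (1 + R) * exp ((2 * (C/d0) + 1) * R)"
  define K2 where "K2 = K1 * (C + 1 + (C/d0 + 1))"
  define K3 where "K3 = (K2 + 1) / d0"
  define K4 where "K4 = (1 + R) * exp ((2 * (1 + C) + 1) * R)"
  define K5 where "K5 = 1 + R * (3*C*K4 + 1) + C * (1 + R * (3*K4 + 1))"
  define K6 where "K6 = 2*C*K4"
  have K1: "K1 \<ge> 0" using R by (simp add: K1_def)
  then have K2: "K2 \<ge> 0" using C \<open>d0 > 0\<close> by (simp add: K2_def)
  have K3: "K3 \<ge> 0" using K2 \<open>d0 > 0\<close> by (simp add: K3_def)
  have K4: "K4 \<ge> 0" using R by (simp add: K4_def)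
  have K5: "K5 \<ge> 0" using R C K4 by (simp add: K5_def)
  have K6: "K6 \<ge> 0" using C K4 by (simp add: K6_def)
  define s0 where "s0 = (if S2 > 0 then S2 else S1)"
  have s0: "s0 \<noteq> 0" "s0 \<in> {S1..S2}" using I by (auto simp: s0_def)
  \<comment> \<open>The time s at which w is read off is so short that the quadratic error \<open>K6 * s\<^sup>2 * \<bar>k 0\<bar>\<close> is
    at most half of the main term \<open>\<bar>s\<bar> * \<bar>k 0\<bar>\<close>.\<close>
  define \<mu> where "\<mu> = min 1 (1 / (2 * (K6 + 1) * \<bar>s0\<bar>))"
  have mu: "0 < \<mu>" "\<mu> \<le> 1" using s0 K6 by (auto simp: \<mu>_def)
  define s where "s = s0 * \<mu>"
  have s: "s \<noteq> 0" "s \<in> {S1..S2}"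
  proof -
    show "s \<noteq> 0" using s0 mu by (simp add: s_def)
    have "s = s0 * \<mu>" by (simp add: s_def)
    moreover have "s0 * \<mu> \<le> S2 \<and> S1 \<le> s0 * \<mu>"
    proof (cases "S2 > 0")
      case True
      then have "0 \<le> s0 * \<mu>" "s0 * \<mu> \<le> s0 * 1" using mu by (auto simp: s0_def intro!: mult_left_mono)
      then show ?thesis using True I by (simp add: s0_def)
    next
      case False
      then have "s0 * \<mu> \<le> 0" "s0 * 1 \<le> s0 * \<mu>" using mu I by (auto simp: s0_def mult_nonpos_nonneg mult_le_cancel_left2)
      then show ?thesis using False I by (simp add: s0_def)
    qed
    ultimately show "s \<in> {S1..S2}" by simp
  qed
  have sK: "K6 * \<bar>s\<bar> \<le> 1/2"
  proof -
    have "\<bar>s\<bar> = \<bar>s0\<bar> * \<mu>" using mu by (simp add: s_def abs_mult)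
    also have "\<dots> \<le> \<bar>s0\<bar> * (1 / (2 * (K6 + 1) * \<bar>s0\<bar>))" by (intro mult_left_mono) (auto simp: \<mu>_def)
    also have "\<dots> = 1 / (2 * (K6 + 1))" using s0 by simp
    finally have "K6 * \<bar>s\<bar> \<le> K6 * (1 / (2 * (K6 + 1)))" using K6 by (intro mult_left_mono)
    also have "\<dots> \<le> 1/2" using K6 by (simp add: field_simps)
    finally show ?thesis .
  qed
  have seg: "closed_segment 0 t \<subseteq> {S1..S2}" if "t \<in> {S1..S2}" for t
    using that I by (auto simp: closed_segment_eq_real_ivl split: if_splits)
  show ?thesis
  proof (rule that[of "4 * K3 / \<bar>s\<bar> + 2 * K5"])
    show "4 * K3 / \<bar>s\<bar> + 2 * K5 \<ge> 0" using K3 K5 by simp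
    fix v :: "real \<Rightarrow> real^2" and v' k k' j j' and \<eta> :: real
    assume \<eta>: "\<eta> \<ge> 0" and v0: "norm (v 0) \<le> \<eta>"
      and v: "\<And>\<sigma>. \<sigma> \<in> {S1..S2} \<Longrightarrow> (v has_vector_derivative v' \<sigma>) (at \<sigma>)"
      and v': "\<And>\<sigma>. \<sigma> \<in> {S1..S2} \<Longrightarrow> norm (v' \<sigma> - k \<sigma> *\<^sub>R dirN (a \<sigma>)) \<le> \<eta>"
      and k: "\<And>\<sigma>. \<sigma> \<in> {S1..S2} \<Longrightarrow> (k has_real_derivative k' \<sigma>) (at \<sigma>)"
      and k': "\<And>\<sigma>. \<sigma> \<in> {S1..S2} \<Longrightarrow> \<bar>k' \<sigma>\<bar> \<le> C * norm (v \<sigma>) + \<eta>"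
      and j: "\<And>\<sigma>. \<sigma> \<in> {S1..S2} \<Longrightarrow> \<bar>j \<sigma> - D \<sigma> * (dirN (a \<sigma>) \<bullet> v \<sigma>)\<bar> \<le> \<eta>"
      and dj: "\<And>\<sigma>. \<sigma> \<in> {S1..S2} \<Longrightarrow> (j has_real_derivative j' \<sigma>) (at \<sigma>)"
      and j': "\<And>\<sigma>. \<sigma> \<in> {S1..S2} \<Longrightarrow> \<bar>j' \<sigma> - c \<sigma> * (dirN (a \<sigma>) \<bullet> v \<sigma>)\<bar> \<le> \<eta>"
    define w where "w \<sigma> = dirN (a \<sigma>) \<bullet> v \<sigma>" for \<sigma>
    have I0: "0 \<in> {S1..S2}" using I by simp
    have wle: "\<bar>w \<sigma>\<bar> \<le> norm (v \<sigma>)" for \<sigma>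
      using Cauchy_Schwarz_ineq2[of "dirN (a \<sigma>)" "v \<sigma>"] by (simp add: w_def)
    \<comment> \<open>the normal component is controlled by \<open>j\<close>\<close>
    have wj: "\<bar>w \<sigma>\<bar> \<le> (\<bar>j \<sigma>\<bar> + \<eta>) / d0" if "\<sigma> \<in> {S1..S2}" for \<sigma>
    proof -
      have "d0 * \<bar>w \<sigma>\<bar> \<le> \<bar>D \<sigma> * w \<sigma>\<bar>"
        using bounds(2)[OF that] \<open>d0 > 0\<close> by (simp add: abs_mult mult_right_mono)
      also have "\<dots> \<le> \<bar>j \<sigma>\<bar> + \<eta>" using j[OF that] by (simp add: w_def)
      finally show ?thesis using \<open>d0 > 0\<close> by (simp add: field_simps)
    qed
    have jb: "\<bar>j \<sigma>\<bar> \<le> K2 * \<eta>" if "\<sigma> \<in> {S1..S2}" for \<sigma>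
    proof -
      have "norm (j \<sigma>) \<le> K1 * (norm (j 0) + (C/d0 + 1) * \<eta>)"
        unfolding K1_def
      proof (rule gronwall_uniform[where e' = j'])
        show "norm (j' t) \<le> C/d0 * norm (j t) + (C/d0 + 1) * \<eta>" if t: "t \<in> {S1..S2}" for t
        proof -
          have "\<bar>c t * w t\<bar> \<le> C * ((\<bar>j t\<bar> + \<eta>) / d0)"
            unfolding abs_mult using wj[OF t] bounds(4)[OF t] C by (intro mult_mono) auto
          then have "\<bar>j' t\<bar> \<le> C * ((\<bar>j t\<bar> + \<eta>) / d0) + \<eta>"
            using j'[OF t] unfolding w_def by linarith
          then show ?thesis using \<open>d0 > 0\<close> by (simp add: field_simps)
        qed
        show "(j has_vector_derivative j' t) (at t)" if "t \<in> {S1..S2}" for t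
          using dj[OF that] by (simp add: has_real_derivative_iff_has_vector_derivative)
      qed (use R I C \<open>d0 > 0\<close> \<eta> that in auto)
      moreover have "norm (j 0) \<le> (C + 1) * \<eta>"
      proof -
        have "\<bar>D 0 * w 0\<bar> \<le> C * \<eta>"
          unfolding abs_mult using bounds(2,3)[OF I0] \<open>d0 > 0\<close> C wle[of 0] v0 by (intro mult_mono) auto
        then show ?thesis using j[OF I0] unfolding w_def distrib_right by simp
      qed
      ultimately have "norm (j \<sigma>) \<le> K1 * ((C + 1) * \<eta> + (C/d0 + 1) * \<eta>)"
        using K1 by (smt (verit) mult_left_mono)
      then show ?thesis by (simp add: K2_def algebra_simps)
    qed
    have wb: "\<bar>w \<sigma>\<bar> \<le> K3 * \<eta>" if "\<sigma> \<in> {S1..S2}" for \<sigma>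
    proof -
      have "(\<bar>j \<sigma>\<bar> + \<eta>) / d0 \<le> (K2 * \<eta> + \<eta>) / d0"
        using jb[OF that] \<open>d0 > 0\<close> by (intro divide_right_mono) auto
      also have "\<dots> = K3 * \<eta>" by (simp add: K3_def distrib_right)
      finally show ?thesis using wj[OF that] by linarith
    qed
    \<comment> \<open>all components grow at most exponentially\<close>
    have eb: "norm (v \<sigma>, k \<sigma>) \<le> K4 * (\<bar>k 0\<bar> + 3 * \<eta>)" if "\<sigma> \<in> {S1..S2}" for \<sigma>
    proof -
      have "norm (v \<sigma>, k \<sigma>) \<le> K4 * (norm (v 0, k 0) + 2 * \<eta>)"
        unfolding K4_def
      proof (rule gronwall_uniform[where e = "\<lambda>\<sigma>. (v \<sigma>, k \<sigma>)" and e' = "\<lambda>\<sigma>. (v' \<sigma>, k' \<sigma>)"])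
        fix t assume t: "t \<in> {S1..S2}"
        show "((\<lambda>\<sigma>. (v \<sigma>, k \<sigma>)) has_vector_derivative (v' t, k' t)) (at t)"
          using v[OF t] k[OF t]
          by (intro has_vector_derivative_Pair) (simp_all add: has_real_derivative_iff_has_vector_derivative)
        have n: "norm (v t) \<le> norm (v t, k t)" "\<bar>k t\<bar> \<le> norm (v t, k t)"
          using norm_fst_le[of "v t" "k t"] norm_snd_le[of "k t" "v t"] by auto
        have "norm (v' t) \<le> \<bar>k t\<bar> + \<eta>"
          using norm_triangle_sub[of "v' t" "k t *\<^sub>R dirN (a t)"] v'[OF t] by simp
        moreover have "norm (v' t, k' t) \<le> norm (v' t) + \<bar>k' t\<bar>"
          using norm_Pair_le[of "v' t" "k' t"] by simp
        moreover have "C * norm (v t) \<le> C * norm (v t, k t)" using n C by (intro mult_left_mono)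
        ultimately show "norm (v' t, k' t) \<le> (1 + C) * norm (v t, k t) + 2 * \<eta>"
          using k'[OF t] n unfolding distrib_right by linarith
      qed (use R I C \<eta> that in auto)
      also have "\<dots> \<le> K4 * (\<bar>k 0\<bar> + 3 * \<eta>)"
        using norm_Pair_le[of "v 0" "k 0"] v0 K4 by (intro mult_left_mono) auto
      finally show ?thesis .
    qed
    let ?E = "K4 * (\<bar>k 0\<bar> + 3 * \<eta>)"
    have vb: "norm (v \<sigma>) \<le> ?E" and kb: "\<bar>k \<sigma>\<bar> \<le> ?E" if "\<sigma> \<in> {S1..S2}" for \<sigma>
      using eb[OF that] norm_fst_le[of "v \<sigma>" "k \<sigma>"] norm_snd_le[of "k \<sigma>" "v \<sigma>"] by auto
    have kd: "\<bar>k \<sigma> - k 0\<bar> \<le> (C * ?E + \<eta>) * \<bar>\<sigma>\<bar>" if s1: "\<sigma> \<in> {S1..S2}" for \<sigma>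
    proof -
      have "norm (k \<sigma> - k 0) \<le> (C * ?E + \<eta>) * \<bar>\<sigma>\<bar>"
      proof (rule increment_bound[where f' = k'])
        fix t assume "t \<in> closed_segment 0 \<sigma>"
        then have t: "t \<in> {S1..S2}" using seg[OF s1] by blast
        show "(k has_vector_derivative k' t) (at t)"
          using k[OF t] by (simp add: has_real_derivative_iff_has_vector_derivative)
        have "C * norm (v t) \<le> C * ?E" using vb[OF t] C by (rule mult_left_mono)
        then show "norm (k' t) \<le> C * ?E + \<eta>" using k'[OF t] by simp
      qed
      then show ?thesis by simp
    qed
    have vd: "norm (v \<sigma>) \<le> \<eta> + (?E + \<eta>) * \<bar>\<sigma>\<bar>" if s1: "\<sigma> \<in> {S1..S2}" for \<sigma>
    proof -
      have "norm (v \<sigma> - v 0) \<le> (?E + \<eta>) * \<bar>\<sigma>\<bar>"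
      proof (rule increment_bound[where f' = v'])
        fix t assume "t \<in> closed_segment 0 \<sigma>"
        then have t: "t \<in> {S1..S2}" using seg[OF s1] by blast
        show "(v has_vector_derivative v' t) (at t)" by (rule v[OF t])
        show "norm (v' t) \<le> ?E + \<eta>"
          using norm_triangle_sub[of "v' t" "k t *\<^sub>R dirN (a t)"] v'[OF t] kb[OF t] by simp
      qed
      then show ?thesis using v0 norm_triangle_sub[of "v \<sigma>" "v 0"] by linarith
    qed
    define \<phi> where "\<phi> \<sigma> = w \<sigma> - \<sigma> * k 0" for \<sigma>
    define \<phi>' where "\<phi>' \<sigma> = dirN (a \<sigma>) \<bullet> v' \<sigma> - a' \<sigma> * (dirT (a \<sigma>) \<bullet> v \<sigma>) - k 0" for \<sigma>
    have d\<phi>: "(\<phi> has_vector_derivative \<phi>' \<sigma>) (at \<sigma>)" if "\<sigma> \<in> {S1..S2}" for \<sigma>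
    proof -
      have "((dirN \<circ> a) has_vector_derivative a' \<sigma> *\<^sub>R (- dirT (a \<sigma>))) (at \<sigma>)"
        using base[OF that] dirN_has_vector_derivative
        by (intro vector_diff_chain_at) (auto simp: has_real_derivative_iff_has_vector_derivative)
      from bounded_bilinear.has_vector_derivative[OF bounded_bilinear_inner this v[OF that]]
      have "(w has_vector_derivative dirN (a \<sigma>) \<bullet> v' \<sigma> - a' \<sigma> * (dirT (a \<sigma>) \<bullet> v \<sigma>)) (at \<sigma>)"
        by (simp add: w_def[abs_def] o_def)
      moreover have "((\<lambda>\<sigma>. \<sigma> * k 0) has_vector_derivative k 0) (at \<sigma>)"
        by (auto intro!: derivative_eq_intros simp flip: has_real_derivative_iff_has_vector_derivative)
      ultimately show ?thesis
        unfolding \<phi>_def[abs_def] \<phi>'_def by (rule has_vector_derivative_diff)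
    qed
    have b\<phi>: "\<bar>\<phi>' \<sigma>\<bar> \<le> K5 * \<eta> + K6 * \<bar>s\<bar> * \<bar>k 0\<bar>" if s1: "\<sigma> \<in> {S1..S2}" and ss: "\<bar>\<sigma>\<bar> \<le> \<bar>s\<bar>" for \<sigma>
    proof -
      have sR: "\<bar>s\<bar> \<le> R" using s R by auto
      have e: "dirN (a \<sigma>) \<bullet> v' \<sigma> = dirN (a \<sigma>) \<bullet> (v' \<sigma> - k \<sigma> *\<^sub>R dirN (a \<sigma>)) + k \<sigma>"
        by (simp add: inner_diff_right)
      have 1: "\<bar>dirN (a \<sigma>) \<bullet> (v' \<sigma> - k \<sigma> *\<^sub>R dirN (a \<sigma>))\<bar> \<le> \<eta>"
        using Cauchy_Schwarz_ineq2[of "dirN (a \<sigma>)" "v' \<sigma> - k \<sigma> *\<^sub>R dirN (a \<sigma>)"] v'[OF s1] by simp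
      have "\<bar>a' \<sigma> * (dirT (a \<sigma>) \<bullet> v \<sigma>)\<bar> \<le> C * norm (v \<sigma>)"
        unfolding abs_mult
        using bounds(1)[OF s1] C Cauchy_Schwarz_ineq2[of "dirT (a \<sigma>)" "v \<sigma>"] by (intro mult_mono) auto
      also have "\<dots> \<le> C * (\<eta> + (?E + \<eta>) * \<bar>s\<bar>)"
      proof -
        have "0 \<le> ?E" using K4 \<eta> by simp
        then have "(?E + \<eta>) * \<bar>\<sigma>\<bar> \<le> (?E + \<eta>) * \<bar>s\<bar>" using ss \<eta> by (intro mult_left_mono) auto
        then show ?thesis using vd[OF s1] C by (intro mult_left_mono) auto
      qed
      finally have 2: "\<bar>a' \<sigma> * (dirT (a \<sigma>) \<bullet> v \<sigma>)\<bar> \<le> C * (\<eta> + (?E + \<eta>) * \<bar>s\<bar>)" .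
      have 3: "\<bar>k \<sigma> - k 0\<bar> \<le> (C * ?E + \<eta>) * \<bar>s\<bar>"
      proof -
        have "0 \<le> C * ?E + \<eta>" using K4 \<eta> C by simp
        then have "(C * ?E + \<eta>) * \<bar>\<sigma>\<bar> \<le> (C * ?E + \<eta>) * \<bar>s\<bar>" using ss by (intro mult_left_mono)
        then show ?thesis using kd[OF s1] by linarith
      qed
      have "\<bar>\<phi>' \<sigma>\<bar> \<le> \<eta> + (C * ?E + \<eta>) * \<bar>s\<bar> + C * (\<eta> + (?E + \<eta>) * \<bar>s\<bar>)"
        using 1 2 3 unfolding \<phi>'_def e by linarith
      also have "\<dots> = \<eta> + C * \<eta> + \<bar>s\<bar> * (\<eta> * (3*C*K4 + 1 + C * (3*K4 + 1))) + K6 * \<bar>s\<bar> * \<bar>k 0\<bar>"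
        by (simp add: K6_def algebra_simps)
      also have "\<bar>s\<bar> * (\<eta> * (3*C*K4 + 1 + C * (3*K4 + 1))) \<le> R * (\<eta> * (3*C*K4 + 1 + C * (3*K4 + 1)))"
        using sR \<eta> C K4 by (intro mult_right_mono) auto
      finally show ?thesis by (simp add: K5_def algebra_simps)
    qed
    have "norm (\<phi> s - \<phi> 0) \<le> (K5 * \<eta> + K6 * \<bar>s\<bar> * \<bar>k 0\<bar>) * \<bar>s\<bar>"
    proof (rule increment_bound[where f' = \<phi>'])
      fix t assume t: "t \<in> closed_segment 0 s"
      then have t1: "t \<in> {S1..S2}" using seg[OF s(2)] by blast
      show "(\<phi> has_vector_derivative \<phi>' t) (at t)" by (rule d\<phi>[OF t1])
      have "\<bar>t\<bar> \<le> \<bar>s\<bar>" using t by (auto simp: closed_segment_eq_real_ivl split: if_splits)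
      then show "norm (\<phi>' t) \<le> K5 * \<eta> + K6 * \<bar>s\<bar> * \<bar>k 0\<bar>" using b\<phi>[OF t1] by simp
    qed
    moreover have "\<phi> s - \<phi> 0 = w s - w 0 - s * k 0" by (simp add: \<phi>_def)
    ultimately have "\<bar>s * k 0\<bar> \<le> \<bar>w s\<bar> + \<bar>w 0\<bar> + (K5 * \<eta> + K6 * \<bar>s\<bar> * \<bar>k 0\<bar>) * \<bar>s\<bar>"
      unfolding real_norm_def by linarith
    also have "\<dots> \<le> 2 * K3 * \<eta> + (K5 * \<eta> + 1/2 * \<bar>k 0\<bar>) * \<bar>s\<bar>"
    proof -
      have "(K5 * \<eta> + K6 * \<bar>s\<bar> * \<bar>k 0\<bar>) * \<bar>s\<bar> \<le> (K5 * \<eta> + 1/2 * \<bar>k 0\<bar>) * \<bar>s\<bar>"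
        by (rule mult_right_mono) (use mult_right_mono[OF sK, of "\<bar>k 0\<bar>"] in simp_all)
      then show ?thesis using wb[OF s(2)] wb[OF I0] by linarith
    qed
    finally have "\<bar>k 0\<bar> * \<bar>s\<bar> \<le> 2 * (2 * K3 * \<eta> + K5 * \<eta> * \<bar>s\<bar>)"
      by (simp add: abs_mult algebra_simps)
    then have "\<bar>k 0\<bar> \<le> 2 * (2 * K3 * \<eta> + K5 * \<eta> * \<bar>s\<bar>) / \<bar>s\<bar>"
      using s(1) by (simp add: pos_le_divide_eq)
    also have "\<dots> = (4 * K3 / \<bar>s\<bar> + 2 * K5) * \<eta>" using s(1) by (simp add: field_simps)
    finally show "\<bar>k 0\<bar> \<le> (4 * K3 / \<bar>s\<bar> + 2 * K5) * \<eta>" .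
  qed
qed

section \<open>The fan of characteristics\<close>

text \<open>The curl measures the failure of the derivative of F to be symmetric.\<close>

lemma curl_cross:
  assumes "F differentiable (at x)"
  shows "frechet_derivative F (at x) (dirT a) \<bullet> v - frechet_derivative F (at x) v \<bullet> dirT a = curl F x * (dirN a \<bullet> v)"
  unfolding frechet_derivative_partial[OF assms] curl_def
  by (simp add: sum_2 inner_2 algebra_simps)

text \<open>The data of a nondegenerate side: g is the seed curve, P and \<open>\<theta>\<close> solve the characteristic
  system with initial values on g, and h is the hitting time, which is negative if C is reached
  against the direction T.\<close>

locale char_fan =
  fixes \<Omega> :: "(real^2) set" and F :: "real^2 \<Rightarrow> real^2" and H u :: "real^2 \<Rightarrow> real"
    and C V :: "(real^2) set" and \<alpha> \<beta> s :: real and g :: "real \<Rightarrow> real^2" and W :: "(real \<times> real) set"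
    and P :: "real \<Rightarrow> real \<Rightarrow> real^2" and \<theta> :: "real \<Rightarrow> real \<Rightarrow> real" and h :: "real \<Rightarrow> real"
  assumes open_domain: "open \<Omega>" and F_C1: "C1_on \<Omega> F" and H_C1: "C1_on \<Omega> H" and u_C1: "C1_on \<Omega> u"
    and V_nonsing: "V \<subseteq> \<Omega> - sing_set \<Omega> F u" and C_sing: "C \<subseteq> sing_set \<Omega> F u"
    and s_sign: "s \<in> {1, -1}"
    and seed: "\<And>\<tau>. \<tau> \<in> {\<alpha><..<\<beta>} \<Longrightarrow> g \<tau> \<in> V \<and> (g has_vector_derivative s *\<^sub>R normal_dir F u (g \<tau>)) (at \<tau>)"
    and W_open: "open W" and W_strip: "W \<subseteq> UNIV \<times> {\<alpha><..<\<beta>}"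
    and W_section: "\<And>\<tau>. \<tau> \<in> {\<alpha><..<\<beta>} \<Longrightarrow> is_interval {\<sigma>. (\<sigma>, \<tau>) \<in> W} \<and> (0, \<tau>) \<in> W \<and> (h \<tau>, \<tau>) \<in> W"
    and char_system: "\<And>\<sigma> \<tau>. (\<sigma>, \<tau>) \<in> W \<Longrightarrow> P \<sigma> \<tau> \<in> \<Omega> \<and>
         ((\<lambda>\<sigma>. P \<sigma> \<tau>) has_vector_derivative dirT (\<theta> \<sigma> \<tau>)) (at \<sigma>) \<and>
         ((\<lambda>\<sigma>. \<theta> \<sigma> \<tau>) has_real_derivative - H (P \<sigma> \<tau>)) (at \<sigma>)"
    and initial: "\<And>\<tau>. \<tau> \<in> {\<alpha><..<\<beta>} \<Longrightarrow> P 0 \<tau> = g \<tau> \<and> normal_dir F u (g \<tau>) = dirN (\<theta> 0 \<tau>)"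
    and angle_cont: "continuous_on {\<alpha><..<\<beta>} (\<theta> 0)"
    and hits: "\<And>\<tau>. \<tau> \<in> {\<alpha><..<\<beta>} \<Longrightarrow> P (h \<tau>) \<tau> \<in> C \<and>
         (\<forall>\<sigma>\<in>closed_segment 0 (h \<tau>) - {h \<tau>}. P \<sigma> \<tau> \<in> V \<and>
            ((\<lambda>\<sigma>. P \<sigma> \<tau>) has_vector_derivative char_dir F u (P \<sigma> \<tau>)) (at \<sigma>))"
    and h_cont: "continuous_on {\<alpha><..<\<beta>} h"
begin

abbreviation gradF :: "real^2 \<Rightarrow> real^2" where "gradF x \<equiv> grad u x + F x"

lemma C_V_disjoint: "C \<inter> V = {}"
  using V_nonsing C_sing by blast

lemma gradF_continuous: "continuous_on \<Omega> gradF"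
  by (intro continuous_intros C1_on_grad_continuous[OF u_C1] C1_on_continuous[OF F_C1])

lemma h_nonzero: "\<tau> \<in> {\<alpha><..<\<beta>} \<Longrightarrow> h \<tau> \<noteq> 0"
  using hits[of \<tau>] initial[of \<tau>] seed[of \<tau>] C_V_disjoint by auto

lemma W_time: "(\<sigma>, \<tau>) \<in> W \<Longrightarrow> \<tau> \<in> {\<alpha><..<\<beta>}"
  using W_strip by blast

lemma segment_in_W: "(\<sigma>, \<tau>) \<in> W \<Longrightarrow> closed_segment 0 \<sigma> \<times> {\<tau>} \<subseteq> W"
proof -
  assume W: "(\<sigma>, \<tau>) \<in> W"
  then have "convex {\<sigma>. (\<sigma>, \<tau>) \<in> W}" "(0, \<tau>) \<in> W"
    using W_section[OF W_time[OF W]] is_interval_convex by auto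
  then have "closed_segment 0 \<sigma> \<subseteq> {\<sigma>. (\<sigma>, \<tau>) \<in> W}"
    using W by (intro closed_segment_subset) auto
  then show ?thesis by auto
qed

lemma g_derivative:
  assumes "\<tau> \<in> {\<alpha><..<\<beta>}"
  shows "(g has_vector_derivative s *\<^sub>R dirN (\<theta> 0 \<tau>)) (at \<tau>)"
  using seed[OF assms] initial[OF assms] by simp

sublocale flow_family "char_field H" "char_lin H" "\<Omega> \<times> UNIV" W "\<lambda>\<sigma> \<tau>. (P \<sigma> \<tau>, \<theta> \<sigma> \<tau>)"
proof (rule flow_family.intro)
  fix S :: "((real^2) \<times> real) set" and \<eta> :: real
  assume "compact S" "S \<subseteq> \<Omega> \<times> UNIV"
  then show "\<exists>M\<ge>0. \<forall>z\<in>S. \<forall>v. norm (char_lin H z v) \<le> M * norm v"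
    by (rule char_lin_bound[OF H_C1])
  assume "\<eta> > 0"
  with \<open>compact S\<close> \<open>S \<subseteq> \<Omega> \<times> UNIV\<close>
  show "\<exists>\<delta>>0. \<forall>z\<in>S. ball z \<delta> \<subseteq> \<Omega> \<times> UNIV \<and> (\<forall>x\<in>ball z \<delta>. \<forall>x'\<in>ball z \<delta>.
      norm (char_field H x' - char_field H x - char_lin H z (x' - x)) \<le> \<eta> * norm (x' - x))"
    by (rule char_field_strict[OF open_domain H_C1])
next
  show "linear (char_lin H z)" if "z \<in> \<Omega> \<times> UNIV" for z
    using that by (intro char_lin_linear[OF H_C1]) auto
  show "open W" by (rule W_open)
  show "closed_segment 0 \<sigma> \<times> {\<tau>} \<subseteq> W" if "(\<sigma>, \<tau>) \<in> W" for \<sigma> \<tau>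
    by (rule segment_in_W[OF that])
  show "(P \<sigma> \<tau>, \<theta> \<sigma> \<tau>) \<in> \<Omega> \<times> UNIV" if "(\<sigma>, \<tau>) \<in> W" for \<sigma> \<tau>
    using char_system[OF that] by simp
  show "((\<lambda>\<sigma>. (P \<sigma> \<tau>, \<theta> \<sigma> \<tau>)) has_vector_derivative char_field H (P \<sigma> \<tau>, \<theta> \<sigma> \<tau>)) (at \<sigma>)" if "(\<sigma>, \<tau>) \<in> W" for \<sigma> \<tau>
    using char_system[OF that] unfolding char_field_def
    by (intro has_vector_derivative_Pair) (simp_all add: has_real_derivative_iff_has_vector_derivative)
  show "isCont (\<lambda>\<tau>. (P 0 \<tau>, \<theta> 0 \<tau>)) \<tau>" if "(0, \<tau>) \<in> W" for \<tau>
  proof -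
    have t: "\<tau> \<in> {\<alpha><..<\<beta>}" by (rule W_time[OF that])
    have "isCont g \<tau>" by (rule has_vector_derivative_continuous[OF g_derivative[OF t]])
    then have "isCont (P 0) \<tau>"
    proof (rule continuous_transform_within[of _ _ _ "min (\<tau> - \<alpha>) (\<beta> - \<tau>)"])
      show "g x = P 0 x" if "dist x \<tau> < min (\<tau> - \<alpha>) (\<beta> - \<tau>)" for x
      proof -
        have "x \<in> {\<alpha><..<\<beta>}" using that by (auto simp: dist_real_def abs_less_iff)
        then show ?thesis using initial by simp
      qed
    qed (use t in auto)
    moreover have "isCont (\<theta> 0) \<tau>"
      using angle_cont t by (simp add: continuous_on_eq_continuous_at)
    ultimately show ?thesis by (intro continuous_intros)
  qed
qed

lemma char_relation:
  assumes t: "\<tau> \<in> {\<alpha><..<\<beta>}" and "\<sigma> \<in> closed_segment 0 (h \<tau>)" "\<sigma> \<noteq> h \<tau>"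
  shows "gradF (P \<sigma> \<tau>) = norm (gradF (P \<sigma> \<tau>)) *\<^sub>R dirN (\<theta> \<sigma> \<tau>)" "gradF (P \<sigma> \<tau>) \<noteq> 0"
    "normal_dir F u (P \<sigma> \<tau>) = dirN (\<theta> \<sigma> \<tau>)"
proof -
  have W: "(\<sigma>, \<tau>) \<in> W" using segment_in_W[of "h \<tau>" \<tau>] W_section[OF t] assms by auto
  have V: "P \<sigma> \<tau> \<in> V" and der: "((\<lambda>\<sigma>. P \<sigma> \<tau>) has_vector_derivative char_dir F u (P \<sigma> \<tau>)) (at \<sigma>)"
    using hits[OF t] assms by auto
  show nz: "gradF (P \<sigma> \<tau>) \<noteq> 0" using V V_nonsing by (auto simp: sing_set_def)
  have "char_dir F u (P \<sigma> \<tau>) = dirT (\<theta> \<sigma> \<tau>)"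
    using vector_derivative_unique_at[OF der] char_system[OF W] by simp
  then show nd: "normal_dir F u (P \<sigma> \<tau>) = dirN (\<theta> \<sigma> \<tau>)"
    by (simp add: char_dir_def dirT_def vec_eq_iff forall_2)
  show "gradF (P \<sigma> \<tau>) = norm (gradF (P \<sigma> \<tau>)) *\<^sub>R dirN (\<theta> \<sigma> \<tau>)"
    unfolding nd[symmetric] using nz by (simp add: normal_dir_def)
qed

text \<open>To first order the circulation of \<open>grad u + F\<close> along the segment from \<open>P \<sigma> t1\<close> to \<open>P \<sigma> t2\<close>.\<close>

definition flux :: "real \<Rightarrow> real \<Rightarrow> real \<Rightarrow> real"
  where "flux t1 t2 \<sigma> = u (P \<sigma> t2) - u (P \<sigma> t1) + F (P \<sigma> t1) \<bullet> (P \<sigma> t2 - P \<sigma> t1)"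

text \<open>The derivative of \<open>flux\<close> in \<open>\<sigma>\<close>. The derivatives of u and the values of F cancel, because
  \<open>grad u + F\<close> is orthogonal to characteristics; what remains contains F only through differences,
  so that its first order part is the curl.\<close>

definition flux' :: "real \<Rightarrow> real \<Rightarrow> real \<Rightarrow> real"
  where "flux' t1 t2 \<sigma> = frechet_derivative F (at (P \<sigma> t1)) (dirT (\<theta> \<sigma> t1)) \<bullet> (P \<sigma> t2 - P \<sigma> t1)
    - (F (P \<sigma> t2) - F (P \<sigma> t1)) \<bullet> dirT (\<theta> \<sigma> t2)"

lemma flux_derivative:
  assumes t: "t1 \<in> {\<alpha><..<\<beta>}" "t2 \<in> {\<alpha><..<\<beta>}"
    and seg: "\<sigma> \<in> closed_segment 0 (h t1) - {h t1}" "\<sigma> \<in> closed_segment 0 (h t2) - {h t2}"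
  shows "(flux t1 t2 has_real_derivative flux' t1 t2 \<sigma>) (at \<sigma>)"
proof -
  have W: "(\<sigma>, t1) \<in> W" "(\<sigma>, t2) \<in> W"
    using segment_in_W[of "h t1" t1] segment_in_W[of "h t2" t2] W_section[OF t(1)] W_section[OF t(2)] seg by auto
  have dP: "((\<lambda>\<sigma>. P \<sigma> t1) has_derivative (\<lambda>x. x *\<^sub>R dirT (\<theta> \<sigma> t1))) (at \<sigma>)"
    "((\<lambda>\<sigma>. P \<sigma> t2) has_derivative (\<lambda>x. x *\<^sub>R dirT (\<theta> \<sigma> t2))) (at \<sigma>)"
    using char_system[OF W(1)] char_system[OF W(2)] unfolding has_vector_derivative_def by auto
  have in\<Omega>: "P \<sigma> t1 \<in> \<Omega>" "P \<sigma> t2 \<in> \<Omega>" using char_system W by auto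
  have udiff: "frechet_derivative u (at x) v = grad u x \<bullet> v" if "x \<in> \<Omega>" for x v
    using frechet_derivative_eq_grad that u_C1 by (auto simp: C1_on_def)
  have DFlin: "linear (frechet_derivative F (at (P \<sigma> t1)))"
    using C1_on_has_derivative[OF F_C1 in\<Omega>(1)] has_derivative_linear by blast
  have orth: "grad u (P \<sigma> t1) \<bullet> dirT (\<theta> \<sigma> t1) = - (F (P \<sigma> t1) \<bullet> dirT (\<theta> \<sigma> t1))"
    "grad u (P \<sigma> t2) \<bullet> dirT (\<theta> \<sigma> t2) = - (F (P \<sigma> t2) \<bullet> dirT (\<theta> \<sigma> t2))"
  proof -
    have "gradF (P \<sigma> \<tau>) \<bullet> dirT (\<theta> \<sigma> \<tau>) = 0" if "\<tau> \<in> {\<alpha><..<\<beta>}" "\<sigma> \<in> closed_segment 0 (h \<tau>) - {h \<tau>}" for \<tau>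
      using char_relation(1)[of \<tau> \<sigma>] that by (metis DiffD1 DiffD2 dir_inner(3) inner_scaleR_left insertI1 mult_zero_right)
    then show "grad u (P \<sigma> t1) \<bullet> dirT (\<theta> \<sigma> t1) = - (F (P \<sigma> t1) \<bullet> dirT (\<theta> \<sigma> t1))"
      "grad u (P \<sigma> t2) \<bullet> dirT (\<theta> \<sigma> t2) = - (F (P \<sigma> t2) \<bullet> dirT (\<theta> \<sigma> t2))"
      using t seg by (simp_all add: inner_add_left add_eq_0_iff)
  qed
  have du: "((\<lambda>\<sigma>. u (P \<sigma> \<tau>)) has_derivative (\<lambda>x. frechet_derivative u (at (P \<sigma> \<tau>)) (x *\<^sub>R dirT (\<theta> \<sigma> \<tau>)))) (at \<sigma>)"
    if "P \<sigma> \<tau> \<in> \<Omega>" "((\<lambda>\<sigma>. P \<sigma> \<tau>) has_derivative (\<lambda>x. x *\<^sub>R dirT (\<theta> \<sigma> \<tau>))) (at \<sigma>)" for \<tau>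
    using has_derivative_compose[OF that(2) C1_on_has_derivative[OF u_C1 that(1)]] .
  have dF: "((\<lambda>\<sigma>. F (P \<sigma> t1)) has_derivative (\<lambda>x. frechet_derivative F (at (P \<sigma> t1)) (x *\<^sub>R dirT (\<theta> \<sigma> t1)))) (at \<sigma>)"
    using has_derivative_compose[OF dP(1) C1_on_has_derivative[OF F_C1 in\<Omega>(1)]] .
  have "(flux t1 t2 has_derivative (\<lambda>x. frechet_derivative u (at (P \<sigma> t2)) (x *\<^sub>R dirT (\<theta> \<sigma> t2))
      - frechet_derivative u (at (P \<sigma> t1)) (x *\<^sub>R dirT (\<theta> \<sigma> t1))
      + (F (P \<sigma> t1) \<bullet> (x *\<^sub>R dirT (\<theta> \<sigma> t2) - x *\<^sub>R dirT (\<theta> \<sigma> t1))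
        + frechet_derivative F (at (P \<sigma> t1)) (x *\<^sub>R dirT (\<theta> \<sigma> t1)) \<bullet> (P \<sigma> t2 - P \<sigma> t1)))) (at \<sigma>)"
    unfolding flux_def[abs_def]
    by (intro has_derivative_add has_derivative_diff has_derivative_inner du dF dP in\<Omega>)
  moreover have "(\<lambda>x. frechet_derivative u (at (P \<sigma> t2)) (x *\<^sub>R dirT (\<theta> \<sigma> t2))
      - frechet_derivative u (at (P \<sigma> t1)) (x *\<^sub>R dirT (\<theta> \<sigma> t1))
      + (F (P \<sigma> t1) \<bullet> (x *\<^sub>R dirT (\<theta> \<sigma> t2) - x *\<^sub>R dirT (\<theta> \<sigma> t1))
        + frechet_derivative F (at (P \<sigma> t1)) (x *\<^sub>R dirT (\<theta> \<sigma> t1)) \<bullet> (P \<sigma> t2 - P \<sigma> t1)))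
     = (*) (flux' t1 t2 \<sigma>)"
    by (rule ext) (simp add: udiff in\<Omega> orth flux'_def linear_cmul[OF DFlin] inner_diff_left
        inner_diff_right algebra_simps)
  ultimately show ?thesis by (simp add: has_field_derivative_def)
qed

text \<open>Times between the seed and the singular curve, the hitting time excluded. Being compact, the
  interval stays away from the hitting times of all nearby characteristics.\<close>

definition regular_interval :: "real \<Rightarrow> real \<Rightarrow> real \<Rightarrow> bool"
  where "regular_interval S1 S2 \<tau> \<longleftrightarrow> \<tau> \<in> {\<alpha><..<\<beta>} \<and> S1 \<le> 0 \<and> 0 \<le> S2 \<and> {S1..S2} \<subseteq> closed_segment 0 (h \<tau>) - {h \<tau>}"

lemma regular_intervalD:
  assumes "regular_interval S1 S2 \<tau>"
  shows "\<tau> \<in> {\<alpha><..<\<beta>}" "S1 \<le> 0" "0 \<le> S2" "{S1..S2} \<times> {\<tau>} \<subseteq> W"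
  using assms segment_in_W[of "h \<tau>" \<tau>] W_section[of \<tau>] by (auto simp: regular_interval_def)

lemma regular_interval_nearby:
  assumes r: "regular_interval S1 S2 \<tau>"
  obtains d where "d > 0" "\<And>\<tau>'. \<tau>' \<in> ball \<tau> d \<Longrightarrow> regular_interval S1 S2 \<tau>'"
proof -
  have t: "\<tau> \<in> {\<alpha><..<\<beta>}" using r by (simp add: regular_interval_def)
  have hc: "isCont h \<tau>" using h_cont t by (simp add: continuous_on_eq_continuous_at)
  have S: "S1 \<le> 0" "0 \<le> S2" "S1 \<in> closed_segment 0 (h \<tau>) - {h \<tau>}" "S2 \<in> closed_segment 0 (h \<tau>) - {h \<tau>}"
    using r subsetD[of "{S1..S2}" "closed_segment 0 (h \<tau>) - {h \<tau>}"] by (auto simp: regular_interval_def)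
  define m where "m = (if h \<tau> > 0 then h \<tau> - S2 else S1 - h \<tau>)"
  have "m > 0" using S h_nonzero[OF t] by (auto simp: m_def closed_segment_eq_real_ivl split: if_splits)
  then obtain d where d: "d > 0" "\<And>x. dist x \<tau> < d \<Longrightarrow> dist (h x) (h \<tau>) < m"
    using hc unfolding continuous_at_eps_delta by blast
  show ?thesis
  proof (rule that[of "min d (min (\<tau> - \<alpha>) (\<beta> - \<tau>))"])
    show "min d (min (\<tau> - \<alpha>) (\<beta> - \<tau>)) > 0" using d t by simp
    fix \<tau>' assume a: "\<tau>' \<in> ball \<tau> (min d (min (\<tau> - \<alpha>) (\<beta> - \<tau>)))"
    then have "\<tau>' \<in> {\<alpha><..<\<beta>}" by (auto simp: dist_norm)
    moreover have "\<bar>h \<tau>' - h \<tau>\<bar> < m" using d(2)[of \<tau>'] a by (simp add: dist_norm abs_minus_commute)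
    ultimately show "regular_interval S1 S2 \<tau>'"
      using S h_nonzero[OF t] unfolding regular_interval_def m_def closed_segment_eq_real_ivl
      by (cases "h \<tau> > 0") auto
  qed
qed

end

lemma curl_continuous: "C1_on A F \<Longrightarrow> continuous_on A (curl F)"
  unfolding C1_on_def curl_def[abs_def] by (intro continuous_intros) auto

context char_fan
begin

lemma P_continuous: "{S1..S2} \<times> {\<tau>} \<subseteq> W \<Longrightarrow> continuous_on {S1..S2} (\<lambda>\<sigma>. P \<sigma> \<tau>)"
  by (intro continuous_at_imp_continuous_on ballI has_vector_derivative_continuous)
    (use char_system in blast)

lemma P_compact: "{S1..S2} \<times> {\<tau>} \<subseteq> W \<Longrightarrow> compact ((\<lambda>\<sigma>. P \<sigma> \<tau>) ` {S1..S2}) \<and> (\<lambda>\<sigma>. P \<sigma> \<tau>) ` {S1..S2} \<subseteq> \<Omega>"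
  using char_system by (intro conjI compact_continuous_image P_continuous) auto

text \<open>Both estimates hold with errors small relative to the displacement, although u is only
  \<open>C\<^sup>1\<close>: the gradient of u enters through strict differentiability, and second derivatives of u
  never occur.\<close>

lemma flux_linearized:
  assumes r: "regular_interval S1 S2 \<tau>" and "\<eta> > 0"
  obtains d where "d > 0" "\<And>\<tau>'. \<tau>' \<in> ball \<tau> d \<Longrightarrow> regular_interval S1 S2 \<tau>'"
    "\<And>t1 t2 \<sigma>. \<lbrakk>t1 \<in> ball \<tau> d; t2 \<in> ball \<tau> d; \<sigma> \<in> {S1..S2}\<rbrakk> \<Longrightarrow>
      \<bar>flux t1 t2 \<sigma> - norm (gradF (P \<sigma> \<tau>)) * (dirN (\<theta> \<sigma> \<tau>) \<bullet> (P \<sigma> t2 - P \<sigma> t1))\<bar> \<le> \<eta> * norm (P \<sigma> t2 - P \<sigma> t1)"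
    "\<And>t1 t2 \<sigma>. \<lbrakk>t1 \<in> ball \<tau> d; t2 \<in> ball \<tau> d; \<sigma> \<in> {S1..S2}\<rbrakk> \<Longrightarrow>
      \<bar>flux' t1 t2 \<sigma> - curl F (P \<sigma> \<tau>) * (dirN (\<theta> \<sigma> \<tau>) \<bullet> (P \<sigma> t2 - P \<sigma> t1))\<bar> \<le> \<eta> * norm (P \<sigma> t2 - P \<sigma> t1)"
proof -
  note rD = regular_intervalD[OF r]
  let ?S = "(\<lambda>\<sigma>. P \<sigma> \<tau>) ` {S1..S2}"
  have S: "compact ?S" "?S \<subseteq> \<Omega>" using P_compact[OF rD(4)] by auto
  have "\<eta>/8 > 0" using \<open>\<eta> > 0\<close> by simp
  obtain \<delta>u where \<delta>u: "\<delta>u > 0"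
    "\<And>z x y. \<lbrakk>z \<in> ?S; x \<in> ball z \<delta>u; y \<in> ball z \<delta>u\<rbrakk> \<Longrightarrow>
      norm (u y - u x - frechet_derivative u (at z) (y - x)) \<le> \<eta>/8 * norm (y - x)"
    by (rule C1_on_strictly_differentiable[OF open_domain u_C1 S \<open>\<eta>/8 > 0\<close>]) (rule that)
  obtain \<delta>F where \<delta>F: "\<delta>F > 0"
    "\<And>z x y. \<lbrakk>z \<in> ?S; x \<in> ball z \<delta>F; y \<in> ball z \<delta>F\<rbrakk> \<Longrightarrow>
      norm (F y - F x - frechet_derivative F (at z) (y - x)) \<le> \<eta>/8 * norm (y - x)"
    "\<And>z w v. \<lbrakk>z \<in> ?S; w \<in> ball z \<delta>F\<rbrakk> \<Longrightarrow>
      norm (frechet_derivative F (at w) v - frechet_derivative F (at z) v) \<le> \<eta>/8 * norm v"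
    by (rule C1_on_strictly_differentiable[OF open_domain F_C1 S \<open>\<eta>/8 > 0\<close>]) (rule that)
  obtain M where M: "M \<ge> 0" "\<And>z v. z \<in> ?S \<Longrightarrow> norm (frechet_derivative F (at z) v) \<le> M * norm v"
    by (rule C1_on_derivative_bound[OF F_C1 S]) (rule that)
  define e where "e = Min {\<delta>u, \<delta>F, 1, \<eta> / (8 * (M + 1))}"
  have e: "e > 0" "e \<le> \<delta>u" "e \<le> \<delta>F" "e \<le> 1" "e \<le> \<eta> / (8 * (M + 1))"
    using \<delta>u(1) \<delta>F(1) \<open>\<eta> > 0\<close> M(1) by (auto simp: e_def)
  have Me: "(M + 1) * e \<le> \<eta>/8" using e(5) M(1) by (simp add: field_simps)
  obtain d1 where d1: "d1 > 0" "\<And>\<tau>'. \<tau>' \<in> ball \<tau> d1 \<Longrightarrow> regular_interval S1 S2 \<tau>'"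
    by (rule regular_interval_nearby[OF r]) (rule that)
  obtain d2 where d2: "d2 > 0"
    "\<And>\<tau>' \<sigma>. \<lbrakk>\<tau>' \<in> ball \<tau> d2; \<sigma> \<in> {S1..S2}\<rbrakk> \<Longrightarrow> norm ((P \<sigma> \<tau>', \<theta> \<sigma> \<tau>') - (P \<sigma> \<tau>, \<theta> \<sigma> \<tau>)) < e"
    by (rule continuous_dependence[OF rD(4,2,3) e(1)]) (rule that)
  have near: "norm (P \<sigma> \<tau>' - P \<sigma> \<tau>) < e" "\<bar>\<theta> \<sigma> \<tau>' - \<theta> \<sigma> \<tau>\<bar> < e" if "\<tau>' \<in> ball \<tau> d2" "\<sigma> \<in> {S1..S2}" for \<tau>' \<sigma>
    using d2(2)[OF that] norm_fst_le[of "P \<sigma> \<tau>' - P \<sigma> \<tau>" "\<theta> \<sigma> \<tau>' - \<theta> \<sigma> \<tau>"]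
      norm_snd_le[of "\<theta> \<sigma> \<tau>' - \<theta> \<sigma> \<tau>" "P \<sigma> \<tau>' - P \<sigma> \<tau>"] by auto
  show ?thesis
  proof (rule that[of "min d1 d2"])
    show "min d1 d2 > 0" using d1 d2 by simp
    show "regular_interval S1 S2 \<tau>'" if "\<tau>' \<in> ball \<tau> (min d1 d2)" for \<tau>' using that d1(2) by simp
    fix t1 t2 \<sigma> assume t: "t1 \<in> ball \<tau> (min d1 d2)" "t2 \<in> ball \<tau> (min d1 d2)" and s: "\<sigma> \<in> {S1..S2}"
    define z where "z = P \<sigma> \<tau>"
    define p where "p = P \<sigma> t1"
    define q where "q = P \<sigma> t2"
    define D where "D = frechet_derivative F (at z)"
    define T where "T = dirT (\<theta> \<sigma> \<tau>)"
    define T1 where "T1 = dirT (\<theta> \<sigma> t1)"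
    define T2 where "T2 = dirT (\<theta> \<sigma> t2)"
    have zS: "z \<in> ?S" using s by (auto simp: z_def)
    then have z\<Omega>: "z \<in> \<Omega>" using S by blast
    have pq: "p \<in> ball z e" "q \<in> ball z e"
      using near(1)[of t1 \<sigma>] near(1)[of t2 \<sigma>] t s by (auto simp: dist_norm norm_minus_commute z_def p_def q_def)
    have T: "norm (T1 - T) \<le> e" "norm (T2 - T) \<le> e"
      using near(2)[of t1 \<sigma>] near(2)[of t2 \<sigma>] t s dirT_Lipschitz[of "\<theta> \<sigma> t1" "\<theta> \<sigma> \<tau>"]
        dirT_Lipschitz[of "\<theta> \<sigma> t2" "\<theta> \<sigma> \<tau>"] by (auto simp: T_def T1_def T2_def)
    have nT: "norm T1 = 1" "norm T2 = 1" by (simp_all add: T1_def T2_def)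
    have Dlin: "linear D"
      using C1_on_has_derivative[OF F_C1 z\<Omega>] has_derivative_linear unfolding D_def by blast
    have rel: "gradF z = norm (gradF z) *\<^sub>R dirN (\<theta> \<sigma> \<tau>)"
      unfolding z_def by (rule char_relation(1)[OF rD(1)]) (use r s in \<open>auto simp: regular_interval_def\<close>)
    have u1: "norm (u q - u p - grad u z \<bullet> (q - p)) \<le> \<eta>/8 * norm (q - p)"
    proof -
      have "u differentiable (at z)" using u_C1 z\<Omega> by (simp add: C1_on_def)
      then have "grad u z \<bullet> (q - p) = frechet_derivative u (at z) (q - p)"
        by (simp add: frechet_derivative_eq_grad)
      then show ?thesis using \<delta>u(2)[OF zS, of p q] pq e(2) by simp
    qed
    have F1: "norm (F p - F z) \<le> \<eta>/4"
    proof -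
      have "norm (F p - F z - D (p - z)) \<le> \<eta>/8 * norm (p - z)"
        unfolding D_def using \<delta>F(2)[OF zS, of z p] pq e(1,3) by simp
      moreover have "norm (D (p - z)) \<le> M * norm (p - z)" unfolding D_def by (rule M(2)[OF zS])
      moreover have "\<eta>/8 * norm (p - z) \<le> \<eta>/8 * 1"
        using pq e(4) \<open>\<eta> > 0\<close> by (intro mult_left_mono) (auto simp: dist_norm norm_minus_commute)
      moreover have "M * norm (p - z) \<le> (M + 1) * e"
        using pq M(1) by (intro mult_mono) (auto simp: dist_norm norm_minus_commute)
      ultimately show ?thesis
        using Me norm_triangle_sub[of "F p - F z" "D (p - z)"] by linarith
    qed
    have "flux t1 t2 \<sigma> - norm (gradF z) * (dirN (\<theta> \<sigma> \<tau>) \<bullet> (q - p))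
       = (u q - u p - grad u z \<bullet> (q - p)) + (F p - F z) \<bullet> (q - p)"
    proof -
      have "norm (gradF z) * (dirN (\<theta> \<sigma> \<tau>) \<bullet> (q - p)) = gradF z \<bullet> (q - p)"
        by (subst (2) rel) simp
      then show ?thesis by (simp add: flux_def p_def q_def inner_add_left inner_diff_left)
    qed
    moreover have "\<bar>(F p - F z) \<bullet> (q - p)\<bar> \<le> \<eta>/4 * norm (q - p)"
      using Cauchy_Schwarz_ineq2[of "F p - F z" "q - p"] mult_right_mono[OF F1, of "norm (q - p)"] by simp
    moreover have "0 \<le> \<eta> * norm (q - p)" using \<open>\<eta> > 0\<close> by simp
    ultimately show "\<bar>flux t1 t2 \<sigma> - norm (gradF (P \<sigma> \<tau>)) * (dirN (\<theta> \<sigma> \<tau>) \<bullet> (P \<sigma> t2 - P \<sigma> t1))\<bar>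
        \<le> \<eta> * norm (P \<sigma> t2 - P \<sigma> t1)"
      using u1 unfolding z_def[symmetric] p_def[symmetric] q_def[symmetric] real_norm_def by linarith
    have Fdiff: "F differentiable (at z)" using F_C1 z\<Omega> by (simp add: C1_on_def)
    have "flux' t1 t2 \<sigma> - curl F z * (dirN (\<theta> \<sigma> \<tau>) \<bullet> (q - p))
       = (frechet_derivative F (at p) T1 - D T1) \<bullet> (q - p) + D (T1 - T) \<bullet> (q - p)
        - (F q - F p - D (q - p)) \<bullet> T2 - D (q - p) \<bullet> (T2 - T)"
      unfolding curl_cross[OF Fdiff, symmetric] flux'_def
      by (simp add: p_def q_def z_def D_def T_def T1_def T2_def
          linear_diff[OF Dlin, unfolded D_def z_def] inner_diff_left inner_diff_right)
    moreover have "\<bar>(frechet_derivative F (at p) T1 - D T1) \<bullet> (q - p)\<bar> \<le> \<eta>/8 * norm (q - p)"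
    proof -
      have "norm (frechet_derivative F (at p) T1 - D T1) \<le> \<eta>/8"
        unfolding D_def using \<delta>F(3)[OF zS, of p T1] pq e(3) nT by simp
      then show ?thesis
        using Cauchy_Schwarz_ineq2[of "frechet_derivative F (at p) T1 - D T1" "q - p"]
          mult_right_mono[of _ "\<eta>/8" "norm (q - p)"] by (smt (verit) norm_ge_zero)
    qed
    moreover have "\<bar>D (T1 - T) \<bullet> (q - p)\<bar> \<le> \<eta>/8 * norm (q - p)"
    proof -
      have "norm (D (T1 - T)) \<le> M * norm (T1 - T)" unfolding D_def by (rule M(2)[OF zS])
      also have "\<dots> \<le> (M + 1) * e" using T M(1) by (intro mult_mono) auto
      finally have "norm (D (T1 - T)) \<le> \<eta>/8" using Me by simp
      then show ?thesis
        using Cauchy_Schwarz_ineq2[of "D (T1 - T)" "q - p"]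
          mult_right_mono[of _ "\<eta>/8" "norm (q - p)"] by (smt (verit) norm_ge_zero)
    qed
    moreover have "\<bar>(F q - F p - D (q - p)) \<bullet> T2\<bar> \<le> \<eta>/8 * norm (q - p)"
    proof -
      have "norm (F q - F p - D (q - p)) \<le> \<eta>/8 * norm (q - p)"
        unfolding D_def using \<delta>F(2)[OF zS, of p q] pq e(3) by simp
      then show ?thesis using Cauchy_Schwarz_ineq2[of "F q - F p - D (q - p)" T2] nT by simp
    qed
    moreover have "\<bar>D (q - p) \<bullet> (T2 - T)\<bar> \<le> \<eta>/8 * norm (q - p)"
    proof -
      have "\<bar>D (q - p) \<bullet> (T2 - T)\<bar> \<le> (M * norm (q - p)) * e"
        using Cauchy_Schwarz_ineq2[of "D (q - p)" "T2 - T"] M(2)[OF zS, of "q - p"] T M(1) unfolding D_def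
        by (meson mult_mono norm_ge_zero order_trans mult_nonneg_nonneg)
      also have "\<dots> \<le> ((M + 1) * e) * norm (q - p)"
        using M(1) e(1) by (simp add: algebra_simps)
      also have "\<dots> \<le> \<eta>/8 * norm (q - p)" by (rule mult_right_mono[OF Me]) simp
      finally show ?thesis .
    qed
    ultimately show "\<bar>flux' t1 t2 \<sigma> - curl F (P \<sigma> \<tau>) * (dirN (\<theta> \<sigma> \<tau>) \<bullet> (P \<sigma> t2 - P \<sigma> t1))\<bar>
        \<le> \<eta> * norm (P \<sigma> t2 - P \<sigma> t1)"
      using \<open>0 \<le> \<eta> * norm (q - p)\<close> unfolding z_def[symmetric] p_def[symmetric] q_def[symmetric] by linarith
  qed
qed

lemma seed_linearized:
  assumes t: "\<tau> \<in> {\<alpha><..<\<beta>}" and "\<eta> > 0"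
  obtains d where "d > 0" "ball \<tau> d \<subseteq> {\<alpha><..<\<beta>}"
    "\<And>t1 t2. \<lbrakk>t1 \<in> ball \<tau> d; t2 \<in> ball \<tau> d\<rbrakk> \<Longrightarrow>
      norm (g t2 - g t1 - ((t2 - t1) * s) *\<^sub>R dirN (\<theta> 0 \<tau>)) \<le> \<eta> * \<bar>t2 - t1\<bar>"
proof -
  have "isCont (\<theta> 0) \<tau>" using angle_cont t by (simp add: continuous_on_eq_continuous_at)
  then obtain d1 where d1: "d1 > 0" "\<And>x. dist x \<tau> < d1 \<Longrightarrow> dist (\<theta> 0 x) (\<theta> 0 \<tau>) < \<eta>"
    using \<open>\<eta> > 0\<close> unfolding continuous_at_eps_delta by blast
  obtain d2 where d2: "d2 > 0" "ball \<tau> d2 \<subseteq> {\<alpha><..<\<beta>}"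
    using openE[OF open_greaterThanLessThan t] by blast
  show ?thesis
  proof (rule that[of "min d1 d2"])
    show "min d1 d2 > 0" "ball \<tau> (min d1 d2) \<subseteq> {\<alpha><..<\<beta>}" using d1 d2 by auto
    fix t1 t2 assume b: "t1 \<in> ball \<tau> (min d1 d2)" "t2 \<in> ball \<tau> (min d1 d2)"
    let ?f = "\<lambda>x. g x - (x * s) *\<^sub>R dirN (\<theta> 0 \<tau>)"
    have "norm (?f t2 - ?f t1) \<le> \<eta> * norm (t2 - t1)"
    proof (rule differentiable_bound[of "ball \<tau> (min d1 d2)" ?f "\<lambda>x h. h *\<^sub>R (s *\<^sub>R (dirN (\<theta> 0 x) - dirN (\<theta> 0 \<tau>)))"])
      fix x assume x: "x \<in> ball \<tau> (min d1 d2)"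
      then have "x \<in> {\<alpha><..<\<beta>}" using d2(2) by auto
      from g_derivative[OF this]
      have "((\<lambda>x. g x) has_derivative (\<lambda>h. h *\<^sub>R s *\<^sub>R dirN (\<theta> 0 x))) (at x)"
        unfolding has_vector_derivative_def .
      then have "(?f has_derivative (\<lambda>h. h *\<^sub>R (s *\<^sub>R (dirN (\<theta> 0 x) - dirN (\<theta> 0 \<tau>))))) (at x)"
        by (auto intro!: derivative_eq_intros simp: scaleR_diff_right)
      then show "(?f has_derivative (\<lambda>h. h *\<^sub>R (s *\<^sub>R (dirN (\<theta> 0 x) - dirN (\<theta> 0 \<tau>))))) (at x within ball \<tau> (min d1 d2))"
        by (rule has_derivative_at_withinI)
      have "norm (dirN (\<theta> 0 x) - dirN (\<theta> 0 \<tau>)) \<le> \<eta>"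
        using dirN_Lipschitz[of "\<theta> 0 x" "\<theta> 0 \<tau>"] d1(2)[of x] x by (auto simp: dist_norm abs_minus_commute)
      then show "onorm (\<lambda>h. h *\<^sub>R (s *\<^sub>R (dirN (\<theta> 0 x) - dirN (\<theta> 0 \<tau>)))) \<le> \<eta>"
      proof (intro onorm_bound)
        assume d: "norm (dirN (\<theta> 0 x) - dirN (\<theta> 0 \<tau>)) \<le> \<eta>"
        have "\<bar>s\<bar> = 1" using s_sign by auto
        then show "norm (h *\<^sub>R (s *\<^sub>R (dirN (\<theta> 0 x) - dirN (\<theta> 0 \<tau>)))) \<le> \<eta> * norm h" for h :: real
          using mult_right_mono[OF d abs_ge_zero[of h]] by (simp add: mult.commute abs_mult)
      qed (use \<open>\<eta> > 0\<close> in simp)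
    qed (use b in auto)
    then show "norm (g t2 - g t1 - ((t2 - t1) * s) *\<^sub>R dirN (\<theta> 0 \<tau>)) \<le> \<eta> * \<bar>t2 - t1\<bar>"
      by (simp add: algebra_simps)
  qed
qed

lemma regular_interval_exists:
  assumes t: "\<tau> \<in> {\<alpha><..<\<beta>}"
  obtains S1 S2 where "regular_interval S1 S2 \<tau>" "S1 < S2"
proof (cases "h \<tau> > 0")
  case True
  then show ?thesis using t
    by (intro that[of 0 "h \<tau> / 2"]) (auto simp: regular_interval_def closed_segment_eq_real_ivl)
next
  case False
  then show ?thesis using t h_nonzero[OF t]
    by (intro that[of "h \<tau> / 2" 0]) (auto simp: regular_interval_def closed_segment_eq_real_ivl)
qed

abbreviation pt :: "real \<Rightarrow> real \<Rightarrow> (real^2) \<times> real" where "pt \<sigma> \<tau> \<equiv> (P \<sigma> \<tau>, \<theta> \<sigma> \<tau>)"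

lemma uniform_bound:
  assumes "continuous_on \<Omega> f" "{S1..S2} \<times> {\<tau>} \<subseteq> W"
  shows "\<exists>M. \<forall>\<sigma>\<in>{S1..S2}. \<bar>f (P \<sigma> \<tau>)\<bar> \<le> (M::real)"
proof -
  have "bounded (f ` ((\<lambda>\<sigma>. P \<sigma> \<tau>) ` {S1..S2}))"
    using P_compact[OF assms(2)]
    by (intro compact_imp_bounded compact_continuous_image[OF continuous_on_subset[OF assms(1)]]) auto
  then show ?thesis by (auto simp: bounded_iff)
qed

text \<open>Before the hitting time \<open>\<bar>grad u + F\<bar>\<close> is bounded below, which is what recovering the angle
  requires.\<close>

lemma fan_observability:
  assumes r: "regular_interval S1 S2 \<tau>" and "S1 < S2"
  obtains M where "M \<ge> 0" "\<And>v v' k k' j j' \<eta>.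
    \<lbrakk>\<eta> \<ge> 0; norm (v 0) \<le> \<eta>;
     \<And>\<sigma>. \<sigma> \<in> {S1..S2} \<Longrightarrow> ((\<lambda>\<sigma>. (v \<sigma>, k \<sigma>)) has_vector_derivative (v' \<sigma>, k' \<sigma>)) (at \<sigma>);
     \<And>\<sigma>. \<sigma> \<in> {S1..S2} \<Longrightarrow> norm ((v' \<sigma>, k' \<sigma>) - char_lin H (pt \<sigma> \<tau>) (v \<sigma>, k \<sigma>)) \<le> \<eta>;
     \<And>\<sigma>. \<sigma> \<in> {S1..S2} \<Longrightarrow> (j has_real_derivative j' \<sigma>) (at \<sigma>);
     \<And>\<sigma>. \<sigma> \<in> {S1..S2} \<Longrightarrow> \<bar>j \<sigma> - norm (gradF (P \<sigma> \<tau>)) * (dirN (\<theta> \<sigma> \<tau>) \<bullet> v \<sigma>)\<bar> \<le> \<eta>;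
     \<And>\<sigma>. \<sigma> \<in> {S1..S2} \<Longrightarrow> \<bar>j' \<sigma> - curl F (P \<sigma> \<tau>) * (dirN (\<theta> \<sigma> \<tau>) \<bullet> v \<sigma>)\<bar> \<le> \<eta>\<rbrakk>
    \<Longrightarrow> \<bar>k 0\<bar> \<le> M * \<eta>"
proof -
  note rD = regular_intervalD[OF r]
  let ?S = "(\<lambda>\<sigma>. P \<sigma> \<tau>) ` {S1..S2}"
  have S: "compact ?S" "?S \<subseteq> \<Omega>" using P_compact[OF rD(4)] by auto
  obtain m1 where m1: "\<And>\<sigma>. \<sigma> \<in> {S1..S2} \<Longrightarrow> \<bar>H (P \<sigma> \<tau>)\<bar> \<le> m1"
    using uniform_bound[OF C1_on_continuous[OF H_C1] rD(4)] by blast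
  obtain m2 where m2: "\<And>\<sigma>. \<sigma> \<in> {S1..S2} \<Longrightarrow> \<bar>norm (gradF (P \<sigma> \<tau>))\<bar> \<le> m2"
    using uniform_bound[OF continuous_on_norm[OF gradF_continuous] rD(4)] by blast
  obtain m3 where m3: "\<And>\<sigma>. \<sigma> \<in> {S1..S2} \<Longrightarrow> \<bar>curl F (P \<sigma> \<tau>)\<bar> \<le> m3"
    using uniform_bound[OF curl_continuous[OF F_C1] rD(4)] by blast
  obtain m4 where m4: "m4 \<ge> 0" "\<And>z v. z \<in> ?S \<Longrightarrow> norm (frechet_derivative H (at z) v) \<le> m4 * norm v"
    by (rule C1_on_derivative_bound[OF H_C1 S]) (rule that)
  define c where "c = Max {m1, m2, m3, m4}"
  have c: "m1 \<le> c" "m2 \<le> c" "m3 \<le> c" "m4 \<le> c" by (simp_all add: c_def)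
  have "c \<ge> 0" using c(4) m4(1) by linarith
  have nz: "gradF (P \<sigma> \<tau>) \<noteq> 0" if "\<sigma> \<in> {S1..S2}" for \<sigma>
    by (rule char_relation(2)[OF rD(1)]) (use r that in \<open>auto simp: regular_interval_def\<close>)
  have "\<exists>d0>0. \<forall>\<sigma>\<in>{S1..S2}. d0 \<le> norm (gradF (P \<sigma> \<tau>))"
  proof -
    have "continuous_on {S1..S2} (\<lambda>\<sigma>. norm (gradF (P \<sigma> \<tau>)))"
      using continuous_on_compose2[OF continuous_on_norm[OF gradF_continuous] P_continuous[OF rD(4)]] S by blast
    then obtain m where "m \<in> {S1..S2}" "\<And>\<sigma>. \<sigma> \<in> {S1..S2} \<Longrightarrow> norm (gradF (P m \<tau>)) \<le> norm (gradF (P \<sigma> \<tau>))"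
      using continuous_attains_inf[of "{S1..S2}" "\<lambda>\<sigma>. norm (gradF (P \<sigma> \<tau>))"] \<open>S1 < S2\<close> by auto
    then show ?thesis using nz by (intro exI[of _ "norm (gradF (P m \<tau>))"]) auto
  qed
  then obtain d0 where d0: "d0 > 0" "\<And>\<sigma>. \<sigma> \<in> {S1..S2} \<Longrightarrow> d0 \<le> norm (gradF (P \<sigma> \<tau>))" by blast
  have th: "((\<lambda>\<sigma>. \<theta> \<sigma> \<tau>) has_real_derivative - H (P \<sigma> \<tau>)) (at \<sigma>)" if "\<sigma> \<in> {S1..S2}" for \<sigma>
    using char_system[of \<sigma> \<tau>] that rD(4) by blast
  have bH: "\<bar>- H (P \<sigma> \<tau>)\<bar> \<le> c" and bG: "norm (gradF (P \<sigma> \<tau>)) \<le> c" and bc: "\<bar>curl F (P \<sigma> \<tau>)\<bar> \<le> c"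
    if "\<sigma> \<in> {S1..S2}" for \<sigma>
    using m1[OF that] m2[OF that] m3[OF that] c by auto
  show ?thesis
  proof (rule observability[OF rD(2,3) \<open>S1 < S2\<close> \<open>c \<ge> 0\<close> d0(1) th bH d0(2) bG bc])
    fix M :: real
    assume M: "M \<ge> 0" "\<And>v v' k k' j j' \<eta>.
    \<lbrakk>\<eta> \<ge> 0; norm (v 0) \<le> \<eta>;
     \<And>\<sigma>. \<sigma> \<in> {S1..S2} \<Longrightarrow> (v has_vector_derivative v' \<sigma>) (at \<sigma>);
     \<And>\<sigma>. \<sigma> \<in> {S1..S2} \<Longrightarrow> norm (v' \<sigma> - k \<sigma> *\<^sub>R dirN (\<theta> \<sigma> \<tau>)) \<le> \<eta>;
     \<And>\<sigma>. \<sigma> \<in> {S1..S2} \<Longrightarrow> (k has_real_derivative k' \<sigma>) (at \<sigma>);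
     \<And>\<sigma>. \<sigma> \<in> {S1..S2} \<Longrightarrow> \<bar>k' \<sigma>\<bar> \<le> c * norm (v \<sigma>) + \<eta>;
     \<And>\<sigma>. \<sigma> \<in> {S1..S2} \<Longrightarrow> \<bar>j \<sigma> - norm (gradF (P \<sigma> \<tau>)) * (dirN (\<theta> \<sigma> \<tau>) \<bullet> v \<sigma>)\<bar> \<le> \<eta>;
     \<And>\<sigma>. \<sigma> \<in> {S1..S2} \<Longrightarrow> (j has_real_derivative j' \<sigma>) (at \<sigma>);
     \<And>\<sigma>. \<sigma> \<in> {S1..S2} \<Longrightarrow> \<bar>j' \<sigma> - curl F (P \<sigma> \<tau>) * (dirN (\<theta> \<sigma> \<tau>) \<bullet> v \<sigma>)\<bar> \<le> \<eta>\<rbrakk>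
    \<Longrightarrow> \<bar>k 0\<bar> \<le> M * \<eta>"
    show thesis
  proof (rule that[OF M(1)], rule M(2))
    fix v v' k k' j j' and \<eta> \<sigma> :: real
    assume \<sigma>: "\<sigma> \<in> {S1..S2}"
      and d: "\<And>\<sigma>. \<sigma> \<in> {S1..S2} \<Longrightarrow> ((\<lambda>\<sigma>. (v \<sigma>, k \<sigma>)) has_vector_derivative (v' \<sigma>, k' \<sigma>)) (at \<sigma>)"
      and l: "\<And>\<sigma>. \<sigma> \<in> {S1..S2} \<Longrightarrow> norm ((v' \<sigma>, k' \<sigma>) - char_lin H (pt \<sigma> \<tau>) (v \<sigma>, k \<sigma>)) \<le> \<eta>"
    show "(v has_vector_derivative v' \<sigma>) (at \<sigma>)"
      using bounded_linear.has_vector_derivative[OF bounded_linear_fst d[OF \<sigma>]] by simp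
    show "(k has_real_derivative k' \<sigma>) (at \<sigma>)"
      using bounded_linear.has_vector_derivative[OF bounded_linear_snd d[OF \<sigma>]]
      by (simp add: has_real_derivative_iff_has_vector_derivative)
    have eq: "(v' \<sigma>, k' \<sigma>) - char_lin H (pt \<sigma> \<tau>) (v \<sigma>, k \<sigma>)
        = (v' \<sigma> - k \<sigma> *\<^sub>R dirN (\<theta> \<sigma> \<tau>), k' \<sigma> + frechet_derivative H (at (P \<sigma> \<tau>)) (v \<sigma>))"
      by (simp add: char_lin_def)
    show "norm (v' \<sigma> - k \<sigma> *\<^sub>R dirN (\<theta> \<sigma> \<tau>)) \<le> \<eta>"
      using l[OF \<sigma>] norm_fst_le unfolding eq by (rule order_trans[rotated])
    have "norm (k' \<sigma> + frechet_derivative H (at (P \<sigma> \<tau>)) (v \<sigma>)) \<le> \<eta>"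
      using l[OF \<sigma>] norm_snd_le unfolding eq by (rule order_trans[rotated])
    moreover have "norm (frechet_derivative H (at (P \<sigma> \<tau>)) (v \<sigma>)) \<le> m4 * norm (v \<sigma>)"
      by (rule m4(2)) (use \<sigma> in blast)
    moreover have "m4 * norm (v \<sigma>) \<le> c * norm (v \<sigma>)" using c(4) by (intro mult_right_mono) auto
    ultimately show "\<bar>k' \<sigma>\<bar> \<le> c * norm (v \<sigma>) + \<eta>" unfolding real_norm_def by linarith
  qed assumption+
  qed assumption+
qed

text \<open>The angle along the seed curve is differentiable: the gain of one derivative. Positions on
  the seed curve are \<open>C\<^sup>1\<close> in \<open>\<tau>\<close> because the seed runs along the continuous field N. The
  observability estimate turns this into control of the angle, once for differences and once for
  differences of difference quotients.\<close>

lemma initial_quot_Cauchy: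
  assumes "(0, \<tau>) \<in> W"
  shows "quot_Cauchy pt {0} \<tau>"
  unfolding quot_Cauchy_def
proof (intro allI impI)
  fix \<epsilon> :: real assume "\<epsilon> > 0"
  have t: "\<tau> \<in> {\<alpha><..<\<beta>}" by (rule W_time[OF assms])
  obtain S1 S2 where r: "regular_interval S1 S2 \<tau>" and "S1 < S2"
    by (rule regular_interval_exists[OF t]) (rule that)
  note rD = regular_intervalD[OF r]
  have I0: "0 \<in> {S1..S2}" using rD by simp
  show "\<exists>d>0. \<forall>t1\<in>ball \<tau> d. \<forall>t1'\<in>ball \<tau> d. \<forall>t2\<in>ball \<tau> d. \<forall>t2'\<in>ball \<tau> d. t1 \<noteq> t1' \<longrightarrow> t2 \<noteq> t2' \<longrightarrow>
     (\<forall>\<sigma>\<in>{0}. norm (diff_quot pt \<sigma> t1 t1' - diff_quot pt \<sigma> t2 t2') \<le> \<epsilon>)"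
  proof (rule fan_observability[OF r \<open>S1 < S2\<close>])
  fix M :: real
  assume M: "M \<ge> 0" "\<And>v v' k k' j j' \<eta>.
    \<lbrakk>\<eta> \<ge> 0; norm (v 0) \<le> \<eta>;
     \<And>\<sigma>. \<sigma> \<in> {S1..S2} \<Longrightarrow> ((\<lambda>\<sigma>. (v \<sigma>, k \<sigma>)) has_vector_derivative (v' \<sigma>, k' \<sigma>)) (at \<sigma>);
     \<And>\<sigma>. \<sigma> \<in> {S1..S2} \<Longrightarrow> norm ((v' \<sigma>, k' \<sigma>) - char_lin H (pt \<sigma> \<tau>) (v \<sigma>, k \<sigma>)) \<le> \<eta>;
     \<And>\<sigma>. \<sigma> \<in> {S1..S2} \<Longrightarrow> (j has_real_derivative j' \<sigma>) (at \<sigma>);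
     \<And>\<sigma>. \<sigma> \<in> {S1..S2} \<Longrightarrow> \<bar>j \<sigma> - norm (gradF (P \<sigma> \<tau>)) * (dirN (\<theta> \<sigma> \<tau>) \<bullet> v \<sigma>)\<bar> \<le> \<eta>;
     \<And>\<sigma>. \<sigma> \<in> {S1..S2} \<Longrightarrow> \<bar>j' \<sigma> - curl F (P \<sigma> \<tau>) * (dirN (\<theta> \<sigma> \<tau>) \<bullet> v \<sigma>)\<bar> \<le> \<eta>\<rbrakk>
    \<Longrightarrow> \<bar>k 0\<bar> \<le> M * \<eta>"
  obtain d1 G where G: "d1 > 0" "G \<ge> 1"
    "\<And>t1 t2 \<sigma>. \<lbrakk>t1 \<in> ball \<tau> d1; t2 \<in> ball \<tau> d1; \<sigma> \<in> {S1..S2}\<rbrakk> \<Longrightarrow>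
      norm (pt \<sigma> t2 - pt \<sigma> t1) \<le> G * norm (pt 0 t2 - pt 0 t1)"
    by (rule difference_bound[OF rD(4,2,3)]) (rule that)
  define B where "B = 4 * M + 4"
  define \<eta> where "\<eta> = Min {1, 1 / (2 * (M + 1) * G), \<epsilon> / ((M + 1) * (2 * G * B + 2))}"
  have B: "B > 0" using M(1) by (simp add: B_def)
  have pos: "(M + 1) * (2 * G * B + 2) > 0" "2 * (M + 1) * G > 0"
    using M(1) G(2) B by (auto intro!: mult_pos_pos add_nonneg_pos)
  have \<eta>: "\<eta> > 0" "\<eta> \<le> 1" "\<eta> \<le> 1 / (2 * (M + 1) * G)" "\<eta> \<le> \<epsilon> / ((M + 1) * (2 * G * B + 2))"
    using pos \<open>\<epsilon> > 0\<close> by (auto simp: \<eta>_def)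
  have \<eta>1: "M * (\<eta> * G) \<le> 1/2"
  proof -
    have "\<eta> * (2 * (M + 1) * G) \<le> 1" using \<eta>(3) pos(2) by (simp add: pos_le_divide_eq)
    moreover have "0 \<le> \<eta> * G" using \<eta> G by simp
    ultimately show ?thesis by (simp add: algebra_simps)
  qed
  have \<eta>2: "(M + 1) * (\<eta> * (2 * G * B + 2)) \<le> \<epsilon>"
    using \<eta>(4) pos(1) by (simp add: pos_le_divide_eq mult.commute mult.left_commute)
  obtain d2 where d2: "d2 > 0" "\<And>\<tau>'. \<tau>' \<in> ball \<tau> d2 \<Longrightarrow> {S1..S2} \<times> {\<tau>'} \<subseteq> W"
    "\<And>t1 t2 \<sigma>. \<lbrakk>t1 \<in> ball \<tau> d2; t2 \<in> ball \<tau> d2; \<sigma> \<in> {S1..S2}\<rbrakk> \<Longrightarrow>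
      norm (char_field H (pt \<sigma> t2) - char_field H (pt \<sigma> t1) - char_lin H (pt \<sigma> \<tau>) (pt \<sigma> t2 - pt \<sigma> t1))
      \<le> \<eta> * norm (pt \<sigma> t2 - pt \<sigma> t1)"
    by (rule difference_linearized[OF rD(4,2,3) \<eta>(1)]) (rule that)
  obtain d3 where d3: "d3 > 0" "\<And>\<tau>'. \<tau>' \<in> ball \<tau> d3 \<Longrightarrow> regular_interval S1 S2 \<tau>'"
    "\<And>t1 t2 \<sigma>. \<lbrakk>t1 \<in> ball \<tau> d3; t2 \<in> ball \<tau> d3; \<sigma> \<in> {S1..S2}\<rbrakk> \<Longrightarrow>
      \<bar>flux t1 t2 \<sigma> - norm (gradF (P \<sigma> \<tau>)) * (dirN (\<theta> \<sigma> \<tau>) \<bullet> (P \<sigma> t2 - P \<sigma> t1))\<bar> \<le> \<eta> * norm (P \<sigma> t2 - P \<sigma> t1)"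
    "\<And>t1 t2 \<sigma>. \<lbrakk>t1 \<in> ball \<tau> d3; t2 \<in> ball \<tau> d3; \<sigma> \<in> {S1..S2}\<rbrakk> \<Longrightarrow>
      \<bar>flux' t1 t2 \<sigma> - curl F (P \<sigma> \<tau>) * (dirN (\<theta> \<sigma> \<tau>) \<bullet> (P \<sigma> t2 - P \<sigma> t1))\<bar> \<le> \<eta> * norm (P \<sigma> t2 - P \<sigma> t1)"
    by (rule flux_linearized[OF r \<eta>(1)]) (rule that)
  obtain d4 where d4: "d4 > 0" "ball \<tau> d4 \<subseteq> {\<alpha><..<\<beta>}"
    "\<And>t1 t2. \<lbrakk>t1 \<in> ball \<tau> d4; t2 \<in> ball \<tau> d4\<rbrakk> \<Longrightarrow>
      norm (g t2 - g t1 - ((t2 - t1) * s) *\<^sub>R dirN (\<theta> 0 \<tau>)) \<le> \<eta> * \<bar>t2 - t1\<bar>"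
    by (rule seed_linearized[OF t \<eta>(1)]) (rule that)
  define d where "d = Min {d1, d2, d3, d4}"
  have d: "d > 0" "d \<le> d1" "d \<le> d2" "d \<le> d3" "d \<le> d4"
    using G(1) d2(1) d3(1) d4(1) by (auto simp: d_def)
  have ball: "x \<in> ball \<tau> d1" "x \<in> ball \<tau> d2" "x \<in> ball \<tau> d3" "x \<in> ball \<tau> d4" "x \<in> {\<alpha><..<\<beta>}"
    "P 0 x = g x" "{S1..S2} \<times> {x} \<subseteq> W"
    if "x \<in> ball \<tau> d" for x
  proof -
    show "x \<in> ball \<tau> d1" "x \<in> ball \<tau> d2" "x \<in> ball \<tau> d3" "x \<in> ball \<tau> d4" using that d by auto
    then show "x \<in> {\<alpha><..<\<beta>}" "{S1..S2} \<times> {x} \<subseteq> W" using d4(2) d2(2) by auto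
    then show "P 0 x = g x" using initial by blast
  qed
  have dP: "((\<lambda>\<sigma>. pt \<sigma> b - pt \<sigma> a) has_vector_derivative char_field H (pt \<sigma> b) - char_field H (pt \<sigma> a)) (at \<sigma>)"
    if "a \<in> ball \<tau> d" "b \<in> ball \<tau> d" "\<sigma> \<in> {S1..S2}" for a b \<sigma>
    using ball(7)[OF that(1)] ball(7)[OF that(2)] that(3) by (intro has_vector_derivative_diff sol) auto
  have dflux: "(flux a b has_real_derivative flux' a b \<sigma>) (at \<sigma>)"
    if "a \<in> ball \<tau> d" "b \<in> ball \<tau> d" "\<sigma> \<in> {S1..S2}" for a b \<sigma>
    using d3(2)[OF ball(3)[OF that(1)]] d3(2)[OF ball(3)[OF that(2)]] that
    unfolding regular_interval_def by (intro flux_derivative) auto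
  have fle: "norm (P \<sigma> b - P \<sigma> a) \<le> norm (pt \<sigma> b - pt \<sigma> a)" for a b \<sigma>
    using norm_fst_le[of "P \<sigma> b - P \<sigma> a" "\<theta> \<sigma> b - \<theta> \<sigma> a"] by simp
  have gle: "norm (P 0 b - P 0 a) \<le> 2 * \<bar>b - a\<bar>" if "a \<in> ball \<tau> d" "b \<in> ball \<tau> d" for a b
  proof -
    have "\<bar>s\<bar> = 1" using s_sign by auto
    then have "norm (((b - a) * s) *\<^sub>R dirN (\<theta> 0 \<tau>)) = \<bar>b - a\<bar>" by (simp add: abs_mult)
    moreover have "\<eta> * \<bar>b - a\<bar> \<le> 1 * \<bar>b - a\<bar>" using \<eta>(2) by (intro mult_right_mono) auto
    ultimately show ?thesis
      using d4(3)[OF ball(4)[OF that(1)] ball(4)[OF that(2)]]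
        norm_triangle_sub[of "g b - g a" "((b - a) * s) *\<^sub>R dirN (\<theta> 0 \<tau>)"]
        ball(6)[OF that(1)] ball(6)[OF that(2)] by simp
  qed
  \<comment> \<open>The error terms are proportional to the full difference, angle included. They carry the
    factor \<open>\<eta>\<close>, and \<open>\<eta>\<close> is so small that \<open>M * \<eta> * G \<le> 1/2\<close> lets the left-hand side absorb them.\<close>
  have Lip: "norm (pt 0 b - pt 0 a) \<le> B * \<bar>b - a\<bar>" if ab: "a \<in> ball \<tau> d" "b \<in> ball \<tau> d" for a b
  proof -
    define \<rho> where "\<rho> = norm (pt 0 b - pt 0 a)"
    have "\<rho> \<ge> 0" by (simp add: \<rho>_def)
    have bnd: "norm (pt \<sigma> b - pt \<sigma> a) \<le> G * \<rho>" if "\<sigma> \<in> {S1..S2}" for \<sigma>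
      unfolding \<rho>_def by (rule G(3)) (use ball ab that in auto)
    have bnd': "\<eta> * norm (pt \<sigma> b - pt \<sigma> a) \<le> 2 * \<bar>b - a\<bar> + \<eta> * G * \<rho>" if "\<sigma> \<in> {S1..S2}" for \<sigma>
    proof -
      have "\<eta> * norm (pt \<sigma> b - pt \<sigma> a) \<le> \<eta> * (G * \<rho>)"
        by (rule mult_left_mono[OF bnd[OF that] less_imp_le[OF \<eta>(1)]])
      also have "\<dots> \<le> 2 * \<bar>b - a\<bar> + \<eta> * G * \<rho>" by simp
      finally show ?thesis .
    qed
    have bnd'': "\<eta> * norm (P \<sigma> b - P \<sigma> a) \<le> 2 * \<bar>b - a\<bar> + \<eta> * G * \<rho>" if "\<sigma> \<in> {S1..S2}" for \<sigma>
      using mult_left_mono[OF fle[of \<sigma> b a], of \<eta>] \<eta>(1) bnd'[OF that] by linarith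
    have nn: "0 \<le> \<eta> * G * \<rho>" using \<eta>(1) G(2) \<open>\<rho> \<ge> 0\<close> by simp
    have "\<bar>\<theta> 0 b - \<theta> 0 a\<bar> \<le> M * (2 * \<bar>b - a\<bar> + \<eta> * G * \<rho>)"
    proof (rule M(2)[where v = "\<lambda>\<sigma>. P \<sigma> b - P \<sigma> a" and k = "\<lambda>\<sigma>. \<theta> \<sigma> b - \<theta> \<sigma> a" and j = "flux a b" and j' = "flux' a b"
          and v' = "\<lambda>\<sigma>. fst (char_field H (pt \<sigma> b) - char_field H (pt \<sigma> a))"
          and k' = "\<lambda>\<sigma>. snd (char_field H (pt \<sigma> b) - char_field H (pt \<sigma> a))"])
      show "0 \<le> 2 * \<bar>b - a\<bar> + \<eta> * G * \<rho>" using nn by simp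
      show "norm (P 0 b - P 0 a) \<le> 2 * \<bar>b - a\<bar> + \<eta> * G * \<rho>" using gle[OF ab] nn by linarith
      fix \<sigma> assume \<sigma>: "\<sigma> \<in> {S1..S2}"
      show "((\<lambda>\<sigma>. (P \<sigma> b - P \<sigma> a, \<theta> \<sigma> b - \<theta> \<sigma> a)) has_vector_derivative
          (fst (char_field H (pt \<sigma> b) - char_field H (pt \<sigma> a)), snd (char_field H (pt \<sigma> b) - char_field H (pt \<sigma> a)))) (at \<sigma>)"
        using dP[OF ab \<sigma>] by (simp only: prod.collapse diff_Pair)
      show "norm ((fst (char_field H (pt \<sigma> b) - char_field H (pt \<sigma> a)), snd (char_field H (pt \<sigma> b) - char_field H (pt \<sigma> a)))
          - char_lin H (pt \<sigma> \<tau>) (P \<sigma> b - P \<sigma> a, \<theta> \<sigma> b - \<theta> \<sigma> a)) \<le> 2 * \<bar>b - a\<bar> + \<eta> * G * \<rho>"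
        using d2(3)[OF ball(2)[OF ab(1)] ball(2)[OF ab(2)] \<sigma>] bnd'[OF \<sigma>]
        unfolding prod.collapse diff_Pair by linarith
      show "(flux a b has_real_derivative flux' a b \<sigma>) (at \<sigma>)" by (rule dflux[OF ab \<sigma>])
      show "\<bar>flux a b \<sigma> - norm (gradF (P \<sigma> \<tau>)) * (dirN (\<theta> \<sigma> \<tau>) \<bullet> (P \<sigma> b - P \<sigma> a))\<bar> \<le> 2 * \<bar>b - a\<bar> + \<eta> * G * \<rho>"
        using d3(3)[OF ball(3)[OF ab(1)] ball(3)[OF ab(2)] \<sigma>] bnd''[OF \<sigma>] by linarith
      show "\<bar>flux' a b \<sigma> - curl F (P \<sigma> \<tau>) * (dirN (\<theta> \<sigma> \<tau>) \<bullet> (P \<sigma> b - P \<sigma> a))\<bar> \<le> 2 * \<bar>b - a\<bar> + \<eta> * G * \<rho>"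
        using d3(4)[OF ball(3)[OF ab(1)] ball(3)[OF ab(2)] \<sigma>] bnd''[OF \<sigma>] by linarith
    qed
    also have "\<dots> \<le> 2 * M * \<bar>b - a\<bar> + 1/2 * \<rho>"
      using mult_right_mono[OF \<eta>1 \<open>\<rho> \<ge> 0\<close>] by (simp add: algebra_simps)
    moreover have "\<rho> \<le> norm (P 0 b - P 0 a) + \<bar>\<theta> 0 b - \<theta> 0 a\<bar>"
      using norm_Pair_le[of "P 0 b - P 0 a" "\<theta> 0 b - \<theta> 0 a"] by (simp add: \<rho>_def)
    ultimately have "\<rho> \<le> 4 * \<bar>b - a\<bar> + 4 * (M * \<bar>b - a\<bar>)" using gle[OF ab] by linarith
    then show ?thesis by (simp add: \<rho>_def B_def algebra_simps)
  qed
  show "\<exists>d>0. \<forall>t1\<in>ball \<tau> d. \<forall>t1'\<in>ball \<tau> d. \<forall>t2\<in>ball \<tau> d. \<forall>t2'\<in>ball \<tau> d. t1 \<noteq> t1' \<longrightarrow> t2 \<noteq> t2' \<longrightarrow>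
     (\<forall>\<sigma>\<in>{0}. norm (diff_quot pt \<sigma> t1 t1' - diff_quot pt \<sigma> t2 t2') \<le> \<epsilon>)"
  proof (intro exI conjI ballI impI)
    show "d > 0" by (rule d(1))
    fix a1 b1 a2 b2 \<sigma>0 :: real
    assume ab1: "a1 \<in> ball \<tau> d" "b1 \<in> ball \<tau> d" and ab2: "a2 \<in> ball \<tau> d" "b2 \<in> ball \<tau> d"
      and ne: "a1 \<noteq> b1" "a2 \<noteq> b2" and \<sigma>0: "\<sigma>0 \<in> {0}"
    define i1 where "i1 = inverse (b1 - a1)"
    define i2 where "i2 = inverse (b2 - a2)"
    have i: "\<bar>i1\<bar> * \<bar>b1 - a1\<bar> = 1" "\<bar>i2\<bar> * \<bar>b2 - a2\<bar> = 1"
      using ne by (simp_all add: i1_def i2_def flip: abs_mult)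
    have scaled: "\<bar>x\<bar> * norm (pt \<sigma> b - pt \<sigma> a) \<le> G * B"
      if ab: "a \<in> ball \<tau> d" "b \<in> ball \<tau> d" and x: "\<bar>x\<bar> * \<bar>b - a\<bar> = 1" and \<sigma>: "\<sigma> \<in> {S1..S2}" for a b x \<sigma>
    proof -
      have "norm (pt \<sigma> b - pt \<sigma> a) \<le> G * norm (pt 0 b - pt 0 a)"
        by (rule G(3)) (use ball ab \<sigma> in auto)
      also have "\<dots> \<le> G * (B * \<bar>b - a\<bar>)" using Lip[OF ab] G(2) by (intro mult_left_mono) auto
      finally have "\<bar>x\<bar> * norm (pt \<sigma> b - pt \<sigma> a) \<le> \<bar>x\<bar> * (G * (B * \<bar>b - a\<bar>))" by (intro mult_left_mono) auto
      also have "\<dots> = G * B * (\<bar>x\<bar> * \<bar>b - a\<bar>)" by (simp add: algebra_simps)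
      finally show ?thesis using x by simp
    qed
    have scaled': "\<bar>x * e\<bar> \<le> \<eta> * (G * B)"
      if "a \<in> ball \<tau> d" "b \<in> ball \<tau> d" "\<bar>x\<bar> * \<bar>b - a\<bar> = 1" "\<sigma> \<in> {S1..S2}" "\<bar>e\<bar> \<le> \<eta> * norm (P \<sigma> b - P \<sigma> a)" for a b x \<sigma> e
    proof -
      have "\<bar>e\<bar> \<le> \<eta> * norm (pt \<sigma> b - pt \<sigma> a)"
        using that(5) mult_left_mono[OF fle[of \<sigma> b a], of \<eta>] \<eta>(1) by linarith
      then have "\<bar>x\<bar> * \<bar>e\<bar> \<le> \<bar>x\<bar> * (\<eta> * norm (pt \<sigma> b - pt \<sigma> a))" by (intro mult_left_mono) auto
      also have "\<dots> = \<eta> * (\<bar>x\<bar> * norm (pt \<sigma> b - pt \<sigma> a))" by simp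
      also have "\<dots> \<le> \<eta> * (G * B)" using scaled[OF that(1-4)] \<eta>(1) by (intro mult_left_mono) auto
      finally show ?thesis by (simp add: abs_mult)
    qed
    define v where "v \<sigma> = i1 *\<^sub>R (P \<sigma> b1 - P \<sigma> a1) - i2 *\<^sub>R (P \<sigma> b2 - P \<sigma> a2)" for \<sigma>
    define k where "k \<sigma> = i1 * (\<theta> \<sigma> b1 - \<theta> \<sigma> a1) - i2 * (\<theta> \<sigma> b2 - \<theta> \<sigma> a2)" for \<sigma>
    define dd where "dd \<sigma> = i1 *\<^sub>R (char_field H (pt \<sigma> b1) - char_field H (pt \<sigma> a1))
        - i2 *\<^sub>R (char_field H (pt \<sigma> b2) - char_field H (pt \<sigma> a2))" for \<sigma>
    define \<rho> where "\<rho> = \<eta> * (2 * G * B + 2)"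
    have \<rho>2: "2 * (\<eta> * (G * B)) \<le> \<rho>" "2 * \<eta> \<le> \<rho>" using \<eta>(1) G(2) B by (auto simp: \<rho>_def algebra_simps)
    have vk: "(v \<sigma>, k \<sigma>) = i1 *\<^sub>R (pt \<sigma> b1 - pt \<sigma> a1) - i2 *\<^sub>R (pt \<sigma> b2 - pt \<sigma> a2)" for \<sigma>
      by (simp add: v_def k_def)
    have v0: "norm (v 0) \<le> 2 * \<eta>"
    proof -
      have e: "norm (x *\<^sub>R (P 0 b - P 0 a) - s *\<^sub>R dirN (\<theta> 0 \<tau>)) \<le> \<eta>"
        if ab: "a \<in> ball \<tau> d" "b \<in> ball \<tau> d" and x: "\<bar>x\<bar> * \<bar>b - a\<bar> = 1" "x * (b - a) = 1" for a b x
      proof -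
        have "x *\<^sub>R (P 0 b - P 0 a) - s *\<^sub>R dirN (\<theta> 0 \<tau>) = x *\<^sub>R (g b - g a - ((b - a) * s) *\<^sub>R dirN (\<theta> 0 \<tau>))"
          using x(2) ball(6)[OF ab(1)] ball(6)[OF ab(2)] by (simp add: scaleR_diff_right flip: mult.assoc)
        then have "norm (x *\<^sub>R (P 0 b - P 0 a) - s *\<^sub>R dirN (\<theta> 0 \<tau>)) = \<bar>x\<bar> * norm (g b - g a - ((b - a) * s) *\<^sub>R dirN (\<theta> 0 \<tau>))"
          by simp
        also have "\<dots> \<le> \<bar>x\<bar> * (\<eta> * \<bar>b - a\<bar>)"
          using d4(3)[OF ball(4)[OF ab(1)] ball(4)[OF ab(2)]] by (intro mult_left_mono) auto
        also have "\<dots> = \<eta>" using x by simp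
        finally show ?thesis .
      qed
      have "norm (i1 *\<^sub>R (P 0 b1 - P 0 a1) - s *\<^sub>R dirN (\<theta> 0 \<tau>)) \<le> \<eta>"
        "norm (i2 *\<^sub>R (P 0 b2 - P 0 a2) - s *\<^sub>R dirN (\<theta> 0 \<tau>)) \<le> \<eta>"
        using e[OF ab1 i(1)] e[OF ab2 i(2)] ne by (simp_all add: i1_def i2_def)
      moreover have "v 0 = (i1 *\<^sub>R (P 0 b1 - P 0 a1) - s *\<^sub>R dirN (\<theta> 0 \<tau>)) - (i2 *\<^sub>R (P 0 b2 - P 0 a2) - s *\<^sub>R dirN (\<theta> 0 \<tau>))"
        by (simp add: v_def)
      moreover from this have "norm (v 0) \<le> norm (i1 *\<^sub>R (P 0 b1 - P 0 a1) - s *\<^sub>R dirN (\<theta> 0 \<tau>))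
          + norm (i2 *\<^sub>R (P 0 b2 - P 0 a2) - s *\<^sub>R dirN (\<theta> 0 \<tau>))"
        by (simp only: norm_triangle_ineq4)
      ultimately show ?thesis by linarith
    qed
    have k0: "\<bar>k 0\<bar> \<le> M * \<rho>"
    proof (rule M(2)[where v = v and k = k and j = "\<lambda>\<sigma>. i1 * flux a1 b1 \<sigma> - i2 * flux a2 b2 \<sigma>"
          and j' = "\<lambda>\<sigma>. i1 * flux' a1 b1 \<sigma> - i2 * flux' a2 b2 \<sigma>"
          and v' = "\<lambda>\<sigma>. fst (dd \<sigma>)" and k' = "\<lambda>\<sigma>. snd (dd \<sigma>)"])
      show "0 \<le> \<rho>" using \<rho>2(2) \<eta>(1) by linarith
      show "norm (v 0) \<le> \<rho>" using v0 \<rho>2(2) by linarith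
      fix \<sigma> assume \<sigma>: "\<sigma> \<in> {S1..S2}"
      show "((\<lambda>\<sigma>. (v \<sigma>, k \<sigma>)) has_vector_derivative (fst (dd \<sigma>), snd (dd \<sigma>))) (at \<sigma>)"
        unfolding vk dd_def prod.collapse
        by (intro has_vector_derivative_diff dP[OF ab1 \<sigma>] dP[OF ab2 \<sigma>]
            bounded_linear.has_vector_derivative[OF bounded_linear_scaleR_right])
      have ptA: "pt \<sigma> \<tau> \<in> \<Omega> \<times> UNIV" using rD(4) \<sigma> in_A by blast
      have lin: "linear (char_lin H (pt \<sigma> \<tau>))" by (rule L_linear[OF ptA])
      let ?E = "\<lambda>a b. char_field H (pt \<sigma> b) - char_field H (pt \<sigma> a) - char_lin H (pt \<sigma> \<tau>) (pt \<sigma> b - pt \<sigma> a)"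
      have E: "norm (x *\<^sub>R ?E a b) \<le> \<eta> * (G * B)"
        if ab: "a \<in> ball \<tau> d" "b \<in> ball \<tau> d" and x: "\<bar>x\<bar> * \<bar>b - a\<bar> = 1" for a b x
      proof -
        have "norm (x *\<^sub>R ?E a b) \<le> \<bar>x\<bar> * (\<eta> * norm (pt \<sigma> b - pt \<sigma> a))"
          unfolding norm_scaleR using d2(3)[OF ball(2)[OF ab(1)] ball(2)[OF ab(2)] \<sigma>] by (intro mult_left_mono) auto
        also have "\<dots> = \<eta> * (\<bar>x\<bar> * norm (pt \<sigma> b - pt \<sigma> a))" by simp
        also have "\<dots> \<le> \<eta> * (G * B)" using scaled[OF ab x \<sigma>] \<eta>(1) by (intro mult_left_mono) auto
        finally show ?thesis .
      qed
      have "(fst (dd \<sigma>), snd (dd \<sigma>)) - char_lin H (pt \<sigma> \<tau>) (v \<sigma>, k \<sigma>) = i1 *\<^sub>R ?E a1 b1 - i2 *\<^sub>R ?E a2 b2"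
        unfolding vk linear_diff[OF lin, of "i1 *\<^sub>R _"] linear_cmul[OF lin] prod.collapse dd_def
        by (simp add: scaleR_diff_right)
      then have "norm ((fst (dd \<sigma>), snd (dd \<sigma>)) - char_lin H (pt \<sigma> \<tau>) (v \<sigma>, k \<sigma>)) \<le> norm (i1 *\<^sub>R ?E a1 b1) + norm (i2 *\<^sub>R ?E a2 b2)"
        by (simp only: norm_triangle_ineq4)
      then show "norm ((fst (dd \<sigma>), snd (dd \<sigma>)) - char_lin H (pt \<sigma> \<tau>) (v \<sigma>, k \<sigma>)) \<le> \<rho>"
        using E[OF ab1 i(1)] E[OF ab2 i(2)] \<rho>2(1) by linarith
      show "((\<lambda>\<sigma>. i1 * flux a1 b1 \<sigma> - i2 * flux a2 b2 \<sigma>) has_real_derivative i1 * flux' a1 b1 \<sigma> - i2 * flux' a2 b2 \<sigma>) (at \<sigma>)"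
        by (intro DERIV_diff DERIV_cmult dflux ab1 ab2 \<sigma>)
      let ?f = "\<lambda>a b. flux a b \<sigma> - norm (gradF (P \<sigma> \<tau>)) * (dirN (\<theta> \<sigma> \<tau>) \<bullet> (P \<sigma> b - P \<sigma> a))"
      have "i1 * flux a1 b1 \<sigma> - i2 * flux a2 b2 \<sigma> - norm (gradF (P \<sigma> \<tau>)) * (dirN (\<theta> \<sigma> \<tau>) \<bullet> v \<sigma>) = i1 * ?f a1 b1 - i2 * ?f a2 b2"
        by (simp add: v_def inner_diff_right algebra_simps)
      then show "\<bar>i1 * flux a1 b1 \<sigma> - i2 * flux a2 b2 \<sigma> - norm (gradF (P \<sigma> \<tau>)) * (dirN (\<theta> \<sigma> \<tau>) \<bullet> v \<sigma>)\<bar> \<le> \<rho>"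
        using scaled'[OF ab1 i(1) \<sigma> d3(3)[OF ball(3)[OF ab1(1)] ball(3)[OF ab1(2)] \<sigma>]]
          scaled'[OF ab2 i(2) \<sigma> d3(3)[OF ball(3)[OF ab2(1)] ball(3)[OF ab2(2)] \<sigma>]] \<rho>2(1) by linarith
      let ?f' = "\<lambda>a b. flux' a b \<sigma> - curl F (P \<sigma> \<tau>) * (dirN (\<theta> \<sigma> \<tau>) \<bullet> (P \<sigma> b - P \<sigma> a))"
      have "i1 * flux' a1 b1 \<sigma> - i2 * flux' a2 b2 \<sigma> - curl F (P \<sigma> \<tau>) * (dirN (\<theta> \<sigma> \<tau>) \<bullet> v \<sigma>) = i1 * ?f' a1 b1 - i2 * ?f' a2 b2"
        by (simp add: v_def inner_diff_right algebra_simps)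
      then show "\<bar>i1 * flux' a1 b1 \<sigma> - i2 * flux' a2 b2 \<sigma> - curl F (P \<sigma> \<tau>) * (dirN (\<theta> \<sigma> \<tau>) \<bullet> v \<sigma>)\<bar> \<le> \<rho>"
        using scaled'[OF ab1 i(1) \<sigma> d3(4)[OF ball(3)[OF ab1(1)] ball(3)[OF ab1(2)] \<sigma>]]
          scaled'[OF ab2 i(2) \<sigma> d3(4)[OF ball(3)[OF ab2(1)] ball(3)[OF ab2(2)] \<sigma>]] \<rho>2(1) by linarith
    qed
    have "diff_quot pt \<sigma>0 a1 b1 - diff_quot pt \<sigma>0 a2 b2 = (v 0, k 0)"
      using \<sigma>0 by (simp add: diff_quot_def v_def k_def i1_def i2_def)
    then have "norm (diff_quot pt \<sigma>0 a1 b1 - diff_quot pt \<sigma>0 a2 b2) \<le> norm (v 0) + norm (k 0)"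
      by (simp only: norm_Pair_le)
    also have "\<dots> \<le> \<rho> + M * \<rho>" using v0 k0 \<rho>2(2) unfolding real_norm_def by linarith
    also have "\<dots> = (M + 1) * \<rho>" by (simp add: algebra_simps)
    also have "\<dots> \<le> \<epsilon>" using \<eta>2 by (simp add: \<rho>_def)
    finally show "norm (diff_quot pt \<sigma>0 a1 b1 - diff_quot pt \<sigma>0 a2 b2) \<le> \<epsilon>" .
  qed
  qed
qed

text \<open>The Jacobian determinant of P. It is the normal component of the variation, because the
  derivative of P in \<open>\<sigma>\<close> is the unit vector T.\<close>

definition jac :: "real \<Rightarrow> real \<Rightarrow> real"
  where "jac \<sigma> \<tau> = dirN (\<theta> \<sigma> \<tau>) \<bullet> fst (param_deriv \<sigma> \<tau>)"

lemma param_has_derivative: "(\<sigma>, \<tau>) \<in> W \<Longrightarrow> (pt \<sigma> has_vector_derivative param_deriv \<sigma> \<tau>) (at \<tau>)"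
  by (rule param_deriv[OF initial_quot_Cauchy])

lemma param_deriv_cont: "continuous_on W (\<lambda>(\<sigma>, \<tau>). param_deriv \<sigma> \<tau>)"
  by (rule param_deriv_continuous[OF initial_quot_Cauchy])

lemma param_deriv_limit:
  assumes "{S1..S2} \<times> {\<tau>} \<subseteq> W" "S1 \<le> 0" "0 \<le> S2" "\<epsilon> > 0"
  shows "\<exists>d>0. \<forall>t1\<in>ball \<tau> d. \<forall>t2\<in>ball \<tau> d. t1 \<noteq> t2 \<longrightarrow>
    (\<forall>\<sigma>\<in>{S1..S2}. norm (diff_quot pt \<sigma> t1 t2 - param_deriv \<sigma> \<tau>) \<le> \<epsilon>)"
  by (rule param_deriv_uniform_limit(1)[OF initial_quot_Cauchy assms])

lemma joint_derivative:
  assumes "(\<sigma>, \<tau>) \<in> W"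
  shows "((\<lambda>(\<sigma>, \<tau>). pt \<sigma> \<tau>) has_derivative (\<lambda>(a, b). a *\<^sub>R char_field H (pt \<sigma> \<tau>) + b *\<^sub>R param_deriv \<sigma> \<tau>)) (at (\<sigma>, \<tau>))"
  by (rule flow_has_derivative[OF initial_quot_Cauchy assms])

lemma joint_continuous: "continuous_on W (\<lambda>(\<sigma>, \<tau>). P \<sigma> \<tau>)" "continuous_on W (\<lambda>(\<sigma>, \<tau>). \<theta> \<sigma> \<tau>)"
proof -
  have c: "continuous_on W (\<lambda>(\<sigma>, \<tau>). pt \<sigma> \<tau>)"
    by (intro continuous_at_imp_continuous_on ballI) (auto intro: has_derivative_continuous[OF joint_derivative])
  show "continuous_on W (\<lambda>(\<sigma>, \<tau>). P \<sigma> \<tau>)" "continuous_on W (\<lambda>(\<sigma>, \<tau>). \<theta> \<sigma> \<tau>)"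
    using continuous_on_fst[OF c] continuous_on_snd[OF c] by (simp_all add: case_prod_unfold)
qed

lemma dirN_continuous [continuous_intros]: "continuous_on S f \<Longrightarrow> continuous_on S (\<lambda>x. dirN (f x))" for f :: "'b::t2_space \<Rightarrow> real"
  unfolding dirN_def vector_2_eq
  by (intro continuous_on_add continuous_on_scaleR continuous_on_const continuous_on_minus
      continuous_on_cos continuous_on_sin)

lemma dirT_continuous [continuous_intros]: "continuous_on S f \<Longrightarrow> continuous_on S (\<lambda>x. dirT (f x))" for f :: "'b::t2_space \<Rightarrow> real"
  unfolding dirT_def vector_2_eq
  by (intro continuous_on_add continuous_on_scaleR continuous_on_const continuous_on_minus
      continuous_on_cos continuous_on_sin)

lemma jac_continuous: "continuous_on W (\<lambda>(\<sigma>, \<tau>). jac \<sigma> \<tau>)"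
  using continuous_on_inner[OF dirN_continuous[OF joint_continuous(2)] continuous_on_fst[OF param_deriv_cont]]
  by (simp add: jac_def case_prod_unfold)

lemma slice_continuous:
  assumes "continuous_on W (\<lambda>(\<sigma>, \<tau>). f \<sigma> \<tau>)" "S \<times> {\<tau>} \<subseteq> W"
  shows "continuous_on S (\<lambda>\<sigma>. f \<sigma> \<tau>)"
proof -
  have "continuous_on S (\<lambda>\<sigma>. (\<sigma>, \<tau>))" by (intro continuous_intros)
  from continuous_on_compose2[OF assms(1) this] show ?thesis using assms(2) by auto
qed

text \<open>The infinitesimal form of Stokes' theorem. The circulations divided by \<open>t2 - t1\<close> converge
  uniformly to \<open>\<bar>grad u + F\<bar> * jac\<close>, their derivatives to \<open>curl F * jac\<close>, and limit and derivative
  can be interchanged.\<close>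

lemma area_times_jac_derivative_within:
  assumes r: "regular_interval S1 S2 \<tau>" and \<sigma>: "\<sigma> \<in> {S1..S2}"
  shows "((\<lambda>\<sigma>. norm (gradF (P \<sigma> \<tau>)) * jac \<sigma> \<tau>) has_real_derivative curl F (P \<sigma> \<tau>) * jac \<sigma> \<tau>) (at \<sigma> within {S1..S2})"
proof -
  note rD = regular_intervalD[OF r]
  have slice: "{S1..S2} \<times> {\<tau>} \<subseteq> W" by (rule rD(4))
  have cont_pd: "continuous_on {S1..S2} (\<lambda>\<sigma>. param_deriv \<sigma> \<tau>)"
    by (rule slice_continuous[OF param_deriv_cont slice])
  then have "bounded ((\<lambda>\<sigma>. param_deriv \<sigma> \<tau>) ` {S1..S2})"
    by (intro compact_imp_bounded compact_continuous_image) auto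
  then obtain B where B: "B > 0" "\<And>\<sigma>. \<sigma> \<in> {S1..S2} \<Longrightarrow> norm (param_deriv \<sigma> \<tau>) \<le> B"
    unfolding bounded_pos by blast
  obtain m3 where m3: "\<And>\<sigma>. \<sigma> \<in> {S1..S2} \<Longrightarrow> \<bar>curl F (P \<sigma> \<tau>)\<bar> \<le> m3"
    using uniform_bound[OF curl_continuous[OF F_C1] slice] by blast
  obtain m2 where m2: "\<And>\<sigma>. \<sigma> \<in> {S1..S2} \<Longrightarrow> \<bar>norm (gradF (P \<sigma> \<tau>))\<bar> \<le> m2"
    using uniform_bound[OF continuous_on_norm[OF gradF_continuous] slice] by blast
  define m where "m = max m2 m3"
  have m: "\<bar>curl F (P \<sigma> \<tau>)\<bar> \<le> m" "\<bar>norm (gradF (P \<sigma> \<tau>))\<bar> \<le> m" if "\<sigma> \<in> {S1..S2}" for \<sigma>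
    using m2[OF that] m3[OF that] by (auto simp: m_def)
  have m0: "m \<ge> 0" using m(1)[OF \<sigma>] by linarith
  define t where "t n = \<tau> + inverse (real (Suc n))" for n
  have tne: "t n \<noteq> \<tau>" for n by (simp add: t_def)
  have tlim: "t \<longlonglongrightarrow> \<tau>" unfolding t_def by (rule LIMSEQ_inverse_real_of_nat_add)
  have ev: "\<forall>\<^sub>F n in sequentially. t n \<in> ball \<tau> d" if "d > 0" for d
    using tendstoD[OF tlim that] by (simp add: dist_commute)
  \<comment> \<open>uniform approximation of the flux quotients and of their derivatives\<close>
  have approx: "\<forall>\<^sub>F n in sequentially. regular_interval S1 S2 (t n) \<and> (\<forall>\<sigma>\<in>{S1..S2}.
      \<bar>flux \<tau> (t n) \<sigma> / (t n - \<tau>) - norm (gradF (P \<sigma> \<tau>)) * jac \<sigma> \<tau>\<bar> \<le> e \<and>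
      \<bar>flux' \<tau> (t n) \<sigma> / (t n - \<tau>) - curl F (P \<sigma> \<tau>) * jac \<sigma> \<tau>\<bar> \<le> e)" if "e > 0" for e :: real
  proof -
    define \<eta> where "\<eta> = min 1 (e / (B + 1 + m))"
    have den: "B + 1 + m > 0" using B(1) m0 by simp
    have \<eta>: "\<eta> > 0" "\<eta> \<le> 1" "\<eta> * (B + 1 + m) \<le> e"
    proof -
      show "\<eta> > 0" "\<eta> \<le> 1" using that den by (auto simp: \<eta>_def)
      have "\<eta> \<le> e / (B + 1 + m)" by (simp add: \<eta>_def)
      then show "\<eta> * (B + 1 + m) \<le> e" using den by (simp add: pos_le_divide_eq)
    qed
    obtain d1 where d1: "d1 > 0" "\<And>\<tau>'. \<tau>' \<in> ball \<tau> d1 \<Longrightarrow> regular_interval S1 S2 \<tau>'"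
      "\<And>t1 t2 \<sigma>. \<lbrakk>t1 \<in> ball \<tau> d1; t2 \<in> ball \<tau> d1; \<sigma> \<in> {S1..S2}\<rbrakk> \<Longrightarrow>
        \<bar>flux t1 t2 \<sigma> - norm (gradF (P \<sigma> \<tau>)) * (dirN (\<theta> \<sigma> \<tau>) \<bullet> (P \<sigma> t2 - P \<sigma> t1))\<bar> \<le> \<eta> * norm (P \<sigma> t2 - P \<sigma> t1)"
      "\<And>t1 t2 \<sigma>. \<lbrakk>t1 \<in> ball \<tau> d1; t2 \<in> ball \<tau> d1; \<sigma> \<in> {S1..S2}\<rbrakk> \<Longrightarrow>
        \<bar>flux' t1 t2 \<sigma> - curl F (P \<sigma> \<tau>) * (dirN (\<theta> \<sigma> \<tau>) \<bullet> (P \<sigma> t2 - P \<sigma> t1))\<bar> \<le> \<eta> * norm (P \<sigma> t2 - P \<sigma> t1)"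
      by (rule flux_linearized[OF r \<eta>(1)]) (rule that)
    obtain d2 where d2: "d2 > 0" "\<And>t1 t2 \<sigma>. t1 \<in> ball \<tau> d2 \<Longrightarrow> t2 \<in> ball \<tau> d2 \<Longrightarrow> t1 \<noteq> t2 \<Longrightarrow> \<sigma> \<in> {S1..S2} \<Longrightarrow>
        norm (diff_quot pt \<sigma> t1 t2 - param_deriv \<sigma> \<tau>) \<le> \<eta>"
      using param_deriv_limit[OF slice rD(2,3) \<eta>(1)] by blast
    have "min d1 d2 > 0" using d1 d2 by simp
    from ev[OF this] show ?thesis
    proof (rule eventually_mono, intro conjI ballI)
      fix n assume n: "t n \<in> ball \<tau> (min d1 d2)"
      show "regular_interval S1 S2 (t n)" using n by (intro d1(2)) auto
      fix \<sigma> assume \<sigma>: "\<sigma> \<in> {S1..S2}"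
      define q where "q = (P \<sigma> (t n) - P \<sigma> \<tau>) /\<^sub>R (t n - \<tau>)"
      have "norm (diff_quot pt \<sigma> \<tau> (t n) - param_deriv \<sigma> \<tau>) \<le> \<eta>"
        by (rule d2(2)) (use n \<sigma> d2(1) tne[of n] in auto)
      then have q: "norm (q - fst (param_deriv \<sigma> \<tau>)) \<le> \<eta>"
        using norm_fst_snd_le(1)[of "diff_quot pt \<sigma> \<tau> (t n) - param_deriv \<sigma> \<tau>"]
        by (simp add: q_def diff_quot_def)
      have qB: "norm q \<le> B + 1"
        using q norm_triangle_sub[of q "fst (param_deriv \<sigma> \<tau>)"] B(2)[OF \<sigma>] norm_fst_snd_le(1)[of "param_deriv \<sigma> \<tau>"] \<eta>(2)
        by linarith
      have Nq: "\<bar>dirN (\<theta> \<sigma> \<tau>) \<bullet> q - jac \<sigma> \<tau>\<bar> \<le> \<eta>"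
        using Cauchy_Schwarz_ineq2[of "dirN (\<theta> \<sigma> \<tau>)" "q - fst (param_deriv \<sigma> \<tau>)"] q
        by (simp add: jac_def inner_diff_right)
      have general: "\<bar>x / (t n - \<tau>) - y * jac \<sigma> \<tau>\<bar> \<le> e"
        if "\<bar>x - y * (dirN (\<theta> \<sigma> \<tau>) \<bullet> (P \<sigma> (t n) - P \<sigma> \<tau>))\<bar> \<le> \<eta> * norm (P \<sigma> (t n) - P \<sigma> \<tau>)" "\<bar>y\<bar> \<le> m" for x y
      proof -
        let ?i = "inverse (t n - \<tau>)"
        have "x / (t n - \<tau>) - y * (dirN (\<theta> \<sigma> \<tau>) \<bullet> q) = ?i * (x - y * (dirN (\<theta> \<sigma> \<tau>) \<bullet> (P \<sigma> (t n) - P \<sigma> \<tau>)))"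
          by (simp add: q_def divide_inverse algebra_simps)
        then have "\<bar>x / (t n - \<tau>) - y * (dirN (\<theta> \<sigma> \<tau>) \<bullet> q)\<bar> \<le> \<bar>?i\<bar> * (\<eta> * norm (P \<sigma> (t n) - P \<sigma> \<tau>))"
          using that(1) by (simp only: abs_mult mult_left_mono abs_ge_zero)
        also have "\<dots> = \<eta> * norm q" by (simp add: q_def)
        also have "\<dots> \<le> \<eta> * (B + 1)" using qB \<eta>(1) by (intro mult_left_mono) auto
        finally have 1: "\<bar>x / (t n - \<tau>) - y * (dirN (\<theta> \<sigma> \<tau>) \<bullet> q)\<bar> \<le> \<eta> * (B + 1)" .
        have "\<bar>y * (dirN (\<theta> \<sigma> \<tau>) \<bullet> q - jac \<sigma> \<tau>)\<bar> \<le> m * \<eta>"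
          unfolding abs_mult using Nq that(2) m0 by (intro mult_mono) auto
        then show ?thesis using 1 \<eta>(3) by (simp add: algebra_simps)
      qed
      have tb: "\<tau> \<in> ball \<tau> d1" "t n \<in> ball \<tau> d1" using n d1(1) by auto
      show "\<bar>flux \<tau> (t n) \<sigma> / (t n - \<tau>) - norm (gradF (P \<sigma> \<tau>)) * jac \<sigma> \<tau>\<bar> \<le> e"
        by (rule general[OF d1(3)[OF tb \<sigma>] m(2)[OF \<sigma>]])
      show "\<bar>flux' \<tau> (t n) \<sigma> / (t n - \<tau>) - curl F (P \<sigma> \<tau>) * jac \<sigma> \<tau>\<bar> \<le> e"
        by (rule general[OF d1(4)[OF tb \<sigma>] m(1)[OF \<sigma>]])
    qed
  qed
  have "\<forall>\<^sub>F n in sequentially. regular_interval S1 S2 (t n)"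
    using approx[OF zero_less_one] by (rule eventually_mono) simp
  then obtain N where N: "\<And>n. n \<ge> N \<Longrightarrow> regular_interval S1 S2 (t n)"
    by (auto simp: eventually_sequentially)
  let ?g = "\<lambda>n \<sigma>. flux \<tau> (t (n + N)) \<sigma> / (t (n + N) - \<tau>)"
  let ?g' = "\<lambda>n \<sigma>. flux' \<tau> (t (n + N)) \<sigma> / (t (n + N) - \<tau>)"
  let ?f = "\<lambda>\<sigma>. norm (gradF (P \<sigma> \<tau>)) * jac \<sigma> \<tau>"
  let ?f' = "\<lambda>\<sigma>. curl F (P \<sigma> \<tau>) * jac \<sigma> \<tau>"
  have lim: "(\<lambda>n. ?g n x) \<longlonglongrightarrow> ?f x" if "x \<in> {S1..S2}" for x
  proof (rule LIMSEQ_ignore_initial_segment)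
    show "(\<lambda>n. flux \<tau> (t n) x / (t n - \<tau>)) \<longlonglongrightarrow> ?f x"
    proof (rule tendstoI)
      fix e :: real assume "e > 0"
      then have "e/2 > 0" by simp
      from approx[OF this] show "\<forall>\<^sub>F n in sequentially. dist (flux \<tau> (t n) x / (t n - \<tau>)) (?f x) < e"
      proof (rule eventually_mono)
        fix n
        assume a: "regular_interval S1 S2 (t n) \<and> (\<forall>\<sigma>\<in>{S1..S2}.
          \<bar>flux \<tau> (t n) \<sigma> / (t n - \<tau>) - norm (gradF (P \<sigma> \<tau>)) * jac \<sigma> \<tau>\<bar> \<le> e/2 \<and>
          \<bar>flux' \<tau> (t n) \<sigma> / (t n - \<tau>) - curl F (P \<sigma> \<tau>) * jac \<sigma> \<tau>\<bar> \<le> e/2)"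
        have "\<bar>flux \<tau> (t n) x / (t n - \<tau>) - ?f x\<bar> \<le> e/2" using conjunct2[OF a] that by simp
        then show "dist (flux \<tau> (t n) x / (t n - \<tau>)) (?f x) < e" using \<open>e > 0\<close> by (simp add: dist_real_def)
      qed
    qed
  qed
  have "\<exists>g. \<forall>x\<in>{S1..S2}. (\<lambda>n. ?g n x) \<longlonglongrightarrow> g x \<and> (g has_derivative (\<lambda>y. ?f' x * y)) (at x within {S1..S2})"
  proof (rule has_derivative_sequence)
    show "(?g n has_derivative (\<lambda>y. ?g' n x * y)) (at x within {S1..S2})" if x: "x \<in> {S1..S2}" for n x
    proof -
      have "(flux \<tau> (t (n + N)) has_real_derivative flux' \<tau> (t (n + N)) x) (at x)"
        using r N[of "n + N"] x unfolding regular_interval_def by (intro flux_derivative) auto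
      then have "(?g n has_real_derivative ?g' n x) (at x)" by (rule DERIV_cdivide)
      then show ?thesis
        unfolding has_field_derivative_def by (rule has_derivative_at_withinI)
    qed
    show "\<forall>\<^sub>F n in sequentially. \<forall>x\<in>{S1..S2}. \<forall>h. norm (?g' n x * h - ?f' x * h) \<le> e * norm h" if "e > 0" for e
    proof -
      have "\<forall>\<^sub>F n in sequentially. \<forall>x\<in>{S1..S2}. \<bar>flux' \<tau> (t n) x / (t n - \<tau>) - ?f' x\<bar> \<le> e"
        using approx[OF that] by (rule eventually_mono) blast
      then have "\<forall>\<^sub>F n in sequentially. \<forall>x\<in>{S1..S2}. \<bar>?g' n x - ?f' x\<bar> \<le> e"
        by (subst eventually_sequentially_seg)
      then show ?thesis
      proof (rule eventually_mono, intro ballI allI)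
        fix n x h assume a: "\<forall>x\<in>{S1..S2}. \<bar>?g' n x - ?f' x\<bar> \<le> e" and x: "x \<in> {S1..S2}"
        have "norm (?g' n x * h - ?f' x * h) = \<bar>?g' n x - ?f' x\<bar> * \<bar>h\<bar>"
          by (simp only: real_norm_def left_diff_distrib[symmetric] abs_mult)
        also have "\<dots> \<le> e * norm h" using a x by (simp add: mult_right_mono)
        finally show "norm (?g' n x * h - ?f' x * h) \<le> e * norm h" .
      qed
    qed
    show "(\<lambda>n. ?g n \<sigma>) \<longlonglongrightarrow> ?f \<sigma>" by (rule lim[OF \<sigma>])
  qed (use \<sigma> in auto)
  then obtain G where G: "\<And>x. x \<in> {S1..S2} \<Longrightarrow> (\<lambda>n. ?g n x) \<longlonglongrightarrow> G x"
    "\<And>x. x \<in> {S1..S2} \<Longrightarrow> (G has_derivative (\<lambda>y. ?f' x * y)) (at x within {S1..S2})" by blast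
  have eq: "G x = ?f x" if "x \<in> {S1..S2}" for x
    using LIMSEQ_unique[OF G(1)[OF that] lim[OF that]] .
  have "(?f has_derivative (\<lambda>y. ?f' \<sigma> * y)) (at \<sigma> within {S1..S2})"
    by (rule has_derivative_transform[OF \<sigma> _ G(2)[OF \<sigma>]]) (simp add: eq)
  then show ?thesis by (simp add: has_field_derivative_def)
qed

lemma area_times_jac_derivative:
  assumes t: "\<tau> \<in> {\<alpha><..<\<beta>}" and \<sigma>: "\<sigma> \<in> open_segment 0 (h \<tau>)"
  shows "((\<lambda>\<sigma>. norm (gradF (P \<sigma> \<tau>)) * jac \<sigma> \<tau>) has_real_derivative curl F (P \<sigma> \<tau>) * jac \<sigma> \<tau>) (at \<sigma>)"
proof (cases "h \<tau> > 0")
  case True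
  then have "regular_interval 0 ((\<sigma> + h \<tau>)/2) \<tau>" "0 < \<sigma>" "\<sigma> < (\<sigma> + h \<tau>)/2"
    using t \<sigma> by (auto simp: regular_interval_def closed_segment_eq_real_ivl open_segment_eq_real_ivl)
  then show ?thesis
    using area_times_jac_derivative_within[of 0 "(\<sigma> + h \<tau>)/2" \<tau> \<sigma>]
      at_within_interior[of \<sigma> "{0..(\<sigma> + h \<tau>)/2}"] by simp
next
  case False
  then have "regular_interval ((\<sigma> + h \<tau>)/2) 0 \<tau>" "\<sigma> < 0" "(\<sigma> + h \<tau>)/2 < \<sigma>"
    using t \<sigma> h_nonzero[OF t] by (auto simp: regular_interval_def closed_segment_eq_real_ivl open_segment_eq_real_ivl)
  then show ?thesis
    using area_times_jac_derivative_within[of "(\<sigma> + h \<tau>)/2" 0 \<tau> \<sigma>]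
      at_within_interior[of \<sigma> "{(\<sigma> + h \<tau>)/2..0}"] by simp
qed

text \<open>The function \<open>f = \<bar>grad u + F\<bar> * jac\<close> vanishes at the hitting time and has the sign of \<open>jac\<close>
  just before. By the mean value theorem f changes towards 0 at the rate \<open>curl F * jac\<close>, in which
  \<open>jac\<close> and \<open>curl F\<close> have constant sign near the end. So \<open>curl F\<close> is negative if time increases
  towards the curve and positive otherwise.\<close>

lemma hitting_sign:
  assumes t: "\<tau> \<in> {\<alpha><..<\<beta>}" and j: "jac (h \<tau>) \<tau> \<noteq> 0" and c: "curl F (P (h \<tau>) \<tau>) \<noteq> 0"
  shows "curl F (P (h \<tau>) \<tau>) * h \<tau> < 0"
proof -
  let ?S = "closed_segment 0 (h \<tau>)"
  let ?f = "\<lambda>\<sigma>. norm (gradF (P \<sigma> \<tau>)) * jac \<sigma> \<tau>"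
  have S: "?S \<times> {\<tau>} \<subseteq> W" using segment_in_W W_section[OF t] by blast
  have cP: "continuous_on ?S (\<lambda>\<sigma>. P \<sigma> \<tau>)" by (rule slice_continuous[OF joint_continuous(1) S])
  have P\<Omega>: "(\<lambda>\<sigma>. P \<sigma> \<tau>) ` ?S \<subseteq> \<Omega>" using S char_system by blast
  have cj: "continuous_on ?S (\<lambda>\<sigma>. jac \<sigma> \<tau>)" by (rule slice_continuous[OF jac_continuous S])
  have cc: "continuous_on ?S (\<lambda>\<sigma>. curl F (P \<sigma> \<tau>))"
    by (rule continuous_on_compose2[OF curl_continuous[OF F_C1] cP P\<Omega>])
  have cf: "continuous_on ?S ?f"
    by (intro continuous_on_mult cj continuous_on_compose2[OF continuous_on_norm[OF gradF_continuous] cP P\<Omega>])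
  have h0: "h \<tau> \<noteq> 0" by (rule h_nonzero[OF t])
  have fh: "?f (h \<tau>) = 0" using hits[OF t] C_sing by (auto simp: sing_set_def)
  let ?a = "jac (h \<tau>) \<tau>" and ?c = "curl F (P (h \<tau>) \<tau>)"
  have "((\<lambda>\<sigma>. jac \<sigma> \<tau> * ?a) \<longlongrightarrow> ?a * ?a) (at (h \<tau>) within ?S)"
    "((\<lambda>\<sigma>. curl F (P \<sigma> \<tau>) * ?c) \<longlongrightarrow> ?c * ?c) (at (h \<tau>) within ?S)"
    using cj cc by (auto simp: continuous_on_def intro!: tendsto_intros)
  moreover have "?a * ?a > 0" "?c * ?c > 0" using j c by (auto simp flip: power2_eq_square)
  ultimately have "\<forall>\<^sub>F \<sigma> in at (h \<tau>) within ?S. jac \<sigma> \<tau> * ?a > 0 \<and> curl F (P \<sigma> \<tau>) * ?c > 0"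
    by (intro eventually_conj order_tendstoD(1))
  then obtain d where d: "d > 0" "\<And>\<sigma>. \<sigma> \<in> ?S \<Longrightarrow> \<sigma> \<noteq> h \<tau> \<Longrightarrow> dist \<sigma> (h \<tau>) < d \<Longrightarrow> jac \<sigma> \<tau> * ?a > 0 \<and> curl F (P \<sigma> \<tau>) * ?c > 0"
    unfolding eventually_at by auto
  define \<mu> where "\<mu> = min (1/2) (d / (2 * \<bar>h \<tau>\<bar>))"
  have \<mu>: "0 < \<mu>" "\<mu> < 1" using d(1) h0 by (auto simp: \<mu>_def)
  define \<sigma> where "\<sigma> = (1 - \<mu>) * h \<tau>"
  have "\<bar>h \<tau>\<bar> * \<mu> < d"
  proof -
    have "\<bar>h \<tau>\<bar> * \<mu> \<le> \<bar>h \<tau>\<bar> * (d / (2 * \<bar>h \<tau>\<bar>))" by (intro mult_left_mono) (auto simp: \<mu>_def)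
    also have "\<dots> = d / 2" using h0 by simp
    finally show ?thesis using d(1) by simp
  qed
  moreover have "\<sigma> - h \<tau> = - (\<mu> * h \<tau>)" by (simp add: \<sigma>_def algebra_simps)
  ultimately have \<sigma>d: "dist \<sigma> (h \<tau>) < d" using \<mu> by (simp add: dist_real_def abs_mult mult.commute)
  have near: "jac x \<tau> * ?a > 0 \<and> curl F (P x \<tau>) * ?c > 0" "x \<in> ?S" "x \<noteq> h \<tau>"
    if "x \<in> closed_segment \<sigma> (h \<tau>) - {h \<tau>}" for x
  proof -
    have "\<sigma> \<in> ?S" unfolding in_segment by (rule exI[of _ "1 - \<mu>"]) (use \<mu> in \<open>simp add: \<sigma>_def\<close>)
    then show "x \<in> ?S" "x \<noteq> h \<tau>" using that subset_closed_segment[of \<sigma> "h \<tau>" 0 "h \<tau>"] by auto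
    moreover have "dist x (h \<tau>) < d"
      using that \<sigma>d by (auto simp: closed_segment_eq_real_ivl dist_real_def split: if_splits)
    ultimately show "jac x \<tau> * ?a > 0 \<and> curl F (P x \<tau>) * ?c > 0" by (intro d(2))
  qed
  have \<sigma>ne: "\<sigma> \<noteq> h \<tau>" using \<mu> h0 by (simp add: \<sigma>_def)
  have op: "x \<in> open_segment 0 (h \<tau>)" if "x \<in> open_segment \<sigma> (h \<tau>)" for x
  proof -
    have "x \<in> closed_segment \<sigma> (h \<tau>) - {h \<tau>}" using that by (auto simp: open_segment_def)
    then have "x \<in> ?S" "x \<noteq> h \<tau>" using near by auto
    moreover have "x \<noteq> 0"
    proof (cases "h \<tau> > 0")
      case True
      then have "\<sigma> > 0" using \<mu> by (simp add: \<sigma>_def)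
      then show ?thesis using that True by (auto simp: open_segment_eq_real_ivl split: if_splits)
    next
      case False
      then have "\<sigma> < 0" using \<mu> h0 by (simp add: \<sigma>_def mult_pos_neg)
      then show ?thesis using that False h0 by (auto simp: open_segment_eq_real_ivl split: if_splits)
    qed
    ultimately show ?thesis by (simp add: open_segment_def)
  qed
  obtain z where z: "z \<in> open_segment \<sigma> (h \<tau>)" "?f (h \<tau>) - ?f \<sigma> = (h \<tau> - \<sigma>) * (curl F (P z \<tau>) * jac z \<tau>)"
  proof -
    define lo where "lo = min \<sigma> (h \<tau>)"
    define hi where "hi = max \<sigma> (h \<tau>)"
    have lohi: "lo < hi" using \<sigma>ne by (auto simp: lo_def hi_def)
    have sub: "{lo..hi} \<subseteq> ?S"
    proof
      fix x assume "x \<in> {lo..hi}"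
      then have "x \<in> closed_segment \<sigma> (h \<tau>)" by (auto simp: lo_def hi_def closed_segment_eq_real_ivl)
      then show "x \<in> ?S" using near(2)[of x] by (cases "x = h \<tau>") auto
    qed
    have inn: "x \<in> open_segment \<sigma> (h \<tau>)" if "lo < x" "x < hi" for x
      using that by (auto simp: lo_def hi_def open_segment_eq_real_ivl)
    have "\<exists>l z. lo < z \<and> z < hi \<and> DERIV ?f z :> l \<and> ?f hi - ?f lo = (hi - lo) * l"
    proof (rule MVT[OF lohi])
      show "continuous_on {lo..hi} ?f" by (rule continuous_on_subset[OF cf sub])
      show "?f differentiable (at x)" if "lo < x" "x < hi" for x
        using area_times_jac_derivative[OF t op[OF inn[OF that]]] real_differentiable_def by blast
    qed
    then obtain l z where z: "lo < z" "z < hi" "DERIV ?f z :> l" "?f hi - ?f lo = (hi - lo) * l" by blast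
    have "l = curl F (P z \<tau>) * jac z \<tau>"
      by (rule DERIV_unique[OF z(3) area_times_jac_derivative[OF t op[OF inn[OF z(1,2)]]]])
    then have "?f (h \<tau>) - ?f \<sigma> = (h \<tau> - \<sigma>) * (curl F (P z \<tau>) * jac z \<tau>)"
      using z(4) unfolding lo_def hi_def by (cases "\<sigma> \<le> h \<tau>") (simp_all add: min_def max_def algebra_simps)
    then show thesis by (rule that[OF inn[OF z(1,2)]])
  qed
  have zs: "jac z \<tau> * ?a > 0" "curl F (P z \<tau>) * ?c > 0"
    using near(1)[of z] z(1) by (auto simp: open_segment_def)
  have \<sigma>s: "jac \<sigma> \<tau> * ?a > 0" "\<sigma> \<in> ?S" using near[of \<sigma>] \<sigma>ne by auto
  have pos: "norm (gradF (P \<sigma> \<tau>)) > 0" using char_relation(2)[OF t \<sigma>s(2) \<sigma>ne] by simp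
  have "- (norm (gradF (P \<sigma> \<tau>)) * jac \<sigma> \<tau>) = \<mu> * h \<tau> * (curl F (P z \<tau>) * jac z \<tau>)"
    using z(2) fh by (simp add: \<sigma>_def algebra_simps)
  then have "- (norm (gradF (P \<sigma> \<tau>)) * (jac \<sigma> \<tau> * ?a) * (?c * ?c)) = \<mu> * (h \<tau> * ?c) * ((curl F (P z \<tau>) * ?c) * (jac z \<tau> * ?a))"
    by algebra
  moreover have "norm (gradF (P \<sigma> \<tau>)) * (jac \<sigma> \<tau> * ?a) * (?c * ?c) > 0"
    using pos \<sigma>s(1) \<open>?c * ?c > 0\<close> by simp
  ultimately have "\<mu> * (h \<tau> * ?c) * ((curl F (P z \<tau>) * ?c) * (jac z \<tau> * ?a)) < 0" by linarith
  moreover have "\<mu> > 0" "(curl F (P z \<tau>) * ?c) * (jac z \<tau> * ?a) > 0" using \<mu> zs by auto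
  ultimately have "h \<tau> * ?c < 0"
    by (simp only: mult_less_0_iff zero_less_mult_iff) linarith
  then show ?thesis by (simp add: mult.commute)
qed

end

section \<open>Extension of the normal field across the singular curve\<close>

definition rot :: "real^2 \<Rightarrow> real^2" where "rot v = vector [v $ 2, - (v $ 1)]"

lemma rot_component [simp]: "rot v $ 1 = v $ 2" "rot v $ 2 = - (v $ 1)"
  by (simp_all add: rot_def)

lemma rot_dirN [simp]: "rot (dirN a) = dirT a"
  by (simp add: vec_eq_iff forall_2)

lemma char_dir_eq_rot: "char_dir F u x = rot (normal_dir F u x)"
  by (simp add: char_dir_def rot_def)

definition divergence :: "(real^2 \<Rightarrow> real^2) \<Rightarrow> real^2 \<Rightarrow> real"
  where "divergence X x = partial 1 X x $ 1 + partial 2 X x $ 2"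

lemma partial_eq:
  assumes "(f has_derivative f') (at x)"
  shows "partial i f x = f' (axis i 1)"
  using frechet_derivative_at[OF assms] by (simp add: partial_def)

context char_fan
begin

definition chart :: "real^2 \<Rightarrow> real^2" where "chart z = P (z $ 1) (z $ 2)"

lemma pt_chart_derivative:
  fixes z :: "real^2"
  assumes "(z $ 1, z $ 2) \<in> W"
  shows "((\<lambda>z. pt (z $ 1) (z $ 2)) has_derivative
    (\<lambda>v. v $ 1 *\<^sub>R char_field H (pt (z $ 1) (z $ 2)) + v $ 2 *\<^sub>R param_deriv (z $ 1) (z $ 2))) (at z)"
proof -
  have "((\<lambda>z::real^2. (z $ 1, z $ 2)) has_derivative (\<lambda>v. (v $ 1, v $ 2))) (at z)"
    by (intro bounded_linear_imp_has_derivative bounded_linear_Pair bounded_linear_vec_nth)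
  from has_derivative_compose[OF this joint_derivative[OF assms]] show ?thesis by simp
qed

lemma chart_derivative:
  fixes z :: "real^2"
  assumes "(z $ 1, z $ 2) \<in> W"
  shows "(chart has_derivative (\<lambda>v. v $ 1 *\<^sub>R dirT (\<theta> (z $ 1) (z $ 2)) + v $ 2 *\<^sub>R fst (param_deriv (z $ 1) (z $ 2)))) (at z)"
    and "((\<lambda>z. \<theta> (z $ 1) (z $ 2)) has_derivative (\<lambda>v. - (v $ 1 * H (chart z)) + v $ 2 * snd (param_deriv (z $ 1) (z $ 2)))) (at z)"
  using has_derivative_fst[OF pt_chart_derivative[OF assms]] has_derivative_snd[OF pt_chart_derivative[OF assms]]
  by (simp_all add: chart_def[abs_def] char_field_def)

lemma plane_continuous:
  assumes "continuous_on W (\<lambda>(\<sigma>, \<tau>). f \<sigma> \<tau>)"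
  shows "continuous_on {z::real^2. (z $ 1, z $ 2) \<in> W} (\<lambda>z. f (z $ 1) (z $ 2))"
proof -
  have "continuous_on {z::real^2. (z $ 1, z $ 2) \<in> W} (\<lambda>z. (z $ 1, z $ 2))" by (intro continuous_intros)
  from continuous_on_compose2[OF assms this] show ?thesis by auto
qed

text \<open>The inverse function theorem at a point where \<open>jac\<close> does not vanish. The derivative \<open>R'\<close> of
  the inverse is described by the relation that later evaluates derivatives of functions of R.\<close>

lemma chart_inverse:
  assumes z0: "(z0 $ 1, z0 $ 2) \<in> W" and j0: "jac (z0 $ 1) (z0 $ 2) \<noteq> 0"
  obtains Z B R R' where "open Z" "z0 \<in> Z" "\<And>z. z \<in> Z \<Longrightarrow> (z $ 1, z $ 2) \<in> W" "open B" "homeomorphism Z B chart R"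
    "\<And>z. z \<in> Z \<Longrightarrow> jac (z $ 1) (z $ 2) \<noteq> 0"
    "\<And>y. y \<in> B \<Longrightarrow> (R has_derivative R' y) (at y)"
    "\<And>y w. y \<in> B \<Longrightarrow> R' y w $ 1 *\<^sub>R dirT (\<theta> (R y $ 1) (R y $ 2)) + R' y w $ 2 *\<^sub>R fst (param_deriv (R y $ 1) (R y $ 2)) = w"
proof -
  let ?WQ = "{z::real^2. (z $ 1, z $ 2) \<in> W}"
  have opWQ: "open ?WQ"
  proof -
    have "open ((\<lambda>z::real^2. (z $ 1, z $ 2)) -` W)"
      by (intro open_vimage W_open continuous_intros)
    then show ?thesis by (simp add: vimage_def)
  qed
  have cj: "continuous_on ?WQ (\<lambda>z. jac (z $ 1) (z $ 2))" by (rule plane_continuous[OF jac_continuous])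
  define U where "U = {z \<in> ?WQ. jac (z $ 1) (z $ 2) \<noteq> 0}"
  have opU: "open U"
  proof -
    have "U = ?WQ \<inter> (\<lambda>z. jac (z $ 1) (z $ 2)) -` (- {0})" by (auto simp: U_def)
    moreover have "open \<dots>" by (rule continuous_open_preimage[OF cj opWQ]) auto
    ultimately show ?thesis by simp
  qed
  define D where "D z v = v $ 1 *\<^sub>R dirT (\<theta> (z $ 1) (z $ 2)) + v $ 2 *\<^sub>R fst (param_deriv (z $ 1) (z $ 2))" for z v :: "real^2"
  have Dbl: "bounded_linear (D z)" for z
    unfolding D_def[abs_def]
    by (intro bounded_linear_add bounded_linear_scaleR_const bounded_linear_vec_nth)
  define DB where "DB z = Blinfun (D z)" for z
  have DB: "blinfun_apply (DB z) = D z" for z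
    unfolding DB_def by (rule bounded_linear_Blinfun_apply[OF Dbl])
  have der: "(chart has_derivative blinfun_apply (DB z)) (at z)" if "z \<in> U" for z
    unfolding DB D_def[abs_def] using that by (intro chart_derivative(1)) (simp add: U_def)
  have cont: "continuous_on U DB"
  proof (rule continuous_on_blinfun_componentwise)
    have "continuous_on ?WQ (\<lambda>z. \<theta> (z $ 1) (z $ 2))" "continuous_on ?WQ (\<lambda>z. param_deriv (z $ 1) (z $ 2))"
      by (rule plane_continuous[OF joint_continuous(2)], rule plane_continuous[OF param_deriv_cont])
    then have "continuous_on U (\<lambda>z. \<theta> (z $ 1) (z $ 2))" "continuous_on U (\<lambda>z. param_deriv (z $ 1) (z $ 2))"
      by (auto intro: continuous_on_subset simp: U_def)
    then show "continuous_on U (\<lambda>z. blinfun_apply (DB z) i)" for i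
      unfolding DB D_def by (intro continuous_intros)
  qed
  have z0U: "z0 \<in> U" using z0 j0 by (simp add: U_def)
  have inj: "inj (D z)" if "z \<in> U" for z
  proof -
    have "linear (D z)" using Dbl bounded_linear.linear by blast
    moreover have "v = 0" if "D z v = 0" for v
    proof -
      have "dirN (\<theta> (z $ 1) (z $ 2)) \<bullet> D z v = v $ 2 * jac (z $ 1) (z $ 2)"
        by (simp add: D_def jac_def inner_add_right)
      then have v2: "v $ 2 = 0" using that \<open>z \<in> U\<close> by (simp add: U_def)
      have "dirT (\<theta> (z $ 1) (z $ 2)) \<bullet> D z v = v $ 1" by (simp add: D_def v2 inner_add_right)
      then have "v $ 1 = 0" using that by simp
      with v2 show "v = 0" by (simp add: vec_eq_iff forall_2)
    qed
    ultimately show ?thesis by (simp add: linear_injective_0)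
  qed
  obtain G where G: "linear G" "G \<circ> D z0 = id"
    using linear_injective_left_inverse[OF bounded_linear.linear[OF Dbl] inj[OF z0U]] by blast
  have inv: "Blinfun G o\<^sub>L DB z0 = id_blinfun"
    using G by (intro blinfun_eqI) (simp add: DB bounded_linear_Blinfun_apply linear_conv_bounded_linear fun_eq_iff)
  show thesis
  proof (rule inverse_function_theorem[OF opU der cont z0U inv])
    fix Z B R R'
    assume Z: "open Z" "Z \<subseteq> U" "z0 \<in> Z" "open B" "homeomorphism Z B chart R"
    and R: "\<And>y. y \<in> B \<Longrightarrow> (R has_derivative R' y) (at y)"
    and R': "\<And>y. y \<in> B \<Longrightarrow> R' y = inv (blinfun_apply (DB (R y)))"
    and bij: "\<And>y. y \<in> B \<Longrightarrow> bij (blinfun_apply (DB (R y)))"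
  show thesis
  proof (rule that[OF Z(1,3) _ Z(4,5) _ R])
    show "(z $ 1, z $ 2) \<in> W" "jac (z $ 1) (z $ 2) \<noteq> 0" if "z \<in> Z" for z
      using that Z(2) by (auto simp: U_def)
    show "R' y w $ 1 *\<^sub>R dirT (\<theta> (R y $ 1) (R y $ 2)) + R' y w $ 2 *\<^sub>R fst (param_deriv (R y $ 1) (R y $ 2)) = w" if "y \<in> B" for y w
    proof -
      have "D (R y) (R' y w) = w"
        using surj_f_inv_f[OF bij_is_surj[OF bij[OF that]], of w] by (simp add: R'[OF that] DB)
      then show ?thesis by (simp add: D_def)
    qed
  qed
  qed assumption+
qed

text \<open>For \<open>N = (cos \<theta>, sin \<theta>)\<close> the divergence is minus the derivative of \<open>\<theta>\<close> in the direction T,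
  and along the fan this derivative is \<open>-H\<close> by the characteristic system, beyond the singular
  curve as well.\<close>

lemma extended_normal:
  assumes Z: "\<And>z. z \<in> Z \<Longrightarrow> (z $ 1, z $ 2) \<in> W" and B: "open B" and hom: "homeomorphism Z B chart R"
    and j: "\<And>z. z \<in> Z \<Longrightarrow> jac (z $ 1) (z $ 2) \<noteq> 0"
    and R: "\<And>y. y \<in> B \<Longrightarrow> (R has_derivative R' y) (at y)"
    and R': "\<And>y w. y \<in> B \<Longrightarrow> R' y w $ 1 *\<^sub>R dirT (\<theta> (R y $ 1) (R y $ 2)) + R' y w $ 2 *\<^sub>R fst (param_deriv (R y $ 1) (R y $ 2)) = w"
  defines "\<nu> \<equiv> \<lambda>y. dirN (\<theta> (R y $ 1) (R y $ 2))"
  shows "C1_on B \<nu>" "\<And>y. y \<in> B \<Longrightarrow> divergence \<nu> y = H y"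
proof -
  define mu where "mu z = (H (chart z) * (dirT (\<theta> (z $ 1) (z $ 2)) \<bullet> fst (param_deriv (z $ 1) (z $ 2)))
      + snd (param_deriv (z $ 1) (z $ 2))) / jac (z $ 1) (z $ 2)" for z
  have RZ: "R y \<in> Z" "chart (R y) = y" if "y \<in> B" for y
    using hom that by (auto simp: homeomorphism_def)
  have der: "(\<nu> has_derivative (\<lambda>w. (H y * (dirT (\<theta> (R y $ 1) (R y $ 2)) \<bullet> w) - mu (R y) * (dirN (\<theta> (R y $ 1) (R y $ 2)) \<bullet> w))
      *\<^sub>R dirT (\<theta> (R y $ 1) (R y $ 2)))) (at y)" if y: "y \<in> B" for y
  proof -
    let ?T = "dirT (\<theta> (R y $ 1) (R y $ 2))" and ?N = "dirN (\<theta> (R y $ 1) (R y $ 2))"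
    let ?b = "fst (param_deriv (R y $ 1) (R y $ 2))" and ?k = "snd (param_deriv (R y $ 1) (R y $ 2))"
    let ?j = "jac (R y $ 1) (R y $ 2)"
    have "((\<lambda>y. \<theta> (R y $ 1) (R y $ 2)) has_derivative (\<lambda>w. - (R' y w $ 1 * H y) + R' y w $ 2 * ?k)) (at y)"
      using has_derivative_compose[OF R[OF y] chart_derivative(2)[OF Z[OF RZ(1)[OF y]]]] RZ(2)[OF y] by simp
    from has_derivative_compose[OF this dirN_has_vector_derivative[unfolded has_vector_derivative_def]]
    have "(\<nu> has_derivative (\<lambda>w. (- (R' y w $ 1 * H y) + R' y w $ 2 * ?k) *\<^sub>R (- ?T))) (at y)"
      unfolding \<nu>_def .
    moreover have "(\<lambda>w. (- (R' y w $ 1 * H y) + R' y w $ 2 * ?k) *\<^sub>R (- ?T))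
      = (\<lambda>w. (H y * (?T \<bullet> w) - mu (R y) * (?N \<bullet> w)) *\<^sub>R ?T)"
    proof
      fix w
      have jn: "?j \<noteq> 0" by (rule j[OF RZ(1)[OF y]])
      have "?N \<bullet> w = R' y w $ 2 * ?j"
        by (subst R'[OF y, of w, symmetric]) (simp add: jac_def inner_add_right)
      then have v2: "R' y w $ 2 = (?N \<bullet> w) / ?j" using jn by simp
      have "?T \<bullet> w = R' y w $ 1 + R' y w $ 2 * (?T \<bullet> ?b)"
        by (subst R'[OF y, of w, symmetric]) (simp add: inner_add_right)
      then have v1: "R' y w $ 1 = ?T \<bullet> w - (?N \<bullet> w) / ?j * (?T \<bullet> ?b)" by (simp add: v2)
      have e: "- (- (R' y w $ 1 * H y) + R' y w $ 2 * ?k) = H y * (?T \<bullet> w) - mu (R y) * (?N \<bullet> w)"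
        unfolding v1 v2 mu_def RZ(2)[OF y] using jn by (simp add: field_simps)
      then show "(- (R' y w $ 1 * H y) + R' y w $ 2 * ?k) *\<^sub>R (- ?T) = (H y * (?T \<bullet> w) - mu (R y) * (?N \<bullet> w)) *\<^sub>R ?T"
        unfolding e[symmetric] by (simp only: scaleR_minus_left scaleR_minus_right)
    qed
    ultimately show ?thesis by simp
  qed
  have B\<Omega>: "B \<subseteq> \<Omega>"
  proof
    fix y assume "y \<in> B"
    then have "P (R y $ 1) (R y $ 2) = y" "(R y $ 1, R y $ 2) \<in> W" using RZ Z by (auto simp: chart_def)
    then show "y \<in> \<Omega>" using char_system[of "R y $ 1" "R y $ 2"] by simp
  qed
  have cR: "continuous_on B R" using hom by (simp add: homeomorphism_def)
  have RW: "R ` B \<subseteq> {z. (z $ 1, z $ 2) \<in> W}" using RZ(1) Z by auto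
  have comp: "continuous_on B (\<lambda>y. f (R y $ 1) (R y $ 2))" if "continuous_on W (\<lambda>(\<sigma>, \<tau>). f \<sigma> \<tau>)" for f :: "real \<Rightarrow> real \<Rightarrow> 'z::topological_space"
    using continuous_on_compose2[OF plane_continuous[OF that] cR RW] .
  have cH: "continuous_on B H" using C1_on_continuous[OF H_C1] B\<Omega> by (rule continuous_on_subset)
  have cmu: "continuous_on B (\<lambda>y. mu (R y))"
  proof -
    have "continuous_on B (\<lambda>y. (H y * (dirT (\<theta> (R y $ 1) (R y $ 2)) \<bullet> fst (param_deriv (R y $ 1) (R y $ 2)))
      + snd (param_deriv (R y $ 1) (R y $ 2))) / jac (R y $ 1) (R y $ 2))"
      using j RZ(1)
      by (intro continuous_on_divide continuous_on_add continuous_on_mult continuous_on_inner continuous_on_fst continuous_on_snd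
          dirT_continuous cH comp joint_continuous param_deriv_cont jac_continuous) auto
    then show ?thesis by (rule continuous_on_eq) (simp add: mu_def RZ(2))
  qed
  show "C1_on B \<nu>"
    unfolding C1_on_def
  proof (intro conjI ballI allI)
    show "\<nu> differentiable (at y)" if "y \<in> B" for y
      by (rule differentiableI[OF der[OF that]])
    fix i
    have "continuous_on B (\<lambda>y. (H y * (dirT (\<theta> (R y $ 1) (R y $ 2)) \<bullet> axis i 1) - mu (R y) * (dirN (\<theta> (R y $ 1) (R y $ 2)) \<bullet> axis i 1))
      *\<^sub>R dirT (\<theta> (R y $ 1) (R y $ 2)))"
      by (intro continuous_intros cH cmu comp joint_continuous)
    then show "continuous_on B (partial i \<nu>)"
      by (rule continuous_on_eq) (simp add: partial_eq[OF der])
  qed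
  show "divergence \<nu> y = H y" if y: "y \<in> B" for y
  proof -
    let ?a = "\<theta> (R y $ 1) (R y $ 2)"
    have "divergence \<nu> y = H y * (cos ?a * cos ?a) + H y * (sin ?a * sin ?a)"
      unfolding divergence_def partial_eq[OF der[OF y]]
      by (simp add: inner_axis algebra_simps)
    also have "\<dots> = H y * ((sin ?a)\<^sup>2 + (cos ?a)\<^sup>2)"
      unfolding power2_eq_square distrib_left by (rule add.commute)
    finally show ?thesis by simp
  qed
qed

end

lemma negligible_graph:
  fixes h :: "real \<Rightarrow> real"
  assumes "continuous_on {a<..<b} h"
  shows "negligible {(\<tau>, \<sigma>). \<tau> \<in> {a<..<b} \<and> \<sigma> = h \<tau>}"
proof -
  let ?G = "{(\<tau>, \<sigma>). \<tau> \<in> {a<..<b} \<and> \<sigma> = h \<tau>}"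
  have "?G \<in> sets borel"
  proof -
    have c: "continuous_on ({a<..<b} \<times> UNIV) (\<lambda>z. snd z - h (fst z))"
      by (intro continuous_intros continuous_on_compose2[OF assms]) auto
    have "closedin (top_of_set ({a<..<b} \<times> UNIV)) {z \<in> {a<..<b} \<times> UNIV. snd z - h (fst z) = 0}"
      by (rule continuous_closedin_preimage_constant[OF c])
    then obtain S where S: "closed S" "{z \<in> {a<..<b} \<times> UNIV. snd z - h (fst z) = 0} = ({a<..<b} \<times> UNIV) \<inter> S"
      unfolding closedin_closed by blast
    have "?G = ({a<..<b} \<times> UNIV) \<inter> S" unfolding S(2)[symmetric] by auto
    moreover have "open ({a<..<b} \<times> (UNIV::real set))" by (intro open_Times) auto
    ultimately show ?thesis using S(1) by auto
  qed
  then have m: "?G \<in> sets (lborel \<Otimes>\<^sub>M lborel)" unfolding lborel_prod sets_lborel .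
  have "emeasure (lborel \<Otimes>\<^sub>M lborel) ?G = (\<integral>\<^sup>+\<tau>. emeasure lborel (Pair \<tau> -` ?G) \<partial>lborel)"
    by (rule lborel.emeasure_pair_measure_alt[OF m])
  also have "\<dots> = (\<integral>\<^sup>+\<tau>. 0 \<partial>(lborel :: real measure))"
  proof (rule nn_integral_cong)
    fix \<tau> :: real
    have "Pair \<tau> -` ?G = {} \<or> Pair \<tau> -` ?G = {h \<tau>}" by auto
    then show "emeasure lborel (Pair \<tau> -` ?G) = 0"
      by (rule disjE) (simp_all only: emeasure_empty emeasure_lborel_singleton)
  qed
  finally have "emeasure lborel ?G = 0" by (simp add: lborel_prod)
  then have "?G \<in> null_sets lborel" using \<open>?G \<in> sets borel\<close> by (intro null_setsI) auto
  then show ?thesis by (simp add: negligible_iff_null_sets null_sets_completionI)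
qed

text \<open>A \<open>C\<^sup>1\<close> unit field N of divergence H on a neighborhood B that continues the normal field of
  the side V, such that through every singular point q of B a characteristic of N crosses from V
  to \<open>V'\<close>. The sign \<open>\<kappa>\<close> tells in which direction of time it does so, and the length \<open>\<epsilon>\<close> of the
  crossing does not depend on q.\<close>

definition normal_extension ::
  "(real^2 \<Rightarrow> real^2) \<Rightarrow> (real^2 \<Rightarrow> real) \<Rightarrow> (real^2 \<Rightarrow> real) \<Rightarrow> (real^2) set \<Rightarrow> (real^2) set \<Rightarrow> (real^2) set \<Rightarrow>
    real \<Rightarrow> (real^2) set \<Rightarrow> (real^2 \<Rightarrow> real^2) \<Rightarrow> real \<Rightarrow> bool"
  where "normal_extension F H u K V V' \<kappa> B N \<epsilon> \<longleftrightarrow>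
    open B \<and> C1_on B N \<and> (\<forall>x\<in>B. norm (N x) = 1 \<and> divergence N x = H x) \<and>
    (\<forall>x\<in>B \<inter> V. normal_dir F u x = N x) \<and> negligible (B \<inter> K) \<and> 0 < \<epsilon> \<and>
    (\<forall>q\<in>B \<inter> K. \<exists>c \<phi>. c 0 = q \<and> (\<forall>t\<in>{-\<epsilon><..<\<epsilon>}. c t \<in> B \<and> N (c t) = dirN (\<phi> t) \<and>
      (c has_vector_derivative dirT (\<phi> t)) (at t) \<and> (\<phi> has_real_derivative - H (c t)) (at t) \<and>
      (\<kappa> * t < 0 \<longrightarrow> c t \<in> V) \<and> (0 < \<kappa> * t \<longrightarrow> c t \<in> V')))"

lemma det_columns: "det (transpose (vector [a, b]) :: real^2^2) = a $ 1 * b $ 2 - a $ 2 * b $ 1"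
  by (simp add: det_2 transpose_def)

context char_fan
begin

text \<open>Nondegeneracy from one side is an open condition along the fan: the same fan witnesses it at
  every point where it hits the singular curve with nonzero Jacobian.\<close>

lemma side_at:
  assumes t: "\<tau> \<in> {\<alpha><..<\<beta>}" and j: "jac (h \<tau>) \<tau> \<noteq> 0"
  shows "nondegenerate_side \<Omega> F H u C V (P (h \<tau>) \<tau>)"
proof -
  have W: "(h \<tau>, \<tau>) \<in> W" using W_section[OF t] by simp
  have dP: "((\<lambda>\<sigma>. P \<sigma> \<tau>) has_vector_derivative dirT (\<theta> (h \<tau>) \<tau>)) (at (h \<tau>))"
    using char_system[OF W] by simp
  have dT: "((\<lambda>\<tau>'. P (h \<tau>) \<tau>') has_vector_derivative fst (param_deriv (h \<tau>) \<tau>)) (at \<tau>)"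
    using bounded_linear.has_vector_derivative[OF bounded_linear_fst param_has_derivative[OF W]] by simp
  have "det (transpose (vector [dirT (\<theta> (h \<tau>) \<tau>), fst (param_deriv (h \<tau>) \<tau>)]) :: real^2^2) = jac (h \<tau>) \<tau>"
    unfolding det_columns jac_def inner_2 by simp
  then have det: "det (transpose (vector [dirT (\<theta> (h \<tau>) \<tau>), fst (param_deriv (h \<tau>) \<tau>)]) :: real^2^2) \<noteq> 0"
    using j by simp
  show ?thesis
    unfolding nondegenerate_side_def
    apply (rule exI[of _ \<alpha>], rule exI[of _ \<beta>], rule exI[of _ \<tau>], rule exI[of _ s], rule exI[of _ g],
        rule exI[of _ W], rule exI[of _ P], rule exI[of _ \<theta>], rule exI[of _ h],
        rule exI[of _ "dirT (\<theta> (h \<tau>) \<tau>)"], rule exI[of _ "fst (param_deriv (h \<tau>) \<tau>)"])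
    unfolding dirT_def[symmetric] dirN_def[symmetric]
    apply (intro conjI)
    using t apply simp
    using t apply simp
    apply (rule s_sign)
    using seed apply blast
    apply (rule W_open)
    apply (rule W_strip)
    using W_section apply blast
    using char_system apply blast
    using initial apply blast
    apply (rule angle_cont)
    using hits apply blast
    apply (rule h_cont)
    apply (rule refl)
    apply (rule dP)
    apply (rule dT)
    apply (rule det)
    done
qed

lemma before_hitting:
  assumes t: "\<tau> \<in> {\<alpha><..<\<beta>}" and "\<sigma> \<in> closed_segment 0 (h \<tau>) - {h \<tau>}"
  shows "P \<sigma> \<tau> \<in> V" "normal_dir F u (P \<sigma> \<tau>) = dirN (\<theta> \<sigma> \<tau>)"
  using hits[OF t] assms char_relation(3)[OF t, of \<sigma>] by auto

text \<open>In the chart given by the fan the singular set is near p the graph of the hitting time h. It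
  contains the graph, and since it is an arc, invariance of domain shows that the graph is a
  neighborhood of p in it. The part of the chart before the graph lies in V. The part beyond it is
  connected and free of singular points; as p is a limit of points of \<open>V'\<close>, it lies in \<open>V'\<close>. So
  the lines of the chart are the crossing curves.\<close>

lemma local_structure:
  assumes t0: "\<tau>0 \<in> {\<alpha><..<\<beta>}" and j0: "jac (h \<tau>0) \<tau>0 \<noteq> 0"
    and U: "open U" "U \<subseteq> \<Omega>" and CU: "C = U \<inter> sing_set \<Omega> F u"
    and VV': "U - sing_set \<Omega> F u = V \<union> V'" "V \<inter> V' = {}" "open V" "open V'"
    and clos: "P (h \<tau>0) \<tau>0 \<in> closure V'" and Chom: "C homeomorphic {0<..<1::real}"
  shows "\<exists>B N \<epsilon>. P (h \<tau>0) \<tau>0 \<in> B \<and> B \<subseteq> U \<and> normal_extension F H u (sing_set \<Omega> F u) V V' (sgn (h \<tau>0)) B N \<epsilon> \<and>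
    (\<forall>q\<in>B \<inter> sing_set \<Omega> F u. nondegenerate_side \<Omega> F H u C V q)"
proof -
  let ?K = "sing_set \<Omega> F u"
  define h0 where "h0 = h \<tau>0"
  define \<kappa> where "\<kappa> = sgn h0"
  define p where "p = P h0 \<tau>0"
  have h0: "h0 \<noteq> 0" unfolding h0_def by (rule h_nonzero[OF t0])
  have \<kappa>: "\<kappa> = 1 \<and> h0 > 0 \<or> \<kappa> = -1 \<and> h0 < 0" using h0 by (auto simp: \<kappa>_def sgn_if)
  define z0 :: "real^2" where "z0 = vector [h0, \<tau>0]"
  have z0: "z0 $ 1 = h0" "z0 $ 2 = \<tau>0" by (simp_all add: z0_def)
  have W0: "(z0 $ 1, z0 $ 2) \<in> W" using W_section[OF t0] by (simp add: z0 h0_def)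
  have j0': "jac (z0 $ 1) (z0 $ 2) \<noteq> 0" using j0 by (simp add: z0 h0_def)
  have pC: "p \<in> C" using hits[OF t0] by (simp add: p_def h0_def)
  then have pU: "p \<in> U" using CU by blast
  show ?thesis
  proof (rule chart_inverse[OF W0 j0'])
    fix Z B R R'
    assume Zop: "open Z" and z0Z: "z0 \<in> Z" and ZW: "\<And>z. z \<in> Z \<Longrightarrow> (z $ 1, z $ 2) \<in> W"
      and Bop: "open B" and hom: "homeomorphism Z B chart R"
      and Zj: "\<And>z. z \<in> Z \<Longrightarrow> jac (z $ 1) (z $ 2) \<noteq> 0"
      and R: "\<And>y. y \<in> B \<Longrightarrow> (R has_derivative R' y) (at y)"
      and R': "\<And>y w. y \<in> B \<Longrightarrow> R' y w $ 1 *\<^sub>R dirT (\<theta> (R y $ 1) (R y $ 2)) + R' y w $ 2 *\<^sub>R fst (param_deriv (R y $ 1) (R y $ 2)) = w"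
    define N where "N = (\<lambda>y. dirN (\<theta> (R y $ 1) (R y $ 2)))"
    note ext = extended_normal[OF ZW Bop hom Zj R R', folded N_def]
    have ccont: "continuous_on Z chart" using hom by (simp add: homeomorphism_def)
    have RQ: "R (chart z) = z" if "z \<in> Z" for z using hom that by (simp add: homeomorphism_def)
    have p_chart: "chart z0 = p" by (simp add: chart_def z0 p_def)
    have box: "\<exists>r>0. \<forall>z. \<bar>z $ 1 - h0\<bar> < r \<longrightarrow> \<bar>z $ 2 - \<tau>0\<bar> < r \<longrightarrow> z \<in> S" if S: "open S" "z0 \<in> S" for S :: "(real^2) set"
    proof -
      obtain e where e: "e > 0" "ball z0 e \<subseteq> S" using S openE by blast
      show ?thesis
      proof (intro exI[of _ "e/2"] conjI allI impI)
        fix z :: "real^2" assume "\<bar>z $ 1 - h0\<bar> < e/2" "\<bar>z $ 2 - \<tau>0\<bar> < e/2"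
        moreover have "norm (z - z0) \<le> \<bar>z $ 1 - h0\<bar> + \<bar>z $ 2 - \<tau>0\<bar>"
          using norm_le_l1_cart[of "z - z0"] by (simp add: sum_2 z0)
        ultimately have "dist z0 z < e" by (simp add: dist_norm norm_minus_commute)
        then show "z \<in> S" using e by auto
      qed (use e in simp)
    qed
    have "open (Z \<inter> chart -` U)" by (rule continuous_open_preimage[OF ccont Zop U(1)])
    moreover have "z0 \<in> Z \<inter> chart -` U" using z0Z pU p_chart by simp
    ultimately obtain r1 where r1: "r1 > 0" "\<And>z. \<bar>z $ 1 - h0\<bar> < r1 \<Longrightarrow> \<bar>z $ 2 - \<tau>0\<bar> < r1 \<Longrightarrow> z \<in> Z \<inter> chart -` U"
      using box by blast
    define r where "r = min r1 (\<bar>h0\<bar> / 2)"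
    have r: "r > 0" "r \<le> r1" "r \<le> \<bar>h0\<bar> / 2" using r1(1) h0 by (auto simp: r_def)
    have hc: "isCont h \<tau>0" using h_cont t0 by (simp add: continuous_on_eq_continuous_at)
    have hnear: "\<exists>d>0. \<forall>\<tau>. \<bar>\<tau> - \<tau>0\<bar> < d \<longrightarrow> \<tau> \<in> {\<alpha><..<\<beta>} \<and> \<bar>h \<tau> - h0\<bar> < e" if "e > 0" for e
    proof -
      obtain d1 where d1: "d1 > 0" "\<And>\<tau>. dist \<tau> \<tau>0 < d1 \<Longrightarrow> dist (h \<tau>) (h \<tau>0) < e"
        using hc \<open>e > 0\<close> unfolding continuous_at_eps_delta by blast
      show ?thesis
        by (rule exI[of _ "min d1 (min (\<tau>0 - \<alpha>) (\<beta> - \<tau>0))"])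
          (use d1 t0 in \<open>auto simp: dist_real_def h0_def abs_less_iff\<close>)
    qed
    obtain d1 where d1: "d1 > 0" "\<And>\<tau>. \<bar>\<tau> - \<tau>0\<bar> < d1 \<Longrightarrow> \<tau> \<in> {\<alpha><..<\<beta>} \<and> \<bar>h \<tau> - h0\<bar> < r"
      using hnear[OF r(1)] by blast
    define \<delta> where "\<delta> = min d1 r"
    have \<delta>: "\<delta> > 0" "\<delta> \<le> d1" "\<delta> \<le> r" using d1(1) r(1) by (auto simp: \<delta>_def)
    define J where "J = {\<tau>0 - \<delta><..<\<tau>0 + \<delta>}"
    have J: "\<bar>\<tau> - \<tau>0\<bar> < \<delta>" if "\<tau> \<in> J" for \<tau> using that by (auto simp: J_def)
    have Jab: "J \<subseteq> {\<alpha><..<\<beta>}" using d1(2) J \<delta>(2) by force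
    let ?z = "\<lambda>\<tau>. vector [h \<tau>, \<tau>] :: real^2"
    have zJ: "?z \<tau> \<in> Z" if "\<tau> \<in> J" for \<tau>
      using r1(2)[of "?z \<tau>"] d1(2)[of \<tau>] J[OF that] \<delta> r(2) by simp
    let ?X = "\<lambda>\<tau>. P (h \<tau>) \<tau>"
    have chX: "chart (?z \<tau>) = ?X \<tau>" for \<tau> by (simp add: chart_def)
    have XC: "?X \<tau> \<in> C" if "\<tau> \<in> J" for \<tau> using hits Jab that by blast
    have Xinj: "inj_on ?X J"
    proof (rule inj_onI)
      fix a b assume ab: "a \<in> J" "b \<in> J" "?X a = ?X b"
      then have "?z a = ?z b" using RQ[OF zJ[OF ab(1)]] RQ[OF zJ[OF ab(2)]] chX by metis
      then show "a = b" by (metis vector_2(2))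
    qed
    have Xcont: "continuous_on J ?X"
    proof -
      have "continuous_on J (\<lambda>\<tau>. (h \<tau>, \<tau>))"
        by (intro continuous_intros continuous_on_subset[OF h_cont Jab])
      from continuous_on_compose2[OF joint_continuous(1) this] show ?thesis
        using W_section Jab by fastforce
    qed
    obtain \<phi> \<psi> where \<phi>: "homeomorphism C {0<..<1::real} \<phi> \<psi>" using Chom unfolding homeomorphic_def by blast
    have \<phi>C: "continuous_on C \<phi>" "\<phi> ` C = {0<..<1}" "\<And>x. x \<in> C \<Longrightarrow> \<psi> (\<phi> x) = x"
      using \<phi> by (auto simp: homeomorphism_def)
    \<comment> \<open>The hitting points form a relatively open part of the arc C.\<close>
    have "open ((\<phi> \<circ> ?X) ` J)"
    proof (rule invariance_of_domain)
      show "continuous_on J (\<phi> \<circ> ?X)"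
        by (intro continuous_on_compose Xcont continuous_on_subset[OF \<phi>C(1)]) (use XC in auto)
      show "open J" by (simp add: J_def)
      show "inj_on (\<phi> \<circ> ?X) J"
        by (intro comp_inj_on Xinj inj_on_subset[OF inj_on_inverseI[of C \<psi> \<phi>]]) (use \<phi>C(3) XC in auto)
    qed
    then have "openin (top_of_set C) (C \<inter> \<phi> -` ((\<phi> \<circ> ?X) ` J))"
      by (rule continuous_openin_preimage_gen[OF \<phi>C(1)])
    then obtain G where G: "open G" "C \<inter> \<phi> -` ((\<phi> \<circ> ?X) ` J) = C \<inter> G"
      unfolding openin_open by blast
    have GX: "x \<in> ?X ` J" if "x \<in> C" "x \<in> G" for x
    proof -
      have "x \<in> C \<inter> \<phi> -` ((\<phi> \<circ> ?X) ` J)" using that G(2) by blast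
      then obtain \<tau> where \<tau>: "\<tau> \<in> J" "\<phi> x = \<phi> (?X \<tau>)" by auto
      then have "x = ?X \<tau>" using \<phi>C(3)[OF that(1)] \<phi>C(3)[OF XC[OF \<tau>(1)]] by metis
      then show ?thesis using \<tau>(1) by blast
    qed
    have \<tau>0J: "\<tau>0 \<in> J" using \<delta>(1) by (simp add: J_def)
    have pX: "?X \<tau>0 = p" by (simp add: p_def h0_def)
    then have "p \<in> C \<inter> \<phi> -` ((\<phi> \<circ> ?X) ` J)" using \<tau>0J pC by force
    then have pG: "p \<in> G" using G(2) by blast
    have "open (Z \<inter> chart -` G)" by (rule continuous_open_preimage[OF ccont Zop G(1)])
    moreover have "z0 \<in> Z \<inter> chart -` G" using z0Z pG p_chart by simp
    ultimately obtain r2 where r2: "r2 > 0" "\<And>z. \<bar>z $ 1 - h0\<bar> < r2 \<Longrightarrow> \<bar>z $ 2 - \<tau>0\<bar> < r2 \<Longrightarrow> z \<in> Z \<inter> chart -` G"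
      using box by blast
    define \<rho> where "\<rho> = min r r2"
    have \<rho>: "\<rho> > 0" "\<rho> \<le> r" "\<rho> \<le> r2" using r(1) r2(1) by (auto simp: \<rho>_def)
    have "\<rho>/2 > 0" using \<rho>(1) by simp
    from hnear[OF this] obtain d2 where d2: "d2 > 0" "\<And>\<tau>. \<bar>\<tau> - \<tau>0\<bar> < d2 \<Longrightarrow> \<tau> \<in> {\<alpha><..<\<beta>} \<and> \<bar>h \<tau> - h0\<bar> < \<rho>/2"
      by blast
    define \<delta>2 where "\<delta>2 = min d2 (min \<delta> \<rho>)"
    have \<delta>2: "\<delta>2 > 0" "\<delta>2 \<le> d2" "\<delta>2 \<le> \<delta>" "\<delta>2 \<le> \<rho>" using d2(1) \<delta>(1) \<rho>(1) by (auto simp: \<delta>2_def)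
    define Bx where "Bx = {z::real^2. \<bar>z $ 1 - h0\<bar> < \<rho> \<and> \<bar>z $ 2 - \<tau>0\<bar> < \<delta>2}"
    have Bx_open: "open Bx"
      unfolding Bx_def by (intro open_Collect_conj open_Collect_less continuous_intros)
    have BxZ: "z \<in> Z" "chart z \<in> G" "chart z \<in> U" if "z \<in> Bx" for z
      using r1(2)[of z] r2(2)[of z] that \<rho> r \<delta>2 by (auto simp: Bx_def)
    have z0Bx: "z0 \<in> Bx" using \<rho>(1) \<delta>2(1) by (simp add: Bx_def z0)
    define Bp where "Bp = chart ` Bx"
    have Bp_open: "open Bp"
    proof -
      have "openin (top_of_set B) (chart ` Bx)"
        by (rule homeomorphism_imp_open_map[OF hom]) (use BxZ(1) Bx_open Zop in \<open>auto simp: openin_open_eq\<close>)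
      then show ?thesis using Bop by (simp add: Bp_def openin_open_eq)
    qed
    have BpB: "Bp \<subseteq> B" using hom BxZ(1) by (auto simp: Bp_def homeomorphism_def)
    have BpU: "Bp \<subseteq> U" using BxZ(3) by (auto simp: Bp_def)
    have pBp: "p \<in> Bp" using z0Bx p_chart by (auto simp: Bp_def)
    have time: "z $ 2 \<in> {\<alpha><..<\<beta>}" "\<bar>h (z $ 2) - h0\<bar> < \<rho>/2" if "z \<in> Bx" for z
      using d2(2)[of "z $ 2"] that \<delta>2(2) by (auto simp: Bx_def)
    have sing_iff: "chart z \<in> ?K \<longleftrightarrow> z $ 1 = h (z $ 2)" if z: "z \<in> Bx" for z
    proof
      assume "chart z \<in> ?K"
      then have "chart z \<in> C" using CU BxZ(3)[OF z] by blast
      from GX[OF this BxZ(2)[OF z]] obtain \<tau> where \<tau>: "\<tau> \<in> J" "chart z = chart (?z \<tau>)" by (auto simp: chX)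
      then have "z = ?z \<tau>" using RQ[OF BxZ(1)[OF z]] RQ[OF zJ[OF \<tau>(1)]] by metis
      then show "z $ 1 = h (z $ 2)" by simp
    next
      assume "z $ 1 = h (z $ 2)"
      then have "chart z = ?X (z $ 2)" by (simp add: chart_def)
      then show "chart z \<in> ?K" using hits[OF time(1)[OF z]] CU by auto
    qed
    have before: "chart z \<in> V" "normal_dir F u (chart z) = N (chart z)" if z: "z \<in> Bx" and lt: "\<kappa> * (z $ 1 - h (z $ 2)) < 0" for z
    proof -
      have "\<bar>z $ 1 - h0\<bar> < \<bar>h0\<bar> / 2" "\<bar>h (z $ 2) - h0\<bar> < \<bar>h0\<bar> / 2"
        using z time(2)[OF z] \<rho> r(3) by (auto simp: Bx_def)
      then have "0 < h0 \<longrightarrow> 0 < z $ 1 \<and> 0 < h (z $ 2)" "h0 < 0 \<longrightarrow> z $ 1 < 0 \<and> h (z $ 2) < 0"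
        by linarith+
      then have "z $ 1 \<in> closed_segment 0 (h (z $ 2)) - {h (z $ 2)}"
        using \<kappa> lt by (auto simp: closed_segment_eq_real_ivl)
      from before_hitting[OF time(1)[OF z] this]
      show "chart z \<in> V" "normal_dir F u (chart z) = N (chart z)"
        using RQ[OF BxZ(1)[OF z]] by (simp_all add: chart_def N_def)
    qed
    define A where "A = {z \<in> Bx. 0 < \<kappa> * (z $ 1 - h (z $ 2))}"
    have "connected A"
    proof -
      let ?T = "{0<..<1::real} \<times> {\<tau>0 - \<delta>2<..<\<tau>0 + \<delta>2}"
      let ?m = "\<lambda>w. vector [h (snd w) + fst w * (h0 + \<kappa> * \<rho> - h (snd w)), snd w] :: real^2"
      have sub: "{\<tau>0 - \<delta>2<..<\<tau>0 + \<delta>2} \<subseteq> {\<alpha><..<\<beta>}" using d2(2) \<delta>2(2) by force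
      have "continuous_on ?T ?m"
        unfolding vector_2_eq
        by (intro continuous_intros continuous_on_compose2[OF continuous_on_subset[OF h_cont sub]]) auto
      moreover have "connected ?T" by (intro connected_Times) auto
      ultimately have "connected (?m ` ?T)" by (rule connected_continuous_image)
      moreover have "?m ` ?T = A"
      proof (intro set_eqI iffI)
        fix z assume "z \<in> ?m ` ?T"
        then obtain y where y: "y \<in> ?T" "z = ?m y" by blast
        define x where "x = fst y"
        define \<tau> where "\<tau> = snd y"
        have x: "0 < x" "x < 1" "\<bar>\<tau> - \<tau>0\<bar> < \<delta>2" using y(1) by (auto simp: x_def \<tau>_def abs_less_iff)
        have z: "z = vector [h \<tau> + x * (h0 + \<kappa> * \<rho> - h \<tau>), \<tau>]" by (simp add: y(2) x_def \<tau>_def)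
        have hh: "\<bar>h \<tau> - h0\<bar> < \<rho>/2" using d2(2)[of \<tau>] x \<delta>2 by simp
        define w where "w = \<kappa> * (h0 - h \<tau>) + \<rho>"
        have w: "w > 0" using \<kappa>
        proof
          assume "\<kappa> = 1 \<and> 0 < h0" then show ?thesis using hh[unfolded abs_less_iff] \<rho>(1) unfolding w_def by simp
        next
          assume "\<kappa> = - 1 \<and> h0 < 0" then show ?thesis using hh[unfolded abs_less_iff] \<rho>(1) unfolding w_def by simp
        qed
        have e1: "\<kappa> * (z $ 1 - h (z $ 2)) = x * w" using \<kappa> by (auto simp: z w_def algebra_simps)
        have e2: "z $ 1 - h0 = (1 - x) * (h \<tau> - h0) + x * (\<kappa> * \<rho>)" by (simp add: z algebra_simps)
        have "\<bar>z $ 1 - h0\<bar> \<le> (1 - x) * \<bar>h \<tau> - h0\<bar> + x * \<rho>"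
          unfolding e2 using abs_triangle_ineq[of "(1 - x) * (h \<tau> - h0)" "x * (\<kappa> * \<rho>)"] x \<kappa> \<rho>(1) by (auto simp: abs_mult)
        also have "\<dots> < (1 - x) * \<rho> + x * \<rho>"
          using hh x \<rho>(1) by (intro add_strict_right_mono mult_strict_left_mono) auto
        finally have "\<bar>z $ 1 - h0\<bar> < \<rho>" by (simp add: algebra_simps)
        moreover have "0 < \<kappa> * (z $ 1 - h (z $ 2))" unfolding e1 using w x by simp
        moreover have "z $ 2 = \<tau>" by (simp add: z)
        ultimately show "z \<in> A" unfolding A_def Bx_def mem_Collect_eq using x(3) by simp
      next
        fix z assume z: "z \<in> A"
        define \<tau> where "\<tau> = z $ 2"
        have zB: "z \<in> Bx" and pos: "0 < \<kappa> * (z $ 1 - h \<tau>)" using z by (auto simp: A_def \<tau>_def)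
        have hh: "\<bar>h \<tau> - h0\<bar> < \<rho>/2" using time(2)[OF zB] by (simp add: \<tau>_def)
        define w where "w = \<kappa> * (h0 - h \<tau>) + \<rho>"
        have w: "w > 0" using \<kappa>
        proof
          assume "\<kappa> = 1 \<and> 0 < h0" then show ?thesis using hh[unfolded abs_less_iff] \<rho>(1) unfolding w_def by simp
        next
          assume "\<kappa> = - 1 \<and> h0 < 0" then show ?thesis using hh[unfolded abs_less_iff] \<rho>(1) unfolding w_def by simp
        qed
        define x where "x = \<kappa> * (z $ 1 - h \<tau>) / w"
        have x: "0 < x" "x < 1"
        proof -
          show "0 < x" using pos w by (simp add: x_def)
          have "\<kappa> * (z $ 1 - h \<tau>) < w" using zB \<kappa> by (auto simp: Bx_def w_def abs_less_iff)
          then show "x < 1" using w by (simp add: x_def)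
        qed
        have "x * w = \<kappa> * (z $ 1 - h \<tau>)" using w by (simp add: x_def)
        then have "x * (h0 + \<kappa> * \<rho> - h \<tau>) = z $ 1 - h \<tau>" using \<kappa> by (auto simp: w_def algebra_simps)
        then have "?m (x, \<tau>) = z" by (simp add: vec_eq_iff forall_2 \<tau>_def)
        moreover have "(x, \<tau>) \<in> ?T" using x zB by (auto simp: Bx_def \<tau>_def abs_less_iff)
        ultimately show "z \<in> ?m ` ?T" by (metis (no_types, lifting) image_eqI)
      qed
      ultimately show ?thesis by simp
    qed
    then have connA: "connected (chart ` A)"
      using BxZ(1) by (intro connected_continuous_image continuous_on_subset[OF ccont]) (auto simp: A_def)
    have A_sub: "chart ` A \<subseteq> V \<union> V'"
    proof -
      have "chart z \<notin> ?K" "chart z \<in> U" if "z \<in> A" for z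
        using that sing_iff[of z] BxZ(3)[of z] by (auto simp: A_def)
      then show ?thesis using VV'(1) by blast
    qed
    have after: "chart z \<in> V'" if "z \<in> A" for z
    proof -
      have "V \<inter> chart ` A = {} \<or> V' \<inter> chart ` A = {}"
        using connectedD[OF connA VV'(3,4)] VV'(2) A_sub by blast
      moreover have "V' \<inter> chart ` A \<noteq> {}"
      proof -
        have "Bp \<inter> V' \<noteq> {}"
          using clos pBp Bp_open closure_iff_nhds_not_empty[of p V'] unfolding p_def h0_def
          by (metis Int_commute subset_refl)
        then obtain w where w: "w \<in> Bx" "chart w \<in> V'" by (auto simp: Bp_def)
        have "\<not> \<kappa> * (w $ 1 - h (w $ 2)) < 0" using before(1)[OF w(1)] w(2) VV'(2) by blast
        moreover have "w $ 1 \<noteq> h (w $ 2)" using sing_iff[OF w(1)] w(2) VV'(1) by blast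
        ultimately have "w \<in> A" using w(1) \<kappa> by (auto simp: A_def)
        then show ?thesis using w(2) by blast
      qed
      ultimately show ?thesis using that A_sub by blast
    qed
    have nd: "normal_dir F u x = N x" if x: "x \<in> Bp \<inter> V" for x
    proof -
      obtain z where z: "z \<in> Bx" "x = chart z" using x by (auto simp: Bp_def)
      have "z \<notin> A" using after VV'(2) x z(2) by blast
      moreover have "z $ 1 \<noteq> h (z $ 2)" using sing_iff[OF z(1)] x z(2) VV'(1) by blast
      ultimately have "\<kappa> * (z $ 1 - h (z $ 2)) < 0" using z(1) \<kappa> by (auto simp: A_def)
      then show ?thesis using before(2)[OF z(1)] z(2) by simp
    qed
    have onK: "\<exists>\<tau>. \<bar>\<tau> - \<tau>0\<bar> < \<delta>2 \<and> q = ?X \<tau> \<and> ?z \<tau> \<in> Bx" if q: "q \<in> Bp \<inter> ?K" for q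
    proof -
      obtain z where z: "z \<in> Bx" "q = chart z" using q by (auto simp: Bp_def)
      have "z = ?z (z $ 2)" using sing_iff[OF z(1)] q z(2) by (simp add: vec_eq_iff forall_2)
      then show ?thesis using z chX by (metis (mono_tags, lifting) Bx_def mem_Collect_eq)
    qed
    have neg: "negligible (Bp \<inter> ?K)"
    proof -
      let ?G = "{(\<tau>, \<sigma>). \<tau> \<in> {\<tau>0 - \<delta>2<..<\<tau>0 + \<delta>2} \<and> \<sigma> = h \<tau>}"
      let ?f = "\<lambda>w. P (snd w) (fst w)"
      have sub: "{\<tau>0 - \<delta>2<..<\<tau>0 + \<delta>2} \<subseteq> {\<alpha><..<\<beta>}" using d2(2) \<delta>2(2) by force
      have "negligible ?G" by (rule negligible_graph[OF continuous_on_subset[OF h_cont sub]])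
      moreover have "?f differentiable_on ?G"
      proof (rule differentiable_at_imp_differentiable_on)
        fix w assume "w \<in> ?G"
        then have W: "(snd w, fst w) \<in> W" using sub W_section[of "fst w"] by auto
        have "((\<lambda>w::real \<times> real. (snd w, fst w)) has_derivative (\<lambda>w. (snd w, fst w))) (at w)"
          by (intro bounded_linear_imp_has_derivative bounded_linear_Pair bounded_linear_snd bounded_linear_fst)
        from has_derivative_fst[OF has_derivative_compose[OF this joint_derivative[OF W]]]
        show "?f differentiable (at w)" by (auto simp: differentiable_def case_prod_unfold)
      qed
      ultimately have "negligible (?f ` ?G)" by (intro negligible_differentiable_image_negligible) simp_all
      moreover have "Bp \<inter> ?K \<subseteq> ?f ` ?G"
      proof
        fix q assume "q \<in> Bp \<inter> ?K"
        from onK[OF this] obtain \<tau> where "\<bar>\<tau> - \<tau>0\<bar> < \<delta>2" "q = ?f (\<tau>, h \<tau>)" by auto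
        then show "q \<in> ?f ` ?G" by (intro image_eqI[of _ _ "(\<tau>, h \<tau>)"]) (auto simp: abs_less_iff)
      qed
      ultimately show ?thesis by (rule negligible_subset)
    qed
    have cross: "\<exists>c \<phi>. c 0 = q \<and> (\<forall>t\<in>{-(\<rho>/2)<..<\<rho>/2}. c t \<in> Bp \<and> N (c t) = dirN (\<phi> t) \<and>
      (c has_vector_derivative dirT (\<phi> t)) (at t) \<and> (\<phi> has_real_derivative - H (c t)) (at t) \<and>
      (\<kappa> * t < 0 \<longrightarrow> c t \<in> V) \<and> (0 < \<kappa> * t \<longrightarrow> c t \<in> V'))" if q: "q \<in> Bp \<inter> ?K" for q
    proof -
      obtain \<tau> where \<tau>: "\<bar>\<tau> - \<tau>0\<bar> < \<delta>2" "q = ?X \<tau>" using onK[OF q] by blast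
      let ?c = "\<lambda>t. P (h \<tau> + t) \<tau>" and ?\<phi> = "\<lambda>t. \<theta> (h \<tau> + t) \<tau>"
      have main: "?c t \<in> Bp \<and> N (?c t) = dirN (?\<phi> t) \<and>
        (?c has_vector_derivative dirT (?\<phi> t)) (at t) \<and> (?\<phi> has_real_derivative - H (?c t)) (at t) \<and>
        (\<kappa> * t < 0 \<longrightarrow> ?c t \<in> V) \<and> (0 < \<kappa> * t \<longrightarrow> ?c t \<in> V')" if t: "t \<in> {-(\<rho>/2)<..<\<rho>/2}" for t
      proof -
        define z :: "real^2" where "z = vector [h \<tau> + t, \<tau>]"
        have z: "z $ 1 = h \<tau> + t" "z $ 2 = \<tau>" by (simp_all add: z_def)
        have "\<bar>h \<tau> - h0\<bar> < \<rho>/2" using d2(2)[of \<tau>] \<tau>(1) \<delta>2(2) by simp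
        moreover have "- (\<rho>/2) < t" "t < \<rho>/2" using t by auto
        ultimately have "\<bar>h \<tau> + t - h0\<bar> < \<rho>" by linarith
        then have zB: "z \<in> Bx" using \<tau>(1) by (simp add: Bx_def z)
        have cz: "chart z = ?c t" by (simp add: chart_def z)
        have W: "(h \<tau> + t, \<tau>) \<in> W" using ZW[OF BxZ(1)[OF zB]] by (simp add: z)
        have c1: "?c t \<in> Bp" using zB by (auto simp: Bp_def simp flip: cz)
        have c2: "N (?c t) = dirN (?\<phi> t)" using RQ[OF BxZ(1)[OF zB]] by (simp add: N_def z flip: cz)
        have sh: "((\<lambda>t. h \<tau> + t) has_vector_derivative 1) (at t)" by (auto intro!: derivative_eq_intros)
        have c3: "(?c has_vector_derivative dirT (?\<phi> t)) (at t)"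
          using vector_diff_chain_at[OF sh, of "\<lambda>\<sigma>. P \<sigma> \<tau>"] char_system[OF W] by (simp add: o_def)
        have c4: "(?\<phi> has_real_derivative - H (?c t)) (at t)"
          using vector_diff_chain_at[OF sh, of "\<lambda>\<sigma>. \<theta> \<sigma> \<tau>"] char_system[OF W]
          by (simp add: o_def has_real_derivative_iff_has_vector_derivative)
        have c5: "\<kappa> * t < 0 \<longrightarrow> ?c t \<in> V" using before(1)[OF zB] cz by (simp add: z)
        have c6: "0 < \<kappa> * t \<longrightarrow> ?c t \<in> V'" using after[of z] zB cz by (simp add: z A_def)
        show ?thesis using c1 c2 c3 c4 c5 c6 by blast
      qed
      show ?thesis by (rule exI[of _ ?c], rule exI[of _ ?\<phi>]) (use \<tau>(2) main in simp)
    qed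
    have nds: "nondegenerate_side \<Omega> F H u C V q" if q: "q \<in> Bp \<inter> ?K" for q
    proof -
      obtain \<tau> where \<tau>: "\<bar>\<tau> - \<tau>0\<bar> < \<delta>2" "q = ?X \<tau>" "?z \<tau> \<in> Bx" using onK[OF q] by blast
      have "jac (h \<tau>) \<tau> \<noteq> 0" using Zj[OF BxZ(1)[OF \<tau>(3)]] by simp
      moreover have "\<tau> \<in> {\<alpha><..<\<beta>}" using time(1)[OF \<tau>(3)] by simp
      ultimately show ?thesis using side_at \<tau>(2) by simp
    qed
    have N1: "norm (N x) = 1" for x by (simp add: N_def)
    have "C1_on Bp N"
      using ext(1) BpB unfolding C1_on_def by (auto intro: continuous_on_subset)
    then have "normal_extension F H u ?K V V' \<kappa> Bp N (\<rho>/2)"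
      unfolding normal_extension_def
      using Bp_open N1 ext(2) BpB nd neg \<open>\<rho>/2 > 0\<close> cross by blast
    then show ?thesis
      using pBp BpU nds unfolding \<kappa>_def p_def h0_def by blast
  qed
qed

end

text \<open>The sign of \<open>hitting_sign\<close> is a sign of the hitting time, so that \<open>\<kappa>\<close> depends on the curl
  only and is common to both sides.\<close>

lemma side_structure:
  assumes dom: "open \<Omega>" and C1: "C1_on \<Omega> F" "C1_on \<Omega> H" "C1_on \<Omega> u"
    and side: "nondegenerate_side \<Omega> F H u (U \<inter> sing_set \<Omega> F u) V p" and curl: "curl F p \<noteq> 0"
    and U: "open U" "U \<subseteq> \<Omega>" and Chom: "(U \<inter> sing_set \<Omega> F u) homeomorphic {0<..<1::real}"
    and VV': "U - sing_set \<Omega> F u = V \<union> V'" "V \<inter> V' = {}" "open V" "open V'" and clos: "p \<in> closure V'"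
  shows "\<exists>B N \<epsilon>. p \<in> B \<and> B \<subseteq> U \<and> normal_extension F H u (sing_set \<Omega> F u) V V' (- sgn (curl F p)) B N \<epsilon> \<and>
    (\<forall>q\<in>B \<inter> sing_set \<Omega> F u. nondegenerate_side \<Omega> F H u (U \<inter> sing_set \<Omega> F u) V q)"
proof -
  let ?C = "U \<inter> sing_set \<Omega> F u"
  obtain \<alpha> \<beta> \<tau>0 s g W P \<theta> h P\<sigma> P\<tau> where
    t0: "\<alpha> < \<tau>0" "\<tau>0 < \<beta>" and s: "s \<in> {1, -1}"
    and seed: "\<forall>\<tau>\<in>{\<alpha><..<\<beta>}. g \<tau> \<in> V \<and> (g has_vector_derivative s *\<^sub>R normal_dir F u (g \<tau>)) (at \<tau>)"
    and W: "open W" "W \<subseteq> UNIV \<times> {\<alpha><..<\<beta>}"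
    and sec: "\<forall>\<tau>\<in>{\<alpha><..<\<beta>}. is_interval {\<sigma>. (\<sigma>, \<tau>) \<in> W} \<and> (0, \<tau>) \<in> W \<and> (h \<tau>, \<tau>) \<in> W"
    and sys: "\<forall>(\<sigma>, \<tau>)\<in>W. P \<sigma> \<tau> \<in> \<Omega> \<and>
         ((\<lambda>\<sigma>. P \<sigma> \<tau>) has_vector_derivative vector [sin (\<theta> \<sigma> \<tau>), - cos (\<theta> \<sigma> \<tau>)]) (at \<sigma>) \<and>
         ((\<lambda>\<sigma>. \<theta> \<sigma> \<tau>) has_real_derivative - H (P \<sigma> \<tau>)) (at \<sigma>)"
    and ini: "\<forall>\<tau>\<in>{\<alpha><..<\<beta>}. P 0 \<tau> = g \<tau> \<and> normal_dir F u (g \<tau>) = vector [cos (\<theta> 0 \<tau>), sin (\<theta> 0 \<tau>)]"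
    and thc: "continuous_on {\<alpha><..<\<beta>} (\<theta> 0)"
    and hit: "\<forall>\<tau>\<in>{\<alpha><..<\<beta>}. P (h \<tau>) \<tau> \<in> ?C \<and>
         (\<forall>\<sigma>\<in>closed_segment 0 (h \<tau>) - {h \<tau>}. P \<sigma> \<tau> \<in> V \<and>
            ((\<lambda>\<sigma>. P \<sigma> \<tau>) has_vector_derivative char_dir F u (P \<sigma> \<tau>)) (at \<sigma>))"
    and hc: "continuous_on {\<alpha><..<\<beta>} h" and p: "P (h \<tau>0) \<tau>0 = p"
    and P\<sigma>: "((\<lambda>\<sigma>. P \<sigma> \<tau>0) has_vector_derivative P\<sigma>) (at (h \<tau>0))"
    and P\<tau>: "((\<lambda>\<tau>. P (h \<tau>0) \<tau>) has_vector_derivative P\<tau>) (at \<tau>0)"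
    and det: "det (transpose (vector [P\<sigma>, P\<tau>]) :: real^2^2) \<noteq> 0"
    using side unfolding nondegenerate_side_def by (elim exE conjE) (rule that; assumption)
  interpret char_fan \<Omega> F H u ?C V \<alpha> \<beta> s g W P \<theta> h
  proof (rule char_fan.intro)
    show "V \<subseteq> \<Omega> - sing_set \<Omega> F u" using VV'(1) U(2) by blast
    show "(\<sigma>, \<tau>) \<in> W \<Longrightarrow> P \<sigma> \<tau> \<in> \<Omega> \<and> ((\<lambda>\<sigma>. P \<sigma> \<tau>) has_vector_derivative dirT (\<theta> \<sigma> \<tau>)) (at \<sigma>) \<and>
         ((\<lambda>\<sigma>. \<theta> \<sigma> \<tau>) has_real_derivative - H (P \<sigma> \<tau>)) (at \<sigma>)" for \<sigma> \<tau>
      using sys unfolding dirT_def by blast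
    show "\<tau> \<in> {\<alpha><..<\<beta>} \<Longrightarrow> P 0 \<tau> = g \<tau> \<and> normal_dir F u (g \<tau>) = dirN (\<theta> 0 \<tau>)" for \<tau>
      using ini unfolding dirN_def by blast
  qed (use dom C1 s seed W sec thc hit hc in blast)+
  have t0': "\<tau>0 \<in> {\<alpha><..<\<beta>}" using t0 by simp
  have W0: "(h \<tau>0, \<tau>0) \<in> W" using sec t0' by blast
  have "((\<lambda>\<tau>'. P (h \<tau>0) \<tau>') has_vector_derivative fst (param_deriv (h \<tau>0) \<tau>0)) (at \<tau>0)"
    using bounded_linear.has_vector_derivative[OF bounded_linear_fst param_has_derivative[OF W0]] by simp
  then have e1: "P\<tau> = fst (param_deriv (h \<tau>0) \<tau>0)" by (rule vector_derivative_unique_at[OF P\<tau>])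
  have e2: "P\<sigma> = dirT (\<theta> (h \<tau>0) \<tau>0)"
    using vector_derivative_unique_at[OF P\<sigma>] char_system[OF W0] by blast
  have "det (transpose (vector [P\<sigma>, P\<tau>]) :: real^2^2) = jac (h \<tau>0) \<tau>0"
    unfolding det_columns e1 e2 jac_def inner_2 by simp
  then have j0: "jac (h \<tau>0) \<tau>0 \<noteq> 0" using det by simp
  have "curl F p * h \<tau>0 < 0" using hitting_sign[OF t0' j0] curl p by simp
  then have sg: "sgn (h \<tau>0) = - sgn (curl F p)" by (auto simp: sgn_if mult_less_0_iff)
  show ?thesis
    using local_structure[OF t0' j0 U refl VV' _ Chom] clos unfolding p sg by blast
qed

text \<open>Supplies the limit of points of the opposite side that \<open>side_structure\<close> needs.\<close>

lemma char_curve_end_closure: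
  assumes "char_curve_from \<Omega> F u q c \<epsilon>" "c ` {0<..<\<epsilon>} \<subseteq> V"
  shows "q \<in> closure V"
proof -
  have c: "0 < \<epsilon>" "continuous_on {0..<\<epsilon>} c" "c 0 = q" using assms(1) by (auto simp: char_curve_from_def)
  have "continuous_on (closure {0<..<\<epsilon>/2}) c"
    using c(1) by (intro continuous_on_subset[OF c(2)]) auto
  then have "c ` closure {0<..<\<epsilon>/2} \<subseteq> closure V"
    by (rule image_closure_subset) (use assms(2) c(1) closure_subset[of V] in force)+
  moreover have "0 \<in> closure {0<..<\<epsilon>/2}" using c(1) by simp
  ultimately show ?thesis using c(3) by blast
qed

section \<open>Approximation by test functions\<close>

definition smooth :: "(real^2 \<Rightarrow> real) \<Rightarrow> bool"
  where "smooth f \<longleftrightarrow> (\<forall>ks. iter_partial ks f differentiable_on UNIV)"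

lemma smooth_coinduct:
  assumes "X f" and "\<And>f x. X f \<Longrightarrow> f differentiable (at x)" and "\<And>f i. X f \<Longrightarrow> X (partial i f)"
  shows "smooth f"
proof -
  have "X (iter_partial ks f)" for ks by (induction ks) (use assms in auto)
  then show ?thesis
    unfolding smooth_def using assms(2) by (simp add: differentiable_at_imp_differentiable_on)
qed

fun flat_poly :: "nat \<Rightarrow> real poly" where
  "flat_poly 0 = 1"
| "flat_poly (Suc n) = monom 1 2 * (flat_poly n - pderiv (flat_poly n))"

text \<open>The derivatives of \<open>exp (- 1 / t)\<close>, continued by zero to \<open>t \<le> 0\<close>: \<open>flat (Suc n)\<close> is the
  derivative of \<open>flat n\<close>.\<close>

definition flat :: "nat \<Rightarrow> real \<Rightarrow> real"
  where "flat n t = (if t > 0 then poly (flat_poly n) (1/t) * exp (- (1/t)) else 0)"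

lemma poly_exp_tendsto_0: "((\<lambda>x. poly p x * exp (- x)) \<longlongrightarrow> (0::real)) at_top"
proof -
  have "((\<lambda>x. \<Sum>i\<le>degree p. coeff p i * (x ^ i / exp x)) \<longlongrightarrow> (\<Sum>i\<le>degree p. coeff p i * 0)) at_top"
    by (intro tendsto_sum tendsto_mult tendsto_const tendsto_power_div_exp_0)
  then show ?thesis by (simp add: poly_altdef exp_minus divide_inverse sum_distrib_right mult.assoc)
qed

lemma flat_derivative: "(flat n has_real_derivative flat (Suc n) t) (at t)"
proof -
  consider "t > 0" | "t < 0" | "t = 0" by linarith
  then show ?thesis
  proof cases
    case 1
    let ?f = "\<lambda>t. poly (flat_poly n) (1/t) * exp (- (1/t))"
    have d: "(?f has_real_derivative (1/t)\<^sup>2 * (poly (flat_poly n) (1/t) - poly (pderiv (flat_poly n)) (1/t)) * exp (- (1/t))) (at t)"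
    proof -
      have i: "((\<lambda>t. 1/t) has_real_derivative - (1/t)\<^sup>2) (at t)"
        using 1 by (auto intro!: derivative_eq_intros simp: power2_eq_square field_simps)
      have p: "((\<lambda>t. poly (flat_poly n) (1/t)) has_real_derivative poly (pderiv (flat_poly n)) (1/t) * - (1/t)\<^sup>2) (at t)"
        by (rule DERIV_chain2[OF poly_DERIV i])
      have e: "((\<lambda>t. exp (- (1/t))) has_real_derivative exp (- (1/t)) * (1/t)\<^sup>2) (at t)"
        using DERIV_chain2[OF DERIV_exp DERIV_minus[OF i]] by simp
      show ?thesis using DERIV_mult[OF p e] by (simp add: algebra_simps)
    qed
    have "(flat n has_real_derivative (1/t)\<^sup>2 * (poly (flat_poly n) (1/t) - poly (pderiv (flat_poly n)) (1/t)) * exp (- (1/t))) (at t)"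
      by (rule has_field_derivative_transform_within[OF d 1]) (auto simp: flat_def dist_real_def)
    then show ?thesis using 1 by (simp add: flat_def poly_monom)
  next
    case 2
    have "(flat n has_real_derivative 0) (at t)"
      by (rule has_field_derivative_transform_within[of "\<lambda>_. 0" _ _ _ "- t"]) (use 2 in \<open>auto simp: flat_def dist_real_def\<close>)
    then show ?thesis using 2 by (simp add: flat_def)
  next
    case 3
    have "((\<lambda>h. flat n h / h) \<longlongrightarrow> 0) (at_right 0)"
    proof -
      have "((\<lambda>h. poly (pCons 0 (flat_poly n)) (inverse h) * exp (- inverse h)) \<longlongrightarrow> (0::real)) (at_right 0)"
        by (rule filterlim_compose[OF poly_exp_tendsto_0 filterlim_inverse_at_top_right])
      moreover have "\<forall>\<^sub>F h in at_right 0. poly (pCons 0 (flat_poly n)) (inverse h) * exp (- inverse h) = flat n h / (h::real)"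
        by (rule eventually_at_right_less[THEN eventually_mono]) (simp add: flat_def inverse_eq_divide)
      ultimately show ?thesis by (rule Lim_transform_eventually)
    qed
    moreover have "((\<lambda>h. flat n h / h) \<longlongrightarrow> 0) (at_left 0)"
    proof -
      have "\<forall>\<^sub>F h in at_left 0. 0 = flat n h / (h::real)"
        by (auto simp: flat_def eventually_at_filter)
      then show ?thesis by (rule Lim_transform_eventually[OF tendsto_const])
    qed
    ultimately have "((\<lambda>h. flat n h / h) \<longlongrightarrow> 0) (at 0)" by (simp add: filterlim_split_at)
    then show ?thesis using 3 by (simp add: has_field_derivative_iff flat_def)
  qed
qed

lemma flat_nonneg: "flat 0 t \<ge> 0" and flat_pos: "t > 0 \<Longrightarrow> flat 0 t > 0" and flat_zero: "t \<le> 0 \<Longrightarrow> flat n t = 0"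
  and flat1_nonneg: "flat 1 t \<ge> 0" and flat1_pos: "t > 0 \<Longrightarrow> flat 1 t > 0"
  by (auto simp: flat_def poly_monom)

lemma flat_continuous: "continuous_on S (flat n)"
  by (intro continuous_at_imp_continuous_on ballI DERIV_isCont[OF flat_derivative])

text \<open>A class of functions that contains the mollifiers and is closed under partial derivatives,
  so that smoothness of its members follows by coinduction.\<close>

inductive elementary :: "(real^2 \<Rightarrow> real) \<Rightarrow> bool" where
  "elementary (\<lambda>x. flat n (a + b * x $ i))"
| "elementary (\<lambda>x. c)"
| "elementary f \<Longrightarrow> elementary g \<Longrightarrow> elementary (\<lambda>x. f x + g x)"
| "elementary f \<Longrightarrow> elementary g \<Longrightarrow> elementary (\<lambda>x. f x * g x)"

lemma elementary_partial: "elementary f \<Longrightarrow> (\<forall>x. f differentiable (at x)) \<and> (\<forall>i. elementary (partial i f))"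
proof (induction rule: elementary.induct)
  case (1 n a b j)
  have d: "((\<lambda>x::real^2. flat n (a + b * x $ j)) has_derivative (\<lambda>v. flat (Suc n) (a + b * x $ j) * (b * v $ j))) (at x)" for x
  proof -
    have "((\<lambda>x::real^2. a + b * x $ j) has_derivative (\<lambda>v. b * v $ j)) (at x)"
      by (auto intro!: derivative_eq_intros bounded_linear_imp_has_derivative[OF bounded_linear_vec_nth])
    from has_derivative_compose[OF this flat_derivative[unfolded has_field_derivative_def]] show ?thesis .
  qed
  have "partial i (\<lambda>x. flat n (a + b * x $ j)) = (\<lambda>x. flat (Suc n) (a + b * x $ j) * (b * axis i 1 $ j))" for i
    by (rule ext) (rule partial_eq[OF d])
  then show ?case
    using d by (auto simp: differentiable_def intro: elementary.intros)
next
  case (2 c)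
  have "((\<lambda>x::real^2. c) has_derivative (\<lambda>v. 0)) (at x)" for x by simp
  then have "partial i (\<lambda>x::real^2. c) = (\<lambda>x. 0)" for i by (intro ext) (rule partial_eq)
  then show ?case by (auto intro: elementary.intros)
next
  case (3 f g)
  have "partial i (\<lambda>x. f x + g x) = (\<lambda>x. partial i f x + partial i g x)" for i
  proof
    fix x
    have "((\<lambda>x. f x + g x) has_derivative (\<lambda>v. frechet_derivative f (at x) v + frechet_derivative g (at x) v)) (at x)"
      using 3 by (intro has_derivative_add) (simp_all add: frechet_derivative_works[symmetric])
    from partial_eq[OF this] show "partial i (\<lambda>x. f x + g x) x = partial i f x + partial i g x"
      by (simp add: partial_def)
  qed
  then show ?case using 3 by (auto intro: elementary.intros)
next
  case (4 f g)
  have "partial i (\<lambda>x. f x * g x) = (\<lambda>x. f x * partial i g x + partial i f x * g x)" for i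
  proof
    fix x
    have "((\<lambda>x. f x * g x) has_derivative (\<lambda>v. f x * frechet_derivative g (at x) v + frechet_derivative f (at x) v * g x)) (at x)"
      using 4 by (intro has_derivative_mult) (simp_all add: frechet_derivative_works[symmetric])
    from partial_eq[OF this] show "partial i (\<lambda>x. f x * g x) x = f x * partial i g x + partial i f x * g x"
      by (simp add: partial_def)
  qed
  moreover have "elementary (\<lambda>x. f x * partial i g x + partial i f x * g x)" for i
    using 4 by (intro elementary.intros(3,4)) simp_all
  ultimately show ?case using 4 by simp
qed

lemma elementary_C1: "elementary f \<Longrightarrow> C1_on UNIV f"
  unfolding C1_on_def
  using elementary_partial by (blast intro: continuous_at_imp_continuous_on differentiable_imp_continuous_within)

definition mollifier :: "real \<Rightarrow> real^2 \<Rightarrow> real"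
  where "mollifier \<epsilon> x = flat 0 (\<epsilon> + 1 * x $ 1) * flat 0 (\<epsilon> + (-1) * x $ 1) * (flat 0 (\<epsilon> + 1 * x $ 2) * flat 0 (\<epsilon> + (-1) * x $ 2))"

lemma mollifier_elementary: "elementary (mollifier \<epsilon>)"
  unfolding mollifier_def[abs_def] by (intro elementary.intros)

lemma mollifier_support: "mollifier \<epsilon> x \<noteq> 0 \<Longrightarrow> \<bar>x $ 1\<bar> < \<epsilon> \<and> \<bar>x $ 2\<bar> < \<epsilon>"
proof -
  assume "mollifier \<epsilon> x \<noteq> 0"
  then have nz: "flat 0 (\<epsilon> + 1 * x $ 1) \<noteq> 0" "flat 0 (\<epsilon> + (-1) * x $ 1) \<noteq> 0"
    "flat 0 (\<epsilon> + 1 * x $ 2) \<noteq> 0" "flat 0 (\<epsilon> + (-1) * x $ 2) \<noteq> 0"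
    by (auto simp: mollifier_def)
  have "0 < t" if "flat 0 t \<noteq> 0" for t using that flat_zero[of t 0] by linarith
  from this[OF nz(1)] this[OF nz(2)] this[OF nz(3)] this[OF nz(4)]
  show ?thesis by (simp add: abs_less_iff)
qed

lemma mollifier_nonneg: "mollifier \<epsilon> x \<ge> 0"
  unfolding mollifier_def by (intro mult_nonneg_nonneg flat_nonneg)

lemma mollifier_pos: "\<epsilon> > 0 \<Longrightarrow> mollifier \<epsilon> 0 > 0"
  unfolding mollifier_def by (simp add: flat_pos)

lemma mollifier_even: "mollifier \<epsilon> (x - y) = mollifier \<epsilon> (y - x)"
  unfolding mollifier_def by (simp add: algebra_simps)

lemma integral_cbox_eq_UNIV:
  fixes f :: "'a::euclidean_space \<Rightarrow> 'b::banach"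
  assumes "\<And>x. x \<notin> cbox a b \<Longrightarrow> f x = 0"
  shows "integral (cbox a b) f = integral UNIV f"
proof -
  have "(\<lambda>x. if x \<in> cbox a b then f x else 0) = f" using assms by auto
  then show ?thesis using integral_restrict_UNIV[of "cbox a b" f] by simp
qed

text \<open>The integral of f is invariant under translations; differentiate under the integral sign.\<close>

lemma integral_partial_zero:
  fixes f :: "real^2 \<Rightarrow> real"
  assumes f: "C1_on UNIV f" and supp: "\<And>x. f x \<noteq> 0 \<Longrightarrow> x \<in> cbox a b"
  shows "integral UNIV (partial i f) = 0" "integral (cbox (a - 1) (b + 1)) (partial i f) = 0"
proof -
  let ?A = "a - 1" and ?B = "b + 1" and ?e = "axis i 1 :: real^2"
  have comp: "\<bar>?e $ k\<bar> \<le> 1" for k by (simp add: axis_def)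
  have mem: "x \<in> cbox (?A + t *\<^sub>R ?e) (?B + t *\<^sub>R ?e)" if "x \<in> cbox a b" "\<bar>t\<bar> \<le> 1" for x t
  proof -
    have "\<bar>t * ?e $ k\<bar> \<le> 1" for k unfolding abs_mult using comp[of k] that(2) by (intro mult_le_one) auto
    then have "- 1 \<le> t * ?e $ k \<and> t * ?e $ k \<le> 1" for k by (simp add: abs_le_iff)
    then show ?thesis using that(1) unfolding mem_box_cart
      by (simp) (smt (verit))
  qed
  have const: "integral (cbox ?A ?B) (\<lambda>y. f (t *\<^sub>R ?e + y)) = integral UNIV f" if "\<bar>t\<bar> \<le> 1" for t
  proof -
    have "integral (cbox ?A ?B) (\<lambda>y. f (t *\<^sub>R ?e + y)) = integral (cbox (?A + t *\<^sub>R ?e) (?B + t *\<^sub>R ?e)) f"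
      using integral_shift_cbox_plus[of ?A ?B f "t *\<^sub>R ?e"] by (simp add: o_def)
    also have "\<dots> = integral UNIV f"
      by (rule integral_cbox_eq_UNIV) (use supp mem that in blast)
    finally show ?thesis .
  qed
  have fd: "(f has_derivative frechet_derivative f (at x)) (at x)" for x by (rule C1_on_has_derivative[OF f]) simp
  have cp: "continuous_on UNIV (partial i f)" using f by (simp add: C1_on_def)
  have cf: "continuous_on UNIV f" by (rule C1_on_continuous[OF f])
  have "((\<lambda>t. integral (cbox ?A ?B) (\<lambda>y. f (t *\<^sub>R ?e + y))) has_vector_derivative
      integral (cbox ?A ?B) (\<lambda>y. partial i f (0 *\<^sub>R ?e + y))) (at 0 within {-1..1})"
  proof (rule leibniz_rule_vector_derivative[where fx = "\<lambda>t y. partial i f (t *\<^sub>R ?e + y)"])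
    show "((\<lambda>t. f (t *\<^sub>R ?e + y)) has_vector_derivative partial i f (t *\<^sub>R ?e + y)) (at t within {-1..1})" for t y
    proof -
      have "((\<lambda>t. t *\<^sub>R ?e + y) has_derivative (\<lambda>h. h *\<^sub>R ?e)) (at t)" by (auto intro!: derivative_eq_intros)
      from has_derivative_compose[OF this fd]
      have "((\<lambda>t. f (t *\<^sub>R ?e + y)) has_derivative (\<lambda>h. frechet_derivative f (at (t *\<^sub>R ?e + y)) (h *\<^sub>R ?e))) (at t)" .
      moreover have "frechet_derivative f (at (t *\<^sub>R ?e + y)) (h *\<^sub>R ?e) = h *\<^sub>R partial i f (t *\<^sub>R ?e + y)" for h
        unfolding partial_def using linear_cmul[OF has_derivative_linear[OF fd]] .
      ultimately have "((\<lambda>t. f (t *\<^sub>R ?e + y)) has_vector_derivative partial i f (t *\<^sub>R ?e + y)) (at t)"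
        unfolding has_vector_derivative_def by simp
      then show ?thesis by (rule has_vector_derivative_at_within)
    qed
    show "(\<lambda>y. f (t *\<^sub>R ?e + y)) integrable_on cbox ?A ?B" for t
      by (intro integrable_continuous continuous_on_compose2[OF cf] continuous_intros) auto
    show "continuous_on ({-1..1} \<times> cbox ?A ?B) (\<lambda>(t, y). partial i f (t *\<^sub>R ?e + y))"
      unfolding case_prod_unfold by (intro continuous_on_compose2[OF cp] continuous_intros) auto
  qed auto
  then have "((\<lambda>t. integral (cbox ?A ?B) (\<lambda>y. f (t *\<^sub>R ?e + y))) has_vector_derivative
      integral (cbox ?A ?B) (partial i f)) (at 0)"
    using at_within_interior[of 0 "{-1..1::real}"] by simp
  moreover have "((\<lambda>t. integral (cbox ?A ?B) (\<lambda>y. f (t *\<^sub>R ?e + y))) has_vector_derivative 0) (at 0)"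
  proof -
    have "((\<lambda>t::real. integral UNIV f) has_vector_derivative 0) (at 0)" by simp
    then show ?thesis
      by (rule has_vector_derivative_transform_within[of _ _ _ _ 1]) (use const in \<open>auto simp: dist_real_def\<close>)
  qed
  ultimately show A: "integral (cbox ?A ?B) (partial i f) = 0"
    using vector_derivative_unique_at by blast
  have zero: "partial i f x = 0" if "x \<notin> cbox a b" for x
  proof -
    have "(f has_derivative (\<lambda>v. 0)) (at x)"
    proof (rule has_derivative_transform_within_open[of "\<lambda>_. 0" _ _ _ "- cbox a b"])
      show "0 = f y" if "y \<in> - cbox a b" for y using supp[of y] that by auto
    qed (use that in \<open>auto simp: open_Compl closed_cbox\<close>)
    from partial_eq[OF this] show ?thesis by simp
  qed
  have "integral (cbox ?A ?B) (partial i f) = integral UNIV (partial i f)"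
  proof (rule integral_cbox_eq_UNIV)
    fix x assume "x \<notin> cbox ?A ?B"
    then have "x \<notin> cbox a b" using mem[of x 0] by auto
    then show "partial i f x = 0" by (rule zero)
  qed
  with A show "integral UNIV (partial i f) = 0" by simp
qed

text \<open>Convolution of f with the kernel \<open>\<eta>\<close>. The box \<open>cbox a b\<close> contains the support of f in the
  applications; it makes the integral proper and differentiation under it elementary.\<close>

definition conv :: "real^2 \<Rightarrow> real^2 \<Rightarrow> (real^2 \<Rightarrow> real) \<Rightarrow> (real^2 \<Rightarrow> real) \<Rightarrow> real^2 \<Rightarrow> real"
  where "conv a b f \<eta> x = integral (cbox a b) (\<lambda>y. f y * \<eta> (x - y))"

lemma C1_on_real_derivative:
  assumes "C1_on A f" "x \<in> A"
  shows "(f has_derivative (\<lambda>v. grad f x \<bullet> v)) (at x)"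
proof -
  have d: "f differentiable (at x)" using assms by (simp add: C1_on_def)
  have "frechet_derivative f (at x) = (\<lambda>v. grad f x \<bullet> v)"
    by (rule ext) (rule frechet_derivative_eq_grad[OF d])
  with C1_on_has_derivative[OF assms] show ?thesis by simp
qed

lemma conv_derivative:
  assumes f: "continuous_on UNIV f" and \<eta>: "C1_on UNIV \<eta>"
  shows "conv a b f \<eta> differentiable (at x)" "partial i (conv a b f \<eta>) x = conv a b f (partial i \<eta>) x"
proof -
  let ?D = "\<lambda>x y. f y *\<^sub>R blinfun_inner_left (grad \<eta> (x - y))"
  have cg: "continuous_on UNIV (grad \<eta>)" by (rule C1_on_grad_continuous[OF \<eta>])
  have c\<eta>: "continuous_on UNIV \<eta>" by (rule C1_on_continuous[OF \<eta>])
  have "((\<lambda>x. integral (cbox a b) (\<lambda>y. f y * \<eta> (x - y))) has_derivative blinfun_apply (integral (cbox a b) (?D x))) (at x within UNIV)"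
  proof (rule leibniz_rule)
    fix x y :: "real^2"
    have "((\<lambda>x. x - y) has_derivative (\<lambda>v. v)) (at x)" by (auto intro!: derivative_eq_intros)
    from has_derivative_compose[OF this C1_on_real_derivative[OF \<eta>]]
    have "((\<lambda>x. \<eta> (x - y)) has_derivative (\<lambda>v. grad \<eta> (x - y) \<bullet> v)) (at x)" by simp
    then have "((\<lambda>x. f y * \<eta> (x - y)) has_derivative (\<lambda>v. f y * (grad \<eta> (x - y) \<bullet> v))) (at x)"
      by (rule has_derivative_mult_right)
    moreover have "blinfun_apply (?D x y) = (\<lambda>v. f y * (grad \<eta> (x - y) \<bullet> v))"
      by (rule ext) (simp add: blinfun.scaleR_left inner_commute)
    ultimately show "((\<lambda>x. f y * \<eta> (x - y)) has_derivative blinfun_apply (?D x y)) (at x within UNIV)"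
      by simp
  next
    show "(\<lambda>y. f y * \<eta> (x - y)) integrable_on cbox a b" for x
      by (intro integrable_continuous continuous_on_mult continuous_on_subset[OF f]
          continuous_on_compose2[OF c\<eta>] continuous_intros) auto
    show "continuous_on (UNIV \<times> cbox a b) (\<lambda>(x, y). ?D x y)"
      unfolding case_prod_unfold
      by (intro continuous_on_scaleR continuous_on_compose2[OF f]
          bounded_linear.continuous_on[OF bounded_linear_blinfun_inner_left]
          continuous_on_compose2[OF cg] continuous_intros) auto
  qed auto
  then have d: "(conv a b f \<eta> has_derivative blinfun_apply (integral (cbox a b) (?D x))) (at x)"
    by (simp add: conv_def[abs_def])
  then show "conv a b f \<eta> differentiable (at x)" by (rule differentiableI)
  have int: "?D x integrable_on cbox a b"
    by (intro integrable_continuous continuous_on_scaleR continuous_on_subset[OF f]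
        bounded_linear.continuous_on[OF bounded_linear_blinfun_inner_left]
        continuous_on_compose2[OF cg] continuous_intros) auto
  have "partial i (conv a b f \<eta>) x = blinfun_apply (integral (cbox a b) (?D x)) (axis i 1)"
    by (rule partial_eq[OF d])
  also have "\<dots> = integral (cbox a b) ((\<lambda>g. blinfun_apply g (axis i 1)) \<circ> ?D x)"
    by (rule integral_linear[OF int blinfun.bounded_linear_left, symmetric])
  also have "\<dots> = conv a b f (partial i \<eta>) x"
    by (simp add: conv_def o_def blinfun.scaleR_left inner_axis' grad_def)
  finally show "partial i (conv a b f \<eta>) x = conv a b f (partial i \<eta>) x" .
qed

lemma conv_smooth:
  assumes f: "continuous_on UNIV f" and \<eta>: "elementary \<eta>"
  shows "smooth (conv a b f \<eta>)"
proof (rule smooth_coinduct[where X = "\<lambda>g. \<exists>\<eta>. elementary \<eta> \<and> g = conv a b f \<eta>"])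
  show "\<exists>\<eta>'. elementary \<eta>' \<and> conv a b f \<eta> = conv a b f \<eta>'" using \<eta> by blast
  fix g assume "\<exists>\<eta>. elementary \<eta> \<and> g = conv a b f \<eta>"
  then obtain \<eta> where e: "elementary \<eta>" "g = conv a b f \<eta>" by blast
  show "g differentiable (at x)" for x
    unfolding e(2) by (rule conv_derivative(1)[OF f elementary_C1[OF e(1)]])
  have "partial i g = conv a b f (partial i \<eta>)" for i
    unfolding e(2) by (rule ext) (rule conv_derivative(2)[OF f elementary_C1[OF e(1)]])
  then show "\<exists>\<eta>. elementary \<eta> \<and> partial i g = conv a b f \<eta>" for i
    using elementary_partial[OF e(1)] by blast
qed

lemma partial_zero_outside:
  assumes "closed S" "\<And>x. f x \<noteq> 0 \<Longrightarrow> x \<in> S" "x \<notin> S"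
  shows "partial i f x = 0"
proof -
  have "(f has_derivative (\<lambda>v. 0)) (at x)"
    by (rule has_derivative_transform_within_open[of "\<lambda>_. 0" _ _ _ "- S"]) (use assms in \<open>auto simp: open_Compl\<close>)
  from partial_eq[OF this] show ?thesis by simp
qed

lemma compact_support_uniformly_continuous:
  fixes g :: "real^2 \<Rightarrow> real"
  assumes g: "continuous_on UNIV g" and K: "compact K" "\<And>x. x \<notin> K \<Longrightarrow> g x = 0" and "e > 0"
  obtains d where "d > 0" "\<And>x y :: real^2. norm (x - y) < d \<Longrightarrow> \<bar>g x - g y\<bar> < e"
proof -
  define K' where "K' = {x + y |x y. x \<in> K \<and> y \<in> cball 0 1}"
  have "compact K'" unfolding K'_def by (rule compact_sums[OF K(1) compact_cball])
  then have "uniformly_continuous_on K' g"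
    by (intro compact_uniformly_continuous continuous_on_subset[OF g]) auto
  then obtain d where d: "d > 0" "\<And>x y. x \<in> K' \<Longrightarrow> y \<in> K' \<Longrightarrow> dist y x < d \<Longrightarrow> dist (g y) (g x) < e"
    using \<open>e > 0\<close> unfolding uniformly_continuous_on_def by blast
  have K'I: "y \<in> K'" if "x \<in> K" "norm (y - x) \<le> 1" for x y
    unfolding K'_def using that by (intro CollectI exI[of _ x] exI[of _ "y - x"]) simp
  show ?thesis
  proof (rule that[of "min d 1"])
    fix x y :: "real^2" assume xy: "norm (x - y) < min d 1"
    show "\<bar>g x - g y\<bar> < e"
    proof (cases "x \<in> K \<or> y \<in> K")
      case True
      then have "x \<in> K'" "y \<in> K'"
        using K'I[of x x] K'I[of x y] K'I[of y x] K'I[of y y] xy by (auto simp: norm_minus_commute)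
      then show ?thesis using d(2)[of x y] xy by (simp add: dist_norm norm_minus_commute abs_minus_commute)
    qed (use K(2) \<open>e > 0\<close> in auto)
  qed (use d in auto)
qed

lemma norm_le_components: "norm (v::real^2) \<le> \<bar>v $ 1\<bar> + \<bar>v $ 2\<bar>"
  using norm_le_l1_cart[of v] by (simp add: sum_2)

text \<open>A \<open>C\<^sup>1\<close> function is tested against the weak equation through smooth approximations; only the
  gradients occur in the limit, so they alone need to be close.\<close>

lemma mollification:
  assumes \<phi>: "C1_on UNIV \<phi>" and K: "compact K" "\<And>x. \<phi> x \<noteq> 0 \<Longrightarrow> x \<in> K"
    and B: "open B" "K \<subseteq> B" and "e > 0"
  obtains \<phi>' where "test_function B \<phi>'" "\<And>x. norm (grad \<phi>' x - grad \<phi> x) \<le> e"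
proof -
  have c\<phi>: "continuous_on UNIV \<phi>" by (rule C1_on_continuous[OF \<phi>])
  have cp: "continuous_on UNIV (partial i \<phi>)" for i using \<phi> by (simp add: C1_on_def)
  have pz: "partial i \<phi> x = 0" if "x \<notin> K" for i x
    by (rule partial_zero_outside[OF compact_imp_closed[OF K(1)] K(2) that])
  have "e/2 > 0" using \<open>e > 0\<close> by simp
  obtain d1 where d1: "d1 > 0" "\<And>x y. norm (x - y) < d1 \<Longrightarrow> \<bar>partial 1 \<phi> x - partial 1 \<phi> y\<bar> < e/2"
    by (rule compact_support_uniformly_continuous[OF cp[of 1] K(1) pz[where i = 1] \<open>e/2 > 0\<close>]) (assumption, rule that)
  obtain d2 where d2: "d2 > 0" "\<And>x y. norm (x - y) < d2 \<Longrightarrow> \<bar>partial 2 \<phi> x - partial 2 \<phi> y\<bar> < e/2"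
    by (rule compact_support_uniformly_continuous[OF cp[of 2] K(1) pz[where i = 2] \<open>e/2 > 0\<close>]) (assumption, rule that)
  obtain r where r: "r > 0" "(\<Union>x\<in>K. cball x r) \<subseteq> B"
    using compact_subset_open_imp_cball_epsilon_subset[OF K(1) B] by blast
  obtain a where a: "K \<subseteq> cbox (-a) a" using bounded_subset_cbox_symmetric[OF compact_imp_bounded[OF K(1)]] by blast
  define m where "m = Min {d1, d2, r, 1}"
  have m: "m > 0" "m \<le> d1" "m \<le> d2" "m \<le> r" "m \<le> 1" using d1(1) d2(1) r(1) by (auto simp: m_def)
  define \<epsilon> where "\<epsilon> = m / 4"
  have \<epsilon>: "\<epsilon> > 0" "2*\<epsilon> < d1" "2*\<epsilon> < d2" "2*\<epsilon> \<le> r" "\<epsilon> < 1"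
    using m by (simp_all add: \<epsilon>_def)
  have mC1: "C1_on UNIV (mollifier \<epsilon>)" by (rule elementary_C1[OF mollifier_elementary])
  let ?one = "cbox (-1) (1::real^2)"
  have msupp: "x \<in> ?one" if "mollifier \<epsilon> x \<noteq> 0" for x
    using mollifier_support[OF that] \<epsilon>(5) by (auto simp: mem_box_cart forall_2 abs_less_iff)
  define I where "I = integral UNIV (mollifier \<epsilon>)"
  have I1: "integral ?one (mollifier \<epsilon>) = I"
    unfolding I_def by (rule integral_cbox_eq_UNIV) (use msupp in blast)
  have mint: "mollifier \<epsilon> integrable_on cbox c d" for c d
    by (intro integrable_continuous continuous_on_subset[OF C1_on_continuous[OF mC1]]) auto
  have "I > 0"
  proof -
    have "I \<ge> 0" unfolding I1[symmetric] by (intro integral_nonneg mint mollifier_nonneg)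
    moreover have "I \<noteq> 0"
    proof
      assume "I = 0"
      then have "(mollifier \<epsilon> has_integral 0) ?one" using integrable_integral[OF mint] I1 by metis
      then have "mollifier \<epsilon> 0 = 0"
      proof (rule has_integral_0_cbox_imp_0[rotated 2])
        show "continuous_on ?one (mollifier \<epsilon>)" by (rule continuous_on_subset[OF C1_on_continuous[OF mC1]]) simp
        have "(0::real^2) \<in> box (-1) 1" by (simp add: mem_box_cart)
        then show "box (-1) (1::real^2) \<noteq> {}" by blast
        show "(0::real^2) \<in> ?one" by (simp add: mem_box_cart)
      qed (rule mollifier_nonneg)
      then show False using mollifier_pos[OF \<epsilon>(1)] by simp
    qed
    ultimately show ?thesis by simp
  qed
  define \<eta> where "\<eta> = (\<lambda>x. (1/I) * mollifier \<epsilon> x)"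
  have \<eta>el: "elementary \<eta>" unfolding \<eta>_def by (intro elementary.intros mollifier_elementary)
  have \<eta>C1: "C1_on UNIV \<eta>" by (rule elementary_C1[OF \<eta>el])
  have \<eta>c: "continuous_on UNIV \<eta>" by (rule C1_on_continuous[OF \<eta>C1])
  have \<eta>0: "\<eta> x \<ge> 0" for x using \<open>I > 0\<close> mollifier_nonneg by (simp add: \<eta>_def)
  have \<eta>supp: "x \<in> ?one" "norm x \<le> 2*\<epsilon>" if "\<eta> x \<noteq> 0" for x
  proof -
    have m: "mollifier \<epsilon> x \<noteq> 0" using that by (simp add: \<eta>_def)
    then show "x \<in> ?one" by (rule msupp)
    show "norm x \<le> 2*\<epsilon>" using norm_le_components[of x] mollifier_support[OF m] by linarith
  qed
  define \<phi>' where "\<phi>' = conv (-a) a \<phi> \<eta>"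
  have "smooth \<phi>'" unfolding \<phi>'_def by (rule conv_smooth[OF c\<phi> \<eta>el])
  have supp: "x \<in> (\<Union>z\<in>K. cball z r)" if "\<phi>' x \<noteq> 0" for x
  proof (rule ccontr)
    assume n: "x \<notin> (\<Union>z\<in>K. cball z r)"
    have "\<phi> y * \<eta> (x - y) = 0" for y
    proof (rule ccontr)
      assume "\<phi> y * \<eta> (x - y) \<noteq> 0"
      then have "y \<in> K" "norm (x - y) \<le> 2*\<epsilon>" using K(2)[of y] \<eta>supp(2)[of "x - y"] by auto
      then have "x \<in> cball y r" using \<epsilon>(4) by (simp add: dist_norm norm_minus_commute)
      then show False using n \<open>y \<in> K\<close> by blast
    qed
    then have z: "(\<lambda>y. \<phi> y * \<eta> (x - y)) = (\<lambda>y. 0)" by (rule ext)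
    have "\<phi>' x = 0" unfolding \<phi>'_def conv_def z by simp
    with that show False by simp
  qed
  have compS: "compact (\<Union>z\<in>K. cball z r)"
  proof -
    have "(\<Union>z\<in>K. cball z r) = {x + y |x y. x \<in> K \<and> y \<in> cball 0 r}"
      by (force simp: dist_norm norm_minus_commute intro: exI[of _ "_ - _"])
    then show ?thesis using compact_sums[OF K(1) compact_cball[of 0 r]] by simp
  qed
  have clo: "closure {x. \<phi>' x \<noteq> 0} \<subseteq> (\<Union>z\<in>K. cball z r)"
    by (rule closure_minimal) (use supp compact_imp_closed[OF compS] in auto)
  have test: "test_function B \<phi>'"
    unfolding test_function_def
  proof (intro conjI)
    show "\<forall>ks. iter_partial ks \<phi>' differentiable_on UNIV" using \<open>smooth \<phi>'\<close> by (simp add: smooth_def)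
    show "compact (closure {x. \<phi>' x \<noteq> 0})"
      using compact_Int_closed[OF compS closed_closure, of "{x. \<phi>' x \<noteq> 0}"] clo by (simp add: Int_absorb1)
    show "closure {x. \<phi>' x \<noteq> 0} \<subseteq> B" using clo r(2) by blast
  qed
  have close: "\<bar>partial i \<phi>' x - partial i \<phi> x\<bar> \<le> e/2"
    if near: "\<And>x y. norm (x - y) \<le> 2*\<epsilon> \<Longrightarrow> \<bar>partial i \<phi> x - partial i \<phi> y\<bar> < e/2" for i x
  proof -
    let ?p = "partial i \<phi>"
    define w where "w = (\<lambda>y. \<phi> y * \<eta> (x - y))"
    have wd: "(w has_derivative (\<lambda>v. \<phi> y * - (grad \<eta> (x - y) \<bullet> v) + (grad \<phi> y \<bullet> v) * \<eta> (x - y))) (at y)" for y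
    proof -
      have "((\<lambda>y. x - y) has_derivative (\<lambda>v. - v)) (at y)" by (auto intro!: derivative_eq_intros)
      from has_derivative_compose[OF this C1_on_real_derivative[OF \<eta>C1]]
      have "((\<lambda>y. \<eta> (x - y)) has_derivative (\<lambda>v. - (grad \<eta> (x - y) \<bullet> v))) (at y)" by simp
      from has_derivative_mult[OF C1_on_real_derivative[OF \<phi>] this] show ?thesis by (simp add: w_def)
    qed
    have wp: "partial k w y = - (\<phi> y * partial k \<eta> (x - y)) + partial k \<phi> y * \<eta> (x - y)" for k y
      using partial_eq[OF wd, of k y] by (simp add: inner_axis grad_def)
    have p\<eta>: "continuous_on UNIV (partial k \<eta>)" for k using \<eta>C1 by (simp add: C1_on_def)
    have cw: "continuous_on S (\<lambda>y. \<phi> y * partial k \<eta> (x - y))" "continuous_on S (\<lambda>y. partial k \<phi> y * \<eta> (x - y))" for k S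
      by (intro continuous_on_mult continuous_on_subset[OF c\<phi>] continuous_on_subset[OF cp]
          continuous_on_compose2[OF p\<eta>] continuous_on_compose2[OF \<eta>c] continuous_intros; simp)+
    have wC1: "C1_on UNIV w"
      unfolding C1_on_def
    proof (intro conjI ballI allI)
      show "w differentiable (at y)" for y by (rule differentiableI[OF wd])
      show "continuous_on UNIV (partial k w)" for k
        unfolding wp[abs_def] by (intro continuous_intros cw)
    qed
    have "integral UNIV (partial i w) = 0"
      by (rule integral_partial_zero(1)[OF wC1, of "-a" a]) (use K(2) a in \<open>auto simp: w_def\<close>)
    moreover have "integral (cbox (-a) a) (partial i w) = integral UNIV (partial i w)"
    proof (rule integral_cbox_eq_UNIV)
      fix y assume "y \<notin> cbox (-a) a"
      then have "y \<notin> K" using a by blast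
      then show "partial i w y = 0" using pz K(2) unfolding wp by fastforce
    qed
    moreover have "integral (cbox (-a) a) (partial i w)
        = - integral (cbox (-a) a) (\<lambda>y. \<phi> y * partial i \<eta> (x - y)) + integral (cbox (-a) a) (\<lambda>y. ?p y * \<eta> (x - y))"
      unfolding wp[abs_def]
      by (subst integral_add) (auto intro!: integrable_continuous cw continuous_on_minus)
    ultimately have "partial i \<phi>' x = integral (cbox (-a) a) (\<lambda>y. ?p y * \<eta> (x - y))"
      unfolding \<phi>'_def conv_derivative(2)[OF c\<phi> \<eta>C1] by (simp add: conv_def)
    also have "\<dots> = integral UNIV (\<lambda>y. ?p y * \<eta> (x - y))"
      by (rule integral_cbox_eq_UNIV) (use pz a in auto)
    finally have p1: "partial i \<phi>' x = integral UNIV (\<lambda>y. ?p y * \<eta> (x - y))" .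
    obtain c where c: "cbox (-a) a \<union> cbox (x - 1) (x + 1) \<subseteq> cbox (-c) c"
      using bounded_subset_cbox_symmetric[OF bounded_Un[THEN iffD2, OF conjI[OF bounded_cbox bounded_cbox]]] by blast
    have \<eta>x: "y \<in> cbox (x - 1) (x + 1)" if "\<eta> (x - y) \<noteq> 0" for y
      using \<eta>supp(1)[OF that] by (auto simp: mem_box_cart forall_2)
    have int1: "integral (cbox (-c) c) (\<lambda>y. \<eta> (x - y)) = 1"
    proof -
      have ev: "(\<lambda>y. \<eta> (x - y)) = \<eta> \<circ> (+) (- x)"
        by (rule ext) (simp add: \<eta>_def mollifier_even)
      have "integral (cbox (-c) c) (\<lambda>y. \<eta> (x - y)) = integral (cbox (- c + - x) (c + - x)) \<eta>"
        unfolding ev by (rule integral_shift_cbox_plus)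
      also have "\<dots> = integral UNIV \<eta>"
      proof (rule integral_cbox_eq_UNIV, rule ccontr)
        fix z assume z: "z \<notin> cbox (- c + - x) (c + - x)" "\<eta> z \<noteq> 0"
        have "\<eta> (x - (x + z)) \<noteq> 0" using z(2) mollifier_even[of \<epsilon> 0 z] by (simp add: \<eta>_def)
        from \<eta>x[OF this] have "x + z \<in> cbox (-c) c" using c by blast
        then have "z \<in> cbox (- c + - x) (c + - x)" by (simp add: mem_box_cart) (smt (verit))
        with z(1) show False by simp
      qed
      also have "\<dots> = 1" using \<open>I > 0\<close> by (simp add: \<eta>_def I_def)
      finally show ?thesis .
    qed
    have "integral UNIV (\<lambda>y. ?p y * \<eta> (x - y)) = integral (cbox (-c) c) (\<lambda>y. ?p y * \<eta> (x - y))"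
      by (rule integral_cbox_eq_UNIV[symmetric]) (use \<eta>x c in fastforce)
    then have "partial i \<phi>' x - ?p x = integral (cbox (-c) c) (\<lambda>y. ?p y * \<eta> (x - y)) - ?p x * integral (cbox (-c) c) (\<lambda>y. \<eta> (x - y))"
      by (simp add: p1 int1)
    also have "\<dots> = integral (cbox (-c) c) (\<lambda>y. ?p y * \<eta> (x - y) - ?p x * \<eta> (x - y))"
    proof -
      have "(\<lambda>y. \<eta> (x - y)) integrable_on cbox (-c) c"
        by (intro integrable_continuous continuous_on_compose2[OF \<eta>c] continuous_intros) auto
      then show ?thesis
        by (subst integral_diff) (auto intro!: integrable_continuous cw integrable_on_mult_right)
    qed
    finally have diff: "partial i \<phi>' x - ?p x = integral (cbox (-c) c) (\<lambda>y. ?p y * \<eta> (x - y) - ?p x * \<eta> (x - y))" .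
    have ic: "(\<lambda>y. \<eta> (x - y)) integrable_on cbox (-c) c"
      by (intro integrable_continuous continuous_on_compose2[OF \<eta>c] continuous_intros) auto
    have "norm (integral (cbox (-c) c) (\<lambda>y. ?p y * \<eta> (x - y) - ?p x * \<eta> (x - y))) \<le> integral (cbox (-c) c) (\<lambda>y. e/2 * \<eta> (x - y))"
    proof (rule integral_norm_bound_integral)
      show "(\<lambda>y. ?p y * \<eta> (x - y) - ?p x * \<eta> (x - y)) integrable_on cbox (-c) c"
        by (intro integrable_diff integrable_continuous cw integrable_on_mult_right ic)
      show "(\<lambda>y. e/2 * \<eta> (x - y)) integrable_on cbox (-c) c" by (intro integrable_on_mult_right ic)
      show "norm (?p y * \<eta> (x - y) - ?p x * \<eta> (x - y)) \<le> e/2 * \<eta> (x - y)" for y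
      proof (cases "\<eta> (x - y) = 0")
        case False
        then have "\<bar>?p x - ?p y\<bar> < e/2" using \<eta>supp(2) near by blast
        moreover have "norm (?p y * \<eta> (x - y) - ?p x * \<eta> (x - y)) = \<bar>?p x - ?p y\<bar> * \<eta> (x - y)"
          using \<eta>0[of "x - y"] by (simp add: abs_mult abs_minus_commute flip: left_diff_distrib)
        moreover have "\<bar>?p x - ?p y\<bar> * \<eta> (x - y) \<le> e/2 * \<eta> (x - y)" if "\<bar>?p x - ?p y\<bar> < e/2"
          by (rule mult_right_mono) (use that \<eta>0[of "x - y"] in simp_all)
        ultimately show ?thesis by simp
      qed simp
    qed
    also have "\<dots> = e/2" using int1 by simp
    finally show ?thesis by (simp add: diff)
  qed
  have "norm (grad \<phi>' x - grad \<phi> x) \<le> e" for x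
  proof -
    have "\<bar>partial 1 \<phi>' x - partial 1 \<phi> x\<bar> \<le> e/2" by (rule close) (use d1(2) \<epsilon>(2) in force)
    moreover have "\<bar>partial 2 \<phi>' x - partial 2 \<phi> x\<bar> \<le> e/2" by (rule close) (use d2(2) \<epsilon>(3) in force)
    ultimately show ?thesis
      using norm_le_components[of "grad \<phi>' x - grad \<phi> x"] by (simp add: grad_def)
  qed
  with test show ?thesis by (rule that)
qed

section \<open>Continuity of the flux across the singular curve\<close>

lemma smooth_uminus: "smooth f \<Longrightarrow> smooth (\<lambda>x. - f x)"
proof (rule smooth_coinduct[where X = "\<lambda>g. \<exists>f. smooth f \<and> g = (\<lambda>x. - f x)"])
  fix g assume "\<exists>f. smooth f \<and> g = (\<lambda>x. - f x)"
  then obtain f where f: "smooth f" "g = (\<lambda>x. - f x)" by blast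
  have fd: "f differentiable (at x)" for x
  proof -
    have "iter_partial [] f differentiable_on UNIV" using f(1) unfolding smooth_def by blast
    then show ?thesis by (simp add: differentiable_on_def)
  qed
  have sp: "smooth (partial i f)" for i
  proof -
    have "iter_partial ks (partial i f) = iter_partial (ks @ [i]) f" for ks by (induction ks) auto
    then show ?thesis using f(1) by (simp add: smooth_def)
  qed
  show "g differentiable (at x)" for x unfolding f(2) by (intro differentiable_minus fd)
  have "partial i g = (\<lambda>x. - partial i f x)" for i
  proof
    fix x
    have "(g has_derivative (\<lambda>v. - frechet_derivative f (at x) v)) (at x)"
      unfolding f(2) using fd by (intro has_derivative_minus) (simp add: frechet_derivative_works[symmetric])
    from partial_eq[OF this] show "partial i g x = - partial i f x" by (simp add: partial_def)
  qed
  then show "\<exists>f. smooth f \<and> partial i g = (\<lambda>x. - f x)" for i using sp by blast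
qed blast

lemma test_function_uminus: "test_function B \<phi> \<Longrightarrow> test_function B (\<lambda>x. - \<phi> x)"
  using smooth_uminus[of \<phi>] by (simp add: test_function_def smooth_def)

lemma test_function_mono: "test_function B \<phi> \<Longrightarrow> B \<subseteq> A \<Longrightarrow> test_function A \<phi>"
  by (auto simp: test_function_def)

lemma test_function_C1: "test_function B \<phi> \<Longrightarrow> C1_on UNIV \<phi>"
proof -
  assume t: "test_function B \<phi>"
  have d: "iter_partial ks \<phi> differentiable (at x)" for ks x
    using t by (simp add: test_function_def differentiable_on_def)
  have "continuous_on UNIV (partial i \<phi>)" for i
    using d[of "[i]"] by (auto intro!: continuous_at_imp_continuous_on differentiable_imp_continuous_within)
  then show ?thesis using d[of "[]"] by (simp add: C1_on_def)
qed

lemma integrable_compact_support: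
  fixes f :: "real^2 \<Rightarrow> real"
  assumes "compact S" "continuous_on S f" "\<And>x. x \<notin> S \<Longrightarrow> f x = 0"
  shows "integrable lborel f"
proof -
  have "integrable lborel (\<lambda>x. indicator S x *\<^sub>R f x)" by (rule borel_integrable_compact[OF assms(1,2)])
  moreover have "(\<lambda>x. indicator S x *\<^sub>R f x) = f" using assms(3) by (auto simp: indicator_def fun_eq_iff)
  ultimately show ?thesis by simp
qed

lemma grad_zero_outside:
  assumes "closed S" "\<And>x. f x \<noteq> 0 \<Longrightarrow> x \<in> S" "x \<notin> S"
  shows "grad f x = 0"
  by (simp add: grad_def vec_eq_iff partial_zero_outside[where f = f and S = S, OF assms])

text \<open>The product rule writes \<open>N \<bullet> grad \<phi> + divergence N * \<phi>\<close> as a sum of partial derivatives of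
  compactly supported functions, each of which has integral zero. Extension by zero is harmless,
  since \<open>\<phi>\<close> vanishes near the boundary of B.\<close>

lemma integral_field_grad:
  fixes N :: "real^2 \<Rightarrow> real^2"
  assumes B: "open B" and N: "C1_on B N" and \<phi>: "C1_on UNIV \<phi>"
    and S: "compact S" "S \<subseteq> B" "\<And>x. \<phi> x \<noteq> 0 \<Longrightarrow> x \<in> S"
  shows "integrable lborel (\<lambda>x. N x \<bullet> grad \<phi> x)" "integrable lborel (\<lambda>x. divergence N x * \<phi> x)"
    "integral\<^sup>L lborel (\<lambda>x. N x \<bullet> grad \<phi> x) + integral\<^sup>L lborel (\<lambda>x. divergence N x * \<phi> x) = 0"
proof -
  have cN: "continuous_on B N" by (rule C1_on_continuous[OF N])
  have cpN: "continuous_on B (partial i N)" for i using N by (simp add: C1_on_def)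
  have c\<phi>: "continuous_on UNIV \<phi>" by (rule C1_on_continuous[OF \<phi>])
  have cg: "continuous_on UNIV (grad \<phi>)" by (rule C1_on_grad_continuous[OF \<phi>])
  have g0: "grad \<phi> x = 0" if "x \<notin> S" for x
    by (rule grad_zero_outside[OF compact_imp_closed[OF S(1)] S(3) that])
  have \<phi>0: "\<phi> x = 0" if "x \<notin> S" for x using S(3) that by blast
  show i1: "integrable lborel (\<lambda>x. N x \<bullet> grad \<phi> x)"
    by (rule integrable_compact_support[OF S(1)])
      (intro continuous_intros continuous_on_subset[OF cN S(2)] continuous_on_subset[OF cg], simp, simp add: g0)
  have "continuous_on B (divergence N)"
    unfolding divergence_def[abs_def] by (intro continuous_intros cpN)
  then show i2: "integrable lborel (\<lambda>x. divergence N x * \<phi> x)"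
    by (intro integrable_compact_support[OF S(1)] continuous_on_mult continuous_on_subset[OF c\<phi>])
      (auto intro: continuous_on_subset[OF _ S(2)] simp: \<phi>0)
  obtain a where a: "S \<subseteq> cbox (-a) a" using bounded_subset_cbox_symmetric[OF compact_imp_bounded[OF S(1)]] by blast
  define w where "w k x = (if x \<in> B then \<phi> x * N x $ k else 0)" for k :: 2 and x
  have wd: "(w k has_derivative (\<lambda>v. \<phi> x * (frechet_derivative N (at x) v $ k) + (grad \<phi> x \<bullet> v) * N x $ k)) (at x)"
    if x: "x \<in> B" for k x
  proof -
    have "((\<lambda>x. N x $ k) has_derivative (\<lambda>v. frechet_derivative N (at x) v $ k)) (at x)"
      using has_derivative_compose[OF C1_on_has_derivative[OF N x] bounded_linear_imp_has_derivative[OF bounded_linear_vec_nth[of k]]] .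
    from has_derivative_mult[OF C1_on_real_derivative[OF \<phi>, of x] this]
    have "((\<lambda>x. \<phi> x * N x $ k) has_derivative (\<lambda>v. \<phi> x * (frechet_derivative N (at x) v $ k) + (grad \<phi> x \<bullet> v) * N x $ k)) (at x)"
      by simp
    then show ?thesis
      by (rule has_derivative_transform_within_open[OF _ B x]) (simp add: w_def)
  qed
  have w0: "(w k has_derivative (\<lambda>v. 0)) (at x)" if x: "x \<notin> S" for k x
    by (rule has_derivative_transform_within_open[of "\<lambda>_. 0" _ _ _ "- S"])
      (use x \<phi>0 compact_imp_closed[OF S(1)] in \<open>auto simp: w_def open_Compl\<close>)
  define p where "p i k x = (if x \<in> B then \<phi> x * partial i N x $ k + partial i \<phi> x * N x $ k else 0)" for i k :: 2 and x
  have wp: "partial i (w k) x = p i k x" for i k x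
  proof (cases "x \<in> B")
    case True
    then show ?thesis using partial_eq[OF wd[OF True], of i k] by (simp add: p_def inner_axis grad_def partial_def)
  next
    case False
    then have "x \<notin> S" using S(2) by blast
    from partial_eq[OF w0[OF this]] False show ?thesis by (simp add: p_def)
  qed
  have pz: "p i k x = 0" if "x \<notin> S" for i k x
    using wp[of i k x] partial_eq[OF w0[OF that]] by simp
  have cp: "continuous_on UNIV (p i k)" for i k
  proof -
    have "continuous_on B (\<lambda>x. \<phi> x * partial i N x $ k + partial i \<phi> x * N x $ k)"
      using \<phi> by (intro continuous_intros cpN cN continuous_on_subset[OF c\<phi>]) (auto simp: C1_on_def intro: continuous_on_subset)
    then have c1: "continuous_on B (p i k)" by (rule continuous_on_eq) (simp add: p_def)
    have c2: "continuous_on (- S) (p i k)"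
      by (rule continuous_on_eq[OF continuous_on_const[of _ 0]]) (simp add: pz)
    have "continuous_on (B \<union> - S) (p i k)"
      using c1 c2 B compact_imp_closed[OF S(1)] by (intro continuous_on_open_Un) (auto simp: open_Compl)
    moreover have "B \<union> - S = UNIV" using S(2) by blast
    ultimately show ?thesis by simp
  qed
  have wC1: "C1_on UNIV (w k)" for k
    unfolding C1_on_def
  proof (intro conjI ballI allI)
    show "w k differentiable (at x)" for x
      using differentiableI[OF wd[of x k]] differentiableI[OF w0[of x k]] S(2) by blast
    show "continuous_on UNIV (partial i (w k))" for i
      unfolding wp[abs_def] by (rule cp)
  qed
  have pint: "integrable lborel (p i k)" for i k
    by (rule integrable_compact_support[OF S(1)]) (use pz in \<open>auto intro: continuous_on_subset[OF cp]\<close>)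
  have zero: "integral\<^sup>L lborel (p k k) = 0" for k
  proof -
    have "integral UNIV (partial k (w k)) = 0"
      by (rule integral_partial_zero(1)[OF wC1, of _ "-a" a]) (use \<phi>0 a in \<open>auto simp: w_def split: if_splits\<close>)
    then show ?thesis using integral_lborel[OF pint[of k k]] by (simp add: wp[abs_def])
  qed
  have "N x \<bullet> grad \<phi> x + divergence N x * \<phi> x = p 1 1 x + p 2 2 x" for x
  proof (cases "x \<in> B")
    case True
    then show ?thesis by (simp add: p_def inner_2 grad_def divergence_def algebra_simps)
  next
    case False
    then have "x \<notin> S" using S(2) by blast
    then show ?thesis using pz g0 \<phi>0 by simp
  qed
  then have "integral\<^sup>L lborel (\<lambda>x. N x \<bullet> grad \<phi> x + divergence N x * \<phi> x) = integral\<^sup>L lborel (\<lambda>x. p 1 1 x + p 2 2 x)"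
    by simp
  then show "integral\<^sup>L lborel (\<lambda>x. N x \<bullet> grad \<phi> x) + integral\<^sup>L lborel (\<lambda>x. divergence N x * \<phi> x) = 0"
    using i1 i2 pint zero by simp
qed

text \<open>Since the singular set is null, the first term of the weak inequality vanishes on B, and the
  inequality for \<open>\<phi>\<close> and \<open>-\<phi>\<close> is an equality. Subtracting the integration by parts of \<open>N'\<close> on all
  of B cancels the part over \<open>V'\<close> and the term with H, and leaves the integral of the difference
  over V.\<close>

lemma weak_jump_test:
  assumes dom: "open \<Omega>" and F: "C1_on \<Omega> F" and u: "C1_on \<Omega> u" and weak: "weak_solution \<Omega> F H u"
    and B: "open B" "B \<subseteq> \<Omega>" and V: "open V" "open V'" "V \<inter> V' = {}" "B - sing_set \<Omega> F u = B \<inter> (V \<union> V')"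
    and neg: "negligible (B \<inter> sing_set \<Omega> F u)"
    and N: "C1_on B N" "\<And>x. x \<in> B \<inter> V \<Longrightarrow> normal_dir F u x = N x"
    and N': "C1_on B N'" "\<And>x. x \<in> B \<inter> V' \<Longrightarrow> normal_dir F u x = N' x" "\<And>x. x \<in> B \<Longrightarrow> divergence N' x = H x"
    and \<phi>: "test_function B \<phi>"
  shows "integral\<^sup>L lborel (\<lambda>x. indicator V x * ((N x - N' x) \<bullet> grad \<phi> x)) = 0"
proof -
  let ?K = "sing_set \<Omega> F u"
  have cG: "continuous_on \<Omega> (\<lambda>x. grad u x + F x)"
    by (intro continuous_intros C1_on_grad_continuous[OF u] C1_on_continuous[OF F])
  have BK: "B \<inter> ?K \<in> sets borel"
  proof -
    have "closedin (top_of_set \<Omega>) {x \<in> \<Omega>. grad u x + F x = 0}"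
      by (rule continuous_closedin_preimage_constant[OF cG])
    then obtain T where "closed T" "?K = \<Omega> \<inter> T" unfolding sing_set_def closedin_closed by blast
    then show ?thesis using B(1) dom by auto
  qed
  have "B \<inter> ?K \<in> null_sets lborel"
    using neg BK by (simp add: negligible_iff_null_sets null_sets_completion_iff)
  then have AE: "AE x in lborel. x \<notin> B \<inter> ?K" by (rule AE_not_in)
  have ge: "integral\<^sup>L lborel (\<lambda>x. indicator V x * ((N x - N' x) \<bullet> grad \<psi> x)) \<ge> 0" if t: "test_function B \<psi>" for \<psi>
  proof -
    define S where "S = closure {x. \<psi> x \<noteq> 0}"
    have S: "compact S" "S \<subseteq> B" "\<And>x. \<psi> x \<noteq> 0 \<Longrightarrow> x \<in> S"
      using t closure_subset[of "{x. \<psi> x \<noteq> 0}"] by (auto simp: test_function_def S_def)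
    have \<psi>: "C1_on UNIV \<psi>" by (rule test_function_C1[OF t])
    have g0: "grad \<psi> x = 0" if "x \<notin> B" for x
      by (rule grad_zero_outside[OF compact_imp_closed[OF S(1)] S(3)]) (use that S(2) in auto)
    note i = integral_field_grad[OF B(1) N'(1) \<psi> S] integral_field_grad(1)[OF B(1) N(1) \<psi> S]
    have iV: "integrable lborel (\<lambda>x. indicator V x * ((N x - N' x) \<bullet> grad \<psi> x))"
    proof -
      have "integrable lborel (\<lambda>x. N x \<bullet> grad \<psi> x - N' x \<bullet> grad \<psi> x)" using i(1,4) by simp
      then have "integrable lborel (\<lambda>x. indicator V x *\<^sub>R (N x \<bullet> grad \<psi> x - N' x \<bullet> grad \<psi> x))"
        using V(1) by (intro integrable_mult_indicator) auto
      then show ?thesis by (simp add: inner_diff_left)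
    qed
    have "test_function \<Omega> \<psi>" by (rule test_function_mono[OF t B(2)])
    then have w: "(LINT x:?K|lborel. norm (grad \<psi> x)) + (LINT x:\<Omega> - ?K|lborel. normal_dir F u x \<bullet> grad \<psi> x)
      + (LINT x:\<Omega>|lborel. H x * \<psi> x) \<ge> 0" using weak by (simp add: weak_solution_def)
    have T1: "(LINT x:?K|lborel. norm (grad \<psi> x)) = 0"
      unfolding set_lebesgue_integral_def
    proof (rule integral_eq_zero_AE)
      show "AE x in lborel. indicat_real ?K x *\<^sub>R norm (grad \<psi> x) = 0"
        using AE by (rule AE_mp) (use g0 in \<open>auto simp: indicator_def\<close>)
    qed
    have T2: "(LINT x:\<Omega> - ?K|lborel. normal_dir F u x \<bullet> grad \<psi> x)
      = integral\<^sup>L lborel (\<lambda>x. N' x \<bullet> grad \<psi> x + indicator V x * ((N x - N' x) \<bullet> grad \<psi> x))"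
      unfolding set_lebesgue_integral_def
    proof (rule integral_cong_AE)
      let ?f = "\<lambda>x. indicat_real (\<Omega> - ?K) x *\<^sub>R (normal_dir F u x \<bullet> grad \<psi> x)"
      let ?g = "\<lambda>x. N' x \<bullet> grad \<psi> x + indicator V x * ((N x - N' x) \<bullet> grad \<psi> x)"
      have "?f x = ?g x" if "x \<notin> B \<inter> ?K" for x
      proof (cases "x \<in> B")
        case True
        then have "x \<in> \<Omega> - ?K" "x \<in> V \<or> x \<in> V'" using that B(2) V(4) by auto
        then show ?thesis
          using N(2)[of x] N'(2)[of x] True V(3) by (auto simp: indicator_def inner_diff_left)
      qed (simp add: g0)
      then show "AE x in lborel. ?f x = ?g x" using AE by (auto elim: AE_mp)
      show "?g \<in> borel_measurable lborel" using i(1) iV by (intro borel_measurable_integrable Bochner_Integration.integrable_add)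
      have "continuous_on (\<Omega> - ?K) (\<lambda>x. normal_dir F u x \<bullet> grad \<psi> x)"
        unfolding normal_dir_def
        by (intro continuous_intros continuous_on_subset[OF cG] continuous_on_subset[OF C1_on_grad_continuous[OF \<psi>]])
          (auto simp: sing_set_def)
      moreover have "\<Omega> - ?K \<in> sets borel"
      proof -
        have "closedin (top_of_set \<Omega>) {x \<in> \<Omega>. grad u x + F x = 0}"
          by (rule continuous_closedin_preimage_constant[OF cG])
        then obtain T where "closed T" "?K = \<Omega> \<inter> T" unfolding sing_set_def closedin_closed by blast
        then show ?thesis using dom by auto
      qed
      ultimately show "?f \<in> borel_measurable lborel"
        using borel_measurable_continuous_on_indicator[of "\<Omega> - ?K" "\<lambda>x. normal_dir F u x \<bullet> grad \<psi> x"]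
        by (simp del: real_scaleR_def)
    qed
    have T3: "(LINT x:\<Omega>|lborel. H x * \<psi> x) = integral\<^sup>L lborel (\<lambda>x. divergence N' x * \<psi> x)"
      unfolding set_lebesgue_integral_def
    proof (rule Bochner_Integration.integral_cong[OF refl])
      fix x show "indicat_real \<Omega> x *\<^sub>R (H x * \<psi> x) = divergence N' x * \<psi> x"
      proof (cases "\<psi> x = 0")
        case False
        then have "x \<in> B" using S(2,3) by blast
        then show ?thesis using N'(3)[of x] B(2) by (auto simp: indicator_def)
      qed simp
    qed
    have "integral\<^sup>L lborel (\<lambda>x. N' x \<bullet> grad \<psi> x + indicator V x * ((N x - N' x) \<bullet> grad \<psi> x))
      = integral\<^sup>L lborel (\<lambda>x. N' x \<bullet> grad \<psi> x) + integral\<^sup>L lborel (\<lambda>x. indicator V x * ((N x - N' x) \<bullet> grad \<psi> x))"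
      using i(1) iV by (rule Bochner_Integration.integral_add)
    then show ?thesis using w i(3) unfolding T1 T2 T3 by linarith
  qed
  have "grad (\<lambda>x. - \<phi> x) x = - grad \<phi> x" for x
  proof -
    have "\<phi> differentiable (at x)" using test_function_C1[OF \<phi>] by (simp add: C1_on_def)
    then have "((\<lambda>x. - \<phi> x) has_derivative (\<lambda>v. - frechet_derivative \<phi> (at x) v)) (at x)"
      by (intro has_derivative_minus) (simp add: frechet_derivative_works[symmetric])
    from partial_eq[OF this] show ?thesis by (simp add: grad_def vec_eq_iff partial_def)
  qed
  then have "integral\<^sup>L lborel (\<lambda>x. - (indicator V x * ((N x - N' x) \<bullet> grad \<phi> x))) \<ge> 0"
    using ge[OF test_function_uminus[OF \<phi>]] by simp
  then show ?thesis using ge[OF \<phi>] by simp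
qed

text \<open>The fields are bounded and B has finite measure, so the equality passes to the limit of
  mollifications.\<close>

lemma weak_jump:
  assumes dom: "open \<Omega>" and F: "C1_on \<Omega> F" and u: "C1_on \<Omega> u" and weak: "weak_solution \<Omega> F H u"
    and B: "open B" "B \<subseteq> \<Omega>" "bounded B" and V: "open V" "open V'" "V \<inter> V' = {}" "B - sing_set \<Omega> F u = B \<inter> (V \<union> V')"
    and neg: "negligible (B \<inter> sing_set \<Omega> F u)"
    and N: "C1_on B N" "\<And>x. x \<in> B \<inter> V \<Longrightarrow> normal_dir F u x = N x" "\<And>x. x \<in> B \<Longrightarrow> norm (N x) = 1"
    and N': "C1_on B N'" "\<And>x. x \<in> B \<inter> V' \<Longrightarrow> normal_dir F u x = N' x" "\<And>x. x \<in> B \<Longrightarrow> divergence N' x = H x"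
      "\<And>x. x \<in> B \<Longrightarrow> norm (N' x) = 1"
    and \<phi>: "C1_on UNIV \<phi>" and S: "compact S" "S \<subseteq> B" "\<And>x. \<phi> x \<noteq> 0 \<Longrightarrow> x \<in> S"
  shows "integrable lborel (\<lambda>x. indicator V x * ((N x - N' x) \<bullet> grad \<phi> x))"
    "integral\<^sup>L lborel (\<lambda>x. indicator V x * ((N x - N' x) \<bullet> grad \<phi> x)) = 0"
proof -
  have int: "integrable lborel (\<lambda>x. indicator V x * ((N x - N' x) \<bullet> grad \<psi> x))"
    if "C1_on UNIV \<psi>" "compact T" "T \<subseteq> B" "\<And>x. \<psi> x \<noteq> 0 \<Longrightarrow> x \<in> T" for \<psi> T
  proof -
    have "integrable lborel (\<lambda>x. N x \<bullet> grad \<psi> x - N' x \<bullet> grad \<psi> x)"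
      using integral_field_grad(1)[OF B(1) N(1) that] integral_field_grad(1)[OF B(1) N'(1) that] by simp
    then have "integrable lborel (\<lambda>x. indicator V x *\<^sub>R (N x \<bullet> grad \<psi> x - N' x \<bullet> grad \<psi> x))"
      using V(1) by (intro integrable_mult_indicator) auto
    then show ?thesis by (simp add: inner_diff_left)
  qed
  show i\<phi>: "integrable lborel (\<lambda>x. indicator V x * ((N x - N' x) \<bullet> grad \<phi> x))" by (rule int[OF \<phi> S])
  let ?I = "integral\<^sup>L lborel (\<lambda>x. indicator V x * ((N x - N' x) \<bullet> grad \<phi> x))"
  have fin: "integrable lborel (indicat_real B)"
    using B(1) emeasure_bounded_finite[OF B(3)] by (simp add: integrable_indicator_iff)
  have bound: "\<bar>?I\<bar> \<le> e * (2 * integral\<^sup>L lborel (indicat_real B))" if "e > 0" for e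
  proof -
    obtain \<psi> where \<psi>: "test_function B \<psi>" "\<And>x. norm (grad \<psi> x - grad \<phi> x) \<le> e"
      by (rule mollification[OF \<phi> S(1,3) B(1) S(2) \<open>e > 0\<close>]) (assumption, rule that)
    define T where "T = closure {x. \<psi> x \<noteq> 0}"
    have T: "compact T" "T \<subseteq> B" "\<And>x. \<psi> x \<noteq> 0 \<Longrightarrow> x \<in> T"
      using \<psi>(1) closure_subset[of "{x. \<psi> x \<noteq> 0}"] by (auto simp: test_function_def T_def)
    note i\<psi> = int[OF test_function_C1[OF \<psi>(1)] T]
    have z: "integral\<^sup>L lborel (\<lambda>x. indicator V x * ((N x - N' x) \<bullet> grad \<psi> x)) = 0"
      by (rule weak_jump_test[OF dom F u weak B(1,2) V neg N(1,2) N'(1,2,3) \<psi>(1)])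
    let ?d = "\<lambda>x. indicator V x * ((N x - N' x) \<bullet> grad \<psi> x) - indicator V x * ((N x - N' x) \<bullet> grad \<phi> x)"
    have "integral\<^sup>L lborel ?d = - ?I" using i\<phi> i\<psi> z by simp
    then have "\<bar>?I\<bar> = norm (integral\<^sup>L lborel ?d)" by simp
    also have "\<dots> \<le> integral\<^sup>L lborel (\<lambda>x. norm (?d x))"
      by (rule Bochner_Integration.integral_norm_bound)
    also have "\<dots> \<le> integral\<^sup>L lborel (\<lambda>x. e * (2 * indicat_real B x))"
    proof (rule integral_mono)
      show "integrable lborel (\<lambda>x. norm (?d x))" using i\<phi> i\<psi> by (intro integrable_norm) simp
      show "integrable lborel (\<lambda>x. e * (2 * indicat_real B x))" using fin by simp
      fix x
      show "norm (?d x) \<le> e * (2 * indicat_real B x)"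
      proof (cases "x \<in> B")
        case True
        have "norm (?d x) = \<bar>indicat_real V x\<bar> * \<bar>(N x - N' x) \<bullet> (grad \<psi> x - grad \<phi> x)\<bar>"
          by (simp add: inner_diff_right abs_mult flip: right_diff_distrib)
        also have "\<dots> \<le> 1 * (norm (N x - N' x) * norm (grad \<psi> x - grad \<phi> x))"
          by (intro mult_mono Cauchy_Schwarz_ineq2) (auto simp: indicator_def)
        also have "\<dots> \<le> 1 * (2 * e)"
          using norm_triangle_ineq4[of "N x" "N' x"] N(3)[OF True] N'(4)[OF True] \<psi>(2)[of x] by (intro mult_mono) auto
        finally show ?thesis using True by simp
      next
        case False
        have "grad \<psi> x = 0" by (rule grad_zero_outside[OF compact_imp_closed[OF T(1)] T(3)]) (use False T(2) in auto)
        moreover have "grad \<phi> x = 0" by (rule grad_zero_outside[OF compact_imp_closed[OF S(1)] S(3)]) (use False S(2) in auto)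
        ultimately show ?thesis using \<open>e > 0\<close> by simp
      qed
    qed
    finally show ?thesis by simp
  qed
  show "?I = 0"
  proof (rule ccontr)
    assume "?I \<noteq> 0"
    define m where "m = 2 * integral\<^sup>L lborel (indicat_real B)"
    have m0: "m \<ge> 0" unfolding m_def by simp
    define e where "e = \<bar>?I\<bar> / (2 * (m + 1))"
    have "e > 0" using \<open>?I \<noteq> 0\<close> m0 by (simp add: e_def)
    from bound[OF this] have "\<bar>?I\<bar> \<le> e * m" by (simp add: m_def)
    also have "\<dots> \<le> e * (m + 1)" using \<open>e > 0\<close> by simp
    also have "\<dots> = \<bar>?I\<bar> / 2" using m0 by (simp add: e_def field_simps)
    finally show False using \<open>?I \<noteq> 0\<close> by simp
  qed
qed

section \<open>Stream functions and level lines\<close>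

lemma smooth_step:
  fixes \<delta> :: real
  assumes \<delta>: "\<delta> > 0"
  obtains S S' where "\<And>t. (S has_real_derivative S' t) (at t)" "continuous_on UNIV S'" "\<And>t. S' t \<ge> 0" "S' 0 > 0"
    "\<And>t. \<bar>t\<bar> \<ge> \<delta> \<Longrightarrow> S' t = 0" "\<And>t. t \<le> - \<delta> \<Longrightarrow> S t = 0" "\<And>t. t \<ge> \<delta> \<Longrightarrow> S t = 1"
proof -
  let ?f = "flat 0" and ?g = "flat 1"
  let ?D = "\<lambda>t. ?f (\<delta> + t) + ?f (\<delta> - t)"
  have pos: "?D t > 0" for t
  proof (cases "\<delta> + t > 0")
    case True
    then show ?thesis using flat_pos[OF True] flat_nonneg[of "\<delta> - t"] by simp
  next
    case False
    then have "\<delta> - t > 0" using \<delta> by simp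
    then show ?thesis using flat_pos[of "\<delta> - t"] flat_nonneg[of "\<delta> + t"] by simp
  qed
  define S where "S t = ?f (\<delta> + t) / ?D t" for t
  define S' where "S' t = (?g (\<delta> + t) * ?f (\<delta> - t) + ?f (\<delta> + t) * ?g (\<delta> - t)) / (?D t * ?D t)" for t
  have d1: "((\<lambda>t. ?f (\<delta> + t)) has_real_derivative ?g (\<delta> + t)) (at t)" for t
  proof -
    have "((\<lambda>t. \<delta> + t) has_real_derivative 1) (at t)" by (auto intro!: derivative_eq_intros)
    from DERIV_chain2[where f="?f" and g="\<lambda>t. \<delta> + t" and x=t and s=UNIV, OF flat_derivative this] show ?thesis by simp
  qed
  have d2: "((\<lambda>t. ?f (\<delta> - t)) has_real_derivative - ?g (\<delta> - t)) (at t)" for t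
  proof -
    have "((\<lambda>t. \<delta> - t) has_real_derivative -1) (at t)" by (auto intro!: derivative_eq_intros)
    from DERIV_chain2[where f="?f" and g="\<lambda>t. \<delta> - t" and x=t and s=UNIV, OF flat_derivative this] show ?thesis by simp
  qed
  show ?thesis
  proof (rule that[of S S'])
    show "(S has_real_derivative S' t) (at t)" for t
    proof -
      have "(S has_real_derivative (?g (\<delta> + t) * ?D t - ?f (\<delta> + t) * (?g (\<delta> + t) + - ?g (\<delta> - t))) / (?D t * ?D t)) (at t)"
        unfolding S_def[abs_def] using pos[of t] by (intro DERIV_divide DERIV_add d1 d2) simp
      moreover have "?g (\<delta> + t) * ?D t - ?f (\<delta> + t) * (?g (\<delta> + t) + - ?g (\<delta> - t)) = ?g (\<delta> + t) * ?f (\<delta> - t) + ?f (\<delta> + t) * ?g (\<delta> - t)"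
        by (simp add: algebra_simps)
      ultimately show ?thesis unfolding S'_def by simp
    qed
    have "?D t * ?D t \<noteq> 0" for t using pos[of t] by simp
    then show "continuous_on UNIV S'"
      unfolding S'_def[abs_def]
      by (intro continuous_intros continuous_on_compose2[OF flat_continuous]) auto
    show "S' t \<ge> 0" for t
      unfolding S'_def by (intro divide_nonneg_nonneg add_nonneg_nonneg mult_nonneg_nonneg flat_nonneg flat1_nonneg)
    show "S' 0 > 0"
      unfolding S'_def using flat_pos[OF \<delta>] flat1_pos[OF \<delta>] by (simp add: add_pos_pos)
    show "S' t = 0" if "\<bar>t\<bar> \<ge> \<delta>" for t
    proof -
      have "\<delta> + t \<le> 0 \<or> \<delta> - t \<le> 0" using that by linarith
      then show ?thesis by (auto simp: S'_def flat_zero)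
    qed
    show "S t = 0" if "t \<le> - \<delta>" for t using that by (simp add: S_def flat_zero)
    show "S t = 1" if "t \<ge> \<delta>" for t using that pos[of t] by (simp add: S_def flat_zero)
  qed
qed

text \<open>The Poincare lemma on a disc, with the explicit potential \<open>\<integral> G (p + t (x - p)) \<bullet> (x - p) dt\<close>
  over \<open>[0, 1]\<close>. Differentiating under the integral and using the symmetry of the derivative of G
  turns the integrand into the derivative of \<open>t G (p + t (x - p))\<close>.\<close>

lemma potential:
  fixes G :: "real^2 \<Rightarrow> real^2"
  assumes G: "C1_on (ball p r) G" and sym: "\<And>x. x \<in> ball p r \<Longrightarrow> partial 1 G x $ 2 = partial 2 G x $ 1"
  obtains \<psi> where "\<And>x. x \<in> ball p r \<Longrightarrow> (\<psi> has_derivative (\<lambda>v. G x \<bullet> v)) (at x)"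
proof -
  let ?B = "ball p r"
  let ?y = "\<lambda>x t. p + t *\<^sub>R (x - p)"
  let ?DG = "\<lambda>y h. \<Sum>i\<in>UNIV. h $ i *\<^sub>R partial i G y"
  have cG: "continuous_on ?B G" by (rule C1_on_continuous[OF G])
  have cp: "continuous_on ?B (partial i G)" for i using G by (simp add: C1_on_def)
  have yB: "?y x t \<in> ?B" if "x \<in> ?B" "t \<in> cbox 0 1" for x t
  proof -
    have "norm (t *\<^sub>R (x - p)) \<le> 1 * norm (x - p)" unfolding norm_scaleR using that(2) by (intro mult_right_mono) auto
    then show ?thesis using that(1) by (simp add: dist_norm norm_minus_commute)
  qed
  have DG: "(G has_derivative ?DG y) (at y)" if "y \<in> ?B" for y
  proof -
    have "G differentiable (at y)" using G that by (simp add: C1_on_def)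
    then have "frechet_derivative G (at y) = ?DG y" by (intro ext frechet_derivative_partial)
    with C1_on_has_derivative[OF G that] show ?thesis by simp
  qed
  have DGsym: "?DG y h \<bullet> v = ?DG y v \<bullet> h" if "y \<in> ?B" for y h v
    using sym[OF that] by (simp add: sum_2 inner_2 algebra_simps)
  let ?w = "\<lambda>x t. t *\<^sub>R ?DG (?y x t) (x - p) + G (?y x t)"
  define \<psi> where "\<psi> x = integral (cbox 0 1) (\<lambda>t. G (?y x t) \<bullet> (x - p))" for x
  have cy: "continuous_on (?B \<times> cbox 0 1) (\<lambda>(x, t). ?y x t)"
    unfolding case_prod_unfold by (intro continuous_intros)
  have der: "(\<psi> has_derivative blinfun_apply (integral (cbox 0 1) (\<lambda>t. blinfun_inner_left (?w x t)))) (at x within ?B)"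
    if x: "x \<in> ?B" for x
    unfolding \<psi>_def[abs_def]
  proof (rule leibniz_rule)
    fix x t assume xt: "x \<in> ?B" "t \<in> cbox 0 (1::real)"
    have "((\<lambda>x. ?y x t) has_derivative (\<lambda>v. t *\<^sub>R v)) (at x)" by (auto intro!: derivative_eq_intros)
    from has_derivative_compose[OF this DG[OF yB[OF xt]]]
    have "((\<lambda>x. G (?y x t)) has_derivative (\<lambda>v. ?DG (?y x t) (t *\<^sub>R v))) (at x)" .
    moreover have "((\<lambda>x. x - p) has_derivative (\<lambda>v. v)) (at x)" by (auto intro!: derivative_eq_intros)
    ultimately have "((\<lambda>x. G (?y x t) \<bullet> (x - p)) has_derivative (\<lambda>v. G (?y x t) \<bullet> v + ?DG (?y x t) (t *\<^sub>R v) \<bullet> (x - p))) (at x)"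
      by (rule has_derivative_inner)
    moreover have "(\<lambda>v. G (?y x t) \<bullet> v + ?DG (?y x t) (t *\<^sub>R v) \<bullet> (x - p)) = blinfun_apply (blinfun_inner_left (?w x t))"
    proof
      fix v
      have "?DG (?y x t) (t *\<^sub>R v) \<bullet> (x - p) = ?DG (?y x t) (x - p) \<bullet> (t *\<^sub>R v)" by (rule DGsym[OF yB[OF xt]])
      then show "G (?y x t) \<bullet> v + ?DG (?y x t) (t *\<^sub>R v) \<bullet> (x - p) = blinfun_apply (blinfun_inner_left (?w x t)) v"
        by (simp only: blinfun_inner_left.rep_eq inner_add_right inner_scaleR_right inner_commute[of v])
    qed
    ultimately show "((\<lambda>x. G (?y x t) \<bullet> (x - p)) has_derivative blinfun_apply (blinfun_inner_left (?w x t))) (at x within ?B)"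
      by (simp add: has_derivative_at_withinI)
  next
    show "(\<lambda>t. G (?y x t) \<bullet> (x - p)) integrable_on cbox 0 1" if "x \<in> ?B" for x
      by (intro integrable_continuous continuous_intros continuous_on_compose2[OF cG]) (use yB[OF that] in auto)
    show "continuous_on (?B \<times> cbox 0 1) (\<lambda>(x, t). blinfun_inner_left (?w x t))"
      using yB unfolding case_prod_unfold
      by (intro bounded_linear.continuous_on[OF bounded_linear_blinfun_inner_left] continuous_intros
          continuous_on_compose2[OF cG] continuous_on_compose2[OF cp]) auto
  qed (use x in auto)
  have int: "integral (cbox 0 1) (\<lambda>t. blinfun_inner_left (?w x t)) = blinfun_inner_left (G x)" if x: "x \<in> ?B" for x
  proof -
    have d: "((\<lambda>t. t *\<^sub>R G (?y x t)) has_vector_derivative ?w x t) (at t within {0..1})" if "t \<in> {0..1}" for t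
    proof -
      have yt: "?y x t \<in> ?B" using yB[OF x, of t] that by simp
      have "((\<lambda>t. ?y x t) has_derivative (\<lambda>h. h *\<^sub>R (x - p))) (at t)" by (auto intro!: derivative_eq_intros)
      from has_derivative_compose[OF this DG[OF yt]]
      have "((\<lambda>t. G (?y x t)) has_derivative (\<lambda>h. ?DG (?y x t) (h *\<^sub>R (x - p)))) (at t)" .
      moreover have "?DG (?y x t) (h *\<^sub>R (x - p)) = h *\<^sub>R ?DG (?y x t) (x - p)" for h
        by (simp add: scaleR_sum_right)
      ultimately have "((\<lambda>t. G (?y x t)) has_vector_derivative ?DG (?y x t) (x - p)) (at t)"
        unfolding has_vector_derivative_def by simp
      from has_vector_derivative_scaleR[OF DERIV_ident this]
      have "((\<lambda>t. t *\<^sub>R G (?y x t)) has_vector_derivative ?w x t) (at t)" by simp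
      then show ?thesis by (rule has_vector_derivative_at_within)
    qed
    have "(?w x has_integral (1 *\<^sub>R G (?y x 1) - 0 *\<^sub>R G (?y x 0))) {0..1}"
      by (rule fundamental_theorem_of_calculus[OF _ d]) simp_all
    then have hi: "(?w x has_integral G x) (cbox 0 1)" by simp
    have "((blinfun_inner_left \<circ> ?w x) has_integral blinfun_inner_left (G x)) (cbox 0 1)"
      by (rule has_integral_linear[OF hi bounded_linear_blinfun_inner_left])
    then show ?thesis by (simp add: o_def integral_unique)
  qed
  show ?thesis
  proof (rule that[of \<psi>])
    fix x assume x: "x \<in> ?B"
    have "blinfun_apply (blinfun_inner_left (G x)) = (\<lambda>v. G x \<bullet> v)" by (rule ext) (simp add: inner_commute)
    then show "(\<psi> has_derivative (\<lambda>v. G x \<bullet> v)) (at x)"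
      using der[OF x] unfolding int[OF x] at_within_open[OF x open_ball] by (simp only:)
  qed
qed

lemma rot_has_derivative:
  assumes "(f has_derivative f') F"
  shows "((\<lambda>x. rot (f x)) has_derivative (\<lambda>v. rot (f' v))) F"
proof -
  have "bounded_linear rot"
    unfolding linear_conv_bounded_linear[symmetric]
    by (rule linearI) (simp_all add: vec_eq_iff forall_2)
  from bounded_linear.has_derivative[OF this assms] show ?thesis .
qed

lemma rot_continuous: "continuous_on S f \<Longrightarrow> continuous_on S (\<lambda>x. rot (f x))"
  unfolding rot_def vector_2_eq by (intro continuous_intros)

lemma rot_orthogonal [simp]: "rot v \<bullet> v = 0" "v \<bullet> rot v = 0"
  by (simp_all add: inner_2)

lemma rot_frame:
  assumes "n \<bullet> z \<noteq> 0" "rot z \<bullet> v = 0"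
  shows "v = ((n \<bullet> v) / (n \<bullet> z)) *\<^sub>R z"
proof -
  have "z $ 2 * v $ 1 = z $ 1 * v $ 2" using assms(2) by (simp add: inner_2)
  then have "(n \<bullet> z) *\<^sub>R v = (n \<bullet> v) *\<^sub>R z"
    by (simp add: vec_eq_iff forall_2 inner_2) algebra
  then have "inverse (n \<bullet> z) *\<^sub>R ((n \<bullet> z) *\<^sub>R v) = inverse (n \<bullet> z) *\<^sub>R ((n \<bullet> v) *\<^sub>R z)" by simp
  then show ?thesis using assms(1) by (simp add: divide_inverse mult.commute)
qed

text \<open>A divergence-free field turned by a right angle is curl free, so it is a gradient. The
  stream function \<open>\<psi>\<close> obtained in this way, together with a coordinate along \<open>Z p\<close>, gives a chart
  in which the field lines of Z are horizontal.\<close>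

lemma stream_chart:
  assumes B: "open B" "p \<in> B" and Z: "C1_on B Z" "\<And>x. x \<in> B \<Longrightarrow> divergence Z x = 0" and Zp: "Z p \<noteq> 0"
  obtains \<psi> D \<kappa> \<Phi> \<Phi>' where "open D" "p \<in> D" "D \<subseteq> B" "\<kappa> > 0"
    "\<And>x. x \<in> D \<Longrightarrow> (\<psi> has_derivative (\<lambda>v. rot (Z x) \<bullet> v)) (at x)"
    "\<And>x. x \<in> D \<Longrightarrow> Z p \<bullet> Z x > 0"
    "homeomorphism D {w::real^2. \<bar>w $ 1 - Z p \<bullet> p\<bar> < \<kappa> \<and> \<bar>w $ 2 - \<psi> p\<bar> < \<kappa>} (\<lambda>x. vector [Z p \<bullet> x, \<psi> x]) \<Phi>"
    "\<And>w::real^2. \<bar>w $ 1 - Z p \<bullet> p\<bar> < \<kappa> \<Longrightarrow> \<bar>w $ 2 - \<psi> p\<bar> < \<kappa> \<Longrightarrow> (\<Phi> has_derivative \<Phi>' w) (at w)"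
proof -
  define n where "n = Z p"
  have cZ: "continuous_on B Z" by (rule C1_on_continuous[OF Z(1)])
  have "open {x \<in> B. n \<bullet> Z x > 0}"
  proof -
    have "open (B \<inter> (\<lambda>x. n \<bullet> Z x) -` {0<..})"
      by (rule continuous_open_preimage[OF _ B(1)]) (intro continuous_intros cZ, simp)
    moreover have "B \<inter> (\<lambda>x. n \<bullet> Z x) -` {0<..} = {x \<in> B. n \<bullet> Z x > 0}" by auto
    ultimately show ?thesis by simp
  qed
  moreover have "p \<in> {x \<in> B. n \<bullet> Z x > 0}" using B(2) Zp by (simp add: n_def)
  ultimately obtain r where r: "r > 0" "ball p r \<subseteq> {x \<in> B. n \<bullet> Z x > 0}" by (rule openE)
  have rB: "ball p r \<subseteq> B" using r(2) by blast
  let ?G = "\<lambda>x. rot (Z x)"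
  have dG: "(?G has_derivative (\<lambda>v. rot (frechet_derivative Z (at x) v))) (at x)" if "x \<in> B" for x
    by (rule rot_has_derivative[OF C1_on_has_derivative[OF Z(1) that]])
  have pG: "partial i ?G x = rot (partial i Z x)" if "x \<in> B" for i x
    using partial_eq[OF dG[OF that]] by (simp add: partial_def)
  have GC1: "C1_on (ball p r) ?G"
    unfolding C1_on_def
  proof (intro conjI ballI allI)
    show "?G differentiable (at x)" if "x \<in> ball p r" for x
      using differentiableI[OF dG] that rB by blast
    have "continuous_on (ball p r) (\<lambda>x. rot (partial i Z x))" for i
      using Z(1) rB by (intro rot_continuous) (auto simp: C1_on_def intro: continuous_on_subset)
    then show "continuous_on (ball p r) (partial i ?G)" for i
      by (rule continuous_on_eq) (use pG rB in auto)
  qed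
  have sym: "partial 1 ?G x $ 2 = partial 2 ?G x $ 1" if "x \<in> ball p r" for x
  proof -
    have "x \<in> B" using that rB by blast
    then show ?thesis using Z(2)[of x] by (simp add: pG divergence_def add_eq_0_iff2)
  qed
  obtain \<psi> where \<psi>: "\<And>x. x \<in> ball p r \<Longrightarrow> (\<psi> has_derivative (\<lambda>v. rot (Z x) \<bullet> v)) (at x)"
    by (rule potential[OF GC1 sym]) (assumption, rule that)
  let ?\<Psi> = "\<lambda>x. vector [n \<bullet> x, \<psi> x] :: real^2"
  let ?D\<Psi> = "\<lambda>x v. vector [n \<bullet> v, rot (Z x) \<bullet> v] :: real^2"
  have bl: "bounded_linear (?D\<Psi> x)" for x
    unfolding vector_2_eq
    by (intro bounded_linear_add bounded_linear_scaleR_const bounded_linear_inner_right)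
  define DB where "DB x = Blinfun (?D\<Psi> x)" for x
  have DB: "blinfun_apply (DB x) = ?D\<Psi> x" for x
    unfolding DB_def by (rule bounded_linear_Blinfun_apply[OF bl])
  have der: "(?\<Psi> has_derivative blinfun_apply (DB x)) (at x)" if "x \<in> ball p r" for x
    unfolding DB vector_2_eq
    by (intro has_derivative_add has_derivative_scaleR_left \<psi>[OF that]
        bounded_linear_imp_has_derivative bounded_linear_inner_right)
  have cont: "continuous_on (ball p r) DB"
  proof (rule continuous_on_blinfun_componentwise)
    show "continuous_on (ball p r) (\<lambda>x. blinfun_apply (DB x) i)" for i
      unfolding DB vector_2_eq
      by (intro continuous_intros rot_continuous continuous_on_subset[OF cZ rB])
  qed
  have pr: "p \<in> ball p r" using r(1) by simp
  have inj: "inj (?D\<Psi> p)"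
  proof -
    have "v = 0" if "?D\<Psi> p v = 0" for v
    proof -
      have "n \<bullet> v = 0" "rot (Z p) \<bullet> v = 0" using that by (auto simp: vec_eq_iff forall_2)
      moreover have "n \<bullet> Z p \<noteq> 0" using Zp by (simp add: n_def)
      ultimately show "v = 0" using rot_frame[of n "Z p" v] by simp
    qed
    then show ?thesis unfolding linear_injective_0[OF bounded_linear.linear[OF bl]] by blast
  qed
  obtain G where G: "linear G" "G \<circ> ?D\<Psi> p = id"
    by (rule exE[OF linear_injective_left_inverse[OF bounded_linear.linear[OF bl] inj]]) (erule conjE, rule that)
  have inv: "Blinfun G o\<^sub>L DB p = id_blinfun"
  proof (rule blinfun_eqI)
    fix v
    have "bounded_linear G" using G(1) by (simp add: linear_conv_bounded_linear)
    then show "blinfun_apply (Blinfun G o\<^sub>L DB p) v = blinfun_apply id_blinfun v"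
      using fun_cong[OF G(2), of v]
      by (simp only: blinfun_apply_blinfun_compose bounded_linear_Blinfun_apply DB o_apply id_apply id_blinfun.rep_eq)
  qed
  show thesis
  proof (rule inverse_function_theorem[OF open_ball der cont pr inv])
    fix D0 E \<Phi> \<Phi>'
    assume D0: "open D0" "D0 \<subseteq> ball p r" "p \<in> D0" and E: "open E" "?\<Psi> p \<in> E" and hom: "homeomorphism D0 E ?\<Psi> \<Phi>"
      and d\<Phi>: "\<And>y. y \<in> E \<Longrightarrow> (\<Phi> has_derivative \<Phi>' y) (at y)"
    obtain e where e: "e > 0" "ball (?\<Psi> p) e \<subseteq> E" by (rule openE[OF E])
    define \<kappa> where "\<kappa> = e / 2"
    let ?box = "{w::real^2. \<bar>w $ 1 - n \<bullet> p\<bar> < \<kappa> \<and> \<bar>w $ 2 - \<psi> p\<bar> < \<kappa>}"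
    have box: "?box \<subseteq> E"
    proof
      fix w :: "real^2" assume "w \<in> ?box"
      then have "\<bar>(w - ?\<Psi> p) $ 1\<bar> + \<bar>(w - ?\<Psi> p) $ 2\<bar> < e" by (simp add: \<kappa>_def)
      then have "norm (w - ?\<Psi> p) < e" using norm_le_components[of "w - ?\<Psi> p"] by linarith
      then show "w \<in> E" using e(2) by (auto simp: dist_norm norm_minus_commute)
    qed
    have opbox: "open ?box" by (intro open_Collect_conj open_Collect_less continuous_intros)
    define D where "D = \<Phi> ` ?box"
    have hm: "\<Phi> ` E = D0" "\<And>w. w \<in> E \<Longrightarrow> ?\<Psi> (\<Phi> w) = w" "\<And>x. x \<in> D0 \<Longrightarrow> \<Phi> (?\<Psi> x) = x" "continuous_on D0 ?\<Psi>" "continuous_on E \<Phi>"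
      using hom by (auto simp: homeomorphism_def)
    have DD0: "D \<subseteq> D0" using box hm(1) by (auto simp: D_def)
    have D_eq: "D = D0 \<inter> ?\<Psi> -` ?box"
    proof (intro set_eqI iffI)
      fix x assume "x \<in> D"
      then obtain w where "w \<in> ?box" "x = \<Phi> w" by (auto simp: D_def)
      then show "x \<in> D0 \<inter> ?\<Psi> -` ?box" using hm(2)[of w] hm(1) box by force
    next
      fix x assume x: "x \<in> D0 \<inter> ?\<Psi> -` ?box"
      then have "x = \<Phi> (?\<Psi> x)" "?\<Psi> x \<in> ?box" using hm(3) by auto
      then show "x \<in> D" unfolding D_def by (rule image_eqI)
    qed
    show thesis
    proof (rule that[of D \<kappa> \<psi> \<Phi> \<Phi>'])
      show "open D" unfolding D_eq by (rule continuous_open_preimage[OF hm(4) D0(1) opbox])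
      show "p \<in> D" unfolding D_eq using D0(3) e(1) by (simp add: \<kappa>_def)
      show "D \<subseteq> B" using DD0 D0(2) rB by blast
      show "\<kappa> > 0" using e(1) by (simp add: \<kappa>_def)
      show "(\<psi> has_derivative (\<lambda>v. rot (Z x) \<bullet> v)) (at x)" if "x \<in> D" for x
      using \<psi> that DD0 D0(2) by blast
      show "Z p \<bullet> Z x > 0" if "x \<in> D" for x
      using r(2) that DD0 D0(2) unfolding n_def by blast
      show "homeomorphism D {w::real^2. \<bar>w $ 1 - Z p \<bullet> p\<bar> < \<kappa> \<and> \<bar>w $ 2 - \<psi> p\<bar> < \<kappa>} (\<lambda>x. vector [Z p \<bullet> x, \<psi> x]) \<Phi>"
      unfolding n_def[symmetric]
    proof (rule homeomorphism_of_subsets[OF hom DD0 box])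
      have "?\<Psi> ` \<Phi> ` ?box = (\<lambda>w. w) ` ?box"
        unfolding image_image by (rule image_cong[OF refl]) (rule hm(2)[OF subsetD[OF box]])
      then show "?\<Psi> ` D = ?box" unfolding D_def by simp
    qed
      show "(\<Phi> has_derivative \<Phi>' w) (at w)" if "\<bar>w $ 1 - Z p \<bullet> p\<bar> < \<kappa>" "\<bar>w $ 2 - \<psi> p\<bar> < \<kappa>" for w :: "real^2"
      using that box by (intro d\<Phi>) (auto simp: n_def)
    qed
  qed assumption+
qed

lemma char_system_unique:
  assumes "open \<Omega>" and H: "C1_on \<Omega> H" and p: "p \<in> \<Omega>" and \<epsilon>: "\<epsilon> > 0"
    and c: "c 0 = p" "\<phi> 0 = a" "\<And>t. \<bar>t\<bar> < \<epsilon> \<Longrightarrow> (c has_vector_derivative dirT (\<phi> t)) (at t)"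
      "\<And>t. \<bar>t\<bar> < \<epsilon> \<Longrightarrow> (\<phi> has_real_derivative - H (c t)) (at t)"
    and d: "d 0 = p" "\<eta> 0 = a" "\<And>t. \<bar>t\<bar> < \<epsilon> \<Longrightarrow> (d has_vector_derivative dirT (\<eta> t)) (at t)"
      "\<And>t. \<bar>t\<bar> < \<epsilon> \<Longrightarrow> (\<eta> has_real_derivative - H (d t)) (at t)"
  obtains s where "0 < s" "s < \<epsilon>" "\<And>t. \<bar>t\<bar> \<le> s \<Longrightarrow> c t = d t"
proof -
  let ?z = "(p, a)"
  have S: "compact {?z}" "{?z} \<subseteq> \<Omega> \<times> UNIV" using p by auto
  obtain M where M: "M \<ge> 0" "\<And>v. norm (char_lin H ?z v) \<le> M * norm v"
    using char_lin_bound[OF H S] by blast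
  obtain \<delta> where \<delta>: "\<delta> > 0" "\<And>x x'. x \<in> ball ?z \<delta> \<Longrightarrow> x' \<in> ball ?z \<delta> \<Longrightarrow>
      norm (char_field H x' - char_field H x - char_lin H ?z (x' - x)) \<le> 1 * norm (x' - x)"
    using char_field_strict[OF assms(1) H S zero_less_one] by blast
  let ?x = "\<lambda>t. (c t, \<phi> t)" and ?y = "\<lambda>t. (d t, \<eta> t)"
  have dx: "(?x has_vector_derivative char_field H (?x t)) (at t)" if "\<bar>t\<bar> < \<epsilon>" for t
    using has_vector_derivative_Pair[OF c(3)[OF that] c(4)[OF that, unfolded has_real_derivative_iff_has_vector_derivative]]
    by (simp add: char_field_def)
  have dy: "(?y has_vector_derivative char_field H (?y t)) (at t)" if "\<bar>t\<bar> < \<epsilon>" for t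
    using has_vector_derivative_Pair[OF d(3)[OF that] d(4)[OF that, unfolded has_real_derivative_iff_has_vector_derivative]]
    by (simp add: char_field_def)
  have near: "\<exists>s>0. \<forall>t. \<bar>t\<bar> < s \<longrightarrow> f t \<in> ball ?z \<delta>"
    if f: "(f has_vector_derivative f') (at 0)" and f0: "f 0 = ?z" for f :: "real \<Rightarrow> (real^2) \<times> real" and f'
  proof -
    have "isCont f 0" by (rule has_vector_derivative_continuous[OF f])
    then have "\<exists>s>0. \<forall>t. dist t 0 < s \<longrightarrow> dist (f t) (f 0) < \<delta>"
      using \<delta>(1) unfolding continuous_at_eps_delta by blast
    then show ?thesis by (simp add: f0 dist_commute)
  qed
  obtain s1 where s1: "s1 > 0" "\<And>t. \<bar>t\<bar> < s1 \<Longrightarrow> ?x t \<in> ball ?z \<delta>"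
    using near[OF dx[of 0]] \<epsilon> c(1,2) by auto
  obtain s2 where s2: "s2 > 0" "\<And>t. \<bar>t\<bar> < s2 \<Longrightarrow> ?y t \<in> ball ?z \<delta>"
    using near[OF dy[of 0]] \<epsilon> d(1,2) by auto
  define s where "s = min \<epsilon> (min s1 s2) / 2"
  have s: "0 < s" "s < \<epsilon>" "s < s1" "s < s2" using \<epsilon> s1(1) s2(1) by (auto simp: s_def min_def)
  show thesis
  proof (rule that[OF s(1,2)])
    fix t :: real assume t: "\<bar>t\<bar> \<le> s"
    let ?e = "\<lambda>t. ?x t - ?y t" and ?e' = "\<lambda>t. char_field H (?x t) - char_field H (?y t)"
    have "norm (?e t) \<le> (1 + \<bar>t\<bar>) * exp ((2*(M+1)+1) * \<bar>t\<bar>) * (norm (?e 0) + 0)"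
    proof (rule gronwall)
      fix t assume t: "t \<in> {-s..s}"
      then have t': "\<bar>t\<bar> < \<epsilon>" "\<bar>t\<bar> < s1" "\<bar>t\<bar> < s2" using s by auto
      show "(?e has_vector_derivative ?e' t) (at t within {-s..s})"
        by (rule has_vector_derivative_at_within[OF has_vector_derivative_diff[OF dx[OF t'(1)] dy[OF t'(1)]]])
      have 1: "norm (?e' t - char_lin H ?z (?e t)) \<le> 1 * norm (?e t)"
        by (rule \<delta>(2)[OF s2(2)[OF t'(3)] s1(2)[OF t'(2)]])
      have 2: "norm (?e' t) \<le> norm (?e' t - char_lin H ?z (?e t)) + norm (char_lin H ?z (?e t))"
        using norm_triangle_ineq[of "?e' t - char_lin H ?z (?e t)" "char_lin H ?z (?e t)"] by simp
      show "norm (?e' t) \<le> (M+1) * norm (?e t) + 0"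
        using 1 2 M(2)[of "?e t"] unfolding distrib_right by linarith
    qed (use M(1) s t in auto)
    then have "norm (?e t) \<le> 0" using c(1,2) d(1,2) by (simp only: diff_self norm_zero mult_zero_right add_0_right)
    then show "c t = d t" by (simp add: prod_eq_iff)
  qed
qed

lemma dirN_eq_imp:
  assumes "dirN a = dirN b"
  obtains k :: int where "a = b + 2 * pi * real_of_int k"
proof -
  have "cos a = cos b" "sin a = sin b" using assms by (simp_all add: vec_eq_iff forall_2)
  then show thesis using that sin_cos_eq_iff[of a b] by (auto simp: algebra_simps)
qed

lemma C1_on_gradI:
  assumes d: "\<And>x. x \<in> A \<Longrightarrow> (f has_derivative (\<lambda>v. G x \<bullet> v)) (at x)" and c: "continuous_on A G"
  shows "C1_on A f" "\<And>x. x \<in> A \<Longrightarrow> grad f x = G x"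
proof -
  have p: "partial i f x = G x $ i" if "x \<in> A" for x i
    using partial_eq[OF d[OF that]] by (simp add: inner_axis)
  show "grad f x = G x" if "x \<in> A" for x by (simp add: vec_eq_iff grad_def p[OF that])
  have "continuous_on A (partial i f)" for i
  proof (rule continuous_on_eq)
    show "continuous_on A (\<lambda>x. G x $ i)" by (intro continuous_intros c)
  qed (simp add: p)
  then show "C1_on A f" unfolding C1_on_def using differentiableI[OF d] by blast
qed

lemma C1_on_subset: "C1_on A f \<Longrightarrow> B \<subseteq> A \<Longrightarrow> C1_on B f"
  unfolding C1_on_def by (blast intro: continuous_on_subset)

text \<open>Suppose that a level line of \<open>\<psi>\<close> meets V in A and \<open>V'\<close> in \<open>A'\<close>. Take \<open>\<phi> = \<eta> k\<close>, where k is a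
  bump function of \<open>\<psi>\<close> at this level and \<open>\<eta>\<close>, a function of the coordinate along n, is constant
  except for one smooth step at A and the opposite step at \<open>A'\<close>. As \<open>\<psi>\<close> is constant along Z, the
  integrand \<open>Z \<bullet> grad \<phi>\<close> is \<open>\<eta>' k (n \<bullet> Z)\<close>. On V only the step at A is seen, so the integral over
  V has a sign and does not vanish.\<close>

lemma no_level_crossing:
  fixes \<psi> :: "real^2 \<Rightarrow> real" and \<Phi> :: "real^2 \<Rightarrow> real^2"
  defines "E a b \<kappa> \<equiv> {w::real^2. \<bar>w $ 1 - a\<bar> < \<kappa> \<and> \<bar>w $ 2 - b\<bar> < (\<kappa>::real)}"
  assumes flux: "\<And>\<phi> S. \<lbrakk>C1_on UNIV \<phi>; compact S; S \<subseteq> B; \<And>x. \<phi> x \<noteq> 0 \<Longrightarrow> x \<in> S\<rbrakk> \<Longrightarrow>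
        integrable lborel (\<lambda>x. indicator V x * (Z x \<bullet> grad \<phi> x)) \<and>
        integral\<^sup>L lborel (\<lambda>x. indicator V x * (Z x \<bullet> grad \<phi> x)) = 0"
    and V: "open V" "open V'" "V \<inter> V' = {}" and D: "open D" "D \<subseteq> B" and Z: "continuous_on D Z"
    and \<psi>: "\<And>x. x \<in> D \<Longrightarrow> (\<psi> has_derivative (\<lambda>v. rot (Z x) \<bullet> v)) (at x)"
    and n: "\<And>x. x \<in> D \<Longrightarrow> n \<bullet> Z x > 0"
    and hom: "homeomorphism D (E a b \<kappa>) (\<lambda>x. vector [n \<bullet> x, \<psi> x]) \<Phi>"
    and A: "A \<in> D \<inter> V" "A' \<in> D \<inter> V'" "\<psi> A = \<psi> A'"
  shows False
proof -
  let ?\<Psi> = "\<lambda>x. vector [n \<bullet> x, \<psi> x] :: real^2"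
  let ?E = "E a b \<kappa>"
  have hm: "\<Phi> ` ?E = D" "?\<Psi> ` D = ?E" "\<And>w. w \<in> ?E \<Longrightarrow> ?\<Psi> (\<Phi> w) = w" "\<And>x. x \<in> D \<Longrightarrow> \<Phi> (?\<Psi> x) = x"
    "continuous_on D ?\<Psi>" "continuous_on ?E \<Phi>"
    using hom by (auto simp: homeomorphism_def)
  have Eop: "open ?E" unfolding E_def by (intro open_Collect_conj open_Collect_less continuous_intros)
  have box: "\<exists>e>0. \<forall>w. \<bar>w $ 1 - n \<bullet> x\<bar> \<le> e \<longrightarrow> \<bar>w $ 2 - \<psi> x\<bar> \<le> e \<longrightarrow> w \<in> ?E \<and> \<Phi> w \<in> O'"
    if x: "x \<in> D \<inter> O'" and O': "open O'" for x O'
  proof -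
    have "open (?E \<inter> \<Phi> -` O')" by (rule continuous_open_preimage[OF hm(6) Eop O'])
    moreover have "?\<Psi> x \<in> ?E \<inter> \<Phi> -` O'" using x hm(2,4) by auto
    ultimately obtain r where r: "r > 0" "ball (?\<Psi> x) r \<subseteq> ?E \<inter> \<Phi> -` O'" by (rule openE)
    have "w \<in> ?E \<inter> \<Phi> -` O'" if "\<bar>w $ 1 - n \<bullet> x\<bar> \<le> r/3" "\<bar>w $ 2 - \<psi> x\<bar> \<le> r/3" for w
    proof -
      have "norm (w - ?\<Psi> x) < r" using norm_le_components[of "w - ?\<Psi> x"] that r(1) by simp
      then have "w \<in> ball (?\<Psi> x) r" by (simp add: dist_norm norm_minus_commute)
      then show ?thesis using r(2) by blast
    qed
    then show ?thesis using r(1) by (intro exI[of _ "r/3"]) auto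
  qed
  obtain e1 where e1: "e1 > 0" "\<And>w. \<lbrakk>\<bar>w $ 1 - n \<bullet> A\<bar> \<le> e1; \<bar>w $ 2 - \<psi> A\<bar> \<le> e1\<rbrakk> \<Longrightarrow> w \<in> ?E \<and> \<Phi> w \<in> V"
    using box[of A V] A(1) V(1) by blast
  obtain e2 where e2: "e2 > 0" "\<And>w. \<lbrakk>\<bar>w $ 1 - n \<bullet> A'\<bar> \<le> e2; \<bar>w $ 2 - \<psi> A'\<bar> \<le> e2\<rbrakk> \<Longrightarrow> w \<in> ?E \<and> \<Phi> w \<in> V'"
    using box[of A' V'] A(2) V(2) by blast
  define \<delta> where "\<delta> = min e1 e2"
  have \<delta>: "\<delta> > 0" "\<delta> \<le> e1" "\<delta> \<le> e2" using e1(1) e2(1) by (auto simp: \<delta>_def)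
  define \<xi>1 \<xi>2 l where "\<xi>1 = n \<bullet> A" and "\<xi>2 = n \<bullet> A'" and "l = \<psi> A"
  obtain S S' where S: "\<And>t. (S has_real_derivative S' t) (at t)" "continuous_on UNIV S'" "\<And>t. S' t \<ge> 0" "S' 0 > 0"
    "\<And>t. \<bar>t\<bar> \<ge> \<delta> \<Longrightarrow> S' t = 0" "\<And>t. t \<le> - \<delta> \<Longrightarrow> S t = 0" "\<And>t. t \<ge> \<delta> \<Longrightarrow> S t = 1"
    by (rule smooth_step[OF \<delta>(1)]) (rule that)
  define k where "k t = flat 0 (\<delta> + (t - l)) * flat 0 (\<delta> - (t - l))" for t
  define k' where "k' t = flat 1 (\<delta> + (t - l)) * flat 0 (\<delta> - (t - l)) - flat 0 (\<delta> + (t - l)) * flat 1 (\<delta> - (t - l))" for t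
  have dk: "(k has_real_derivative k' t) (at t)" for t
  proof -
    have "((\<lambda>t. \<delta> + (t - l)) has_real_derivative 1) (at t)" by (auto intro!: derivative_eq_intros)
    from DERIV_chain2[where f="flat 0" and g="\<lambda>t. \<delta> + (t - l)" and x=t and s=UNIV, OF flat_derivative this]
    have 1: "((\<lambda>t. flat 0 (\<delta> + (t - l))) has_real_derivative flat 1 (\<delta> + (t - l))) (at t)" by simp
    have "((\<lambda>t. \<delta> - (t - l)) has_real_derivative -1) (at t)" by (auto intro!: derivative_eq_intros)
    from DERIV_chain2[where f="flat 0" and g="\<lambda>t. \<delta> - (t - l)" and x=t and s=UNIV, OF flat_derivative this]
    have 2: "((\<lambda>t. flat 0 (\<delta> - (t - l))) has_real_derivative - flat 1 (\<delta> - (t - l))) (at t)" by simp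
    from DERIV_mult[OF 1 2] show ?thesis unfolding k_def[abs_def] k'_def by (simp add: algebra_simps)
  qed
  have k0: "k t = 0" if "\<bar>t - l\<bar> \<ge> \<delta>" for t
  proof -
    have "\<delta> + (t - l) \<le> 0 \<or> \<delta> - (t - l) \<le> 0" using that by linarith
    then show ?thesis by (auto simp: k_def flat_zero)
  qed
  have knn: "k t \<ge> 0" for t by (simp add: k_def flat_nonneg)
  have kl: "k l > 0" using flat_pos[OF \<delta>(1)] by (simp add: k_def)
  have ck': "continuous_on UNIV k'"
    unfolding k'_def[abs_def] by (intro continuous_intros continuous_on_compose2[OF flat_continuous]) auto
  have cS: "continuous_on X S" for X by (intro continuous_at_imp_continuous_on ballI DERIV_isCont[OF S(1)])
  have ck: "continuous_on X k" for X by (intro continuous_at_imp_continuous_on ballI DERIV_isCont[OF dk])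
  define \<eta> where "\<eta> t = S (t - \<xi>1) - S (t - \<xi>2)" for t
  define \<eta>' where "\<eta>' t = S' (t - \<xi>1) - S' (t - \<xi>2)" for t
  have d\<eta>: "(\<eta> has_real_derivative \<eta>' t) (at t)" for t
  proof -
    have "((\<lambda>t. S (t - c)) has_real_derivative S' (t - c)) (at t)" for c
    proof -
      have "((\<lambda>t. t - c) has_real_derivative 1) (at t)" by (auto intro!: derivative_eq_intros)
      from DERIV_chain2[where f=S and g="\<lambda>t. t - c" and x=t and s=UNIV, OF S(1) this] show ?thesis by simp
    qed
    then show ?thesis unfolding \<eta>_def[abs_def] \<eta>'_def by (intro DERIV_diff)
  qed
  have c\<eta>': "continuous_on UNIV \<eta>'"
    unfolding \<eta>'_def[abs_def] by (intro continuous_intros continuous_on_compose2[OF S(2)]) auto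
  have c\<eta>: "continuous_on X \<eta>" for X by (intro continuous_at_imp_continuous_on ballI DERIV_isCont[OF d\<eta>])
  define m1 m2 where "m1 = min \<xi>1 \<xi>2 - \<delta>" and "m2 = max \<xi>1 \<xi>2 + \<delta>"
  have \<eta>0: "\<eta> t = 0" if "t \<le> m1 \<or> m2 \<le> t" for t
  proof (cases "t \<le> m1")
    case True
    then show ?thesis by (simp add: \<eta>_def m1_def S(6))
  next
    case False
    then show ?thesis using that by (simp add: \<eta>_def m2_def S(7))
  qed
  let ?Q = "cbox (vector [m1, l - \<delta>]) (vector [m2, l + \<delta>]) :: (real^2) set"
  have Q: "w \<in> ?Q \<longleftrightarrow> m1 \<le> w $ 1 \<and> w $ 1 \<le> m2 \<and> \<bar>w $ 2 - l\<bar> \<le> \<delta>" for w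
    by (auto simp: mem_box_cart forall_2 abs_le_iff)
  have QE: "?Q \<subseteq> ?E"
  proof
    fix w assume "w \<in> ?Q"
    then have w: "m1 \<le> w $ 1" "w $ 1 \<le> m2" "\<bar>w $ 2 - l\<bar> \<le> \<delta>" by (simp_all add: Q)
    have 1: "vector [\<xi>1 + s, w $ 2] \<in> ?E" if "\<bar>s\<bar> \<le> \<delta>" for s
      using e1(2)[of "vector [\<xi>1 + s, w $ 2]"] that w(3) \<delta>(2) by (simp add: \<xi>1_def l_def)
    have 2: "vector [\<xi>2 + s, w $ 2] \<in> ?E" if "\<bar>s\<bar> \<le> \<delta>" for s
      using e2(2)[of "vector [\<xi>2 + s, w $ 2]"] that w(3) \<delta>(3) A(3) by (simp add: \<xi>2_def l_def)
    have "\<bar>\<xi>1 - \<delta> - a\<bar> < \<kappa>" "\<bar>\<xi>1 + \<delta> - a\<bar> < \<kappa>" "\<bar>\<xi>2 - \<delta> - a\<bar> < \<kappa>" "\<bar>\<xi>2 + \<delta> - a\<bar> < \<kappa>" "\<bar>w $ 2 - b\<bar> < \<kappa>"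
      using 1[of "-\<delta>"] 1[of \<delta>] 2[of "-\<delta>"] 2[of \<delta>] \<delta>(1) by (simp_all add: E_def)
    then have "\<bar>w $ 1 - a\<bar> < \<kappa>" "\<bar>w $ 2 - b\<bar> < \<kappa>"
      using w(1,2) by (auto simp: m1_def m2_def min_def max_def abs_less_iff split: if_splits)
    then show "w \<in> ?E" by (simp add: E_def)
  qed
  define T where "T = \<Phi> ` ?Q"
  have T: "compact T" "T \<subseteq> D"
    using compact_continuous_image[OF continuous_on_subset[OF hm(6) QE] compact_cbox] hm(1) QE by (auto simp: T_def)
  have TI: "x \<in> T" if "x \<in> D" "?\<Psi> x \<in> ?Q" for x
    unfolding T_def using imageI[OF that(2), of \<Phi>] unfolding hm(4)[OF that(1)] .
  define \<phi> where "\<phi> x = (if x \<in> D then \<eta> (n \<bullet> x) * k (\<psi> x) else 0)" for x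
  define G where "G x = (if x \<in> D then (\<eta>' (n \<bullet> x) * k (\<psi> x)) *\<^sub>R n + (\<eta> (n \<bullet> x) * k' (\<psi> x)) *\<^sub>R rot (Z x) else 0)" for x
  have \<phi>T: "x \<in> T" if "\<phi> x \<noteq> 0" for x
  proof -
    have xD: "x \<in> D" using that by (auto simp: \<phi>_def split: if_splits)
    have "\<eta> (n \<bullet> x) \<noteq> 0" "k (\<psi> x) \<noteq> 0" using that xD by (auto simp: \<phi>_def)
    then have "\<not> (n \<bullet> x \<le> m1 \<or> m2 \<le> n \<bullet> x)" "\<not> \<bar>\<psi> x - l\<bar> \<ge> \<delta>" using \<eta>0 k0 by blast+
    then have "?\<Psi> x \<in> ?Q" unfolding Q by simp
    then show ?thesis by (rule TI[OF xD])
  qed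
  have cl: "closed T" by (rule compact_imp_closed[OF T(1)])
  have dD: "(\<phi> has_derivative (\<lambda>v. G x \<bullet> v)) (at x)" if x: "x \<in> D" for x
  proof -
    have 1: "((\<lambda>x. n \<bullet> x) has_derivative (\<lambda>v. n \<bullet> v)) (at x)"
      by (rule bounded_linear_imp_has_derivative[OF bounded_linear_inner_right])
    have 2: "((\<lambda>x. \<eta> (n \<bullet> x)) has_derivative (\<lambda>v. \<eta>' (n \<bullet> x) * (n \<bullet> v))) (at x)"
      by (rule has_derivative_compose[OF 1 d\<eta>[unfolded has_field_derivative_def]])
    have 3: "((\<lambda>x. k (\<psi> x)) has_derivative (\<lambda>v. k' (\<psi> x) * (rot (Z x) \<bullet> v))) (at x)"
      by (rule has_derivative_compose[OF \<psi>[OF x] dk[unfolded has_field_derivative_def]])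
    have e: "(\<lambda>v. \<eta> (n \<bullet> x) * (k' (\<psi> x) * (rot (Z x) \<bullet> v)) + \<eta>' (n \<bullet> x) * (n \<bullet> v) * k (\<psi> x)) = (\<lambda>v. G x \<bullet> v)"
      using x by (simp add: G_def inner_add_left algebra_simps)
    have "((\<lambda>x. \<eta> (n \<bullet> x) * k (\<psi> x)) has_derivative (\<lambda>v. G x \<bullet> v)) (at x)"
      using has_derivative_mult[OF 2 3] unfolding e .
    then show ?thesis by (rule has_derivative_transform_within_open[OF _ D(1) x]) (simp add: \<phi>_def)
  qed
  have d0: "(\<phi> has_derivative (\<lambda>v. 0)) (at x)" if "x \<notin> T" for x
    by (rule has_derivative_transform_within_open[of "\<lambda>_. 0" _ _ _ "- T"]) (use that \<phi>T cl in \<open>auto simp: open_Compl\<close>)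
  have G0: "G x = 0" if "x \<notin> T" for x
  proof (cases "x \<in> D")
    case True
    have "(\<lambda>v. G x \<bullet> v) = (\<lambda>v. 0)" by (rule has_derivative_unique[OF dD[OF True] d0[OF that]])
    then have "G x \<bullet> G x = 0" by (rule fun_cong)
    then show ?thesis by simp
  qed (simp add: G_def)
  have dG: "(\<phi> has_derivative (\<lambda>v. G x \<bullet> v)) (at x)" for x
  proof (cases "x \<in> D")
    case False
    then have "x \<notin> T" using T(2) by blast
    then show ?thesis using d0[of x] G0[of x] by simp
  qed (rule dD)
  have c\<psi>: "continuous_on D \<psi>"
    by (intro continuous_at_imp_continuous_on ballI has_derivative_continuous[OF \<psi>])
  have cGD: "continuous_on D G"
  proof (rule continuous_on_eq)
    show "continuous_on D (\<lambda>x. (\<eta>' (n \<bullet> x) * k (\<psi> x)) *\<^sub>R n + (\<eta> (n \<bullet> x) * k' (\<psi> x)) *\<^sub>R rot (Z x))"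
      by (intro continuous_intros rot_continuous Z continuous_on_compose2[OF c\<eta>'] continuous_on_compose2[OF c\<eta>[of UNIV]]
          continuous_on_compose2[OF ck[of UNIV]] continuous_on_compose2[OF ck'] c\<psi>) auto
  qed (simp add: G_def)
  have cG0: "continuous_on (- T) G"
    by (rule continuous_on_eq[OF continuous_on_const[of _ 0]]) (simp add: G0)
  have UN: "D \<union> - T = UNIV" using T(2) by blast
  have "continuous_on (D \<union> - T) G"
    by (rule continuous_on_open_Un[OF D(1) open_Compl[OF cl] cGD cG0])
  then have cG: "continuous_on UNIV G" unfolding UN .
  have C\<phi>: "C1_on UNIV \<phi>" "\<And>x. grad \<phi> x = G x" using C1_on_gradI[OF dG cG] by auto
  let ?f = "\<lambda>x. indicator V x * (Z x \<bullet> grad \<phi> x) :: real"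
  have TB: "T \<subseteq> B" using T(2) D(2) by blast
  have int: "integrable lborel ?f" "integral\<^sup>L lborel ?f = 0"
    using flux[OF C\<phi>(1) T(1) TB \<phi>T] by blast+
  have fV: "?f x = S' (n \<bullet> x - \<xi>1) * k (\<psi> x) * (n \<bullet> Z x)" if x: "x \<in> D" "x \<in> V" for x
  proof -
    have "S' (n \<bullet> x - \<xi>2) * k (\<psi> x) = 0"
    proof (rule ccontr)
      assume "S' (n \<bullet> x - \<xi>2) * k (\<psi> x) \<noteq> 0"
      then have "\<not> \<bar>n \<bullet> x - \<xi>2\<bar> \<ge> \<delta>" "\<not> \<bar>\<psi> x - l\<bar> \<ge> \<delta>" using S(5) k0 by auto
      then have "\<Phi> (?\<Psi> x) \<in> V'" using e2(2)[of "?\<Psi> x"] \<delta>(3) A(3) by (simp add: \<xi>2_def l_def)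
      then show False using hm(4)[OF x(1)] x(2) V(3) by auto
    qed
    then have "\<eta>' (n \<bullet> x) * k (\<psi> x) = S' (n \<bullet> x - \<xi>1) * k (\<psi> x)" by (simp add: \<eta>'_def left_diff_distrib)
    then show ?thesis using x by (simp add: C\<phi>(2) G_def inner_add_right inner_commute[of n])
  qed
  have fnn: "?f x \<ge> 0" for x
  proof (cases "x \<in> D \<and> x \<in> V")
    case True
    then show ?thesis using fV[of x] S(3) knn n[of x] by simp
  next
    case False
    then have "x \<notin> V \<or> x \<notin> T" using T(2) by blast
    then show ?thesis using G0[of x] by (auto simp: C\<phi>(2))
  qed
  have AE: "AE x in lborel. ?f x = 0"
    using int integral_nonneg_eq_0_iff_AE[OF int(1)] fnn by simp
  define R where "R = (D \<inter> V) \<inter> (\<lambda>x. S' (n \<bullet> x - \<xi>1) * k (\<psi> x) * (n \<bullet> Z x)) -` {0<..}"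
  have "open R"
    unfolding R_def
    by (rule continuous_open_preimage[OF _ open_Int[OF D(1) V(1)]])
      (intro continuous_intros continuous_on_compose2[OF S(2)] continuous_on_compose2[OF ck[of UNIV]]
        continuous_on_subset[OF c\<psi>] continuous_on_subset[OF Z]; auto)+
  moreover have "A \<in> R"
    using A(1) S(4) kl n[of A] by (simp add: R_def \<xi>1_def l_def)
  moreover have "AE x in lborel. x \<notin> R"
    using AE
  proof (rule AE_mp)
    have "x \<notin> R" if f0: "?f x = 0" for x
    proof
      assume "x \<in> R"
      then have "x \<in> D" "x \<in> V" "S' (n \<bullet> x - \<xi>1) * k (\<psi> x) * (n \<bullet> Z x) > 0" by (auto simp: R_def)
      then have "?f x > 0" by (simp only: fV)
      then show False using f0 by simp
    qed
    then show "AE x in lborel. ?f x = 0 \<longrightarrow> x \<notin> R" by (intro AE_I2 impI)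
  qed
  ultimately have "negligible R" "open R" "R \<noteq> {}"
    by (auto simp: negligible_iff_null_sets AE_iff_null_sets[of R lborel, symmetric] intro!: null_sets_completionI)
  then show False using open_not_negligible by blast
qed

section \<open>The two sides of the singular curve\<close>

lemma normal_extension_crossing:
  assumes "normal_extension F H u K V V' \<kappa> B N \<epsilon>" "q \<in> B" "q \<in> K"
  obtains c \<phi> where "c 0 = q" "\<And>t. \<bar>t\<bar> < \<epsilon> \<Longrightarrow> c t \<in> B" "\<And>t. \<bar>t\<bar> < \<epsilon> \<Longrightarrow> N (c t) = dirN (\<phi> t)"
    "\<And>t. \<bar>t\<bar> < \<epsilon> \<Longrightarrow> (c has_vector_derivative dirT (\<phi> t)) (at t)"
    "\<And>t. \<bar>t\<bar> < \<epsilon> \<Longrightarrow> (\<phi> has_real_derivative - H (c t)) (at t)"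
    "\<And>t. \<bar>t\<bar> < \<epsilon> \<Longrightarrow> \<kappa> * t < 0 \<Longrightarrow> c t \<in> V" "\<And>t. \<bar>t\<bar> < \<epsilon> \<Longrightarrow> 0 < \<kappa> * t \<Longrightarrow> c t \<in> V'"
proof -
  obtain c \<phi> where "c 0 = q" and *: "\<forall>t\<in>{-\<epsilon><..<\<epsilon>}. c t \<in> B \<and> N (c t) = dirN (\<phi> t) \<and>
      (c has_vector_derivative dirT (\<phi> t)) (at t) \<and> (\<phi> has_real_derivative - H (c t)) (at t) \<and>
      (\<kappa> * t < 0 \<longrightarrow> c t \<in> V) \<and> (0 < \<kappa> * t \<longrightarrow> c t \<in> V')"
    using assms unfolding normal_extension_def by blast
  have "t \<in> {-\<epsilon><..<\<epsilon>}" if "\<bar>t\<bar> < \<epsilon>" for t using that by auto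
  note t = *[rule_format, OF this]
  show thesis by (rule that[of c \<phi>, OF \<open>c 0 = q\<close>]) (use t in blast)+
qed

text \<open>Extensions of the normal field from both sides of the singular curve. The same \<open>\<kappa>\<close> occurs in
  both, with V and \<open>V'\<close> interchanged: this is where the sign of the curl enters.\<close>

locale two_sided =
  fixes \<Omega> :: "(real^2) set" and F :: "real^2 \<Rightarrow> real^2" and H u :: "real^2 \<Rightarrow> real"
    and K V V' B B' :: "(real^2) set" and N N' :: "real^2 \<Rightarrow> real^2" and \<kappa> \<epsilon> \<epsilon>' :: real and p :: "real^2"
  defines "K \<equiv> sing_set \<Omega> F u"
  assumes dom: "open \<Omega>" and C1: "C1_on \<Omega> F" "C1_on \<Omega> H" "C1_on \<Omega> u"
    and weak: "weak_solution \<Omega> F H u"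
    and V: "open V" "open V'" "V \<inter> V' = {}" and B: "B \<subseteq> \<Omega>" "B - K \<subseteq> V \<union> V'" "V \<subseteq> \<Omega> - K" "V' \<subseteq> \<Omega> - K"
    and \<kappa>: "\<kappa> = 1 \<or> \<kappa> = -1"
    and ext: "normal_extension F H u K V V' \<kappa> B N \<epsilon>" and ext': "normal_extension F H u K V' V \<kappa> B' N' \<epsilon>'"
    and p: "p \<in> B" "p \<in> B'" "p \<in> K"
begin

lemma open_B: "open B" "open B'"
  and C1_N: "C1_on B N" "C1_on B' N'"
  and norm_N: "x \<in> B \<Longrightarrow> norm (N x) = 1" "x \<in> B' \<Longrightarrow> norm (N' x) = 1"
  and divergence_N: "x \<in> B \<Longrightarrow> divergence N x = H x" "x \<in> B' \<Longrightarrow> divergence N' x = H x"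
  and normal_N: "x \<in> B \<Longrightarrow> x \<in> V \<Longrightarrow> normal_dir F u x = N x" "x \<in> B' \<Longrightarrow> x \<in> V' \<Longrightarrow> normal_dir F u x = N' x"
  and negligible_K: "negligible (B \<inter> K)"
  and eps: "\<epsilon> > 0" "\<epsilon>' > 0"
  using ext ext' unfolding normal_extension_def by blast+

text \<open>Otherwise both crossing curves through p solve the characteristic system with the same
  initial values, the angles being equal modulo \<open>2 \<pi>\<close>. They coincide near p, but at a time t with
  \<open>\<kappa> * t > 0\<close> one is in \<open>V'\<close> and the other in V.\<close>

lemma normals_differ: "N p \<noteq> N' p"
proof
  assume eq: "N p = N' p"
  obtain c \<phi> where c: "c 0 = p" "\<And>t. \<bar>t\<bar> < \<epsilon> \<Longrightarrow> c t \<in> B" "\<And>t. \<bar>t\<bar> < \<epsilon> \<Longrightarrow> N (c t) = dirN (\<phi> t)"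
    "\<And>t. \<bar>t\<bar> < \<epsilon> \<Longrightarrow> (c has_vector_derivative dirT (\<phi> t)) (at t)"
    "\<And>t. \<bar>t\<bar> < \<epsilon> \<Longrightarrow> (\<phi> has_real_derivative - H (c t)) (at t)"
    "\<And>t. \<bar>t\<bar> < \<epsilon> \<Longrightarrow> \<kappa> * t < 0 \<Longrightarrow> c t \<in> V" "\<And>t. \<bar>t\<bar> < \<epsilon> \<Longrightarrow> 0 < \<kappa> * t \<Longrightarrow> c t \<in> V'"
    by (rule normal_extension_crossing[OF ext p(1,3)]) (rule that)
  obtain d \<omega> where d: "d 0 = p" "\<And>t. \<bar>t\<bar> < \<epsilon>' \<Longrightarrow> d t \<in> B'" "\<And>t. \<bar>t\<bar> < \<epsilon>' \<Longrightarrow> N' (d t) = dirN (\<omega> t)"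
    "\<And>t. \<bar>t\<bar> < \<epsilon>' \<Longrightarrow> (d has_vector_derivative dirT (\<omega> t)) (at t)"
    "\<And>t. \<bar>t\<bar> < \<epsilon>' \<Longrightarrow> (\<omega> has_real_derivative - H (d t)) (at t)"
    "\<And>t. \<bar>t\<bar> < \<epsilon>' \<Longrightarrow> \<kappa> * t < 0 \<Longrightarrow> d t \<in> V'" "\<And>t. \<bar>t\<bar> < \<epsilon>' \<Longrightarrow> 0 < \<kappa> * t \<Longrightarrow> d t \<in> V"
    by (rule normal_extension_crossing[OF ext' p(2,3)]) (rule that)
  have "dirN (\<phi> 0) = dirN (\<omega> 0)" using c(3)[of 0] d(3)[of 0] c(1) d(1) eq eps by simp
  then obtain k :: int where k: "\<phi> 0 = \<omega> 0 + 2 * pi * real_of_int k" by (rule dirN_eq_imp)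
  define m where "m = 2 * pi * real_of_int k"
  have T: "dirT (a + m) = dirT a" for a
    unfolding m_def dirT_def by (simp add: sin_add cos_add mult.commute[of "real_of_int k"] cos_int_2pin sin_int_2pin)
  have p\<Omega>: "p \<in> \<Omega>" using p(1) B(1) by blast
  define e where "e = min \<epsilon> \<epsilon>'"
  have e: "e > 0" "e \<le> \<epsilon>" "e \<le> \<epsilon>'" using eps by (auto simp: e_def)
  have d5: "((\<lambda>t. \<omega> t + m) has_real_derivative - H (d t)) (at t)" if "\<bar>t\<bar> < e" for t
    using DERIV_add[OF d(5) DERIV_const[of m], of t] that e(3) by simp
  have d4: "(d has_vector_derivative dirT (\<omega> t + m)) (at t)" if "\<bar>t\<bar> < e" for t
    using d(4)[of t] that e(3) T by simp
  have c4: "(c has_vector_derivative dirT (\<phi> t)) (at t)" "(\<phi> has_real_derivative - H (c t)) (at t)" if "\<bar>t\<bar> < e" for t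
    using c(4,5)[of t] that e(2) by simp_all
  have k': "\<omega> 0 + m = \<phi> 0" using k by (simp add: m_def)
  obtain s where s: "0 < s" "s < e" "\<And>t. \<bar>t\<bar> \<le> s \<Longrightarrow> c t = d t"
    by (rule char_system_unique[where \<phi>=\<phi> and \<eta>="\<lambda>t. \<omega> t + m" and c=c and d=d,
          OF dom C1(2) p\<Omega> e(1) c(1) refl c4 d(1) k' d4 d5]) (assumption+, rule that)
  have "c (\<kappa> * s) = d (\<kappa> * s)" using s \<kappa> by (intro s(3)) auto
  moreover have "\<bar>\<kappa> * s\<bar> < \<epsilon>" "\<bar>\<kappa> * s\<bar> < \<epsilon>'" "0 < \<kappa> * (\<kappa> * s)" using s e \<kappa> by auto
  ultimately have "c (\<kappa> * s) \<in> V'" "c (\<kappa> * s) \<in> V" using c(7)[of "\<kappa> * s"] d(7)[of "\<kappa> * s"] by auto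
  then show False using V(3) by blast
qed

definition Z where "Z x = N x - N' x"

lemma Z_C1: "C1_on (B \<inter> B') Z"
proof -
  have d: "((\<lambda>x. N x - N' x) has_derivative (\<lambda>v. frechet_derivative N (at x) v - frechet_derivative N' (at x) v)) (at x)"
    if "x \<in> B \<inter> B'" for x
    using that by (intro has_derivative_diff C1_on_has_derivative[OF C1_N(1)] C1_on_has_derivative[OF C1_N(2)]) auto
  have "continuous_on (B \<inter> B') (partial i (\<lambda>x. N x - N' x))" for i
  proof (rule continuous_on_eq)
    show "continuous_on (B \<inter> B') (\<lambda>x. partial i N x - partial i N' x)"
      using C1_N by (intro continuous_intros) (auto simp: C1_on_def intro: continuous_on_subset)
    show "partial i N x - partial i N' x = partial i (\<lambda>x. N x - N' x) x" if "x \<in> B \<inter> B'" for x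
      using partial_eq[OF d[OF that]] by (simp add: partial_def)
  qed
  moreover have "Z = (\<lambda>x. N x - N' x)" by (simp add: Z_def fun_eq_iff)
  ultimately show ?thesis unfolding C1_on_def using differentiableI[OF d] by simp
qed

lemma Z_divergence: "x \<in> B \<inter> B' \<Longrightarrow> divergence Z x = 0"
proof -
  assume x: "x \<in> B \<inter> B'"
  have "((\<lambda>x. N x - N' x) has_derivative (\<lambda>v. frechet_derivative N (at x) v - frechet_derivative N' (at x) v)) (at x)"
    using x by (intro has_derivative_diff C1_on_has_derivative[OF C1_N(1)] C1_on_has_derivative[OF C1_N(2)]) auto
  from partial_eq[OF this] have "partial i (\<lambda>x. N x - N' x) x = partial i N x - partial i N' x" for i
    by (simp add: partial_def)
  moreover have "Z = (\<lambda>x. N x - N' x)" by (simp add: Z_def fun_eq_iff)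
  ultimately show "divergence Z x = 0"
    using divergence_N(1)[of x] divergence_N(2)[of x] x by (simp add: divergence_def)
qed

text \<open>For two unit vectors the line spanned by their difference makes equal angles with both; this is the reason for the
  equality of angles as well as for the monotonicity of the stream function along crossing
  curves.\<close>

lemma Z_inner:
  assumes "x \<in> B \<inter> B'"
  shows "Z x \<bullet> N x = (norm (Z x))\<^sup>2 / 2" "Z x \<bullet> N' x = - ((norm (Z x))\<^sup>2 / 2)"
proof -
  have "N x \<bullet> N x = 1" "N' x \<bullet> N' x = 1" using norm_N[of x] assms by (simp_all add: dot_square_norm)
  then show "Z x \<bullet> N x = (norm (Z x))\<^sup>2 / 2" "Z x \<bullet> N' x = - ((norm (Z x))\<^sup>2 / 2)"
    unfolding power2_norm_eq_inner Z_def by (simp_all add: inner_diff_left inner_diff_right inner_commute[of "N' x" "N x"] field_simps)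
qed

lemma Z_flux:
  assumes G: "open G" "G \<subseteq> B \<inter> B'" "bounded G" and \<phi>: "C1_on UNIV \<phi>" "compact S" "S \<subseteq> G" "\<And>x. \<phi> x \<noteq> 0 \<Longrightarrow> x \<in> S"
  shows "integrable lborel (\<lambda>x. indicator V x * (Z x \<bullet> grad \<phi> x)) \<and>
    integral\<^sup>L lborel (\<lambda>x. indicator V x * (Z x \<bullet> grad \<phi> x)) = 0"
proof -
  have sub: "G \<subseteq> B" "G \<subseteq> B'" using G(2) by auto
  have 1: "G \<subseteq> \<Omega>" using sub(1) B(1) by blast
  have 2: "G - K = G \<inter> (V \<union> V')" using sub(1) B(2-4) by blast
  have 3: "negligible (G \<inter> K)" by (rule negligible_subset[OF negligible_K]) (use sub in blast)
  note J = weak_jump[OF dom C1(1,3) weak G(1) 1 G(3) V 2[unfolded K_def] 3[unfolded K_def] C1_on_subset[OF C1_N(1) sub(1)] _ _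
      C1_on_subset[OF C1_N(2) sub(2)] _ _ _ \<phi>]
  show ?thesis unfolding Z_def
    using J normal_N norm_N divergence_N sub by blast
qed

end

lemma unit_speed_dist:
  assumes "\<And>t. \<bar>t\<bar> < \<epsilon> \<Longrightarrow> (c has_vector_derivative dirT (\<phi> t)) (at t)" and t: "\<bar>t\<bar> < \<epsilon>"
  shows "dist (c 0) (c t) \<le> \<bar>t\<bar>"
proof -
  have "norm (c t - c 0) \<le> 1 * norm (t - 0)"
  proof (rule differentiable_bound[of "{-\<bar>t\<bar>..\<bar>t\<bar>}" c "\<lambda>s h. h *\<^sub>R dirT (\<phi> s)"])
    show "(c has_derivative (\<lambda>h. h *\<^sub>R dirT (\<phi> s))) (at s within {-\<bar>t\<bar>..\<bar>t\<bar>})" if "s \<in> {-\<bar>t\<bar>..\<bar>t\<bar>}" for s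
    proof -
      have "\<bar>s\<bar> < \<epsilon>" using that t by auto
      from has_derivative_at_withinI[OF assms(1)[OF this, unfolded has_vector_derivative_def]] show ?thesis .
    qed
  qed (auto simp: onorm_scaleR_left bounded_linear_ident onorm_id)
  then show ?thesis by (simp add: dist_norm norm_minus_commute)
qed

context two_sided
begin

text \<open>Along the crossing curve through q the function \<open>\<kappa> * \<psi>\<close> increases, in the direction from V
  to \<open>V'\<close>, at a rate of at least m. So near q it takes all values slightly above \<open>\<kappa> * \<psi> q\<close> on \<open>V'\<close>
  and all values slightly below on V.\<close>

lemma stream_monotone:
  assumes D: "D \<subseteq> B \<inter> B'" and \<psi>: "\<And>x. x \<in> D \<Longrightarrow> (\<psi> has_derivative (\<lambda>v. rot (Z x) \<bullet> v)) (at x)"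
    and m: "m > 0" "\<And>x. x \<in> D \<Longrightarrow> m \<le> (norm (Z x))\<^sup>2 / 2" and t0: "t0 \<le> \<epsilon>" "t0 > 0"
    and q: "q \<in> K" "ball q t0 \<subseteq> D" and \<eta>: "0 < \<eta>" "\<eta> < m * t0"
  shows "\<exists>x\<in>D \<inter> V'. \<kappa> * \<psi> x = \<kappa> * \<psi> q + \<eta>" "\<exists>x\<in>D \<inter> V. \<kappa> * \<psi> x = \<kappa> * \<psi> q - \<eta>"
proof -
  have "q \<in> ball q t0" using t0(2) by simp
  then have qB: "q \<in> B" using q(2) D by blast
  obtain c \<phi> where c: "c 0 = q" "\<And>t. \<bar>t\<bar> < \<epsilon> \<Longrightarrow> c t \<in> B" "\<And>t. \<bar>t\<bar> < \<epsilon> \<Longrightarrow> N (c t) = dirN (\<phi> t)"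
    "\<And>t. \<bar>t\<bar> < \<epsilon> \<Longrightarrow> (c has_vector_derivative dirT (\<phi> t)) (at t)"
    "\<And>t. \<bar>t\<bar> < \<epsilon> \<Longrightarrow> (\<phi> has_real_derivative - H (c t)) (at t)"
    "\<And>t. \<bar>t\<bar> < \<epsilon> \<Longrightarrow> \<kappa> * t < 0 \<Longrightarrow> c t \<in> V" "\<And>t. \<bar>t\<bar> < \<epsilon> \<Longrightarrow> 0 < \<kappa> * t \<Longrightarrow> c t \<in> V'"
    by (rule normal_extension_crossing[OF ext qB q(1)]) (rule that)
  have \<kappa>2: "\<kappa> * (\<kappa> * s) = s" "\<bar>\<kappa> * s\<bar> = \<bar>s\<bar>" for s using \<kappa> by auto
  define \<gamma> where "\<gamma> s = c (\<kappa> * s)" for s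
  define f where "f s = \<kappa> * \<psi> (\<gamma> s)" for s
  have \<gamma>0: "\<gamma> 0 = q" using c(1) by (simp add: \<gamma>_def)
  have \<gamma>D: "\<gamma> s \<in> D" if "\<bar>s\<bar> < t0" for s
  proof -
    have 1: "\<bar>\<kappa> * s\<bar> < \<epsilon>" using that t0(1) by (simp add: \<kappa>2)
    have "dist q (c (\<kappa> * s)) \<le> \<bar>\<kappa> * s\<bar>"
      using unit_speed_dist[OF c(4) 1] c(1) by simp
    then show ?thesis using that q(2) by (auto simp: \<gamma>_def \<kappa>2)
  qed
  have df: "(f has_real_derivative (norm (Z (\<gamma> s)))\<^sup>2 / 2) (at s)" if s: "\<bar>s\<bar> < t0" for s
  proof -
    have 1: "\<bar>\<kappa> * s\<bar> < \<epsilon>" using s t0(1) by (simp add: \<kappa>2)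
    have a: "((\<lambda>s. \<kappa> * s) has_derivative (\<lambda>h. \<kappa> * h)) (at s)" by (auto intro!: derivative_eq_intros)
    have b: "(\<gamma> has_derivative (\<lambda>h. (\<kappa> * h) *\<^sub>R dirT (\<phi> (\<kappa> * s)))) (at s)"
      unfolding \<gamma>_def[abs_def]
      by (rule has_derivative_compose[OF a c(4)[OF 1, unfolded has_vector_derivative_def]])
    have d: "((\<lambda>s. \<psi> (\<gamma> s)) has_derivative (\<lambda>h. rot (Z (\<gamma> s)) \<bullet> ((\<kappa> * h) *\<^sub>R dirT (\<phi> (\<kappa> * s))))) (at s)"
      by (rule has_derivative_compose[OF b \<psi>[OF \<gamma>D[OF s]]])
    have "rot (Z (\<gamma> s)) \<bullet> dirT (\<phi> (\<kappa> * s)) = Z (\<gamma> s) \<bullet> N (\<gamma> s)"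
      using c(3)[OF 1] by (simp add: \<gamma>_def inner_2)
    also have "\<dots> = (norm (Z (\<gamma> s)))\<^sup>2 / 2" using \<gamma>D[OF s] D by (intro Z_inner) blast
    finally have e: "rot (Z (\<gamma> s)) \<bullet> dirT (\<phi> (\<kappa> * s)) = (norm (Z (\<gamma> s)))\<^sup>2 / 2" .
    have "(f has_derivative (\<lambda>h. \<kappa> * (rot (Z (\<gamma> s)) \<bullet> ((\<kappa> * h) *\<^sub>R dirT (\<phi> (\<kappa> * s)))))) (at s)"
      unfolding f_def[abs_def] by (rule has_derivative_mult_right[OF d])
    moreover have "(\<lambda>h. \<kappa> * (rot (Z (\<gamma> s)) \<bullet> ((\<kappa> * h) *\<^sub>R dirT (\<phi> (\<kappa> * s))))) = (*) ((norm (Z (\<gamma> s)))\<^sup>2 / 2)"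
      using \<kappa> by (auto simp: e fun_eq_iff)
    ultimately show ?thesis by (simp add: has_field_derivative_def)
  qed
  have cf: "continuous_on S f" if "S \<subseteq> {-t0<..<t0}" for S
  proof (intro continuous_at_imp_continuous_on ballI)
    fix s assume "s \<in> S"
    from subsetD[OF that this] have "\<bar>s\<bar> < t0" by auto
    then show "isCont f s" by (rule DERIV_isCont[OF df])
  qed
  have mono: "f a + m * (b - a) \<le> f b" if "a \<le> b" "-t0 < a" "b < t0" for a b
  proof -
    have "f a - m * a \<le> f b - m * b"
    proof (rule DERIV_nonneg_imp_nondecreasing[OF that(1)])
      fix s assume s: "a \<le> s" "s \<le> b"
      then have s': "\<bar>s\<bar> < t0" using that by auto
      have "((\<lambda>s. f s - m * s) has_real_derivative ((norm (Z (\<gamma> s)))\<^sup>2 / 2 - m * 1)) (at s)"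
        by (intro DERIV_diff df[OF s'] DERIV_cmult DERIV_ident)
      then show "\<exists>y. ((\<lambda>s. f s - m * s) has_real_derivative y) (at s) \<and> y \<ge> 0"
        using m(2)[OF \<gamma>D[OF s']] by (intro exI conjI) auto
    qed
    then show ?thesis by (simp add: algebra_simps)
  qed
  define s1 where "s1 = \<eta> / m"
  have s1: "s1 > 0" "s1 < t0" "m * s1 = \<eta>" using \<eta> m(1) by (auto simp: s1_def field_simps)
  have "\<exists>s\<ge>0. s \<le> s1 \<and> f s = f 0 + \<eta>"
    by (rule IVT'[OF _ _ _ cf]) (use mono[of 0 s1] s1 \<eta> in auto)
  then obtain s where s: "0 \<le> s" "s \<le> s1" "f s = f 0 + \<eta>" by blast
  have "s \<noteq> 0" using s(3) \<eta>(1) by auto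
  then have s': "0 < s" "\<bar>s\<bar> < t0" using s s1 by auto
  have "\<gamma> s \<in> V'" unfolding \<gamma>_def using s' t0(1) by (intro c(7)) (simp_all add: \<kappa>2)
  then show "\<exists>x\<in>D \<inter> V'. \<kappa> * \<psi> x = \<kappa> * \<psi> q + \<eta>"
    using \<gamma>D[OF s'(2)] s(3) \<gamma>0 by (intro bexI[of _ "\<gamma> s"]) (auto simp: f_def)
  have "\<exists>s\<ge>-s1. s \<le> 0 \<and> f s = f 0 - \<eta>"
    by (rule IVT'[OF _ _ _ cf]) (use mono[of "-s1" 0] s1 \<eta> in auto)
  then obtain r where r: "-s1 \<le> r" "r \<le> 0" "f r = f 0 - \<eta>" by blast
  have "r \<noteq> 0" using r(3) \<eta>(1) by auto
  then have r': "r < 0" "\<bar>r\<bar> < t0" using r s1 by auto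
  have "\<gamma> r \<in> V" unfolding \<gamma>_def using r' t0(1) by (intro c(6)) (simp_all add: \<kappa>2)
  then show "\<exists>x\<in>D \<inter> V. \<kappa> * \<psi> x = \<kappa> * \<psi> q - \<eta>"
    using \<gamma>D[OF r'(2)] r(3) \<gamma>0 by (intro bexI[of _ "\<gamma> r"]) (auto simp: f_def)
qed

text \<open>If \<open>\<kappa> * \<psi> a < \<kappa> * \<psi> b\<close> for two singular points near p, the level half way between is
  attained in \<open>V'\<close> near \<open>a\<close> and in V near b, which \<open>no_level_crossing\<close> excludes. The rate m and
  the length \<open>t0\<close> of the crossing curves are uniform, so it is enough that the two values differ
  by less than \<open>m * t0\<close>.\<close>

lemma stream_constant:
  assumes D: "open D" "p \<in> D" "D \<subseteq> B \<inter> B'" "bounded D"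
    and \<psi>: "\<And>x. x \<in> D \<Longrightarrow> (\<psi> has_derivative (\<lambda>v. rot (Z x) \<bullet> v)) (at x)"
    and n: "\<And>x. x \<in> D \<Longrightarrow> Z p \<bullet> Z x > 0"
    and hom: "homeomorphism D {w::real^2. \<bar>w $ 1 - Z p \<bullet> p\<bar> < r \<and> \<bar>w $ 2 - \<psi> p\<bar> < r} (\<lambda>x. vector [Z p \<bullet> x, \<psi> x]) \<Phi>"
  obtains G where "open G" "p \<in> G" "G \<subseteq> D" "\<And>q. q \<in> G \<Longrightarrow> q \<in> K \<Longrightarrow> \<psi> q = \<psi> p"
proof -
  have Zp: "norm (Z p) > 0" using normals_differ by (simp add: Z_def)
  have cZ: "continuous_on D Z" by (rule continuous_on_subset[OF C1_on_continuous[OF Z_C1] D(3)])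
  have "open (D \<inter> (\<lambda>x. norm (Z x)) -` {norm (Z p) / 2<..})"
    by (rule continuous_open_preimage[OF _ D(1)]) (intro continuous_intros cZ, simp)
  moreover have "p \<in> D \<inter> (\<lambda>x. norm (Z x)) -` {norm (Z p) / 2<..}" using Zp D(2) by simp
  ultimately obtain e where e: "e > 0" "ball p e \<subseteq> D \<inter> (\<lambda>x. norm (Z x)) -` {norm (Z p) / 2<..}" by (rule openE)
  define m where "m = (norm (Z p) / 2)\<^sup>2 / 2"
  define t0 where "t0 = min \<epsilon> (e/2)"
  have m: "m > 0" using Zp by (simp add: m_def)
  have t0: "t0 > 0" "t0 \<le> \<epsilon>" "t0 \<le> e/2" using eps e(1) by (auto simp: t0_def)
  have mZ: "m \<le> (norm (Z x))\<^sup>2 / 2" if "x \<in> ball p e" for x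
  proof -
    have "norm (Z p) / 2 \<le> norm (Z x)" using e(2) that by auto
    then show ?thesis unfolding m_def by (intro divide_right_mono power_mono) auto
  qed
  have eD: "ball p e \<subseteq> D" using e(2) by blast
  have eB: "ball p e \<subseteq> B \<inter> B'" using eD D(3) by blast
  have \<psi>e: "(\<psi> has_derivative (\<lambda>v. rot (Z x) \<bullet> v)) (at x)" if "x \<in> ball p e" for x using \<psi> eD that by blast
  have key: "\<not> \<kappa> * \<psi> a < \<kappa> * \<psi> b" if ab: "a \<in> K" "b \<in> K" "a \<in> ball p (e/2)" "b \<in> ball p (e/2)" and d: "\<bar>\<psi> a - \<psi> b\<bar> < m * t0" for a b
  proof
    assume lt: "\<kappa> * \<psi> a < \<kappa> * \<psi> b"
    define \<eta> where "\<eta> = (\<kappa> * \<psi> b - \<kappa> * \<psi> a) / 2"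
    have \<eta>: "0 < \<eta>" "\<eta> < m * t0" using lt d \<kappa> by (auto simp: \<eta>_def)
    have sub: "ball q t0 \<subseteq> ball p e" if "q \<in> ball p (e/2)" for q
    proof
      fix x assume "x \<in> ball q t0"
      then show "x \<in> ball p e" using that t0(3) dist_triangle[of p x q] by simp
    qed
    obtain x where x: "x \<in> ball p e \<inter> V'" "\<kappa> * \<psi> x = \<kappa> * \<psi> a + \<eta>"
      using stream_monotone(1)[OF eB \<psi>e m mZ t0(2,1) ab(1) sub[OF ab(3)] \<eta>] by blast
    obtain y where y: "y \<in> ball p e \<inter> V" "\<kappa> * \<psi> y = \<kappa> * \<psi> b - \<eta>"
      using stream_monotone(2)[OF eB \<psi>e m mZ t0(2,1) ab(2) sub[OF ab(4)] \<eta>] by blast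
    have "\<kappa> * \<psi> x = \<kappa> * \<psi> y" unfolding x(2) y(2) \<eta>_def by (simp add: field_simps)
    then have "\<psi> y = \<psi> x" using \<kappa> by auto
    moreover have "y \<in> D \<inter> V" "x \<in> D \<inter> V'" using x(1) y(1) eD by auto
    ultimately show False
      by (intro no_level_crossing[OF Z_flux[OF D(1,3,4)] V D(1) subset_refl cZ \<psi> n hom])
  qed
  have c\<psi>: "continuous_on D \<psi>"
    by (intro continuous_at_imp_continuous_on ballI has_derivative_continuous[OF \<psi>])
  define G where "G = ball p (e/2) \<inter> \<psi> -` ball (\<psi> p) (m * t0)"
  have e2: "ball p (e/2) \<subseteq> D" using eD e(1) by auto
  show thesis
  proof (rule that[of G])
    show "open G" unfolding G_def
      by (rule continuous_open_preimage[OF continuous_on_subset[OF c\<psi> e2]]) auto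
    show "p \<in> G" using e(1) m t0(1) by (simp add: G_def)
    show "G \<subseteq> D" using e2 by (auto simp: G_def)
    fix q assume q: "q \<in> G" "q \<in> K"
    then have q': "q \<in> ball p (e/2)" "\<bar>\<psi> q - \<psi> p\<bar> < m * t0" "\<bar>\<psi> p - \<psi> q\<bar> < m * t0"
      by (auto simp: G_def dist_real_def)
    have p': "p \<in> ball p (e/2)" using e(1) by simp
    have "\<kappa> * \<psi> q = \<kappa> * \<psi> p" using key[OF q(2) p(3) q'(1) p' q'(2)] key[OF p(3) q(2) p' q'(1,3)] by linarith
    then show "\<psi> q = \<psi> p" using \<kappa> by auto
  qed
qed

text \<open>In the stream chart the singular set lies on one horizontal line. Being an arc, it covers a
  neighborhood of p on this line by invariance of domain. So it is parametrized by the coordinate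
  along \<open>Z p\<close>, which makes r continuously differentiable with derivative a positive multiple of
  Z.\<close>

lemma singular_curve:
  assumes U: "open U" "p \<in> U" "(U \<inter> K) homeomorphic {0<..<1::real}"
    and A: "A \<subseteq> K" "open G" "p \<in> G" "G \<inter> K \<subseteq> A"
  obtains W r Q \<psi> where "C1_curve_at A p W r" "open Q" "p \<in> Q" "(\<psi> has_derivative (\<lambda>v. rot (Z p) \<bullet> v)) (at p)"
    "\<And>q. q \<in> Q \<Longrightarrow> q \<in> K \<Longrightarrow> \<psi> q = \<psi> p"
proof -
  let ?n = "Z p"
  have Zp: "Z p \<noteq> 0" using normals_differ by (simp add: Z_def)
  have B0: "open (B \<inter> B' \<inter> ball p 1)" "p \<in> B \<inter> B' \<inter> ball p 1" using open_B p by auto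
  have Z0: "C1_on (B \<inter> B' \<inter> ball p 1) Z" by (rule C1_on_subset[OF Z_C1]) blast
  have Zdiv: "divergence Z x = 0" if "x \<in> B \<inter> B' \<inter> ball p 1" for x using that by (intro Z_divergence) blast
  show thesis
  proof (rule stream_chart[OF B0 Z0 Zdiv Zp])
    fix \<psi> :: "real^2 \<Rightarrow> real" and D and r0 :: real and \<Phi> :: "real^2 \<Rightarrow> real^2" and \<Phi>'
    assume D: "open D" "p \<in> D" "D \<subseteq> B \<inter> B' \<inter> ball p 1" and r0: "r0 > 0"
      and \<psi>: "\<And>x. x \<in> D \<Longrightarrow> (\<psi> has_derivative (\<lambda>v. rot (Z x) \<bullet> v)) (at x)"
      and n: "\<And>x. x \<in> D \<Longrightarrow> ?n \<bullet> Z x > 0"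
      and hom: "homeomorphism D {w::real^2. \<bar>w $ 1 - ?n \<bullet> p\<bar> < r0 \<and> \<bar>w $ 2 - \<psi> p\<bar> < r0} (\<lambda>x. vector [?n \<bullet> x, \<psi> x]) \<Phi>"
      and d\<Phi>: "\<And>w::real^2. \<bar>w $ 1 - ?n \<bullet> p\<bar> < r0 \<Longrightarrow> \<bar>w $ 2 - \<psi> p\<bar> < r0 \<Longrightarrow> (\<Phi> has_derivative \<Phi>' w) (at w)"
    let ?\<Psi> = "\<lambda>x. vector [?n \<bullet> x, \<psi> x] :: real^2"
    have \<Phi>\<Psi>: "\<Phi> (?\<Psi> x) = x" if "x \<in> D" for x by (rule homeomorphism_apply1[OF hom that])
    have DB: "D \<subseteq> B \<inter> B'" "bounded D" using D(3) bounded_subset[OF bounded_ball, of D p 1] by auto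
    obtain Q0 where Q0: "open Q0" "p \<in> Q0" "Q0 \<subseteq> D" and const: "\<And>q. q \<in> Q0 \<Longrightarrow> q \<in> K \<Longrightarrow> \<psi> q = \<psi> p"
      by (rule stream_constant[OF D(1,2) DB \<psi> n hom]) (assumption+, rule that)
    define Q where "Q = Q0 \<inter> U \<inter> G"
    have Q: "open Q" "p \<in> Q" "Q \<subseteq> D" "Q \<subseteq> Q0" using Q0 U(1,2) A(2,3) by (auto simp: Q_def)
    obtain h h' where hh: "homeomorphism {0<..<1::real} (U \<inter> K) h h'"
      using U(3) homeomorphic_sym unfolding homeomorphic_def by blast
    have hh1: "h ` {0<..<1} = U \<inter> K" "continuous_on {0<..<1} h" "\<And>s. s \<in> {0<..<1} \<Longrightarrow> h' (h s) = s"
      using hh by (auto simp: homeomorphism_def)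
    obtain s0 where s0: "s0 \<in> {0<..<1}" "h s0 = p" using hh1(1) U(2) p(3) by (metis IntI imageE)
    define I where "I = {0<..<1} \<inter> h -` Q"
    have I: "open I" unfolding I_def by (rule continuous_open_preimage[OF hh1(2) _ Q(1)]) auto
    have s0I: "s0 \<in> I" using s0 Q(2) by (simp add: I_def)
    have hI: "h s \<in> Q" "h s \<in> K" if "s \<in> I" for s using that hh1(1) by (auto simp: I_def)
    have level: "\<psi> (h s) = \<psi> p" if "s \<in> I" for s using const hI[OF that] Q(4) by blast
    define f where "f s = ?n \<bullet> h s" for s
    have cf: "continuous_on I f"
      unfolding f_def[abs_def] by (intro continuous_intros continuous_on_subset[OF hh1(2)]) (auto simp: I_def)
    have inj: "inj_on f I"
    proof
      fix s t assume st: "s \<in> I" "t \<in> I" "f s = f t"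
      then have "?\<Psi> (h s) = ?\<Psi> (h t)" by (simp add: f_def level)
      then have "\<Phi> (?\<Psi> (h s)) = \<Phi> (?\<Psi> (h t))" by (rule arg_cong)
      moreover have "h s \<in> D" "h t \<in> D" using hI(1) st(1,2) Q(3) by blast+
      ultimately have "h s = h t" by (simp only: \<Phi>\<Psi>)
      then have "h' (h s) = h' (h t)" by (rule arg_cong)
      moreover have "s \<in> {0<..<1}" "t \<in> {0<..<1}" using st(1,2) by (simp_all add: I_def)
      ultimately show "s = t" by (simp only: hh1(3))
    qed
    have "open (f ` I)" by (rule invariance_of_domain[OF cf I inj])
    moreover have "?n \<bullet> p \<in> f ` I" using s0 s0I by (force simp: f_def)
    ultimately obtain d1 where d1: "d1 > 0" "ball (?n \<bullet> p) d1 \<subseteq> f ` I" by (rule openE)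
    define \<delta> where "\<delta> = min d1 r0"
    have \<delta>: "\<delta> > 0" "\<delta> \<le> d1" "\<delta> \<le> r0" using d1(1) r0 by (auto simp: \<delta>_def)
    define w where "w t = (vector [?n \<bullet> p + \<delta> * t, \<psi> p] :: real^2)" for t
    define r where "r t = \<Phi> (w t)" for t
    define r' where "r' x = (?n \<bullet> x - ?n \<bullet> p) / \<delta>" for x
    define W where "W = Q \<inter> (\<lambda>x. ?n \<bullet> x) -` ball (?n \<bullet> p) \<delta>"
    have rI: "\<exists>s\<in>I. r t = h s \<and> ?n \<bullet> r t = ?n \<bullet> p + \<delta> * t" if t: "t \<in> {-1<..<1}" for t
    proof -
      have "\<bar>\<delta> * t\<bar> < \<delta> * 1" unfolding abs_mult using \<delta>(1) t by (auto intro!: mult_strict_left_mono simp: abs_less_iff)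
      then have "?n \<bullet> p + \<delta> * t \<in> ball (?n \<bullet> p) d1" using \<delta>(2) by (simp add: dist_real_def)
      then obtain s where s: "s \<in> I" "?n \<bullet> p + \<delta> * t = f s" using d1(2) by blast
      have "w t = ?\<Psi> (h s)" unfolding w_def s(2) level[OF s(1)] f_def ..
      moreover have "h s \<in> D" using hI(1)[OF s(1)] Q(3) by blast
      ultimately have "r t = h s" unfolding r_def by (simp only: \<Phi>\<Psi>)
      moreover from this have "?n \<bullet> r t = ?n \<bullet> p + \<delta> * t" using s(2) by (simp only: f_def)
      ultimately show ?thesis using s(1) by blast
    qed
    have rW: "r t \<in> W" "r t \<in> K" "r t \<in> D" "?n \<bullet> r t = ?n \<bullet> p + \<delta> * t" "\<psi> (r t) = \<psi> p" if t: "t \<in> {-1<..<1}" for t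
    proof -
      obtain s where s: "s \<in> I" "r t = h s" "?n \<bullet> r t = ?n \<bullet> p + \<delta> * t" using rI[OF t] by blast
      have "\<bar>\<delta> * t\<bar> < \<delta> * 1" unfolding abs_mult using \<delta>(1) t by (auto intro!: mult_strict_left_mono simp: abs_less_iff)
      then show "r t \<in> W" using s hI(1)[OF s(1)] by (simp add: W_def dist_real_def)
      show "r t \<in> K" "r t \<in> D" "?n \<bullet> r t = ?n \<bullet> p + \<delta> * t" "\<psi> (r t) = \<psi> p"
        using s hI[OF s(1)] level[OF s(1)] Q(3) by auto
    qed
    define v where "v t = (\<delta> / (?n \<bullet> Z (r t))) *\<^sub>R Z (r t)" for t
    have dr: "(r has_vector_derivative v t) (at t)" if t: "t \<in> {-1<..<1}" for t
    proof -
      have "\<bar>\<delta> * t\<bar> < \<delta> * 1" unfolding abs_mult using \<delta>(1) t by (auto intro!: mult_strict_left_mono simp: abs_less_iff)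
      then have box: "\<bar>w t $ 1 - ?n \<bullet> p\<bar> < r0" "\<bar>w t $ 2 - \<psi> p\<bar> < r0" using \<delta>(3) r0 by (simp_all add: w_def)
      have dw: "(w has_derivative (\<lambda>h. h *\<^sub>R vector [\<delta>, 0])) (at t)"
        unfolding w_def[abs_def] vector_2_eq by (auto intro!: derivative_eq_intros)
      define z where "z = \<Phi>' (w t) (vector [\<delta>, 0])"
      have lin: "linear (\<Phi>' (w t))" using has_derivative_linear[OF d\<Phi>[OF box]] .
      have "(r has_derivative (\<lambda>h. \<Phi>' (w t) (h *\<^sub>R vector [\<delta>, 0]))) (at t)"
        unfolding r_def[abs_def] by (rule has_derivative_compose[OF dw d\<Phi>[OF box]])
      then have z: "(r has_derivative (\<lambda>h. h *\<^sub>R z)) (at t)" unfolding linear_cmul[OF lin] z_def .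
      have op: "open {-1<..<1::real}" by simp
      have n1: "((\<lambda>t. ?n \<bullet> r t) has_derivative (\<lambda>h. ?n \<bullet> (h *\<^sub>R z))) (at t)"
        by (rule bounded_linear.has_derivative[OF bounded_linear_inner_right z])
      have "((\<lambda>t. ?n \<bullet> p + \<delta> * t) has_derivative (\<lambda>h. \<delta> * h)) (at t)" by (auto intro!: derivative_eq_intros)
      then have n2: "((\<lambda>t. ?n \<bullet> r t) has_derivative (\<lambda>h. \<delta> * h)) (at t)"
        by (rule has_derivative_transform_within_open[OF _ op t]) (simp add: rW(4))
      have nz: "?n \<bullet> z = \<delta>" using fun_cong[OF has_derivative_unique[OF n1 n2], of 1] by simp
      have p1: "((\<lambda>t. \<psi> (r t)) has_derivative (\<lambda>h. rot (Z (r t)) \<bullet> (h *\<^sub>R z))) (at t)"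
        by (rule has_derivative_compose[OF z \<psi>[OF rW(3)[OF t]]])
      have p2: "((\<lambda>t. \<psi> (r t)) has_derivative (\<lambda>h. 0)) (at t)"
        by (rule has_derivative_transform_within_open[OF has_derivative_const[of "\<psi> p"] op t]) (simp add: rW(5))
      have "rot (Z (r t)) \<bullet> z = 0" using fun_cong[OF has_derivative_unique[OF p1 p2], of 1] by simp
      then have "z = v t"
        using rot_frame[of ?n "Z (r t)" z] n[OF rW(3)[OF t]] nz by (simp add: v_def)
      then show ?thesis using z by (simp add: has_vector_derivative_def)
    qed
    have cr: "continuous_on {-1<..<1} r"
      by (intro continuous_at_imp_continuous_on ballI has_vector_derivative_continuous[OF dr])
    have cZ: "continuous_on D Z" by (rule continuous_on_subset[OF C1_on_continuous[OF Z_C1] DB(1)])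
    have cZr: "continuous_on {-1<..<1} (\<lambda>t. Z (r t))"
      by (rule continuous_on_compose2[OF cZ cr]) (use rW(3) in blast)
    have nv: "?n \<bullet> Z (r t) \<noteq> 0" if "t \<in> {-1<..<1}" for t using n[OF rW(3)[OF that]] by simp
    have cv: "continuous_on {-1<..<1} v"
      unfolding v_def[abs_def] by (intro continuous_intros cZr) (use nv in blast)
    have C1r: "r C1_differentiable_on {-1<..<1}"
      unfolding C1_differentiable_on_def using dr cv by blast
    have v0: "v t \<noteq> 0" if "t \<in> {-1<..<1}" for t using nv[OF that] \<delta>(1) by (auto simp: v_def)
    have WK: "W \<inter> A = W \<inter> K" using A(1,4) by (auto simp: W_def Q_def)
    have r'W: "r' x \<in> {-1<..<1}" "r (r' x) = x" if x: "x \<in> W" "x \<in> K" for x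
    proof -
      have "\<bar>?n \<bullet> x - ?n \<bullet> p\<bar> < \<delta>" using x(1) by (simp add: W_def dist_real_def abs_minus_commute)
      then show "r' x \<in> {-1<..<1}" using \<delta>(1) by (auto simp: r'_def field_simps abs_less_iff)
      have "\<psi> x = \<psi> p" using const x Q(4) by (auto simp: W_def)
      then have "w (r' x) = ?\<Psi> x" using \<delta>(1) by (simp add: w_def r'_def)
      moreover have "x \<in> D" using x(1) Q(3) unfolding W_def by blast
      ultimately show "r (r' x) = x" unfolding r_def by (simp only: \<Phi>\<Psi>)
    qed
    have hr: "homeomorphism {-1<..<1} (W \<inter> A) r r'"
      unfolding WK
    proof (rule homeomorphismI)
      show "continuous_on (W \<inter> K) r'" unfolding r'_def[abs_def] using \<delta>(1) by (intro continuous_intros) auto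
      show "r ` {-1<..<1} \<subseteq> W \<inter> K" using rW(1,2) by blast
      show "r' ` (W \<inter> K) \<subseteq> {-1<..<1}" using r'W(1) by blast
      show "r' (r t) = t" if "t \<in> {-1<..<1}" for t using rW(4)[OF that] \<delta>(1) by (simp add: r'_def)
      show "r (r' x) = x" if "x \<in> W \<inter> K" for x using r'W(2) that by blast
    qed (rule cr)
    have cn: "continuous_on Q (\<lambda>x. ?n \<bullet> x)" by (intro continuous_intros)
    have W: "open W" "p \<in> W" unfolding W_def using continuous_open_preimage[OF cn Q(1) open_ball] Q(2) \<delta>(1) by auto
    have "w 0 = ?\<Psi> p" by (simp add: w_def)
    then have "r 0 = p" using \<Phi>\<Psi>[OF D(2)] by (simp add: r_def)
    then have "C1_curve_at A p W r"
      unfolding C1_curve_at_def using W C1r v0 vector_derivative_at[OF dr] hr by auto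
    then show thesis by (rule that[OF _ Q0(1,2) \<psi>[OF D(2)] const])
  qed assumption+
qed

end

section \<open>Tangents and angles\<close>

lemma norm_rot [simp]: "norm (rot x) = norm x"
  by (simp add: norm_eq_sqrt_inner inner_2 add.commute)

text \<open>The half of the crossing curve that lies in V, traversed away from p, is a characteristic
  curve issuing from p; its tangent at p can be read off since the crossing curve continues beyond
  p.\<close>

lemma normal_extension_char_curve:
  assumes ext: "normal_extension F H u (sing_set \<Omega> F u) V V' \<kappa> B N \<epsilon>" and p: "p \<in> B" "p \<in> sing_set \<Omega> F u"
    and \<kappa>: "\<kappa> = 1 \<or> \<kappa> = -1" and V: "V \<subseteq> \<Omega> - sing_set \<Omega> F u"
  obtains a where "char_curve_from \<Omega> F u p a \<epsilon>" "a ` {0<..<\<epsilon>} \<subseteq> V" "(a has_vector_derivative (- \<kappa>) *\<^sub>R rot (N p)) (at 0)"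
proof -
  have \<epsilon>: "\<epsilon> > 0" and N: "\<And>x. x \<in> B \<Longrightarrow> x \<in> V \<Longrightarrow> normal_dir F u x = N x"
    using ext unfolding normal_extension_def by blast+
  obtain c \<phi> where c: "c 0 = p" "\<And>t. \<bar>t\<bar> < \<epsilon> \<Longrightarrow> c t \<in> B" "\<And>t. \<bar>t\<bar> < \<epsilon> \<Longrightarrow> N (c t) = dirN (\<phi> t)"
    "\<And>t. \<bar>t\<bar> < \<epsilon> \<Longrightarrow> (c has_vector_derivative dirT (\<phi> t)) (at t)"
    "\<And>t. \<bar>t\<bar> < \<epsilon> \<Longrightarrow> (\<phi> has_real_derivative - H (c t)) (at t)"
    "\<And>t. \<bar>t\<bar> < \<epsilon> \<Longrightarrow> \<kappa> * t < 0 \<Longrightarrow> c t \<in> V" "\<And>t. \<bar>t\<bar> < \<epsilon> \<Longrightarrow> 0 < \<kappa> * t \<Longrightarrow> c t \<in> V'"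
    by (rule normal_extension_crossing[OF ext p]) (rule that)
  define a where "a t = c (- \<kappa> * t)" for t
  have abs: "\<bar>- \<kappa> * t\<bar> = \<bar>t\<bar>" "\<kappa> * (- \<kappa> * t) = - t" for t using \<kappa> by auto
  have da: "(a has_vector_derivative (- \<kappa>) *\<^sub>R rot (N (a t))) (at t)" if t: "\<bar>t\<bar> < \<epsilon>" for t
  proof -
    have t': "\<bar>- \<kappa> * t\<bar> < \<epsilon>" using t by (simp only: abs)
    have 1: "((\<lambda>t. - \<kappa> * t) has_vector_derivative (- \<kappa>)) (at t)" by (auto intro!: derivative_eq_intros)
    have "(a has_vector_derivative (- \<kappa>) *\<^sub>R dirT (\<phi> (- \<kappa> * t))) (at t)"
      using vector_diff_chain_at[OF 1 c(4)[OF t']] by (simp add: a_def[abs_def] o_def)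
    then show ?thesis using c(3)[OF t'] by (simp add: a_def)
  qed
  have aV: "a t \<in> V" if "t \<in> {0<..<\<epsilon>}" for t
  proof -
    have "\<bar>- \<kappa> * t\<bar> < \<epsilon>" "\<kappa> * (- \<kappa> * t) < 0" unfolding abs using that by auto
    then show ?thesis unfolding a_def by (rule c(6))
  qed
  have aB: "a t \<in> B" if "\<bar>t\<bar> < \<epsilon>" for t unfolding a_def using that by (intro c(2)) (simp only: abs)
  have a0: "a 0 = p" using c(1) by (simp add: a_def)
  have ca: "continuous_on {0..<\<epsilon>} a"
  proof (intro continuous_at_imp_continuous_on ballI)
    fix t assume "t \<in> {0..<\<epsilon>}"
    then have "\<bar>t\<bar> < \<epsilon>" by auto
    then show "isCont a t" by (rule has_vector_derivative_continuous[OF da])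
  qed
  have "a t \<in> \<Omega> - sing_set \<Omega> F u \<and> (a has_vector_derivative (- \<kappa>) *\<^sub>R char_dir F u (a t)) (at t)" if t: "t \<in> {0<..<\<epsilon>}" for t
  proof -
    have t': "\<bar>t\<bar> < \<epsilon>" using t by auto
    have "char_dir F u (a t) = rot (N (a t))" unfolding char_dir_eq_rot N[OF aB[OF t'] aV[OF t]] ..
    then show ?thesis using da[OF t'] aV[OF t] V by auto
  qed
  moreover have "- \<kappa> \<in> {1, -1}" using \<kappa> by auto
  ultimately have "char_curve_from \<Omega> F u p a \<epsilon>"
    unfolding char_curve_from_def using \<epsilon> ca a0 by blast
  moreover have "a ` {0<..<\<epsilon>} \<subseteq> V" using aV by blast
  ultimately show thesis using da[of 0] \<epsilon> a0 by (intro that[of a]) auto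
qed

lemma char_curve_derivative:
  assumes c: "char_curve_from \<Omega> F u p c \<eta>" and a: "char_curve_from \<Omega> F u p a \<epsilon>" "(a has_vector_derivative v) (at 0)"
    and ev: "\<forall>\<^sub>F t in at_right 0. a t = c t"
  shows "(c has_vector_derivative v) (at 0 within {0..<\<eta>})"
proof -
  obtain b where b: "b > 0" "\<And>t. 0 < t \<Longrightarrow> t < b \<Longrightarrow> a t = c t"
    using ev unfolding eventually_at_right_field by auto
  have 0: "c 0 = a 0" "\<eta> > 0" using c a(1) by (auto simp: char_curve_from_def)
  have *: "(a has_derivative (\<lambda>h. h *\<^sub>R v)) (at 0 within {0..<\<eta>})"
    by (rule has_derivative_at_withinI) (use a(2) in \<open>simp add: has_vector_derivative_def\<close>)
  show ?thesis unfolding has_vector_derivative_def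
  proof (rule has_derivative_transform_within[OF * b(1)])
    show "a t = c t" if "t \<in> {0..<\<eta>}" "dist t 0 < b" for t
      using that b(2)[of t] 0(1) by (cases "t = 0") auto
  qed (use 0(2) in simp)
qed

context two_sided
begin

lemma equal_angles:
  assumes "rot (Z p) \<bullet> v = 0"
  shows "angle_with_line ((- \<kappa>) *\<^sub>R rot (N p)) v = angle_with_line ((- \<kappa>) *\<^sub>R rot (N' p)) v"
proof -
  have "Z p \<bullet> Z p \<noteq> 0" using normals_differ by (simp add: Z_def)
  then have v: "v = ((Z p \<bullet> v) / (Z p \<bullet> Z p)) *\<^sub>R Z p" using assms by (rule rot_frame)
  have "rot (N p) \<bullet> Z p = rot (N' p) \<bullet> Z p"
    unfolding Z_def by (simp add: inner_2 algebra_simps)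
  then have "rot (N p) \<bullet> v = rot (N' p) \<bullet> v" by (subst (1 2) v) simp
  moreover have "norm (N p) = norm (N' p)" using norm_N p by simp
  ultimately show ?thesis unfolding angle_with_line_def by simp
qed

text \<open>The two halves of crossing curves lie on different sides, so they are the two given curves,
  in some order.\<close>

lemma two_char_curve_tangents:
  assumes "the_two_char_curves \<Omega> F u p c1 \<epsilon>1 c2 \<epsilon>2"
  obtains v1 v2 where "(c1 has_vector_derivative v1) (at 0 within {0..<\<epsilon>1})" "(c2 has_vector_derivative v2) (at 0 within {0..<\<epsilon>2})"
    "v1 \<noteq> 0" "v2 \<noteq> 0" "\<And>v. rot (Z p) \<bullet> v = 0 \<Longrightarrow> angle_with_line v1 v = angle_with_line v2 v"
proof -
  have c: "char_curve_from \<Omega> F u p c1 \<epsilon>1" "char_curve_from \<Omega> F u p c2 \<epsilon>2"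
    and uniq: "\<And>c \<eta>. char_curve_from \<Omega> F u p c \<eta> \<Longrightarrow> (\<forall>\<^sub>F t in at_right 0. c t = c1 t) \<or> (\<forall>\<^sub>F t in at_right 0. c t = c2 t)"
    using assms unfolding the_two_char_curves_def by blast+
  let ?v = "(- \<kappa>) *\<^sub>R rot (N p)" and ?v' = "(- \<kappa>) *\<^sub>R rot (N' p)"
  obtain a where a: "char_curve_from \<Omega> F u p a \<epsilon>" "a ` {0<..<\<epsilon>} \<subseteq> V" "(a has_vector_derivative ?v) (at 0)"
    by (rule normal_extension_char_curve[OF ext[unfolded K_def] p(1) p(3)[unfolded K_def] \<kappa> B(3)[unfolded K_def]]) (rule that)
  obtain a' where a': "char_curve_from \<Omega> F u p a' \<epsilon>'" "a' ` {0<..<\<epsilon>'} \<subseteq> V'" "(a' has_vector_derivative ?v') (at 0)"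
    by (rule normal_extension_char_curve[OF ext'[unfolded K_def] p(2) p(3)[unfolded K_def] \<kappa> B(4)[unfolded K_def]]) (rule that)
  have distinct: "\<not> ((\<forall>\<^sub>F t in at_right 0. a t = c t) \<and> (\<forall>\<^sub>F t in at_right 0. a' t = c t))" for c
  proof
    assume "(\<forall>\<^sub>F t in at_right 0. a t = c t) \<and> (\<forall>\<^sub>F t in at_right 0. a' t = c t)"
    then obtain b b' where b: "b > 0" "\<And>t. 0 < t \<Longrightarrow> t < b \<Longrightarrow> a t = c t" and b': "b' > 0" "\<And>t. 0 < t \<Longrightarrow> t < b' \<Longrightarrow> a' t = c t"
      unfolding eventually_at_right_field by auto
    define t where "t = min (min b b') (min \<epsilon> \<epsilon>') / 2"
    have t: "0 < t" "t < b" "t < b'" "t < \<epsilon>" "t < \<epsilon>'" using b(1) b'(1) eps by (auto simp: t_def min_def)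
    then have "t \<in> {0<..<\<epsilon>}" "t \<in> {0<..<\<epsilon>'}" by simp_all
    then have "a t \<in> V" "a' t \<in> V'" using a(2) a'(2) by blast+
    moreover have "a t = a' t" using b(2)[OF t(1,2)] b'(2)[OF t(1,3)] by simp
    ultimately show False using V(3) by auto
  qed
  have "norm ?v = 1" "norm ?v' = 1" using norm_N(1)[OF p(1)] norm_N(2)[OF p(2)] \<kappa> by auto
  then have nz: "?v \<noteq> 0" "?v' \<noteq> 0" by (metis norm_zero zero_neq_one)+
  consider "\<forall>\<^sub>F t in at_right 0. a t = c1 t" "\<forall>\<^sub>F t in at_right 0. a' t = c2 t"
    | "\<forall>\<^sub>F t in at_right 0. a t = c2 t" "\<forall>\<^sub>F t in at_right 0. a' t = c1 t"
    using uniq[OF a(1)] uniq[OF a'(1)] distinct[of c1] distinct[of c2] by argo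
  then show thesis
  proof cases
    case 1
    show thesis
      by (rule that[OF char_curve_derivative[OF c(1) a(1,3) 1(1)] char_curve_derivative[OF c(2) a'(1,3) 1(2)] nz])
        (rule equal_angles)
  next
    case 2
    show thesis
      by (rule that[OF char_curve_derivative[OF c(1) a'(1,3) 2(2)] char_curve_derivative[OF c(2) a(1,3) 2(1)] nz(2,1)])
        (rule equal_angles[symmetric])
  qed
qed

end

lemma curve_tangent_to_level:
  assumes r: "C1_curve_at A p W r" and A: "A \<subseteq> K" and Q: "open Q" "p \<in> Q"
    and \<psi>: "(\<psi> has_derivative (\<lambda>v. g \<bullet> v)) (at p)" and const: "\<And>q. q \<in> Q \<Longrightarrow> q \<in> K \<Longrightarrow> \<psi> q = \<psi> p"
  shows "g \<bullet> vector_derivative r (at 0) = 0"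
proof -
  have r0: "r 0 = p" and C1: "r C1_differentiable_on {-1<..<1}" and im: "r ` {-1<..<1} = W \<inter> A"
    using r unfolding C1_curve_at_def homeomorphism_def by auto
  have "r differentiable (at 0)" using C1 by (intro C1_differentiable_on_eq[THEN iffD1, THEN conjunct1, rule_format]) auto
  then have "(r has_vector_derivative vector_derivative r (at 0)) (at 0)" by (simp add: vector_derivative_works)
  then have d: "(r has_derivative (\<lambda>h. h *\<^sub>R vector_derivative r (at 0))) (at 0)" by (simp add: has_vector_derivative_def)
  have "((\<lambda>t. \<psi> (r t)) has_derivative (\<lambda>h. g \<bullet> (h *\<^sub>R vector_derivative r (at 0)))) (at 0)"
    by (rule has_derivative_compose[OF d]) (simp add: r0 \<psi>)
  note 1 = this
  have cr: "continuous_on {-1<..<1} r" by (rule C1_differentiable_imp_continuous_on[OF C1])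
  have op: "open ({-1<..<1} \<inter> r -` Q)" by (rule continuous_open_preimage[OF cr _ Q(1)]) simp
  have z: "0 \<in> {-1<..<1} \<inter> r -` Q" using r0 Q(2) by simp
  have "\<psi> p = \<psi> (r t)" if "t \<in> {-1<..<1} \<inter> r -` Q" for t
    using const[of "r t"] im A that by (metis IntD1 IntD2 image_eqI subsetD vimageD)
  then have 2: "((\<lambda>t. \<psi> (r t)) has_derivative (\<lambda>h. 0)) (at 0)"
    by (rule has_derivative_transform_within_open[OF has_derivative_const[of "\<psi> p"] op z])
  show ?thesis using fun_cong[OF has_derivative_unique[OF 1 2], of 1] by simp
qed

text \<open>Also the remaining singular points near p are nondegenerate, with the same neighborhood U
  and the same sides; hence the set of nondegenerate points agrees with the singular set near p.\<close>

lemma nondegenerate_two_sided: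
  fixes \<Omega> :: "(real^2) set" and F :: "real^2 \<Rightarrow> real^2" and H u :: "real^2 \<Rightarrow> real"
  assumes dom: "open \<Omega>" and C1: "C1_on \<Omega> F" "C1_on \<Omega> H" "C1_on \<Omega> u" and weak: "weak_solution \<Omega> F H u"
    and curl: "curl F p \<noteq> 0" and p: "nondegenerate_point \<Omega> F H u p"
  obtains U V V' B B' N N' \<epsilon> \<epsilon>' where "two_sided \<Omega> F H u V V' B B' N N' (- sgn (curl F p)) \<epsilon> \<epsilon>' p"
    "open U" "p \<in> U" "(U \<inter> sing_set \<Omega> F u) homeomorphic {0<..<1::real}"
    "B \<inter> B' \<inter> sing_set \<Omega> F u \<subseteq> {q. nondegenerate_point \<Omega> F H u q}"
proof -
  let ?K = "sing_set \<Omega> F u"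
  obtain U V1 V2 where pK: "p \<in> ?K" and U: "open U" "p \<in> U" "U \<subseteq> \<Omega>" and hom: "(U \<inter> ?K) homeomorphic {0<..<1::real}"
    and V: "U - ?K = V1 \<union> V2" "V1 \<inter> V2 = {}" "open V1" "connected V1" "V1 \<noteq> {}" "open V2" "connected V2" "V2 \<noteq> {}"
    and curves: "\<forall>q\<in>U \<inter> ?K. \<exists>c\<^sub>1 \<epsilon>\<^sub>1 c\<^sub>2 \<epsilon>\<^sub>2. the_two_char_curves \<Omega> F u q c\<^sub>1 \<epsilon>\<^sub>1 c\<^sub>2 \<epsilon>\<^sub>2 \<and>
         c\<^sub>1 ` {0<..<\<epsilon>\<^sub>1} \<subseteq> V1 \<and> c\<^sub>2 ` {0<..<\<epsilon>\<^sub>2} \<subseteq> V2"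
    and side1: "nondegenerate_side \<Omega> F H u (U \<inter> ?K) V1 p"
    and side2: "nondegenerate_side \<Omega> F H u (U \<inter> ?K) V2 p"
    using p unfolding nondegenerate_point_def by (elim conjE exE) (rule that; assumption)
  obtain c1 e1 c2 e2 where cc: "char_curve_from \<Omega> F u p c1 e1" "c1 ` {0<..<e1} \<subseteq> V1"
    "char_curve_from \<Omega> F u p c2 e2" "c2 ` {0<..<e2} \<subseteq> V2"
    using bspec[OF curves IntI[OF U(2) pK]] unfolding the_two_char_curves_def by (elim conjE exE) (rule that; assumption)
  have V': "U - ?K = V2 \<union> V1" "V2 \<inter> V1 = {}" using V(1,2) by auto
  note E1 = side_structure[OF dom C1 side1 curl U(1,3) hom V(1,2,3,6) char_curve_end_closure[OF cc(3,4)]]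
  note E2 = side_structure[OF dom C1 side2 curl U(1,3) hom V' V(6,3) char_curve_end_closure[OF cc(1,2)]]
  obtain B N \<epsilon> where S1: "p \<in> B" "B \<subseteq> U" "normal_extension F H u ?K V1 V2 (- sgn (curl F p)) B N \<epsilon>"
    "\<forall>q\<in>B \<inter> ?K. nondegenerate_side \<Omega> F H u (U \<inter> ?K) V1 q"
    using E1 by (elim conjE exE) (rule that; assumption)
  obtain B' N' \<epsilon>' where S2: "p \<in> B'" "B' \<subseteq> U" "normal_extension F H u ?K V2 V1 (- sgn (curl F p)) B' N' \<epsilon>'"
    "\<forall>q\<in>B' \<inter> ?K. nondegenerate_side \<Omega> F H u (U \<inter> ?K) V2 q"
    using E2 by (elim conjE exE) (rule that; assumption)
  have "- sgn (curl F p) = 1 \<or> - sgn (curl F p) = -1" using curl by (auto simp: sgn_if)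
  then have "two_sided \<Omega> F H u V1 V2 B B' N N' (- sgn (curl F p)) \<epsilon> \<epsilon>' p"
    using dom C1 weak V(1,2,3,6) U(3) S1(1,2,3) S2(1,2,3) pK by unfold_locales auto
  moreover have "nondegenerate_point \<Omega> F H u q" if q: "q \<in> B \<inter> B' \<inter> ?K" for q
    unfolding nondegenerate_point_def
    using q S1(2,4) S2(4) U hom V curves by blast
  ultimately show thesis using U(1,2) hom by (intro that[of V1 V2 B B' N N' \<epsilon> \<epsilon>' U]) auto
qed

theorem theoremG:
  fixes \<Omega> :: "(real^2) set" and F :: "real^2 \<Rightarrow> real^2" and H u :: "real^2 \<Rightarrow> real"
  assumes "open \<Omega>" and "connected \<Omega>"
    and "C1_on \<Omega> F" and "C1_on \<Omega> H" and "C1_on \<Omega> u"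
    and "weak_solution \<Omega> F H u"
    and "dir_deriv_extends \<Omega> (sing_set \<Omega> F u) (char_dir F u) (curl F)"
    and "dir_deriv_extends \<Omega> (sing_set \<Omega> F u) (normal_dir F u) H"
    and "\<And>p. nondegenerate_point \<Omega> F H u p \<Longrightarrow> curl F p \<noteq> 0"
  shows "(\<forall>p. nondegenerate_point \<Omega> F H u p \<longrightarrow>
            (\<exists>V r. C1_curve_at {q. nondegenerate_point \<Omega> F H u q} p V r)) \<and>
         (\<forall>p\<^sub>0 V r c\<^sub>1 \<epsilon>\<^sub>1 c\<^sub>2 \<epsilon>\<^sub>2. nondegenerate_point \<Omega> F H u p\<^sub>0 \<longrightarrow>
            C1_curve_at {q. nondegenerate_point \<Omega> F H u q} p\<^sub>0 V r \<longrightarrow>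
            the_two_char_curves \<Omega> F u p\<^sub>0 c\<^sub>1 \<epsilon>\<^sub>1 c\<^sub>2 \<epsilon>\<^sub>2 \<longrightarrow>
            (\<exists>v\<^sub>1 v\<^sub>2. v\<^sub>1 \<noteq> 0 \<and> v\<^sub>2 \<noteq> 0 \<and>
               (c\<^sub>1 has_vector_derivative v\<^sub>1) (at 0 within {0..<\<epsilon>\<^sub>1}) \<and>
               (c\<^sub>2 has_vector_derivative v\<^sub>2) (at 0 within {0..<\<epsilon>\<^sub>2}) \<and>
               angle_with_line v\<^sub>1 (vector_derivative r (at 0)) =
               angle_with_line v\<^sub>2 (vector_derivative r (at 0))))"
proof -
  let ?A = "{q. nondegenerate_point \<Omega> F H u q}"
  have AK: "?A \<subseteq> sing_set \<Omega> F u" by (auto simp: nondegenerate_point_def)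
  have main: "(\<exists>V r. C1_curve_at ?A p V r) \<and>
      (\<forall>V r c\<^sub>1 \<epsilon>\<^sub>1 c\<^sub>2 \<epsilon>\<^sub>2. C1_curve_at ?A p V r \<longrightarrow> the_two_char_curves \<Omega> F u p c\<^sub>1 \<epsilon>\<^sub>1 c\<^sub>2 \<epsilon>\<^sub>2 \<longrightarrow>
            (\<exists>v\<^sub>1 v\<^sub>2. v\<^sub>1 \<noteq> 0 \<and> v\<^sub>2 \<noteq> 0 \<and>
               (c\<^sub>1 has_vector_derivative v\<^sub>1) (at 0 within {0..<\<epsilon>\<^sub>1}) \<and>
               (c\<^sub>2 has_vector_derivative v\<^sub>2) (at 0 within {0..<\<epsilon>\<^sub>2}) \<and>
               angle_with_line v\<^sub>1 (vector_derivative r (at 0)) =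
               angle_with_line v\<^sub>2 (vector_derivative r (at 0))))" (is "?a \<and> ?b")
    if p: "nondegenerate_point \<Omega> F H u p" for p
  proof -
    obtain U V V' B B' N N' \<epsilon> \<epsilon>' where ts: "two_sided \<Omega> F H u V V' B B' N N' (- sgn (curl F p)) \<epsilon> \<epsilon>' p"
      and U: "open U" "p \<in> U" "(U \<inter> sing_set \<Omega> F u) homeomorphic {0<..<1::real}"
      and A: "B \<inter> B' \<inter> sing_set \<Omega> F u \<subseteq> ?A"
      by (rule nondegenerate_two_sided[OF assms(1,3,4,5,6) assms(9)[OF p] p]) (rule that)
    interpret two_sided \<Omega> F H u "sing_set \<Omega> F u" V V' B B' N N' "- sgn (curl F p)" \<epsilon> \<epsilon>' p
      by (rule ts)
    have BB: "open (B \<inter> B')" "p \<in> B \<inter> B'" using open_B ts[unfolded two_sided_def] by auto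
    obtain W r Q \<psi> where 1: "C1_curve_at ?A p W r" and Q: "open Q" "p \<in> Q" and \<psi>: "(\<psi> has_derivative (\<lambda>v. rot (Z p) \<bullet> v)) (at p)"
      and const: "\<And>q. q \<in> Q \<Longrightarrow> q \<in> sing_set \<Omega> F u \<Longrightarrow> \<psi> q = \<psi> p"
      by (rule singular_curve[OF U AK BB A]) (rule that)
    show ?thesis
    proof (intro conjI allI impI)
      show ?a using 1 by blast
      fix V r c1 \<epsilon>1 c2 \<epsilon>2
      assume r: "C1_curve_at ?A p V r" and c: "the_two_char_curves \<Omega> F u p c1 \<epsilon>1 c2 \<epsilon>2"
      have t: "rot (Z p) \<bullet> vector_derivative r (at 0) = 0"
        by (rule curve_tangent_to_level[OF r AK Q \<psi> const])
      obtain v1 v2 where v: "(c1 has_vector_derivative v1) (at 0 within {0..<\<epsilon>1})" "(c2 has_vector_derivative v2) (at 0 within {0..<\<epsilon>2})"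
        "v1 \<noteq> 0" "v2 \<noteq> 0" "\<And>v. rot (Z p) \<bullet> v = 0 \<Longrightarrow> angle_with_line v1 v = angle_with_line v2 v"
        by (rule two_char_curve_tangents[OF c]) (rule that)
      show "\<exists>v\<^sub>1 v\<^sub>2. v\<^sub>1 \<noteq> 0 \<and> v\<^sub>2 \<noteq> 0 \<and>
               (c1 has_vector_derivative v\<^sub>1) (at 0 within {0..<\<epsilon>1}) \<and>
               (c2 has_vector_derivative v\<^sub>2) (at 0 within {0..<\<epsilon>2}) \<and>
               angle_with_line v\<^sub>1 (vector_derivative r (at 0)) =
               angle_with_line v\<^sub>2 (vector_derivative r (at 0))"
        using v(1-4) v(5)[OF t] by blast
    qed
  qed
  show ?thesis using main by blast
qed

end
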